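(* Let $n\ge 2$, let $\Omega=B_1(0)\subset\mathbb{R}^n$ be the unit ball, and for each positive integer $N$ let $\mathcal{A}_N$ be the class of piecewise constant potentials defined in the context. There exist a constant $K_1>0$ depending only on $n$ and an integer $N_0$ such that for every $N\ge N_0$ the following holds: if $C(N)>0$ is a constant such that $$\|q_1-q_2\|_{L^\infty(\Omega)}\le C(N)\,\|\Lambda_{q_1}-\Lambda_{q_2}\|_{\mathcal{L}(H^{1/2}(\partial\Omega),H^{-1/2}(\partial\Omega))}\qquad\text{for all }q_1,q_2\in\mathcal{A}_N,$$ then $$C(N)\ge\tfrac14\,e^{K_1N^{1/(2n-1)}}.$$
   Context: Let $D=[-1/2,1/2]^n$ be the cube of side $1$ centered at the origin. For a positive integer $N$ let $N_1$ be the smallest integer with $N\le N_1^n$ and let $h=1/N_1$. Let $S_{N_1}$ be the set of all open cubes of the form $$D'=(-1/2+(j_1'-1)h,\,-1/2+j_1'h)\times\cdots\times(-1/2+(j_n'-1)h,\,-1/2+j_n'h),$$ with integers $j_1',\dots,j_n'\in\{1,\dots,N_1\}$. Order these cubes lexicographically: for different cubes $D',D''$, $D'\prec D''$ if and only if there is $i_0\in\{1,\dots,n\}$ with $j_i'=j_i''$ for all $i<i_0$ and $j_{i_0}'<j_{i_0}''$. Let $D_1,\dots,D_N$ be the first $N$ cubes in this order and $D_0=\Omega\setminus\bigcup_{j=1}^ND_j$. Define $$\mathcal{A}_N=\Big\{q\in L^\infty(\Omega): q(x)=\sum_{j=1}^Nq_j\chi_{D_j}(x)+\chi_{D_0}(x),\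 q_j\in[1/2,3/2]\Big\}.$$ For $q\in L^\infty(\Omega)$ such that $0$ is not a Dirichlet eigenvalue of $-\Delta+q$ in $\Omega$ (this holds for every $q\in\mathcal{A}_N$), the Dirichlet-to-Neumann map $\Lambda_q:H^{1/2}(\partial\Omega)\to H^{-1/2}(\partial\Omega)$ is $\Lambda_qg=\frac{\partial u}{\partial\nu}\big|_{\partial\Omega}$, where $u\in H^1(\Omega)$ is the weak solution of $(-\Delta+q)u=0$ in $\Omega$, $u=g$ on $\partial\Omega$, and $\nu$ is the exterior unit normal. In weak form $\langle\Lambda_qg,f\rangle=\int_\Omega(\nabla u\cdot\nabla\bar v+qu\bar v)\,dx$ for any $v\in H^1(\Omega)$ with $v|_{\partial\Omega}=f$. The norm on $\mathcal{L}(H^{1/2}(\partial\Omega),H^{-1/2}(\partial\Omega))$ is the operator norm. *)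

theory Defs
  imports
    "HOL-Analysis.Analysis"
    "HOL-Probability.Essential_Supremum"
    "HOL-Library.Fun_Lexorder"
begin

text \<open>
  Functions in \<open>L\<^sup>2\<close>, \<open>L\<^sup>\<infinity>\<close> and \<open>H\<^sup>1\<close> are represented by functions on all of
  \<open>\<real>\<^sup>n\<close> that are Borel on \<open>\<Omega>\<close>; their values outside \<open>\<Omega>\<close> are irrelevant.
\<close>

abbreviation Omega :: "(real^'n) set"
  where "Omega \<equiv> ball 0 1"

abbreviation vol :: "(real^'n) measure"
  where "vol \<equiv> restrict_space lborel Omega"

text \<open>
  Surface measure on the unit sphere, by the cone formula
  \<open>\<sigma>(A) = n |{t x : 0 < t < 1, x \<in> A}|\<close>.
\<close>

definition surf :: "(real^'n) measure"
  where "surf = scale_measure (of_nat CARD('n))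
    (distr (restrict_space lborel (ball 0 1 - {0}))
           (restrict_space borel (sphere 0 1))
           (\<lambda>x. x /\<^sub>R norm x))"

definition square_integrable :: "'a measure \<Rightarrow> ('a \<Rightarrow> 'b::real_normed_vector) \<Rightarrow> bool"
  where "square_integrable M f \<longleftrightarrow>
    f \<in> borel_measurable M \<and> integrable M (\<lambda>x. (norm (f x))\<^sup>2)"

definition Linf_norm :: "(real^'n \<Rightarrow> real) \<Rightarrow> ennreal"
  where "Linf_norm f = esssup vol (\<lambda>x. ennreal \<bar>f x\<bar>)"


subsection \<open>Smooth functions\<close>

definition partial :: "'n \<Rightarrow> (real^'n \<Rightarrow> complex) \<Rightarrow> real^'n \<Rightarrow> complex"
  where "partial i f x = frechet_derivative f (at x) (axis i 1)"

primrec Ck :: "nat \<Rightarrow> (real^'n \<Rightarrow> complex) \<Rightarrow> bool" where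
  "Ck 0 f \<longleftrightarrow> continuous_on UNIV f"
| "Ck (Suc k) f \<longleftrightarrow> (\<forall>x. f differentiable (at x)) \<and> (\<forall>i. Ck k (partial i f))"

definition smooth :: "(real^'n \<Rightarrow> complex) \<Rightarrow> bool"
  where "smooth f \<longleftrightarrow> (\<forall>k. Ck k f)"

definition test_function :: "(real^'n \<Rightarrow> complex) \<Rightarrow> bool"
  where "test_function \<phi> \<longleftrightarrow>
    smooth \<phi> \<and> (\<exists>K. compact K \<and> K \<subseteq> Omega \<and> (\<forall>x. x \<notin> K \<longrightarrow> \<phi> x = 0))"


subsection \<open>The space \<open>H\<^sup>1(\<Omega>)\<close>\<close>

definition is_weak_grad :: "(real^'n \<Rightarrow> complex) \<Rightarrow> (real^'n \<Rightarrow> complex^'n) \<Rightarrow> bool"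
  where "is_weak_grad u G \<longleftrightarrow> square_integrable vol G \<and>
    (\<forall>\<phi> i. test_function \<phi> \<longrightarrow>
      (\<integral>x. u x * partial i \<phi> x \<partial>vol) = - (\<integral>x. G x $ i * \<phi> x \<partial>vol))"

definition H1 :: "(real^'n \<Rightarrow> complex) set"
  where "H1 = {u. square_integrable vol u \<and> (\<exists>G. is_weak_grad u G)}"

definition weak_grad :: "(real^'n \<Rightarrow> complex) \<Rightarrow> real^'n \<Rightarrow> complex^'n"
  where "weak_grad u = (SOME G. is_weak_grad u G)"

definition H1_norm :: "(real^'n \<Rightarrow> complex) \<Rightarrow> real"
  where "H1_norm u =
    sqrt ((\<integral>x. (norm (u x))\<^sup>2 \<partial>vol) + (\<integral>x. (norm (weak_grad u x))\<^sup>2 \<partial>vol))"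


subsection \<open>Traces and the spaces \<open>H\<^sup>1\<^sup>/\<^sup>2(\<partial>\<Omega>)\<close>, \<open>H\<^sup>-\<^sup>1\<^sup>/\<^sup>2(\<partial>\<Omega>)\<close>\<close>

text \<open>
  The trace is the continuous extension to \<open>H\<^sup>1(\<Omega>)\<close>, with values in \<open>L\<^sup>2(\<partial>\<Omega>)\<close>, of the
  restriction map on functions smooth up to the boundary.
\<close>

definition has_trace :: "(real^'n \<Rightarrow> complex) \<Rightarrow> (real^'n \<Rightarrow> complex) \<Rightarrow> bool"
  where "has_trace u g \<longleftrightarrow> u \<in> H1 \<and> square_integrable surf g \<and>
    (\<exists>\<phi> :: nat \<Rightarrow> real^'n \<Rightarrow> complex. (\<forall>k. smooth (\<phi> k)) \<and>
      (\<lambda>k. H1_norm (\<lambda>x. \<phi> k x - u x)) \<longlonglongrightarrow> 0 \<and>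
      (\<lambda>k. \<integral>x. (norm (\<phi> k x - g x))\<^sup>2 \<partial>surf) \<longlonglongrightarrow> 0)"

definition H_half :: "(real^'n \<Rightarrow> complex) set"
  where "H_half = {g. \<exists>u. has_trace u g}"

text \<open>\<open>H\<^sup>1\<^sup>/\<^sup>2(\<partial>\<Omega>)\<close> carries the quotient norm of the trace map.\<close>

definition H_half_norm :: "(real^'n \<Rightarrow> complex) \<Rightarrow> real"
  where "H_half_norm g = Inf {H1_norm u | u. has_trace u g}"

text \<open>
  \<open>H\<^sup>-\<^sup>1\<^sup>/\<^sup>2(\<partial>\<Omega>)\<close> is the space of bounded antilinear functionals on \<open>H\<^sup>1\<^sup>/\<^sup>2(\<partial>\<Omega>)\<close>. The dual norm and
  the operator norm take values in \<open>[0,\<infinity>]\<close>, so that the suprema need no side condition.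
\<close>

definition H_minus_half_norm :: "((real^'n \<Rightarrow> complex) \<Rightarrow> complex) \<Rightarrow> ennreal"
  where "H_minus_half_norm l =
    (SUP f\<in>{f \<in> H_half. H_half_norm f \<le> 1}. ennreal (norm (l f)))"

definition operator_norm ::
    "((real^'n \<Rightarrow> complex) \<Rightarrow> (real^'n \<Rightarrow> complex) \<Rightarrow> complex) \<Rightarrow> ennreal"
  where "operator_norm T =
    (SUP g\<in>{g \<in> H_half. H_half_norm g \<le> 1}. H_minus_half_norm (T g))"


subsection \<open>The Dirichlet-to-Neumann map\<close>

definition energy_form ::
    "(real^'n \<Rightarrow> real) \<Rightarrow> (real^'n \<Rightarrow> complex) \<Rightarrow> (real^'n \<Rightarrow> complex) \<Rightarrow> complex"
  where "energy_form q u v =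
    (\<integral>x. (\<Sum>i\<in>UNIV. weak_grad u x $ i * cnj (weak_grad v x $ i))
          + complex_of_real (q x) * u x * cnj (v x) \<partial>vol)"

definition weak_solution :: "(real^'n \<Rightarrow> real) \<Rightarrow> (real^'n \<Rightarrow> complex) \<Rightarrow> bool"
  where "weak_solution q u \<longleftrightarrow>
    u \<in> H1 \<and> (\<forall>\<phi>. test_function \<phi> \<longrightarrow> energy_form q u \<phi> = 0)"

text \<open>
  \<open>DN_map q g f\<close> is the pairing \<open>\<langle>\<Lambda>\<^sub>q g, f\<rangle>\<close>; it is meaningful for \<open>g, f \<in> H\<^sup>1\<^sup>/\<^sup>2(\<partial>\<Omega>)\<close> and bounded
  \<open>q\<close> for which \<open>0\<close> is not a Dirichlet eigenvalue of \<open>-\<Delta> + q\<close>, in particular for \<open>q \<ge> 1/2\<close>.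
\<close>

definition DN_map ::
    "(real^'n \<Rightarrow> real) \<Rightarrow> (real^'n \<Rightarrow> complex) \<Rightarrow> (real^'n \<Rightarrow> complex) \<Rightarrow> complex"
  where "DN_map q g f =
    (THE z. \<exists>u v. weak_solution q u \<and> has_trace u g \<and> has_trace v f \<and> z = energy_form q u v)"

definition DN_dist :: "(real^'n \<Rightarrow> real) \<Rightarrow> (real^'n \<Rightarrow> real) \<Rightarrow> ennreal"
  where "DN_dist q1 q2 = operator_norm (\<lambda>g f. DN_map q1 g f - DN_map q2 g f)"


subsection \<open>The potentials\<close>

text \<open>
  The coordinates \<open>1, \<dots>, n\<close> are indexed by a finite linearly ordered type \<open>'n\<close>, and \<open>less_fun\<close>
  is the lexicographic order on multi-indices. The cubes need not lie in \<open>\<Omega>\<close> when \<open>n \<ge> 5\<close>.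
\<close>

definition side_count :: "nat \<Rightarrow> nat \<Rightarrow> nat"
  where "side_count n N = (LEAST m. N \<le> m ^ n)"

definition multi_indices :: "nat \<Rightarrow> ('n \<Rightarrow> nat) set"
  where "multi_indices m = {j. \<forall>i. j i \<in> {1..m}}"

definition cube :: "nat \<Rightarrow> ('n \<Rightarrow> nat) \<Rightarrow> (real^'n) set"
  where "cube m j = {x. \<forall>i. - 1/2 + (real (j i) - 1) * (1 / real m) < x $ i \<and>
                            x $ i < - 1/2 + real (j i) * (1 / real m)}"

text \<open>The multi-indices of the first \<open>N\<close> cubes: those preceded by fewer than \<open>N\<close> others.\<close>

definition first_indices :: "nat \<Rightarrow> ('n::{finite,linorder} \<Rightarrow> nat) set"
  where "first_indices N = (let J = multi_indices (side_count CARD('n) N) in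
    {j \<in> J. card {k \<in> J. less_fun k j} < N})"

definition A_class :: "nat \<Rightarrow> (real^'n::{finite,linorder} \<Rightarrow> real) set"
  where "A_class N = {q. \<exists>c :: ('n \<Rightarrow> nat) \<Rightarrow> real.
    let D = cube (side_count CARD('n) N); J = first_indices N; D0 = Omega - (\<Union>j\<in>J. D j) in
      (\<forall>j\<in>J. c j \<in> {1/2..3/2}) \<and>
      (\<forall>x\<in>Omega. q x = (\<Sum>j\<in>J. c j * indicator (D j) x) + indicator D0 x)}"

end

theory Submission imports Defs begin

text \<open>
  Let \<open>Q = [-r,r]\<^sup>n\<close> with \<open>r\<close> small, and consider potentials that differ from 1 only in \<open>Q\<close>. If \<open>u\<close> and \<open>w\<close>
  solve \<open>-\<Delta>u + qu = 0\<close> and \<open>-\<Delta>w + w = 0\<close> with boundary data \<open>g\<close> and \<open>f\<close>, then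
  \<open>\<langle>(\<Lambda>\<^sub>q - \<Lambda>\<^sub>1)g, f\<rangle>\<close> is the integral of \<open>(q - 1) u w\<^sup>*\<close> over \<open>Q\<close>, \<open>w\<^sup>*\<close> being the conjugate of \<open>w\<close>.

  A solution \<open>w\<close> of \<open>\<Delta>w = w\<close> remains a solution when mollified at scale \<open>e\<^sup>-\<^sup>l\<close>, which changes it on \<open>Q\<close> by
  \<open>O(e\<^sup>-\<^sup>l)\<close> and bounds its supremum by \<open>e\<^sup>O\<^sup>(\<^sup>l\<^sup>)\<close>; its Taylor polynomial of order \<open>l\<close> at the origin is then
  exponentially accurate on \<open>Q\<close>. The equation expresses all derivatives at the origin by those of order at
  most one in a fixed direction. So up to \<open>O(e\<^sup>-\<^sup>l)\<close> the solutions span on \<open>Q\<close> a space of dimension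
  \<open>O(l\<^sup>n\<^sup>-\<^sup>1)\<close>, and \<open>\<Lambda>\<^sub>q - \<Lambda>\<^sub>1\<close> is a square matrix of that size with entries of size \<open>e\<^sup>O\<^sup>(\<^sup>l\<^sup>)\<close>. With precision
  \<open>e\<^sup>-\<^sup>l\<close> there are only \<open>exp (O(l\<^sup>2\<^sup>n\<^sup>-\<^sup>1))\<close> such matrices.

  On the other hand, a fixed proportion of the first \<open>N\<close> cubes lies in \<open>Q\<close>, and choosing the value 1 or 3/2
  on each of them gives \<open>2\<^sup>c\<^sup>N\<close> potentials at mutual distance 1/2. For \<open>l\<close> a small multiple of
  \<open>N\<^sup>1\<^sup>/\<^sup>(\<^sup>2\<^sup>n\<^sup>-\<^sup>1\<^sup>)\<close> two of them have Dirichlet-to-Neumann maps at distance \<open>O(e\<^sup>-\<^sup>l)\<close>.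
\<close>

section \<open>Square-integrable functions\<close>

text \<open>The obstacle is that solutions with data in H^(1/2) are a priori only in H^1. Instead of
  an interior regularity theorem the proof uses mollification: a kernel at scale e^-l costs a factor
  e^(nl) in the supremum, and the cube Q pays for it, since r is so small that the Taylor remainder
  on Q gains e^(-(n+1)l). The net decay e^-l is all that is used later. With background 1 and values
  1 and 3/2 every potential is at least 1, so the energy form dominates the squared H^1 norm, and
  existence, uniqueness and stability all come from one projection argument. The exponent 2n-1 is
  2(n-1), for the number of matrix entries, plus 1, because an entry of size e^O(l) stored to
  precision e^-O(l) takes O(l) bits. The cube Q also keeps the cubes that carry the perturbation
  inside the ball, which D leaves when n >= 5; and the lexicographic order does no harm, as the
  cubes with nonpositive first coordinate come early. The prefactor 1/4 results from giving up half
  of the exponent, which absorbs all constants for large N.\<close>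

definition L2n :: "'a measure \<Rightarrow> ('a \<Rightarrow> 'b::real_normed_vector) \<Rightarrow> real"
  where "L2n M f = sqrt (\<integral>x. (norm (f x))\<^sup>2 \<partial>M)"

lemma L2n_nonneg [simp]: "0 \<le> L2n M f"
  by (simp add: L2n_def)

lemma L2n_sq: "(L2n M f)\<^sup>2 = (\<integral>x. (norm (f x))\<^sup>2 \<partial>M)"
  by (simp add: L2n_def)

lemma square_integrable_meas: "square_integrable M f \<Longrightarrow> f \<in> borel_measurable M"
  by (simp add: square_integrable_def)

lemma square_integrable_int: "square_integrable M f \<Longrightarrow> integrable M (\<lambda>x. (norm (f x))\<^sup>2)"
  by (simp add: square_integrable_def)

lemma square_integrable_norm: "square_integrable M f \<Longrightarrow> square_integrable M (\<lambda>x. norm (f x))"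
  by (auto simp: square_integrable_def intro: borel_measurable_norm)

lemma L2n_norm: "L2n M (\<lambda>x. norm (f x)) = L2n M f"
  by (simp add: L2n_def)

lemma L2n_zero [simp]: "L2n M (\<lambda>x. 0) = 0"
  by (simp add: L2n_def)

lemma square_integrable_zero [simp]: "square_integrable M (\<lambda>x. 0)"
  by (simp add: square_integrable_def)

lemma square_integrable_bound:
  assumes "square_integrable M g" "f \<in> borel_measurable M" "AE x in M. norm (f x) \<le> c * norm (g x)"
  shows "square_integrable M f"
  unfolding square_integrable_def
proof
  show "f \<in> borel_measurable M" by fact
  show "integrable M (\<lambda>x. (norm (f x))\<^sup>2)"
  proof (rule Bochner_Integration.integrable_bound)
    show "integrable M (\<lambda>x. c\<^sup>2 * (norm (g x))\<^sup>2)"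
      using assms(1) by (simp add: square_integrable_def)
    show "(\<lambda>x. (norm (f x))\<^sup>2) \<in> borel_measurable M" using assms(2) by measurable
    show "AE x in M. norm ((norm (f x))\<^sup>2) \<le> norm (c\<^sup>2 * (norm (g x))\<^sup>2)"
      using assms(3)
    proof eventually_elim
      case (elim x)
      then have "(norm (f x))\<^sup>2 \<le> (c * norm (g x))\<^sup>2" by (intro power_mono) auto
      then show ?case by (simp add: power_mult_distrib)
    qed
  qed
qed

lemma L2n_bound:
  assumes "square_integrable M g" "f \<in> borel_measurable M" "0 \<le> c"
    "AE x in M. norm (f x) \<le> c * norm (g x)"
  shows "L2n M f \<le> c * L2n M g"
proof -
  have "(\<integral>x. (norm (f x))\<^sup>2 \<partial>M) \<le> (\<integral>x. c\<^sup>2 * (norm (g x))\<^sup>2 \<partial>M)"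
  proof (rule integral_mono_AE)
    show "integrable M (\<lambda>x. (norm (f x))\<^sup>2)"
      using square_integrable_bound[OF assms(1,2,4)] by (simp add: square_integrable_def)
    show "integrable M (\<lambda>x. c\<^sup>2 * (norm (g x))\<^sup>2)"
      using assms(1) by (simp add: square_integrable_def)
    show "AE x in M. (norm (f x))\<^sup>2 \<le> c\<^sup>2 * (norm (g x))\<^sup>2"
      using assms(4)
    proof eventually_elim
      case (elim x)
      then have "(norm (f x))\<^sup>2 \<le> (c * norm (g x))\<^sup>2" by (intro power_mono) auto
      then show ?case by (simp add: power_mult_distrib)
    qed
  qed
  also have "\<dots> = c\<^sup>2 * (\<integral>x. (norm (g x))\<^sup>2 \<partial>M)" by simp
  finally have "L2n M f \<le> sqrt (c\<^sup>2 * (\<integral>x. (norm (g x))\<^sup>2 \<partial>M))"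
    unfolding L2n_def by (rule real_sqrt_le_mono)
  then show ?thesis using assms(3) by (simp add: L2n_def real_sqrt_mult)
qed

lemma L2n_cong_AE:
  assumes "f \<in> borel_measurable M" "g \<in> borel_measurable M" "AE x in M. f x = g x"
  shows "L2n M f = L2n M g"
  unfolding L2n_def
  by (rule arg_cong[where f=sqrt], rule integral_cong_AE) (use assms in auto)

lemma square_integrable_scaleR:
  "square_integrable M f \<Longrightarrow> square_integrable M (\<lambda>x. c *\<^sub>R (f x :: 'b::{real_normed_vector,second_countable_topology}))"
  by (rule square_integrable_bound[of M f _ "\<bar>c\<bar>"]) (auto simp: square_integrable_def)

lemma square_integrable_add:
  fixes f g :: "'a \<Rightarrow> 'b::{real_normed_vector,second_countable_topology}"
  assumes "square_integrable M f" "square_integrable M g"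
  shows "square_integrable M (\<lambda>x. f x + g x)"
  unfolding square_integrable_def
proof
  have [measurable]: "f \<in> borel_measurable M" "g \<in> borel_measurable M"
    using assms by (auto simp: square_integrable_def)
  show "(\<lambda>x. f x + g x) \<in> borel_measurable M" by measurable
  show "integrable M (\<lambda>x. (norm (f x + g x))\<^sup>2)"
  proof (rule Bochner_Integration.integrable_bound)
    show "integrable M (\<lambda>x. 2 * (norm (f x))\<^sup>2 + 2 * (norm (g x))\<^sup>2)"
      using assms by (auto simp: square_integrable_def)
    show "AE x in M. norm ((norm (f x + g x))\<^sup>2) \<le> norm (2 * (norm (f x))\<^sup>2 + 2 * (norm (g x))\<^sup>2)"
    proof (rule AE_I2)
      fix x
      have "(norm (f x + g x))\<^sup>2 \<le> (norm (f x) + norm (g x))\<^sup>2"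
        by (intro power_mono norm_triangle_ineq) auto
      also have "\<dots> \<le> 2 * (norm (f x))\<^sup>2 + 2 * (norm (g x))\<^sup>2"
        using sum_squares_bound[of "norm (f x)" "norm (g x)"] by (simp add: power2_sum)
      finally show "norm ((norm (f x + g x))\<^sup>2) \<le> norm (2 * (norm (f x))\<^sup>2 + 2 * (norm (g x))\<^sup>2)" by simp
    qed
  qed measurable
qed

lemma square_integrable_uminus:
  fixes f :: "'a \<Rightarrow> 'b::{real_normed_vector,second_countable_topology}"
  shows "square_integrable M f \<Longrightarrow> square_integrable M (\<lambda>x. - f x)"
  using square_integrable_scaleR[of M f "-1"] by simp

lemma square_integrable_diff:
  fixes f g :: "'a \<Rightarrow> 'b::{real_normed_vector,second_countable_topology}"
  assumes "square_integrable M f" "square_integrable M g"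
  shows "square_integrable M (\<lambda>x. f x - g x)"
  using square_integrable_add[OF assms(1) square_integrable_uminus[OF assms(2)]] by simp

lemma square_integrable_sum:
  fixes f :: "'i \<Rightarrow> 'a \<Rightarrow> 'b::{real_normed_vector,second_countable_topology}"
  assumes "\<And>i. i \<in> I \<Longrightarrow> square_integrable M (f i)"
  shows "square_integrable M (\<lambda>x. \<Sum>i\<in>I. f i x)"
  using assms by (induction I rule: infinite_finite_induct) (auto intro: square_integrable_add)

lemma square_integrable_mult_integrable:
  fixes f g :: "'a \<Rightarrow> 'b::{real_normed_vector,second_countable_topology}"
  assumes "square_integrable M f" "square_integrable M g"
  shows "integrable M (\<lambda>x. norm (f x) * norm (g x))"
proof (rule Bochner_Integration.integrable_bound)
  have [measurable]: "f \<in> borel_measurable M" "g \<in> borel_measurable M"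
    using assms by (auto simp: square_integrable_def)
  show "integrable M (\<lambda>x. (norm (f x))\<^sup>2 + (norm (g x))\<^sup>2)"
    using assms by (auto simp: square_integrable_def)
  show "AE x in M. norm (norm (f x) * norm (g x)) \<le> norm ((norm (f x))\<^sup>2 + (norm (g x))\<^sup>2)"
  proof (rule AE_I2)
    fix x
    have "2 * (norm (f x) * norm (g x)) \<le> (norm (f x))\<^sup>2 + (norm (g x))\<^sup>2"
      using sum_squares_bound[of "norm (f x)" "norm (g x)"] by simp
    moreover have "0 \<le> norm (f x) * norm (g x)" by simp
    ultimately have "norm (f x) * norm (g x) \<le> (norm (f x))\<^sup>2 + (norm (g x))\<^sup>2" by linarith
    then show "norm (norm (f x) * norm (g x)) \<le> norm ((norm (f x))\<^sup>2 + (norm (g x))\<^sup>2)" by simp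
  qed
qed (use assms in \<open>auto simp: square_integrable_def\<close>)

text \<open>Integrates the pointwise inequality 2|f||g| <= t|f|^2 + |g|^2/t and optimizes over t
  afterwards. The optimal t = b/a makes sense if both norms are positive; otherwise t tends to
  infinity or to 0.\<close>

lemma L2_Cauchy_Schwarz:
  fixes f g :: "'a \<Rightarrow> 'b::{real_normed_vector,second_countable_topology}"
  assumes f: "square_integrable M f" and g: "square_integrable M g"
  shows "(\<integral>x. norm (f x) * norm (g x) \<partial>M) \<le> L2n M f * L2n M g"
proof -
  define a b where "a = L2n M f" and "b = L2n M g"
  have ab: "0 \<le> a" "0 \<le> b" by (auto simp: a_def b_def)
  have a2: "(\<integral>x. (norm (f x))\<^sup>2 \<partial>M) = a\<^sup>2" and b2: "(\<integral>x. (norm (g x))\<^sup>2 \<partial>M) = b\<^sup>2"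
    by (auto simp: a_def b_def L2n_sq)
  have fi: "integrable M (\<lambda>x. (norm (f x))\<^sup>2)" and gi: "integrable M (\<lambda>x. (norm (g x))\<^sup>2)"
    using f g by (auto simp: square_integrable_def)
  have key: "2 * (\<integral>x. norm (f x) * norm (g x) \<partial>M) \<le> t * a\<^sup>2 + b\<^sup>2 / t" if t: "0 < t" for t
  proof -
    have "(\<integral>x. 2 * (norm (f x) * norm (g x)) \<partial>M) \<le> (\<integral>x. t * (norm (f x))\<^sup>2 + (norm (g x))\<^sup>2 / t \<partial>M)"
    proof (rule integral_mono)
      fix x
      have "0 \<le> (t * norm (f x) - norm (g x))\<^sup>2 / t" using t by simp
      also have "\<dots> = t * (norm (f x))\<^sup>2 + (norm (g x))\<^sup>2 / t - 2 * (norm (f x) * norm (g x))"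
        using t by (simp add: field_simps power2_eq_square)
      finally show "2 * (norm (f x) * norm (g x)) \<le> t * (norm (f x))\<^sup>2 + (norm (g x))\<^sup>2 / t" by simp
    qed (use fi gi square_integrable_mult_integrable[OF f g] in auto)
    then show ?thesis using fi gi by (simp add: a2 b2)
  qed
  show ?thesis
  proof (cases "a = 0 \<or> b = 0")
    case True
    have "(\<integral>x. norm (f x) * norm (g x) \<partial>M) \<le> 0"
    proof (rule field_le_epsilon)
      fix e :: real assume e: "0 < e"
      show "(\<integral>x. norm (f x) * norm (g x) \<partial>M) \<le> 0 + e"
      proof (cases "a = 0")
        case a0: True
        \<comment> \<open>t = (b^2 + 1)/e makes b^2/t at most e; the 1 keeps t positive when b =
          0.\<close>
        have "0 < b\<^sup>2 + 1" by (simp add: add_nonneg_pos)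
        then have "b\<^sup>2 / ((b\<^sup>2 + 1) / e) \<le> e"
          using e by (simp add: field_simps)
        moreover have "0 < (b\<^sup>2 + 1) / e" using e by (simp add: add_nonneg_pos)
        ultimately show ?thesis using key[of "(b\<^sup>2 + 1) / e"] a0 e by simp
      next
        case False
        then have b0: "b = 0" using True by simp
        have "0 < a\<^sup>2 + 1" by (simp add: add_nonneg_pos)
        then have "e / (a\<^sup>2 + 1) * a\<^sup>2 \<le> e"
          using e by (simp add: field_simps)
        moreover have "0 < e / (a\<^sup>2 + 1)" using e by (simp add: add_nonneg_pos)
        ultimately show ?thesis using key[of "e / (a\<^sup>2 + 1)"] b0 e by simp
      qed
    qed
    then show ?thesis using ab by (simp add: a_def[symmetric] b_def[symmetric]) (meson mult_nonneg_nonneg order_trans)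
  next
    case False
    then have "0 < a" "0 < b" using ab by auto
    then show ?thesis using key[of "b / a"] by (simp add: field_simps power2_eq_square a_def b_def)
  qed
qed

lemma L2n_triangle:
  fixes f g :: "'a \<Rightarrow> 'b::{real_normed_vector,second_countable_topology}"
  assumes f: "square_integrable M f" and g: "square_integrable M g"
  shows "L2n M (\<lambda>x. f x + g x) \<le> L2n M f + L2n M g"
proof -
  have fi: "integrable M (\<lambda>x. (norm (f x))\<^sup>2)" and gi: "integrable M (\<lambda>x. (norm (g x))\<^sup>2)"
    using f g by (auto simp: square_integrable_def)
  have pi: "integrable M (\<lambda>x. norm (f x) * norm (g x))"
    by (rule square_integrable_mult_integrable[OF f g])
  have "(L2n M (\<lambda>x. f x + g x))\<^sup>2 \<le> (\<integral>x. (norm (f x))\<^sup>2 + (norm (g x))\<^sup>2 + 2 * (norm (f x) * norm (g x)) \<partial>M)"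
    unfolding L2n_sq
  proof (rule integral_mono)
    show "integrable M (\<lambda>x. (norm (f x + g x))\<^sup>2)"
      using square_integrable_add[OF f g] by (simp add: square_integrable_def)
    fix x
    have "(norm (f x + g x))\<^sup>2 \<le> (norm (f x) + norm (g x))\<^sup>2"
      by (intro power_mono norm_triangle_ineq) auto
    then show "(norm (f x + g x))\<^sup>2 \<le> (norm (f x))\<^sup>2 + (norm (g x))\<^sup>2 + 2 * (norm (f x) * norm (g x))"
      by (simp add: power2_sum)
  qed (use fi gi pi in auto)
  also have "\<dots> = (L2n M f)\<^sup>2 + (L2n M g)\<^sup>2 + 2 * (\<integral>x. norm (f x) * norm (g x) \<partial>M)"
    using fi gi pi by (simp add: L2n_sq)
  also have "\<dots> \<le> (L2n M f + L2n M g)\<^sup>2"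
    using L2_Cauchy_Schwarz[OF f g] by (simp add: power2_sum)
  finally show ?thesis by (rule power2_le_imp_le) simp
qed

lemma L2n_scaleR: "L2n M (\<lambda>x. c *\<^sub>R f x) = \<bar>c\<bar> * L2n M f"
  by (simp add: L2n_def power_mult_distrib real_sqrt_mult)

lemma L2n_uminus: "L2n M (\<lambda>x. - f x) = L2n M f"
  by (simp add: L2n_def)

lemma L2n_minus_commute: "L2n M (\<lambda>x. f x - g x) = L2n M (\<lambda>x. g x - f x)"
  by (simp add: L2n_def norm_minus_commute)

lemma L2n_triangle_diff:
  fixes f g h :: "'a \<Rightarrow> 'b::{real_normed_vector,second_countable_topology}"
  assumes "square_integrable M f" "square_integrable M g" "square_integrable M h"
  shows "L2n M (\<lambda>x. f x - h x) \<le> L2n M (\<lambda>x. f x - g x) + L2n M (\<lambda>x. g x - h x)"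
  using L2n_triangle[OF square_integrable_diff[OF assms(1,2)] square_integrable_diff[OF assms(2,3)]]
  by simp

lemma L2n_triangle2:
  fixes f g :: "'a \<Rightarrow> 'b::{real_normed_vector,second_countable_topology}"
  assumes "square_integrable M f" "square_integrable M g"
  shows "L2n M f \<le> L2n M (\<lambda>x. f x - g x) + L2n M g"
  using L2n_triangle[OF square_integrable_diff[OF assms] assms(2)] by simp

lemma L2n_sum:
  fixes f :: "'i \<Rightarrow> 'a \<Rightarrow> 'b::{real_normed_vector,second_countable_topology}"
  assumes "\<And>i. i \<in> I \<Longrightarrow> square_integrable M (f i)"
  shows "L2n M (\<lambda>x. \<Sum>i\<in>I. f i x) \<le> (\<Sum>i\<in>I. L2n M (f i))"
  using assms
proof (induction I rule: infinite_finite_induct)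
  case (insert i I)
  have "L2n M (\<lambda>x. f i x + (\<Sum>i\<in>I. f i x)) \<le> L2n M (f i) + L2n M (\<lambda>x. \<Sum>i\<in>I. f i x)"
    by (rule L2n_triangle) (use insert in \<open>auto intro: square_integrable_sum\<close>)
  then show ?case using insert by fastforce
qed auto

lemma nn_integral_norm_eq_L2n:
  assumes "square_integrable M f"
  shows "(\<integral>\<^sup>+x. ennreal ((norm (f x))\<^sup>2) \<partial>M) = ennreal ((L2n M f)\<^sup>2)"
  using assms by (simp add: L2n_sq square_integrable_def nn_integral_eq_integral)

lemma L2n_le_nn:
  assumes "f \<in> borel_measurable M" "(\<integral>\<^sup>+x. ennreal ((norm (f x))\<^sup>2) \<partial>M) \<le> ennreal (c\<^sup>2)" "0 \<le> c"
  shows "square_integrable M f" "L2n M f \<le> c"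
proof -
  have i: "integrable M (\<lambda>x. (norm (f x))\<^sup>2)"
    using assms le_less_trans[OF assms(2)] by (intro integrableI_bounded) auto
  then show *: "square_integrable M f" using assms by (simp add: square_integrable_def)
  have "ennreal ((L2n M f)\<^sup>2) \<le> ennreal (c\<^sup>2)" using assms(2) nn_integral_norm_eq_L2n[OF *] by simp
  then have "(L2n M f)\<^sup>2 \<le> c\<^sup>2" by simp
  then show "L2n M f \<le> c" using assms(3) by (rule power2_le_imp_le)
qed

text \<open>A sequence with increments at most \<open>2\<^sup>-\<^sup>k\<close> converges almost everywhere, because the sum of
  the pointwise increments is square integrable.\<close>

lemma L2_fast_Cauchy_limit:
  fixes f :: "nat \<Rightarrow> 'a \<Rightarrow> 'b::{banach,second_countable_topology}"
  assumes f: "\<And>k. square_integrable M (f k)"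
    and fast: "\<And>k. L2n M (\<lambda>x. f (Suc k) x - f k x) \<le> (1/2) ^ k"
  shows "\<exists>g. square_integrable M g \<and> (\<forall>k. L2n M (\<lambda>x. f k x - g x) \<le> 2 * (1/2)^k)"
proof -
  have fm [measurable]: "f k \<in> borel_measurable M" for k
    using f by (simp add: square_integrable_def)
  define d where "d k x = norm (f (Suc k) x - f k x)" for k x
  have dm [measurable]: "d k \<in> borel_measurable M" for k unfolding d_def by measurable
  have dS: "square_integrable M (d k)" for k
    unfolding d_def by (rule square_integrable_norm[OF square_integrable_diff[OF f f]])
  have dn: "L2n M (d k) \<le> (1/2)^k" for k
    using fast[of k] unfolding d_def by (simp add: L2n_norm)
  \<comment> \<open>Increments are summed from an arbitrary start j, so that one estimate yields
    both convergence and the rate 2 (1/2)^j.\<close>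
  define s where "s j m x = (\<Sum>i\<in>{j..<j+m}. d i x)" for j m x
  have sm [measurable]: "s j m \<in> borel_measurable M" for j m unfolding s_def by measurable
  have geo: "(\<Sum>i\<in>{j..<j+m}. (1/2::real)^i) \<le> 2 * (1/2)^j" for j m
  proof -
    have "(\<Sum>i\<in>{j..<j+m}. (1/2::real)^i) = 2 * (1/2)^j - 2 * (1/2)^(j+m)"
      by (induction m) auto
    then show ?thesis by simp
  qed
  have sn: "(\<integral>\<^sup>+x. ennreal ((s j m x)\<^sup>2) \<partial>M) \<le> ennreal ((2 * (1/2)^j)\<^sup>2)" for j m
  proof -
    have S: "square_integrable M (s j m)" unfolding s_def by (rule square_integrable_sum) (rule dS)
    have "L2n M (s j m) \<le> (\<Sum>i\<in>{j..<j+m}. L2n M (d i))"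
      unfolding s_def by (rule L2n_sum) (rule dS)
    also have "\<dots> \<le> (\<Sum>i\<in>{j..<j+m}. (1/2)^i)" by (rule sum_mono) (rule dn)
    also have "\<dots> \<le> 2 * (1/2)^j" by (rule geo)
    finally have "(L2n M (s j m))\<^sup>2 \<le> (2 * (1/2)^j)\<^sup>2" by (rule power_mono) simp
    then show ?thesis using nn_integral_norm_eq_L2n[OF S] by (simp add: ennreal_leI)
  qed
  define T where "T j x = (SUP m. ennreal ((s j m x)\<^sup>2))" for j x
  have Tm [measurable]: "T j \<in> borel_measurable M" for j unfolding T_def by measurable
  have d0: "0 \<le> d i x" for i x by (simp add: d_def)
  have smono: "s j m x \<le> s j m' x" if "m \<le> m'" for j m m' x
    unfolding s_def by (rule sum_mono2) (use that d0 in auto)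
  have s0: "0 \<le> s j m x" for j m x unfolding s_def by (rule sum_nonneg) (rule d0)
  have Tn: "(\<integral>\<^sup>+x. T j x \<partial>M) \<le> ennreal ((2 * (1/2)^j)\<^sup>2)" for j
  proof -
    have "(\<integral>\<^sup>+x. T j x \<partial>M) = (SUP m. \<integral>\<^sup>+x. ennreal ((s j m x)\<^sup>2) \<partial>M)"
      unfolding T_def
      by (rule nn_integral_monotone_convergence_SUP)
         (auto intro!: incseq_SucI le_funI ennreal_leI power_mono smono s0)
    also have "\<dots> \<le> ennreal ((2 * (1/2)^j)\<^sup>2)" by (rule SUP_least) (rule sn)
    finally show ?thesis .
  qed
  \<comment> \<open>\<open>T 0\<close> is the square of the sum of all increments. Its integral is
    finite, so it is finite almost everywhere, which means absolute convergence.\<close>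
  have "AE x in M. T 0 x \<noteq> \<infinity>"
    by (rule nn_integral_PInf_AE) (use Tn[of 0] in \<open>auto simp: top_unique\<close>)
  then have conv: "AE x in M. convergent (\<lambda>k. f k x)"
  proof eventually_elim
    case (elim x)
    have bd: "(\<Sum>i<m. d i x) \<le> sqrt (enn2real (T 0 x))" for m
    proof -
      have "ennreal ((s 0 m x)\<^sup>2) \<le> T 0 x" unfolding T_def by (rule SUP_upper) simp
      also have "\<dots> = ennreal (enn2real (T 0 x))" using elim by (simp add: less_top)
      finally have "(s 0 m x)\<^sup>2 \<le> enn2real (T 0 x)" by simp
      then have "s 0 m x \<le> sqrt (enn2real (T 0 x))" by (rule real_le_rsqrt)
      then show ?thesis by (simp add: s_def atLeast0LessThan)
    qed
    have "summable (\<lambda>k. d k x)" by (rule bounded_imp_summable[OF d0, where B = "sqrt (enn2real (T 0 x))"])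
         (use bd[of "Suc k" for k] in \<open>simp only: lessThan_Suc_atMost[symmetric]\<close>)
    then have "summable (\<lambda>k. f (Suc k) x - f k x)"
      unfolding d_def by (rule summable_norm_cancel)
    then have "convergent (\<lambda>m. \<Sum>k<m. f (Suc k) x - f k x)" by (simp add: summable_iff_convergent)
    then have "convergent (\<lambda>m. (\<Sum>k<m. f (Suc k) x - f k x) + f 0 x)"
      by (rule convergent_add[OF _ convergent_const])
    then show ?case unfolding sum_lessThan_telescope[of "\<lambda>k. f k x"] by simp
  qed
  \<comment> \<open>Where the sequence diverges, \<open>lim\<close> is an unspecified value;
    \<open>g\<close> is still measurable and the divergence set is null.\<close>
  define g where "g x = lim (\<lambda>k. f k x)" for x
  have gm [measurable]: "g \<in> borel_measurable M" unfolding g_def by measurable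
  have le: "(\<integral>\<^sup>+x. ennreal ((norm (f j x - g x))\<^sup>2) \<partial>M) \<le> ennreal ((2 * (1/2)^j)\<^sup>2)" for j
  proof -
    have "(\<integral>\<^sup>+x. ennreal ((norm (f j x - g x))\<^sup>2) \<partial>M) \<le> (\<integral>\<^sup>+x. T j x \<partial>M)"
    proof (rule nn_integral_mono_AE)
      show "AE x in M. ennreal ((norm (f j x - g x))\<^sup>2) \<le> T j x"
        using conv
      proof eventually_elim
        case (elim x)
        then have lim: "(\<lambda>k. f k x) \<longlonglongrightarrow> g x" unfolding g_def by (simp add: convergent_LIMSEQ_iff)
        have tele: "norm (f j x - f (j + m) x) \<le> s j m x" for m
        proof (induction m)
          case (Suc m)
          have "norm (f j x - f (j + Suc m) x) \<le> norm (f j x - f (j + m) x) + norm (f (j+m) x - f (Suc (j + m)) x)"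
            using norm_triangle_ineq[of "f j x - f (j + m) x" "f (j+m) x - f (Suc (j + m)) x"] by simp
          also have "\<dots> \<le> s j m x + d (j + m) x" using Suc by (simp add: d_def norm_minus_commute)
          finally show ?case by (simp add: s_def)
        qed (simp add: s_def)
        have up: "ennreal ((norm (f j x - f (j + m) x))\<^sup>2) \<le> T j x" for m
        proof -
          have "ennreal ((norm (f j x - f (j + m) x))\<^sup>2) \<le> ennreal ((s j m x)\<^sup>2)"
            by (rule ennreal_leI, rule power_mono[OF tele]) simp
          also have "\<dots> \<le> T j x" unfolding T_def by (rule SUP_upper) simp
          finally show ?thesis .
        qed
        have "(\<lambda>m. f (m + j) x) \<longlonglongrightarrow> g x" using lim by (rule LIMSEQ_ignore_initial_segment)
        then have "(\<lambda>m. ennreal ((norm (f j x - f (j + m) x))\<^sup>2)) \<longlonglongrightarrow> ennreal ((norm (f j x - g x))\<^sup>2)"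
          by (intro tendsto_ennrealI tendsto_intros) (simp add: add.commute)
        then show ?case by (rule LIMSEQ_le_const2) (use up in auto)
      qed
    qed
    also have "\<dots> \<le> ennreal ((2 * (1/2)^j)\<^sup>2)" by (rule Tn)
    finally show ?thesis .
  qed
  have *: "square_integrable M (\<lambda>x. f j x - g x)" "L2n M (\<lambda>x. f j x - g x) \<le> 2 * (1/2)^j" for j
    using L2n_le_nn[of "\<lambda>x. f j x - g x" M "2 * (1/2)^j"] le[of j] by auto
  have "square_integrable M g"
    using square_integrable_diff[OF f[of 0] *(1)[of 0]] by simp
  with * show ?thesis by blast
qed

text \<open>A subsequence with increments at most (1/2)^k has a limit by
  \<open>L2_fast_Cauchy_limit\<close>, and a Cauchy sequence follows its subsequence.\<close>

lemma L2_complete: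
  fixes f :: "nat \<Rightarrow> 'a \<Rightarrow> 'b::{banach,second_countable_topology}"
  assumes f: "\<And>k. square_integrable M (f k)"
    and cau: "\<And>e. 0 < e \<Longrightarrow> \<exists>K. \<forall>i\<ge>K. \<forall>j\<ge>K. L2n M (\<lambda>x. f i x - f j x) < e"
  shows "\<exists>g. square_integrable M g \<and> (\<lambda>k. L2n M (\<lambda>x. f k x - g x)) \<longlonglongrightarrow> 0"
proof -
  have "\<exists>K. \<forall>i\<ge>K. \<forall>j\<ge>K. L2n M (\<lambda>x. f i x - f j x) < (1/2)^k" for k :: nat
    by (rule cau) simp
  then obtain K where K: "\<And>k i j. K k \<le> i \<Longrightarrow> K k \<le> j \<Longrightarrow> L2n M (\<lambda>x. f i x - f j x) < (1/2)^k" by metis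
  \<comment> \<open>Summing the thresholds puts \<open>K k\<close> below both \<open>r k\<close> and
    \<open>r (Suc k)\<close>, so the Cauchy bound with index k applies to the k-th
    increment.\<close>
  define r where "r k = (\<Sum>i\<le>k. K i)" for k
  have rK: "K k \<le> r k" for k unfolding r_def by (rule member_le_sum) auto
  have rS: "K k \<le> r (Suc k)" for k using rK[of k] by (simp add: r_def)
  have "\<exists>g. square_integrable M g \<and> (\<forall>k. L2n M (\<lambda>x. f (r k) x - g x) \<le> 2 * (1/2)^k)"
    by (rule L2_fast_Cauchy_limit) (use f K rK rS in \<open>auto intro: less_imp_le\<close>)
  then obtain g where g: "square_integrable M g" "\<And>k. L2n M (\<lambda>x. f (r k) x - g x) \<le> 2 * (1/2)^k" by blast
  have "(\<lambda>k. L2n M (\<lambda>x. f k x - g x)) \<longlonglongrightarrow> 0"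
  proof (rule LIMSEQ_I)
    fix e :: real assume e: "0 < e"
    obtain k where k: "(1/2::real)^k < e / 3" using real_arch_pow_inv[of "e/3" "1/2"] e by auto
    have "L2n M (\<lambda>x. f i x - g x) < e" if i: "K k \<le> i" for i
    proof -
      have "L2n M (\<lambda>x. f i x - g x) \<le> L2n M (\<lambda>x. f i x - f (r k) x) + L2n M (\<lambda>x. f (r k) x - g x)"
        by (rule L2n_triangle_diff) (use f g in auto)
      also have "\<dots> < (1/2)^k + 2 * (1/2)^k" using K[OF i rK[of k]] g(2)[of k] by simp
      finally show ?thesis using k by simp
    qed
    then show "\<exists>no. \<forall>n\<ge>no. norm (L2n M (\<lambda>x. f n x - g x) - 0) < e" by (intro exI[of _ "K k"]) auto
  qed
  with g show ?thesis by blast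
qed

section \<open>Smooth functions of one variable\<close>

text \<open>A smooth function of one variable is carried together with all its derivatives,
  \<open>h k\<close> being the k-th one. Constructions then supply the derivatives explicitly
  instead of arguing about an iterated \<open>deriv\<close>.\<close>

definition deriv_seq :: "(nat \<Rightarrow> real \<Rightarrow> real) \<Rightarrow> bool"
  where "deriv_seq h \<longleftrightarrow> (\<forall>k t. (h k has_real_derivative h (Suc k) t) (at t))"

lemma deriv_seqD: "deriv_seq h \<Longrightarrow> (h k has_real_derivative h (Suc k) t) (at t)"
  by (simp add: deriv_seq_def)

lemma deriv_seq_continuous: "deriv_seq h \<Longrightarrow> continuous_on A (h k)"
  by (meson DERIV_isCont continuous_at_imp_continuous_on deriv_seqD)

lemma poly_times_exp_neg_tendsto: "((\<lambda>s. poly p s * exp (- s)) \<longlongrightarrow> 0) (at_top :: real filter)"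
proof -
  have "((\<lambda>s. \<Sum>i\<le>degree p. coeff p i * (s ^ i / exp s)) \<longlongrightarrow> (\<Sum>i\<le>degree p. coeff p i * 0)) (at_top :: real filter)"
    by (intro tendsto_intros tendsto_power_div_exp_0)
  then show ?thesis
    by (simp add: poly_altdef exp_minus divide_inverse sum_distrib_right mult.assoc)
qed

text \<open>For p = 1 this is the classical flat function exp(-1/t). Allowing a polynomial factor in
  1/t makes the family closed under differentiation.\<close>

definition flat_exp :: "real poly \<Rightarrow> real \<Rightarrow> real"
  where "flat_exp p t = (if 0 < t then poly p (1 / t) * exp (- (1 / t)) else 0)"

lemma flat_exp_tendsto_right: "((\<lambda>t. flat_exp p t) \<longlongrightarrow> 0) (at_right 0)"
proof -
  have "((\<lambda>t. poly p (inverse t) * exp (- inverse t)) \<longlongrightarrow> 0) (at_right (0::real))"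
    by (rule filterlim_compose[OF poly_times_exp_neg_tendsto filterlim_inverse_at_top_right])
  moreover have "\<forall>\<^sub>F t in at_right 0. poly p (inverse t) * exp (- inverse t) = flat_exp p t"
    using eventually_at_right_less[of 0] by eventually_elim (simp add: flat_exp_def field_simps)
  ultimately show ?thesis by (rule Lim_transform_eventually)
qed

text \<open>With s = 1/t one has d/dt = -s^2 d/ds, so p(s) exp(-s) becomes s^2 (p - p')(s) exp(-s).
  The two \<open>pCons 0\<close> multiply by s^2.\<close>

lemma flat_exp_deriv:
  "(flat_exp p has_real_derivative flat_exp (pCons 0 (pCons 0 (p - pderiv p))) t) (at t)"
proof -
  consider "0 < t" | "t < 0" | "t = 0" by linarith
  then show ?thesis
  proof cases
    case 1
    have "((\<lambda>t. poly p (1/t) * exp (- (1/t))) has_real_derivative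
       flat_exp (pCons 0 (pCons 0 (p - pderiv p))) t) (at t)"
      using 1 by (auto intro!: derivative_eq_intros DERIV_chain'[OF _ poly_DERIV] simp: flat_exp_def field_simps power2_eq_square)
    then show ?thesis
      by (rule has_field_derivative_transform_within_open[where S="{0<..}"]) (use 1 in \<open>auto simp: flat_exp_def\<close>)
  next
    case 2
    have "((\<lambda>t. 0) has_real_derivative flat_exp (pCons 0 (pCons 0 (p - pderiv p))) t) (at t)"
      using 2 by (simp add: flat_exp_def)
    then show ?thesis
      by (rule has_field_derivative_transform_within_open[where S="{..<0}"]) (use 2 in \<open>auto simp: flat_exp_def\<close>)
  next
    case 3
    \<comment> \<open>The right difference quotient at 0 belongs to the family again, with s p(s) in
      place of p, so it tends to 0.\<close>
    have R: "((\<lambda>h. flat_exp p h / h) \<longlongrightarrow> 0) (at_right 0)"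
    proof -
      have "\<forall>\<^sub>F h in at_right 0. flat_exp (pCons 0 p) h = flat_exp p h / h"
        using eventually_at_right_less[of "0::real"] by eventually_elim (simp add: flat_exp_def)
      then show ?thesis by (rule Lim_transform_eventually[OF flat_exp_tendsto_right])
    qed
    have L: "((\<lambda>h. flat_exp p h / h) \<longlongrightarrow> 0) (at_left 0)"
    proof -
      have "\<forall>\<^sub>F h in at_left 0. (0::real) = flat_exp p h / h"
        unfolding eventually_at_filter by (rule always_eventually) (auto simp: flat_exp_def)
      then show ?thesis by (rule Lim_transform_eventually[OF tendsto_const])
    qed
    have "((\<lambda>h. flat_exp p h / h) \<longlongrightarrow> 0) (at 0)"
      using L R by (simp add: filterlim_at_split)
    then show ?thesis using 3 by (simp add: DERIV_def flat_exp_def)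
  qed
qed

definition flat_exp_seq :: "nat \<Rightarrow> real \<Rightarrow> real"
  where "flat_exp_seq k = flat_exp (((\<lambda>p. pCons 0 (pCons 0 (p - pderiv p))) ^^ k) 1)"

lemma deriv_seq_flat_exp: "deriv_seq flat_exp_seq"
  unfolding deriv_seq_def flat_exp_seq_def by (simp add: flat_exp_deriv del: pCons_0_0)

lemma flat_exp_seq_0: "flat_exp_seq 0 t = (if 0 < t then exp (- (1 / t)) else 0)"
  by (simp add: flat_exp_seq_def flat_exp_def)

lemma deriv_seq_affine:
  assumes "deriv_seq h"
  shows "deriv_seq (\<lambda>k t. c ^ k * h k (a + c * t))"
  unfolding deriv_seq_def
proof (intro allI)
  fix k t
  have "((\<lambda>t. h k (a + c * t)) has_real_derivative h (Suc k) (a + c * t) * c) (at t)"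
    by (rule DERIV_chain'[OF _ deriv_seqD[OF assms]]) (auto intro!: derivative_eq_intros)
  from DERIV_cmult[OF this, of "c^k"]
  show "((\<lambda>t. c ^ k * h k (a + c * t)) has_real_derivative c ^ Suc k * h (Suc k) (a + c * t)) (at t)"
    by (simp add: mult_ac)
qed

text \<open>\<open>leibniz f g i j k\<close> is the k-th derivative of the product of
  \<open>f i\<close> and \<open>g j\<close>. Splitting off one derivative at a time avoids binomial
  coefficients.\<close>

fun leibniz :: "(nat \<Rightarrow> real \<Rightarrow> real) \<Rightarrow> (nat \<Rightarrow> real \<Rightarrow> real) \<Rightarrow> nat \<Rightarrow> nat \<Rightarrow> nat \<Rightarrow> real \<Rightarrow> real" where
  "leibniz f g i j 0 t = f i t * g j t"
| "leibniz f g i j (Suc k) t = leibniz f g (Suc i) j k t + leibniz f g i (Suc j) k t"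

lemma deriv_seq_leibniz:
  assumes "deriv_seq f" "deriv_seq g"
  shows "deriv_seq (leibniz f g 0 0)"
proof -
  have "(leibniz f g i j k has_real_derivative leibniz f g i j (Suc k) t) (at t)" for i j k t
  proof (induction k arbitrary: i j)
    case 0
    have "((\<lambda>t. f i t * g j t) has_real_derivative f (Suc i) t * g j t + g (Suc j) t * f i t) (at t)"
      by (rule DERIV_mult) (use assms in \<open>auto intro: deriv_seqD\<close>)
    moreover have "leibniz f g i j 0 = (\<lambda>t. f i t * g j t)" by (rule ext) simp
    ultimately show ?case by (simp add: mult_ac)
  next
    case (Suc k)
    have "leibniz f g i j (Suc k) = (\<lambda>t. leibniz f g (Suc i) j k t + leibniz f g i (Suc j) k t)" by (rule ext) simp
    moreover have "((\<lambda>t. leibniz f g (Suc i) j k t + leibniz f g i (Suc j) k t) has_real_derivative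
      leibniz f g (Suc i) j (Suc k) t + leibniz f g i (Suc j) (Suc k) t) (at t)"
      by (rule DERIV_add; rule Suc)
    ultimately show ?case by (metis leibniz.simps(2))
  qed
  then show ?thesis by (simp add: deriv_seq_def)
qed

section \<open>Bump functions and smooth steps\<close>

lemma deriv_seq_zero_on_open:
  assumes "deriv_seq h" "open S" "\<And>t. t \<in> S \<Longrightarrow> h 0 t = 0" "t \<in> S"
  shows "h k t = 0"
  using assms(4)
proof (induction k arbitrary: t)
  case 0
  then show ?case using assms(3) by simp
next
  case (Suc k)
  have "((\<lambda>t. 0) has_real_derivative h (Suc k) t) (at t)"
    by (rule has_field_derivative_transform_within_open[OF deriv_seqD[OF assms(1), of k]])
       (use Suc assms(2) in auto)
  then show ?case using DERIV_unique DERIV_const by blast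
qed

text \<open>The product of the flat function at 1 + t and at 1 - t is positive exactly on (-1,
  1).\<close>

lemma exists_bump:
  "\<exists>b. deriv_seq b \<and> (\<forall>t. 0 \<le> b 0 t) \<and> (\<forall>t. \<bar>t\<bar> < 1 \<longrightarrow> 0 < b 0 t) \<and> (\<forall>k t. 1 \<le> \<bar>t\<bar> \<longrightarrow> b k t = 0)"
proof -
  define f where "f = (\<lambda>k t. (1::real) ^ k * flat_exp_seq k (1 + 1 * t))"
  define g where "g = (\<lambda>k t. (-1::real) ^ k * flat_exp_seq k (1 + (-1) * t))"
  define b where "b = leibniz f g 0 0"
  have b: "deriv_seq b"
    unfolding b_def f_def g_def by (intro deriv_seq_leibniz deriv_seq_affine deriv_seq_flat_exp)
  have b0: "b 0 t = flat_exp_seq 0 (1 + t) * flat_exp_seq 0 (1 - t)" for t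
    by (simp add: b_def f_def g_def)
  have out: "b k t = 0" if "1 < \<bar>t\<bar>" for k t
    by (rule deriv_seq_zero_on_open[OF b, where S="{..< -1} \<union> {1<..}"]) (use that in \<open>auto simp: b0 flat_exp_seq_0\<close>)
  have "b k t = 0" if t: "1 \<le> \<bar>t\<bar>" for k t
  \<comment> \<open>All derivatives vanish on the open set |t| > 1; at |t| = 1 their values are
    limits from outside.\<close>
  proof (cases "1 < \<bar>t\<bar>")
    case False
    then have t1: "t = 1 \<or> t = -1" using t by auto
    define s where "s = (\<lambda>m::nat. t * (1 + 1 / real (Suc m)))"
    have "s \<longlonglongrightarrow> t * (1 + 0)" unfolding s_def by (intro tendsto_intros LIMSEQ_Suc[OF lim_1_over_n])
    then have "(\<lambda>m. b k (s m)) \<longlonglongrightarrow> b k t"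
      using deriv_seq_continuous[OF b, of UNIV k] by (simp add: continuous_on_tendsto_compose)
    moreover have "b k (s m) = 0" for m
    proof (rule out)
      have "\<bar>s m\<bar> = 1 + 1 / real (Suc m)" using t1 by (auto simp: s_def abs_mult)
      then show "1 < \<bar>s m\<bar>" by simp
    qed
    ultimately show ?thesis by (simp add: LIMSEQ_const_iff)
  qed (rule out)
  with b show ?thesis by (intro exI[of _ b]) (auto simp: b0 flat_exp_seq_0)
qed

text \<open>A primitive of a bump, normalized to end at 1 and rescaled from [-1,1] to [1/2,1]. The
  bound on the first derivative later controls the gradient of cutoff functions.\<close>

lemma exists_step:
  "\<exists>h. deriv_seq h \<and> (\<forall>t\<le>1/2. h 0 t = 0) \<and> (\<forall>t\<ge>1. h 0 t = 1) \<and> (\<forall>t. 0 \<le> h 0 t \<and> h 0 t \<le> 1)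
    \<and> (\<exists>B. \<forall>t. \<bar>h 1 t\<bar> \<le> B)"
proof -
  obtain b where b: "deriv_seq b" "\<And>t. 0 \<le> b 0 t" "\<And>t. \<bar>t\<bar> < 1 \<Longrightarrow> 0 < b 0 t" "\<And>k t. 1 \<le> \<bar>t\<bar> \<Longrightarrow> b k t = 0"
    using exists_bump by blast
  have bc: "continuous_on A (b 0)" for A by (rule deriv_seq_continuous[OF b(1)])
  define H where "H x = integral {-1..x} (b 0)" for x
  \<comment> \<open>The base point of the integral may lie anywhere to the left of the support. With
    a base point below t, \<open>H\<close> can be differentiated at every t, including t <=
    -1.\<close>
  have Ha: "integral {a..x} (b 0) = H x" if "a \<le> -1" for a x
  proof (cases "-1 \<le> x")
    case True
    have "integral {a..-1} (b 0) + integral {-1..x} (b 0) = integral {a..x} (b 0)"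
      by (rule Henstock_Kurzweil_Integration.integral_combine) (use that True in \<open>auto intro: integrable_continuous_interval bc\<close>)
    moreover have "integral {a..-1} (b 0) = integral {a..-1} (\<lambda>_. 0)"
      by (rule Henstock_Kurzweil_Integration.integral_cong) (use b(4) in auto)
    ultimately show ?thesis by (simp add: H_def)
  next
    case False
    have "integral {a..x} (b 0) = integral {a..x} (\<lambda>_. 0)"
      by (rule Henstock_Kurzweil_Integration.integral_cong) (use b(4) False in auto)
    then show ?thesis using False by (simp add: H_def)
  qed
  have Hd: "(H has_real_derivative b 0 t) (at t)" for t
  proof -
    define a where "a = min (-1) t - 1"
    have "((\<lambda>x. integral {a..x} (b 0)) has_real_derivative b 0 t) (at t within {a..t+1})"
      by (rule integral_has_real_derivative) (auto simp: a_def intro: bc)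
    moreover have "(\<lambda>x. integral {a..x} (b 0)) = H"
      using Ha[of a] by (auto simp: a_def)
    ultimately have "(H has_real_derivative b 0 t) (at t within {a..t+1})" by simp
    then show ?thesis by (subst (asm) at_within_Icc_at) (auto simp: a_def)
  qed
  have Hmono: "H s \<le> H t" if "s \<le> t" for s t
    by (rule DERIV_nonneg_imp_nondecreasing[OF that]) (use Hd b(2) in blast)
  have H0: "H t = 0" if "t \<le> -1" for t
    using that by (cases "t = -1") (auto simp: H_def)
  have H1: "H t = H 1" if "1 \<le> t" for t
  proof -
    have "integral {-1..1} (b 0) + integral {1..t} (b 0) = integral {-1..t} (b 0)"
      by (rule Henstock_Kurzweil_Integration.integral_combine) (use that in \<open>auto intro: integrable_continuous_interval bc\<close>)
    moreover have "integral {1..t} (b 0) = integral {1..t} (\<lambda>_. 0)"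
      by (rule Henstock_Kurzweil_Integration.integral_cong) (use b(4) in auto)
    ultimately show ?thesis by (simp add: H_def)
  qed
  have Hpos: "0 < H 1"
  proof -
    have "H (-1/2) < H (1/2)"
      by (rule DERIV_pos_imp_increasing) (use Hd b(3) in \<open>auto intro!: exI\<close>)
    moreover have "0 \<le> H (-1/2)" using Hmono[of "-1" "-1/2"] H0[of "-1"] by simp
    moreover have "H (1/2) \<le> H 1" by (rule Hmono) simp
    ultimately show ?thesis by simp
  qed
  define G where "G k t = (case k of 0 \<Rightarrow> H t | Suc j \<Rightarrow> b j t) / H 1" for k t
  have G: "deriv_seq G"
    unfolding deriv_seq_def
  proof (intro allI)
    fix k t
    show "(G k has_real_derivative G (Suc k) t) (at t)"
      unfolding G_def by (rule DERIV_cdivide) (cases k; simp add: Hd deriv_seqD[OF b(1)])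
  qed
  \<comment> \<open>-3 + 4t maps 1/2 to -1 and 1 to 1.\<close>
  define h where "h = (\<lambda>k t. 4 ^ k * G k (-3 + 4 * t))"
  have h: "deriv_seq h" unfolding h_def by (rule deriv_seq_affine[OF G])
  have "H t \<ge> 0" for t using Hmono[of "-1" t] H0[of t] H0[of "-1"] by (cases "t \<le> -1") auto
  moreover have "H t \<le> H 1" for t using Hmono[of t 1] H1[of t] by (cases "t \<le> 1") auto
  ultimately have "\<forall>t. 0 \<le> h 0 t \<and> h 0 t \<le> 1" using Hpos by (simp add: h_def G_def)
  moreover have "\<exists>B. \<forall>t. \<bar>h 1 t\<bar> \<le> B"
  proof -
    have "compact (b 0 ` {-1..1})" by (rule compact_continuous_image[OF bc]) simp
    then obtain B where B: "\<And>s. s \<in> {-1..1} \<Longrightarrow> norm (b 0 s) \<le> B"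
      by (metis bounded_iff compact_imp_bounded imageI)
    have "\<bar>b 0 s\<bar> \<le> max B 0" for s
    proof (cases "\<bar>s\<bar> \<le> 1")
      case True
      then show ?thesis using B[of s] by (auto simp: abs_le_iff)
    next
      case False
      then show ?thesis using b(4)[of s 0] by simp
    qed
    then have "\<bar>h 1 t\<bar> \<le> 4 * (max B 0 / H 1)" for t
      using Hpos by (simp add: h_def G_def abs_mult divide_right_mono)
    then show ?thesis by blast
  qed
  ultimately show ?thesis
  proof (intro exI[of _ h] conjI)
    show "\<forall>t\<le>1/2. h 0 t = 0" using H0 by (simp add: h_def G_def)
    show "\<forall>t\<ge>1. h 0 t = 1"
    proof (intro allI impI)
      fix t :: real assume "1 \<le> t"
      then show "h 0 t = 1" using H1[of "-3 + 4 * t"] Hpos by (simp add: h_def G_def)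
    qed
  qed (use h in auto)
qed

section \<open>Smooth functions of several variables\<close>

lemma partial_eq: "(f has_derivative D) (at x) \<Longrightarrow> partial i f x = D (axis i 1)"
  unfolding partial_def by (metis frechet_derivative_at)

lemma has_derivative_partials:
  assumes "f differentiable (at x)"
  shows "(f has_derivative (\<lambda>h. \<Sum>i\<in>UNIV. (h $ i) *\<^sub>R partial i f x)) (at x)"
proof -
  have D: "(f has_derivative frechet_derivative f (at x)) (at x)"
    using assms frechet_derivative_works by blast
  have lin: "linear (frechet_derivative f (at x))"
    using D has_derivative_linear by blast
  have "frechet_derivative f (at x) h = (\<Sum>i\<in>UNIV. (h $ i) *\<^sub>R partial i f x)" for h
  proof -
    have "h = (\<Sum>i\<in>UNIV. (h $ i) *\<^sub>R axis i 1)"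
      by (simp add: vec_eq_iff axis_def if_distrib cong: if_cong)
    then have "frechet_derivative f (at x) h = frechet_derivative f (at x) (\<Sum>i\<in>UNIV. (h $ i) *\<^sub>R axis i 1)" by simp
    also have "\<dots> = (\<Sum>i\<in>UNIV. (h $ i) *\<^sub>R frechet_derivative f (at x) (axis i 1))"
      by (simp add: linear_sum[OF lin] linear_scale[OF lin])
    finally show ?thesis by (simp add: partial_def)
  qed
  then have "frechet_derivative f (at x) = (\<lambda>h. \<Sum>i\<in>UNIV. (h $ i) *\<^sub>R partial i f x)" by (rule ext)
  then show ?thesis using D by simp
qed

lemma Ck_SucI:
  assumes "\<And>x. (f has_derivative D x) (at x)" "\<And>i. Ck k (\<lambda>x. D x (axis i 1))"
  shows "Ck (Suc k) f"
proof -
  have "partial i f = (\<lambda>x. D x (axis i 1))" for i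
    using partial_eq[OF assms(1)] by auto
  then show ?thesis using assms by (auto simp: differentiable_def)
qed

lemma Ck_Suc_imp: "Ck (Suc k) f \<Longrightarrow> Ck k f"
proof (induction k arbitrary: f)
  case 0
  then show ?case
    by (auto intro!: differentiable_imp_continuous_on simp: differentiable_on_def differentiable_at_withinI)
next
  case (Suc k)
  then show ?case by (metis Ck.simps(2))
qed

lemma Ck_const: "Ck k (\<lambda>x. c)"
proof (induction k arbitrary: c)
  case (Suc k)
  show ?case by (rule Ck_SucI[where D="\<lambda>x h. 0"]) (use Suc in auto)
qed simp

lemma Ck_add: "Ck k f \<Longrightarrow> Ck k g \<Longrightarrow> Ck k (\<lambda>x. f x + g x)"
proof (induction k arbitrary: f g)
  case (Suc k)
  have d: "f differentiable (at x)" "g differentiable (at x)" for x using Suc.prems by auto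
  have "Ck k (\<lambda>x. partial i f x + partial i g x)" for i by (rule Suc.IH) (use Suc.prems in auto)
  moreover have "partial i (\<lambda>x. f x + g x) = (\<lambda>x. partial i f x + partial i g x)" for i
    by (rule ext, rule trans[OF partial_eq[OF has_derivative_add[OF has_derivative_partials[OF d(1)] has_derivative_partials[OF d(2)]]]])
       (simp add: axis_def if_distrib[of "\<lambda>c. c *\<^sub>R _"] cong: if_cong)
  ultimately show ?case using d by (auto intro: differentiable_add)
qed (auto intro: continuous_on_add)

lemma partial_mult:
  assumes "f differentiable (at x)" "g differentiable (at x)"
  shows "partial i (\<lambda>x. f x * g x) x = f x * partial i g x + partial i f x * g x"
  by (rule trans[OF partial_eq[OF has_derivative_mult[OF has_derivative_partials[OF assms(1)] has_derivative_partials[OF assms(2)]]]])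
     (simp add: axis_def if_distrib[of "\<lambda>c. c *\<^sub>R _"] cong: if_cong)

lemma partial_add:
  assumes "f differentiable (at x)" "g differentiable (at x)"
  shows "partial i (\<lambda>x. f x + g x) x = partial i f x + partial i g x"
  by (rule trans[OF partial_eq[OF has_derivative_add[OF has_derivative_partials[OF assms(1)] has_derivative_partials[OF assms(2)]]]])
     (simp add: axis_def if_distrib[of "\<lambda>c. c *\<^sub>R _"] cong: if_cong)

lemma Ck_mult: "Ck k f \<Longrightarrow> Ck k g \<Longrightarrow> Ck k (\<lambda>x. f x * g x)"
proof (induction k arbitrary: f g)
  case (Suc k)
  have d: "f differentiable (at x)" "g differentiable (at x)" for x using Suc.prems by auto
  have "Ck k (\<lambda>x. f x * partial i g x + partial i f x * g x)" for i
    by (intro Ck_add Suc.IH) (use Suc.prems Ck_Suc_imp in auto)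
  moreover have "partial i (\<lambda>x. f x * g x) = (\<lambda>x. f x * partial i g x + partial i f x * g x)" for i
    by (rule ext, rule partial_mult) (use d in auto)
  ultimately show ?case using d by (auto intro: differentiable_mult)
qed (auto intro: continuous_on_mult)

lemma Ck_sum: "(\<And>i. i \<in> I \<Longrightarrow> Ck k (f i)) \<Longrightarrow> Ck k (\<lambda>x. \<Sum>i\<in>I. f i x)"
  by (induction I rule: infinite_finite_induct) (auto intro: Ck_const Ck_add)

lemma Ck_prod: "(\<And>i. i \<in> I \<Longrightarrow> Ck k (f i)) \<Longrightarrow> Ck k (\<lambda>x. \<Prod>i\<in>I. f i x)"
  by (induction I rule: infinite_finite_induct) (auto intro: Ck_const Ck_mult)

lemma Ck_coord: "Ck k (\<lambda>x. complex_of_real (x $ i))"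
proof (cases k)
  case 0
  then show ?thesis by (simp add: continuous_intros)
next
  case (Suc j)
  have "Ck (Suc j) (\<lambda>x. complex_of_real (x $ i))"
    by (rule Ck_SucI[where D="\<lambda>x h. complex_of_real (h $ i)"])
       (auto intro!: has_derivative_of_real[OF bounded_linear_imp_has_derivative[OF bounded_linear_vec_nth]] Ck_const)
  then show ?thesis using Suc by simp
qed

text \<open>The index \<open>j\<close> is general because the chain rule turns \<open>h j\<close>
  into \<open>h (Suc j)\<close>. The inner function is real but enters as a complex one, since
  \<open>Ck\<close> speaks of complex functions.\<close>

lemma Ck_compose_deriv_seq:
  assumes h: "deriv_seq h" and g: "\<And>k. Ck k (\<lambda>x. complex_of_real (g x))"
  shows "Ck k (\<lambda>x. complex_of_real (h j (g x)))"
proof (induction k arbitrary: j)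
  case 0
  have "continuous_on UNIV (\<lambda>x. complex_of_real (g x))" using g[of 0] by simp
  then have "continuous_on UNIV (\<lambda>x. Re (complex_of_real (g x)))" by (rule continuous_on_Re)
  then show ?case
    using continuous_on_compose2[OF deriv_seq_continuous[OF h, of UNIV j], of UNIV g] by (auto intro!: continuous_intros)
next
  case (Suc k)
  have gd: "(\<lambda>x. complex_of_real (g x)) differentiable (at x)" for x using g[of 1] by simp
  define D where "D x v = (\<Sum>i\<in>UNIV. (v $ i) *\<^sub>R partial i (\<lambda>x. complex_of_real (g x)) x)" for x v
  have D: "((\<lambda>x. complex_of_real (g x)) has_derivative D x) (at x)" for x
    unfolding D_def by (rule has_derivative_partials[OF gd])
  have gr: "(g has_derivative (\<lambda>v. Re (D x v))) (at x)" for x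
    using has_derivative_Re[OF D[of x]] by simp
  \<comment> \<open>The differential of a real-valued function is real. Hence the derivative of the
    composition is a product of complex factors, to which \<open>Ck_mult\<close> applies.\<close>
  have im: "D x v = complex_of_real (Re (D x v))" for x v
  proof -
    have "((\<lambda>x. complex_of_real (g x)) has_derivative (\<lambda>v. complex_of_real (Re (D x v)))) (at x)"
      by (rule has_derivative_of_real[OF gr])
    then show ?thesis using has_derivative_unique[OF D[of x]] by metis
  qed
  show ?case
  proof (rule Ck_SucI)
    fix x
    have "((\<lambda>x. h j (g x)) has_derivative (\<lambda>v. h (Suc j) (g x) * Re (D x v))) (at x)"
      using has_derivative_compose[OF gr, of "h j" "\<lambda>v. h (Suc j) (g x) * v"] deriv_seqD[OF h, of j "g x"]
      by (simp add: has_field_derivative_def)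
    then have "((\<lambda>x. complex_of_real (h j (g x))) has_derivative (\<lambda>v. complex_of_real (h (Suc j) (g x) * Re (D x v)))) (at x)"
      by (rule has_derivative_of_real)
    then show "((\<lambda>x. complex_of_real (h j (g x))) has_derivative (\<lambda>v. complex_of_real (h (Suc j) (g x)) * D x v)) (at x)"
      by (simp only: im[symmetric] of_real_mult)
  next
    fix i
    have "D x (axis i 1) = partial i (\<lambda>x. complex_of_real (g x)) x" for x
      by (simp add: D_def axis_def if_distrib[of "\<lambda>c. c *\<^sub>R _"] cong: if_cong)
    moreover have "Ck k (\<lambda>x. complex_of_real (h (Suc j) (g x)) * partial i (\<lambda>x. complex_of_real (g x)) x)"
      by (rule Ck_mult[OF Suc]) (use g[of "Suc k"] in auto)
    ultimately show "Ck k (\<lambda>x. complex_of_real (h (Suc j) (g x)) * D x (axis i 1))" by simp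
  qed
qed

lemma smooth_partial: "smooth f \<Longrightarrow> smooth (partial i f)"
  unfolding smooth_def by (metis Ck.simps(2))

lemma smooth_differentiable: "smooth f \<Longrightarrow> f differentiable (at x)"
  unfolding smooth_def by (metis Ck.simps(2))

lemma smooth_has_derivative:
  "smooth f \<Longrightarrow> (f has_derivative (\<lambda>h. \<Sum>i\<in>UNIV. (h $ i) *\<^sub>R partial i f x)) (at x)"
  by (rule has_derivative_partials[OF smooth_differentiable])

lemma smooth_continuous: "smooth f \<Longrightarrow> continuous_on A f"
  unfolding smooth_def using continuous_on_subset[of UNIV f A] by (metis Ck.simps(1) subset_UNIV)

lemma smooth_const: "smooth (\<lambda>x. c)" by (simp add: smooth_def Ck_const)
lemma smooth_add: "smooth f \<Longrightarrow> smooth g \<Longrightarrow> smooth (\<lambda>x. f x + g x)" by (simp add: smooth_def Ck_add)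
lemma smooth_mult: "smooth f \<Longrightarrow> smooth g \<Longrightarrow> smooth (\<lambda>x. f x * g x)" by (simp add: smooth_def Ck_mult)
lemma smooth_cmult: "smooth f \<Longrightarrow> smooth (\<lambda>x. c * f x)" by (rule smooth_mult[OF smooth_const])
lemma smooth_coord: "smooth (\<lambda>x. complex_of_real (x $ i))" by (simp add: smooth_def Ck_coord)
lemma smooth_prod: "(\<And>i. i \<in> I \<Longrightarrow> smooth (f i)) \<Longrightarrow> smooth (\<lambda>x. \<Prod>i\<in>I. f i x)"
  by (simp add: smooth_def Ck_prod)
lemma smooth_sum: "(\<And>i. i \<in> I \<Longrightarrow> smooth (f i)) \<Longrightarrow> smooth (\<lambda>x. \<Sum>i\<in>I. f i x)"
  by (simp add: smooth_def Ck_sum)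
lemma smooth_compose_deriv_seq:
  "deriv_seq h \<Longrightarrow> smooth (\<lambda>x. complex_of_real (g x)) \<Longrightarrow> smooth (\<lambda>x. complex_of_real (h j (g x)))"
  by (simp add: smooth_def Ck_compose_deriv_seq)

lemma partial_cmult: "smooth f \<Longrightarrow> partial i (\<lambda>x. c * f x) x = c * partial i f x"
  using partial_mult[OF smooth_differentiable[OF smooth_const] smooth_differentiable]
  by (auto simp: partial_eq[OF has_derivative_const])

section \<open>Integration over the ball\<close>

lemma Omega_sets [measurable, simp]: "Omega \<in> sets lborel" "Omega \<in> sets borel" by auto

lemma space_vol [simp]: "space vol = Omega" by (simp add: space_restrict_space)

lemma finite_measure_vol: "finite_measure vol"
  by (rule finite_measureI) (simp add: emeasure_restrict_space emeasure_bounded_finite[unfolded infinity_ennreal_def less_top[symmetric]])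

lemma borel_measurable_vol: "f \<in> borel_measurable borel \<Longrightarrow> f \<in> borel_measurable vol"
  by (rule measurable_restrict_space1) simp

lemma continuous_vol: "continuous_on UNIV f \<Longrightarrow> f \<in> borel_measurable vol"
  by (rule borel_measurable_vol[OF borel_measurable_continuous_onI])

lemma integrable_vol_bounded:
  fixes f :: "real^'n \<Rightarrow> 'b::{banach,second_countable_topology}"
  assumes "f \<in> borel_measurable vol" "\<And>x. x \<in> Omega \<Longrightarrow> norm (f x) \<le> B"
  shows "integrable vol f"
  by (rule finite_measure.integrable_const_bound[OF finite_measure_vol, of _ B])
     (use assms in \<open>auto intro!: AE_I2\<close>)

lemma square_integrable_vol_bounded:
  fixes f :: "real^'n \<Rightarrow> 'b::real_normed_vector"
  assumes "f \<in> borel_measurable vol" "\<And>x. x \<in> Omega \<Longrightarrow> norm (f x) \<le> B"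
  shows "square_integrable vol f"
  unfolding square_integrable_def
proof
  show "integrable vol (\<lambda>x. (norm (f x))\<^sup>2)"
    by (rule integrable_vol_bounded[of _ "B\<^sup>2"]) (use assms in \<open>auto intro!: power_mono\<close>)
qed fact

lemma continuous_bounded_Omega:
  assumes "continuous_on UNIV (f :: real^'n \<Rightarrow> 'b::real_normed_vector)"
  shows "\<exists>B. \<forall>x\<in>Omega. norm (f x) \<le> B"
proof -
  have "compact (f ` cball 0 1)"
    by (rule compact_continuous_image) (use assms continuous_on_subset in auto)
  then obtain B where "\<forall>y\<in>f ` cball 0 1. norm y \<le> B"
    using compact_imp_bounded bounded_iff by metis
  then show ?thesis by (intro exI[of _ B]) auto
qed

lemma continuous_square_integrable:
  "continuous_on UNIV (f :: real^'n \<Rightarrow> 'b::real_normed_vector) \<Longrightarrow> square_integrable vol f"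
  using continuous_bounded_Omega[of f] square_integrable_vol_bounded[OF continuous_vol] by blast

lemma continuous_integrable:
  "continuous_on UNIV (f :: real^'n \<Rightarrow> 'b::{banach,second_countable_topology}) \<Longrightarrow> integrable vol f"
  using continuous_bounded_Omega[of f] integrable_vol_bounded[OF continuous_vol] by blast

lemma square_integrable_vol_integrable:
  fixes f :: "real^'n \<Rightarrow> 'b::{banach,second_countable_topology}"
  assumes "square_integrable vol f"
  shows "integrable vol f"
proof -
  have "square_integrable vol (\<lambda>x::real^'n. 1::real)"
    by (rule square_integrable_vol_bounded[of _ 1]) auto
  from square_integrable_mult_integrable[OF square_integrable_norm[OF assms] this]
  have "integrable vol (\<lambda>x. norm (f x))" by simp
  then show ?thesis using assms by (simp add: square_integrable_def integrable_norm_iff)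
qed

section \<open>Integration by parts against test functions\<close>

lemma line_has_vector_derivative:
  assumes "f differentiable (at (x + s *\<^sub>R axis i 1))"
  shows "((\<lambda>s. f (x + s *\<^sub>R axis i 1)) has_vector_derivative partial i f (x + s *\<^sub>R axis i 1)) (at s)"
proof -
  have 1: "((\<lambda>s. x + s *\<^sub>R axis i 1) has_derivative (\<lambda>h. h *\<^sub>R axis i 1)) (at s)"
    by (auto intro!: derivative_eq_intros)
  have "((\<lambda>s. f (x + s *\<^sub>R axis i 1)) has_derivative
     (\<lambda>h. \<Sum>j\<in>UNIV. ((h *\<^sub>R axis i 1 :: real^'a) $ j) *\<^sub>R partial j f (x + s *\<^sub>R axis i 1))) (at s)"
    by (rule has_derivative_compose[OF 1 has_derivative_partials[OF assms]])
  then show ?thesis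
    by (simp add: has_vector_derivative_def axis_def if_distrib[of "\<lambda>c. c *\<^sub>R _"] if_distrib[of "\<lambda>c. _ * c"] cong: if_cong)
qed

lemma integral_translate:
  fixes f :: "real^'n \<Rightarrow> 'b::{banach,second_countable_topology}"
  assumes [measurable]: "f \<in> borel_measurable borel"
  shows "(\<integral>x. f (x + a) \<partial>lborel) = (\<integral>x. f x \<partial>lborel)"
proof -
  have "(\<integral>x. f x \<partial>lborel) = (\<integral>x. f x \<partial>distr lborel borel ((+) a))" by (simp add: lborel_distr_plus)
  also have "\<dots> = (\<integral>x. f (a + x) \<partial>lborel)" by (rule integral_distr) auto
  finally show ?thesis by (simp add: add.commute)
qed

lemma partial_zero_outside:
  assumes "open S" "x \<in> S" "\<And>y. y \<in> S \<Longrightarrow> f y = 0"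
  shows "partial i f x = 0"
proof -
  have "((\<lambda>x. 0) has_derivative (\<lambda>h. 0)) (at x)" by simp
  then have "(f has_derivative (\<lambda>h. 0)) (at x)"
    by (rule has_derivative_transform_within_open[OF _ assms(1,2)]) (use assms in auto)
  then show ?thesis by (simp add: partial_eq)
qed

lemma continuous_compact_support_bounded:
  fixes f :: "'a::metric_space \<Rightarrow> 'b::real_normed_vector"
  assumes "continuous_on UNIV f" "compact K" "\<And>x. x \<notin> K \<Longrightarrow> f x = 0"
  shows "\<exists>B\<ge>0. \<forall>x. norm (f x) \<le> B"
proof -
  have "compact (f ` K)"
    by (rule compact_continuous_image[OF continuous_on_subset[OF assms(1)] assms(2)]) simp
  then obtain B where "\<forall>y\<in>f ` K. norm y \<le> B"
    using compact_imp_bounded bounded_iff by metis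
  then have "norm (f x) \<le> max B 0" for x using assms(3)[of x] by (cases "x \<in> K") auto
  then show ?thesis by (intro exI[of _ "max B 0"]) auto
qed

lemma continuous_compact_support_integrable:
  fixes f :: "real^'n \<Rightarrow> 'b::{banach,second_countable_topology}"
  assumes "continuous_on UNIV f" "compact K" "\<And>x. x \<notin> K \<Longrightarrow> f x = 0"
  shows "integrable lborel f"
proof -
  obtain B where B: "0 \<le> B" "\<And>x. norm (f x) \<le> B" using continuous_compact_support_bounded[OF assms] by blast
  have K: "K \<in> sets borel" "emeasure lborel K < \<infinity>"
    using assms(2) borel_compact emeasure_bounded_finite compact_imp_bounded by blast+
  show ?thesis
  proof (rule Bochner_Integration.integrable_bound)
    show "integrable lborel (\<lambda>x. B *\<^sub>R indicator K x :: real)"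
      using K by (intro integrable_scaleR_right) (simp add: integrable_indicator_iff)
    show "f \<in> borel_measurable lborel" using borel_measurable_continuous_onI[OF assms(1)] by simp
    show "AE x in lborel. norm (f x) \<le> norm (B *\<^sub>R indicator K x :: real)"
      using B assms(3) by (auto intro!: AE_I2 simp: indicator_def)
  qed
qed

text \<open>Translation invariance makes the integrals of the difference quotients vanish.\<close>

lemma integral_partial_eq_0:
  fixes f :: "real^'n \<Rightarrow> complex"
  assumes d: "\<And>x. f differentiable (at x)" and c: "continuous_on UNIV (partial i f)"
    and K: "compact K" "\<And>x. x \<notin> K \<Longrightarrow> f x = 0"
  shows "(\<integral>x. partial i f x \<partial>lborel) = 0"
proof -
  have fc: "continuous_on UNIV f"
    using d by (auto intro!: differentiable_imp_continuous_on simp: differentiable_on_def differentiable_at_withinI)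
  have pK: "partial i f x = 0" if "x \<notin> K" for x
    by (rule partial_zero_outside[of "- K"]) (use that K compact_imp_closed in auto)
  obtain B where B: "0 \<le> B" "\<And>x. norm (partial i f x) \<le> B"
    using continuous_compact_support_bounded[OF c K(1) pK] by blast
  \<comment> \<open>Step sizes are at most 1, so this unit neighbourhood of K contains the supports
    of all difference quotients and carries the dominating function.\<close>
  define K' where "K' = {x + y |x y. x \<in> K \<and> y \<in> cball 0 1}"
  have K'c: "compact K'" unfolding K'_def by (rule compact_sums[OF K(1)]) simp
  have K'sets: "K' \<in> sets borel" "emeasure lborel K' < \<infinity>"
    using K'c borel_compact emeasure_bounded_finite compact_imp_bounded by blast+
  have fm [measurable]: "f \<in> borel_measurable borel" by (rule borel_measurable_continuous_onI[OF fc])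
  define t where "t m = 1 / real (Suc m)" for m
  have t: "0 < t m" "t m \<le> 1" for m by (auto simp: t_def)
  define g where "g m x = (f (x + t m *\<^sub>R axis i 1) - f x) /\<^sub>R t m" for m x
  have fi: "integrable lborel f" by (rule continuous_compact_support_integrable[OF fc K])
  have ft: "integrable lborel (\<lambda>x. f (x + a))" for a
  proof -
    have "integrable (distr lborel borel ((+) a)) f" using fi by (simp add: lborel_distr_plus)
    then have "integrable lborel (\<lambda>x. f (a + x))" by (subst (asm) integrable_distr_eq) auto
    then show ?thesis by (simp add: add.commute)
  qed
  have "(\<integral>x. g m x \<partial>lborel) = 0" for m
    unfolding g_def using fi ft by (simp add: integral_translate)
  moreover have "(\<lambda>m. \<integral>x. g m x \<partial>lborel) \<longlonglongrightarrow> (\<integral>x. partial i f x \<partial>lborel)"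
  proof (rule integral_dominated_convergence)
    show "partial i f \<in> borel_measurable lborel" using borel_measurable_continuous_onI[OF c] by simp
    show "g m \<in> borel_measurable lborel" for m unfolding g_def by measurable
    show "integrable lborel (\<lambda>x. B *\<^sub>R indicator K' x :: real)"
      using K'sets by (intro integrable_scaleR_right) (simp add: integrable_indicator_iff)
    show "AE x in lborel. (\<lambda>m. g m x) \<longlonglongrightarrow> partial i f x"
    proof (rule AE_I2)
      fix x
      have "((\<lambda>s. f (x + s *\<^sub>R axis i 1)) has_vector_derivative partial i f x) (at 0)"
        using line_has_vector_derivative[of f x 0 i] d by simp
      then have N: "((\<lambda>s. norm (f (x + s *\<^sub>R axis i 1) - f x - s *\<^sub>R partial i f x) / \<bar>s\<bar>) \<longlongrightarrow> 0) (at 0)"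
        by (simp add: has_vector_derivative_def has_derivative_iff_norm)
      have "((\<lambda>s. norm ((f (x + s *\<^sub>R axis i 1) - f x) /\<^sub>R s - partial i f x)) \<longlongrightarrow> 0) (at 0)"
      proof (rule Lim_transform_eventually[OF N])
        have "norm (f (x + s *\<^sub>R axis i 1) - f x - s *\<^sub>R partial i f x) / \<bar>s\<bar> =
            norm ((f (x + s *\<^sub>R axis i 1) - f x) /\<^sub>R s - partial i f x)" if "s \<noteq> 0" for s
        proof -
          have "(f (x + s *\<^sub>R axis i 1) - f x) /\<^sub>R s - partial i f x =
              (f (x + s *\<^sub>R axis i 1) - f x - s *\<^sub>R partial i f x) /\<^sub>R s"
            using that by (simp add: scaleR_diff_right)
          then show ?thesis by (simp add: divide_inverse mult.commute)
        qed
        then show "\<forall>\<^sub>F s in at 0. norm (f (x + s *\<^sub>R axis i 1) - f x - s *\<^sub>R partial i f x) / \<bar>s\<bar> =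
            norm ((f (x + s *\<^sub>R axis i 1) - f x) /\<^sub>R s - partial i f x)"
          by (auto simp: eventually_at_filter)
      qed
      then have "((\<lambda>s. (f (x + s *\<^sub>R axis i 1) - f x) /\<^sub>R s) \<longlongrightarrow> partial i f x) (at 0)"
        by (rule LIM_zero_cancel[OF tendsto_norm_zero_cancel])
      moreover have "filterlim t (at 0) sequentially"
        unfolding filterlim_at
      proof
        show "\<forall>\<^sub>F m in sequentially. t m \<in> UNIV \<and> t m \<noteq> 0" using t by (auto intro!: always_eventually simp: less_imp_neq[symmetric])
        show "t \<longlonglongrightarrow> 0" unfolding t_def by (rule LIMSEQ_Suc[OF lim_1_over_n])
      qed
      ultimately show "(\<lambda>m. g m x) \<longlonglongrightarrow> partial i f x"
        unfolding g_def by (rule filterlim_compose)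
    qed
    show "AE x in lborel. norm (g m x) \<le> B *\<^sub>R indicator K' x" for m
    proof (rule AE_I2)
      fix x
      have "norm (f (x + t m *\<^sub>R axis i 1) - f (x + 0 *\<^sub>R axis i 1)) \<le> B * norm (t m - 0)"
      proof (rule differentiable_bound[where S=UNIV and f'="\<lambda>s h. h *\<^sub>R partial i f (x + s *\<^sub>R axis i 1)"])
        show "((\<lambda>s. f (x + s *\<^sub>R axis i 1)) has_derivative (\<lambda>h. h *\<^sub>R partial i f (x + s *\<^sub>R axis i 1))) (at s within UNIV)" for s
          using line_has_vector_derivative[of f x s i] d by (simp add: has_vector_derivative_def)
        show "onorm (\<lambda>h. h *\<^sub>R partial i f (x + s *\<^sub>R axis i 1)) \<le> B" for s :: real
          by (rule onorm_le) (use B in \<open>auto intro!: mult_left_mono simp: mult.commute[of B]\<close>)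
      qed auto
      then have b: "norm (g m x) \<le> B" using t[of m] unfolding g_def norm_scaleR by (simp add: field_simps)
      show "norm (g m x) \<le> B *\<^sub>R indicator K' x"
      proof (cases "x \<in> K'")
        case False
        have "x \<notin> K"
        proof
          assume "x \<in> K"
          then have "x + 0 \<in> K'" unfolding K'_def by (intro CollectI exI[of _ x] exI[of _ 0]) auto
          then show False using False by simp
        qed
        moreover have "x + t m *\<^sub>R axis i 1 \<notin> K"
        proof
          assume "x + t m *\<^sub>R axis i 1 \<in> K"
          then have "(x + t m *\<^sub>R axis i 1) + (- t m *\<^sub>R axis i 1) \<in> K'"
            unfolding K'_def using t[of m] by (intro CollectI exI[of _ "x + t m *\<^sub>R axis i 1"] exI[of _ "- t m *\<^sub>R axis i 1"]) auto
          then show False using False by simp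
        qed
        ultimately show ?thesis using K(2) False by (simp add: g_def)
      qed (use b in simp)
    qed
  qed
  ultimately show ?thesis by (simp add: LIMSEQ_const_iff)
qed

lemma integral_vol_eq_lborel:
  fixes f :: "real^'n \<Rightarrow> 'b::{banach,second_countable_topology}"
  assumes "\<And>x. x \<notin> Omega \<Longrightarrow> f x = 0"
  shows "(\<integral>x. f x \<partial>vol) = (\<integral>x. f x \<partial>lborel)"
proof -
  have "(\<lambda>x. indicator Omega x *\<^sub>R f x) = f" using assms by (auto simp: indicator_def fun_eq_iff)
  then show ?thesis by (simp add: integral_restrict_space)
qed

lemma test_function_smooth: "test_function \<phi> \<Longrightarrow> smooth \<phi>"
  by (simp add: test_function_def)

lemma smooth_mult_test:
  assumes "smooth f" "test_function \<phi>" shows "test_function (\<lambda>x. f x * \<phi> x)"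
  using assms by (auto simp: test_function_def intro!: smooth_mult)

lemma test_function_cmult: "test_function \<phi> \<Longrightarrow> test_function (\<lambda>x. c * \<phi> x)"
  by (rule smooth_mult_test[OF smooth_const])

lemma test_function_add:
  assumes "test_function f" "test_function g" shows "test_function (\<lambda>x. f x + g x)"
proof -
  obtain K L where "compact K" "K \<subseteq> Omega" "\<And>x. x \<notin> K \<Longrightarrow> f x = 0" "compact L" "L \<subseteq> Omega" "\<And>x. x \<notin> L \<Longrightarrow> g x = 0"
    using assms unfolding test_function_def by metis
  then have "compact (K \<union> L) \<and> K \<union> L \<subseteq> Omega \<and> (\<forall>x. x \<notin> K \<union> L \<longrightarrow> f x + g x = 0)" by auto
  moreover have "smooth (\<lambda>x. f x + g x)" using assms by (simp add: test_function_def smooth_add)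
  ultimately show ?thesis unfolding test_function_def by blast
qed

text \<open>The product has compact support in the ball, so its derivative integrates to 0 and no
  boundary term appears.\<close>

lemma integration_by_parts:
  assumes f: "smooth f" and \<phi>: "test_function \<phi>"
  shows "(\<integral>x. f x * partial i \<phi> x \<partial>vol) = - (\<integral>x. partial i f x * \<phi> x \<partial>vol)"
proof -
  have s: "smooth \<phi>" using \<phi> by (simp add: test_function_def)
  have p: "test_function (\<lambda>x. f x * \<phi> x)" by (rule smooth_mult_test[OF f \<phi>])
  then obtain K where K: "compact K" "K \<subseteq> Omega" "\<And>x. x \<notin> K \<Longrightarrow> f x * \<phi> x = 0"
    unfolding test_function_def by blast
  have z: "partial i (\<lambda>x. f x * \<phi> x) x = 0" if "x \<notin> K" for x
    by (rule partial_zero_outside[of "- K"]) (use that K compact_imp_closed in auto)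
  have ps: "smooth (\<lambda>x. f x * \<phi> x)" by (rule smooth_mult[OF f s])
  have "0 = (\<integral>x. partial i (\<lambda>x. f x * \<phi> x) x \<partial>lborel)"
    by (rule integral_partial_eq_0[symmetric, OF smooth_differentiable[OF ps]
          smooth_continuous[OF smooth_partial[OF ps]] K(1,3)])
  also have "\<dots> = (\<integral>x. partial i (\<lambda>x. f x * \<phi> x) x \<partial>vol)"
    by (rule integral_vol_eq_lborel[symmetric]) (use z K(2) in blast)
  also have "\<dots> = (\<integral>x. f x * partial i \<phi> x + partial i f x * \<phi> x \<partial>vol)"
    by (simp add: partial_mult smooth_differentiable f s)
  also have "\<dots> = (\<integral>x. f x * partial i \<phi> x \<partial>vol) + (\<integral>x. partial i f x * \<phi> x \<partial>vol)"
    by (rule Bochner_Integration.integral_add)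
       (intro continuous_integrable continuous_on_mult smooth_continuous f s smooth_partial)+
  finally show ?thesis by (simp add: eq_neg_iff_add_eq_0)
qed

definition grad :: "(real^'n \<Rightarrow> complex) \<Rightarrow> real^'n \<Rightarrow> complex^'n"
  where "grad f x = (\<chi> i. partial i f x)"

lemma grad_continuous: "smooth f \<Longrightarrow> continuous_on A (grad f)"
  unfolding grad_def
  by (rule continuous_on_vec_lambda) (rule smooth_continuous[OF smooth_partial])

section \<open>Uniqueness of weak gradients\<close>

lemma power2_norm_vec: "(norm (x :: ('a::real_normed_vector)^'n))\<^sup>2 = (\<Sum>i\<in>UNIV. (norm (x $ i))\<^sup>2)"
  by (simp add: norm_vec_def L2_set_def sum_nonneg)

lemma smooth_norm_affine: "smooth (\<lambda>x::real^'n. complex_of_real ((1 - (norm x)\<^sup>2) / d))"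
proof -
  have "smooth (\<lambda>x::real^'n. complex_of_real (1/d) + complex_of_real (-1/d) *
      (\<Sum>i\<in>UNIV. complex_of_real (x $ i) * complex_of_real (x $ i)))"
    by (intro smooth_add smooth_const smooth_cmult smooth_sum smooth_mult smooth_coord)
  moreover have "complex_of_real ((1 - (norm x)\<^sup>2) / d) = complex_of_real (1/d) + complex_of_real (-1/d) *
      (\<Sum>i\<in>UNIV. complex_of_real (x $ i) * complex_of_real (x $ i))" for x :: "real^'n"
  proof -
    have "(\<Sum>i\<in>UNIV. complex_of_real (x $ i) * complex_of_real (x $ i)) = complex_of_real ((norm x)\<^sup>2)"
      unfolding power2_norm_vec by (simp add: power2_eq_square)
    then show ?thesis by (simp add: diff_divide_distrib)
  qed
  ultimately show ?thesis by simp
qed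

text \<open>With the step from \<open>exists_step\<close> this cutoff is 1 where |x|^2 <= 1 - d and
  0 where |x|^2 >= 1 - d/2. Using |x|^2 rather than |x| makes smoothness at the origin
  evident.\<close>

lemma cutoff_test_function:
  fixes d :: real
  assumes h: "deriv_seq h" "\<And>t. t \<le> 1/2 \<Longrightarrow> h 0 t = 0" and d: "0 < d"
  shows "test_function (\<lambda>x::real^'n. complex_of_real (h 0 ((1 - (norm x)\<^sup>2) / d)))"
  unfolding test_function_def
proof
  show "smooth (\<lambda>x::real^'n. complex_of_real (h 0 ((1 - (norm x)\<^sup>2) / d)))"
    by (rule smooth_compose_deriv_seq[OF h(1) smooth_norm_affine])
  define K where "K = {x::real^'n. (norm x)\<^sup>2 \<le> 1 - d/2}"
  have "closed K" unfolding K_def by (intro closed_Collect_le continuous_intros)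
  moreover have sub: "K \<subseteq> Omega"
  proof
    fix x assume "x \<in> K"
    then have "(norm x)\<^sup>2 < 1" using d by (simp add: K_def)
    then show "x \<in> Omega" by (simp add: power_less_one_iff abs_square_less_1)
  qed
  then have "bounded K" using bounded_subset bounded_ball by blast
  ultimately have "compact K" by (simp add: compact_eq_bounded_closed)
  moreover have "complex_of_real (h 0 ((1 - (norm x)\<^sup>2) / d)) = 0" if "x \<notin> K" for x
    using h(2)[of "(1 - (norm x)\<^sup>2) / d"] that d by (simp add: K_def field_simps)
  ultimately show "\<exists>K. compact K \<and> K \<subseteq> Omega \<and> (\<forall>x. x \<notin> K \<longrightarrow> complex_of_real (h 0 ((1 - (norm (x::real^'n))\<^sup>2) / d)) = 0)"
    using sub by blast
qed

text \<open>At s = 0 the limit is 0, so products of such factors converge to the indicator of an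
  open box at every point, faces included.\<close>

lemma step_scaled_tendsto:
  assumes "\<And>t. t \<le> 1/2 \<Longrightarrow> h t = (0::real)" "\<And>t. t \<ge> 1 \<Longrightarrow> h t = 1"
  shows "(\<lambda>m. h (real m * s)) \<longlonglongrightarrow> (if 0 < s then 1 else 0)"
proof (cases "0 < s")
  case True
  obtain m0 :: nat where m0: "1 / s < real m0" using reals_Archimedean2 by blast
  have "h (real m * s) = 1" if "m0 \<le> m" for m
  proof (rule assms(2))
    have "1 \<le> real m0 * s" using m0 True by (simp add: field_simps)
    also have "\<dots> \<le> real m * s" using that True by (intro mult_right_mono) auto
    finally show "1 \<le> real m * s" .
  qed
  then have "\<forall>\<^sub>F m in sequentially. h (real m * s) = 1" by (auto simp: eventually_sequentially)
  then show ?thesis using True by (simp add: tendsto_eventually)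
next
  case False
  then have "real m * s \<le> 0" for m by (simp add: mult_nonneg_nonpos)
  then have "h (real m * s) = 0" for m using assms(1)[of "real m * s"] by (smt (verit) divide_pos_pos)
  then show ?thesis using False by simp
qed

text \<open>The indicator of a box is a bounded pointwise limit of test functions:
  \<open>p m\<close> is a product of steps in the coordinates, and the cutoff \<open>c m\<close>,
  which tends to 1 in the ball, makes the support compact there.\<close>

lemma integral_box_eq_0:
  fixes D :: "real^'n \<Rightarrow> complex"
  assumes D: "integrable vol D" and z: "\<And>\<phi>. test_function \<phi> \<Longrightarrow> (\<integral>x. D x * \<phi> x \<partial>vol) = 0"
  shows "(\<integral>x. D x * indicator (box a b) x \<partial>vol) = 0"
proof -
  obtain h where h: "deriv_seq h" "\<And>t. t \<le> 1/2 \<Longrightarrow> h 0 t = 0" "\<And>t. t \<ge> 1 \<Longrightarrow> h 0 t = 1"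
    "\<And>t. 0 \<le> h 0 t" "\<And>t. h 0 t \<le> 1"
    using exists_step by metis
  define c where "c m x = complex_of_real (h 0 ((1 - (norm x)\<^sup>2) / (1 / real (Suc m))))" for m and x :: "real^'n"
  define p where "p m x = (\<Prod>i\<in>UNIV. complex_of_real (h 0 (real m * (x $ i - a $ i))) * complex_of_real (h 0 (real m * (b $ i - x $ i))))" for m and x :: "real^'n"
  have aff: "smooth (\<lambda>x::real^'n. complex_of_real (u + v * x $ i))" for u v i
    using smooth_add[OF smooth_const[of "complex_of_real u"] smooth_cmult[OF smooth_coord[of i], of "complex_of_real v"]] by simp
  have s1: "smooth (\<lambda>x::real^'n. complex_of_real (h 0 (real m * (x $ i - a $ i))))" for m i
    using smooth_compose_deriv_seq[OF h(1) aff[of "- real m * a $ i" "real m" i], of 0] by (simp add: algebra_simps)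
  have s2: "smooth (\<lambda>x::real^'n. complex_of_real (h 0 (real m * (b $ i - x $ i))))" for m i
    using smooth_compose_deriv_seq[OF h(1) aff[of "real m * b $ i" "- real m" i], of 0] by (simp add: algebra_simps)
  have pt: "smooth (p m)" for m
    unfolding p_def by (intro smooth_prod smooth_mult s1 s2)
  have ct: "test_function (c m)" for m
    unfolding c_def by (rule cutoff_test_function[OF h(1,2)]) auto
  have t: "test_function (\<lambda>x. p m x * c m x)" for m by (rule smooth_mult_test[OF pt ct])
  have pn: "norm (p m x) \<le> 1" for m x
  proof -
    have "norm (p m x) = (\<Prod>i\<in>UNIV. \<bar>h 0 (real m * (x $ i - a $ i))\<bar> * \<bar>h 0 (real m * (b $ i - x $ i))\<bar>)"
      unfolding p_def by (simp add: prod_norm[symmetric] norm_mult)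
    also have "\<dots> \<le> 1" by (intro prod_le_1 conjI mult_le_one) (use h in auto)
    finally show ?thesis .
  qed
  have cn: "norm (c m x) \<le> 1" for m x unfolding c_def using h(4,5) by simp
  have "(\<lambda>m. \<integral>x. D x * (p m x * c m x) \<partial>vol) \<longlonglongrightarrow> (\<integral>x. D x * indicator (box a b) x \<partial>vol)"
  proof (rule integral_dominated_convergence[where w="\<lambda>x. norm (D x)"])
    show "(\<lambda>x. D x * indicator (box a b) x) \<in> borel_measurable vol"
      by (intro borel_measurable_times borel_measurable_integrable[OF D] borel_measurable_vol borel_measurable_indicator) simp
    show "(\<lambda>x. D x * (p m x * c m x)) \<in> borel_measurable vol" for m
      using D continuous_vol[OF smooth_continuous[OF pt]] continuous_vol[OF smooth_continuous[OF test_function_smooth[OF ct]]]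
      by (intro borel_measurable_times) auto
    show "integrable vol (\<lambda>x. norm (D x))" using D by simp
    show "AE x in vol. norm (D x * (p m x * c m x)) \<le> norm (D x)" for m
    proof (rule AE_I2)
      fix x
      have "norm (D x) * norm (p m x * c m x) \<le> norm (D x) * 1"
        using mult_le_one[OF pn _ cn] by (intro mult_left_mono) (simp_all add: norm_mult)
      then show "norm (D x * (p m x * c m x)) \<le> norm (D x)" by (simp add: norm_mult)
    qed
    show "AE x in vol. (\<lambda>m. D x * (p m x * c m x)) \<longlonglongrightarrow> D x * indicator (box a b) x"
    proof (rule AE_I2)
      fix x :: "real^'n" assume "x \<in> space vol"
      then have "norm x < 1" by simp
      then have "(norm x)\<^sup>2 < 1" by (simp add: power_less_one_iff abs_square_less_1)
      then have pos: "0 < 1 - (norm x)\<^sup>2" by simp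
      have "(\<lambda>m. h 0 (real (Suc m) * (1 - (norm x)\<^sup>2))) \<longlonglongrightarrow> 1"
        using LIMSEQ_Suc[OF step_scaled_tendsto[of "h 0" "1 - (norm x)\<^sup>2", OF h(2,3)]] pos by simp
      then have "(\<lambda>m. c m x) \<longlonglongrightarrow> complex_of_real 1"
        unfolding c_def by (intro tendsto_of_real) (simp add: mult.commute)
      moreover have "(\<lambda>m. p m x) \<longlonglongrightarrow> (\<Prod>i\<in>UNIV. complex_of_real (if 0 < x $ i - a $ i then 1 else 0) * complex_of_real (if 0 < b $ i - x $ i then 1 else 0))"
        unfolding p_def by (intro tendsto_prod tendsto_mult tendsto_of_real step_scaled_tendsto h)
      moreover have "(\<Prod>i\<in>UNIV. complex_of_real (if 0 < x $ i - a $ i then 1 else 0) * complex_of_real (if 0 < b $ i - x $ i then 1 else 0)) = indicator (box a b) x"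
      proof (cases "x \<in> box a b")
        case True
        then show ?thesis by (simp add: mem_box_cart)
      next
        case False
        then obtain i where "\<not> (a $ i < x $ i \<and> x $ i < b $ i)" by (auto simp: mem_box_cart)
        then show ?thesis using False by (intro trans[OF prod_zero]) (auto intro!: bexI[of _ i])
      qed
      ultimately have "(\<lambda>m. D x * (p m x * c m x)) \<longlonglongrightarrow> D x * (indicator (box a b) x * complex_of_real 1)"
        by (intro tendsto_mult tendsto_const) auto
      then show "(\<lambda>m. D x * (p m x * c m x)) \<longlonglongrightarrow> D x * indicator (box a b) x" by simp
    qed
  qed
  then show ?thesis using z[OF t] by (simp add: LIMSEQ_const_iff)
qed

text \<open>Boxes form an intersection-stable generator of the Borel sets, and the sets with
  vanishing integral form a Dynkin system.\<close>

lemma integral_borel_eq_0: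
  fixes D :: "real^'n \<Rightarrow> complex"
  assumes D: "integrable vol D" and z: "\<And>\<phi>. test_function \<phi> \<Longrightarrow> (\<integral>x. D x * \<phi> x \<partial>vol) = 0"
    and A: "A \<in> sets borel"
  shows "(\<integral>x. D x * indicator A x \<partial>vol) = 0"
proof -
  let ?G = "range (\<lambda>(a, b). box a b :: (real^'n) set)"
  have meas: "B \<in> sigma_sets UNIV ?G \<Longrightarrow> B \<in> sets borel" for B
    by (simp add: borel_eq_box)
  have int: "integrable vol (\<lambda>x. D x * indicator B x)" if "B \<in> sigma_sets UNIV ?G" for B
  proof (rule Bochner_Integration.integrable_bound[OF D])
    show "(\<lambda>x. D x * indicator B x) \<in> borel_measurable vol"
      by (intro borel_measurable_times borel_measurable_integrable[OF D] borel_measurable_vol borel_measurable_indicator meas that)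
  qed (auto simp: indicator_def)
  \<comment> \<open>Complements require the integral over the whole ball, which lies in a single
    box.\<close>
  have all: "(\<integral>x. D x \<partial>vol) = 0"
  proof -
    have "(\<integral>x. D x * indicator (box (- 2 *\<^sub>R 1) (2 *\<^sub>R 1)) x \<partial>vol) = (\<integral>x. D x \<partial>vol)"
    proof (rule Bochner_Integration.integral_cong)
      fix x :: "real^'n" assume "x \<in> space vol"
      then have n: "norm x < 1" by simp
      have "\<bar>x $ i\<bar> < 1" for i using component_le_norm_cart[of x i] n by simp
      then have "- 2 < x $ i \<and> x $ i < 2" for i by (smt (verit))
      then have "x \<in> box (- 2 *\<^sub>R 1) (2 *\<^sub>R 1)" by (simp add: mem_box_cart)
      then show "D x * indicator (box (- 2 *\<^sub>R 1) (2 *\<^sub>R 1)) x = D x" by simp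
    qed simp
    then show ?thesis using integral_box_eq_0[OF D z] by simp
  qed
  have A': "A \<in> sigma_sets UNIV ?G" using A by (simp add: borel_eq_box)
  have st: "Int_stable ?G" by (auto simp: Int_stable_def box_Int_box)
  have PU: "?G \<subseteq> Pow UNIV" by simp
  show ?thesis
    using st PU A'
  proof (induction rule: sigma_sets_induct_disjoint)
    case (basic B)
    then show ?case using integral_box_eq_0[OF D z] by auto
  next
    case empty
    show ?case by simp
  next
    case (compl B)
    have "(\<integral>x. D x * indicator (UNIV - B) x \<partial>vol) = (\<integral>x. D x - D x * indicator B x \<partial>vol)"
      by (rule Bochner_Integration.integral_cong) (auto simp: indicator_def)
    then show ?case using compl D int by (simp add: all)
  next
    case (union B)
    have U: "(\<Union>i. B i) \<in> sigma_sets UNIV ?G" using union by (intro sigma_sets.Union) auto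
    have "(\<lambda>m. \<integral>x. D x * indicator (\<Union>i<m. B i) x \<partial>vol) \<longlonglongrightarrow> (\<integral>x. D x * indicator (\<Union>i. B i) x \<partial>vol)"
    proof (rule integral_dominated_convergence[where w="\<lambda>x. norm (D x)"])
      show "(\<lambda>x. D x * indicator (\<Union>i. B i) x) \<in> borel_measurable vol" using int[OF U] by simp
      show "(\<lambda>x. D x * indicator (\<Union>i<m. B i) x) \<in> borel_measurable vol" for m
      proof -
        have "indicator (\<Union>i<m. B i) \<in> borel_measurable (borel :: (real^'n) measure)"
          using union meas by (intro borel_measurable_indicator sets.finite_UN) auto
        then show ?thesis by (intro borel_measurable_times borel_measurable_integrable[OF D] borel_measurable_vol)
      qed
      show "AE x in vol. (\<lambda>m. D x * indicator (\<Union>i<m. B i) x) \<longlonglongrightarrow> D x * indicator (\<Union>i. B i) x"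
        by (intro AE_I2 tendsto_mult tendsto_const LIMSEQ_indicator_UN)
    qed (use D in \<open>auto simp: indicator_def\<close>)
    moreover have "(\<integral>x. D x * indicator (\<Union>i<m. B i) x \<partial>vol) = 0" for m
    proof -
      have "(\<integral>x. D x * indicator (\<Union>i<m. B i) x \<partial>vol) = (\<integral>x. (\<Sum>i<m. D x * indicator (B i) x) \<partial>vol)"
      proof (rule Bochner_Integration.integral_cong)
        fix x
        have "disjoint_family_on B {..<m}" using union(1) by (auto simp: disjoint_family_on_def)
        then show "D x * indicator (\<Union>i<m. B i) x = (\<Sum>i<m. D x * indicator (B i) x)"
          by (simp add: indicator_UN_disjoint sum_distrib_left)
      qed simp
      also have "\<dots> = (\<Sum>i<m. \<integral>x. D x * indicator (B i) x \<partial>vol)"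
        by (rule Bochner_Integration.integral_sum) (use union int in auto)
      also have "\<dots> = 0" using union by simp
      finally show ?thesis .
    qed
    ultimately show ?case by (simp add: LIMSEQ_const_iff)
  qed
qed

text \<open>Since all integrals over Borel sets vanish, the real and the imaginary part of D have
  the same integrals as the density 0.\<close>

lemma du_Bois_Reymond:
  fixes D :: "real^'n \<Rightarrow> complex"
  assumes D: "integrable vol D" and z: "\<And>\<phi>. test_function \<phi> \<Longrightarrow> (\<integral>x. D x * \<phi> x \<partial>vol) = 0"
  shows "AE x in vol. D x = 0"
proof -
  have *: "(\<integral>x\<in>A. F (D x) \<partial>vol) = (\<integral>x\<in>A. 0 \<partial>vol)"
    if A: "A \<in> sets vol" and F: "bounded_linear F" for A and F :: "complex \<Rightarrow> real"
  proof -
    have "A \<in> sets borel" using A by (auto simp: sets_restrict_space)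
    then have "0 = F (\<integral>x. D x * indicator A x \<partial>vol)"
      using integral_borel_eq_0[OF D z, of A] F by (simp add: bounded_linear.linear linear_0)
    also have "\<dots> = (\<integral>x. F (D x * indicator A x) \<partial>vol)"
    proof (rule integral_bounded_linear[OF F, symmetric])
      show "integrable vol (\<lambda>x. D x * indicator A x)"
        by (rule Bochner_Integration.integrable_bound[OF D]) (use A D in \<open>auto simp: indicator_def\<close>)
    qed
    also have "\<dots> = (\<integral>x\<in>A. F (D x) \<partial>vol)"
      unfolding set_lebesgue_integral_def using F
      by (intro Bochner_Integration.integral_cong) (auto simp: indicator_def bounded_linear.linear linear_0)
    finally show ?thesis by simp
  qed
  have "AE x in vol. Re (D x) = 0"
    by (rule density_unique_real) (use D *[OF _ bounded_linear_Re] in auto)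
  moreover have "AE x in vol. Im (D x) = 0"
    by (rule density_unique_real) (use D *[OF _ bounded_linear_Im] in auto)
  ultimately show ?thesis by eventually_elim (simp add: complex_eq_iff)
qed

section \<open>Jets and the energy form\<close>

text \<open>An element of \<open>H\<^sup>1\<close> is handled through the pair of the function and its weak gradient, an
  element of a single \<open>L\<^sup>2\<close> space; weak gradients chosen by \<open>weak_grad\<close> are linear only almost
  everywhere.\<close>

type_synonym 'n jet = "real^'n \<Rightarrow> complex \<times> (complex^'n)"

definition jet :: "(real^'n \<Rightarrow> complex) \<Rightarrow> 'n jet"
  where "jet u x = (u x, weak_grad u x)"

definition sjet :: "(real^'n \<Rightarrow> complex) \<Rightarrow> 'n jet"
  where "sjet u x = (u x, grad u x)"

text \<open>A function paired with some weak gradient of it. Unlike \<open>jet\<close>, which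
  depends on the choice made in \<open>weak_grad\<close>, such pairs may be added and scaled
  pointwise, and they are closed under L2 limits.\<close>

definition wjet :: "'n::finite jet \<Rightarrow> bool"
  where "wjet U \<longleftrightarrow> square_integrable vol U \<and> (\<forall>\<phi> i. test_function \<phi> \<longrightarrow>
    (\<integral>x. fst (U x) * partial i \<phi> x \<partial>vol) = - (\<integral>x. snd (U x) $ i * \<phi> x \<partial>vol))"

definition cmul :: "complex \<Rightarrow> complex \<times> (complex^'n) \<Rightarrow> complex \<times> (complex^'n)"
  where "cmul c p = (c * fst p, c *s snd p)"

lemma fst_cmul [simp]: "fst (cmul c p) = c * fst p"
  and snd_cmul [simp]: "snd (cmul c p) $ i = c * (snd p $ i)"
  by (auto simp: cmul_def)

lemma power2_norm_Pair: "(norm p)\<^sup>2 = (norm (fst p))\<^sup>2 + (norm (snd p))\<^sup>2"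
  by (simp add: norm_prod_def)

lemma power2_norm_jet: "(norm (p :: complex \<times> (complex^'n)))\<^sup>2 = (norm (fst p))\<^sup>2 + (\<Sum>i\<in>UNIV. (norm (snd p $ i))\<^sup>2)"
  by (simp add: power2_norm_Pair power2_norm_vec)

lemma norm_cmul: "norm (cmul c p) = norm c * norm p"
proof -
  have "(norm (cmul c p))\<^sup>2 = (norm c * norm p)\<^sup>2"
    by (simp add: power2_norm_jet power_mult_distrib norm_mult sum_distrib_left distrib_left)
  then show ?thesis by (simp add: power2_eq_iff_nonneg)
qed

lemma cmul_minus1: "cmul (-1) p = - p"
  by (simp add: cmul_def prod_eq_iff vec_eq_iff)

lemma continuous_cmul: "continuous_on UNIV (cmul c)"
  unfolding cmul_def vector_scalar_mult_def
  by (intro continuous_on_Pair continuous_on_vec_lambda continuous_intros)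

lemma square_integrable_cmul:
  assumes "square_integrable M U" shows "square_integrable M (\<lambda>x. cmul c (U x))"
  by (rule square_integrable_bound[OF assms, of _ "norm c"])
     (auto simp: norm_cmul intro: borel_measurable_continuous_on[OF continuous_cmul square_integrable_meas[OF assms]])

lemma L2n_cmul: "L2n M (\<lambda>x. cmul c (U x)) = norm c * L2n M U"
  by (simp add: L2n_def norm_cmul power_mult_distrib real_sqrt_mult)

lemma norm_fst_le_norm: "norm (fst p) \<le> norm (p :: complex \<times> (complex^'n))"
  by (cases p) (simp add: norm_fst_le)

lemma norm_snd_nth_le_norm: "norm (snd p $ i) \<le> norm (p :: complex \<times> (complex^'n))"
proof (cases p)
  case (Pair a b)
  have "norm (b $ i) \<le> norm b" by (rule Finite_Cartesian_Product.norm_nth_le)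
  also have "\<dots> \<le> norm p" using Pair by (simp add: norm_snd_le)
  finally show ?thesis using Pair by simp
qed

lemma square_integrable_fst:
  assumes "square_integrable M (U :: 'a \<Rightarrow> complex \<times> (complex^'n))" shows "square_integrable M (\<lambda>x. fst (U x))"
  by (rule square_integrable_bound[OF assms, of _ 1])
     (auto intro: norm_fst_le_norm borel_measurable_continuous_on[OF continuous_on_fst[OF continuous_on_id] square_integrable_meas[OF assms]])

lemma square_integrable_snd:
  assumes "square_integrable M (U :: 'a \<Rightarrow> complex \<times> (complex^'n))" shows "square_integrable M (\<lambda>x. snd (U x))"
  by (rule square_integrable_bound[OF assms, of _ 1])
     (auto intro: norm_snd_le[of "snd (U x)" "fst (U x)" for x, simplified]
       borel_measurable_continuous_on[OF continuous_on_snd[OF continuous_on_id] square_integrable_meas[OF assms]])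

lemma square_integrable_snd_nth:
  assumes "square_integrable M (U :: 'a \<Rightarrow> complex \<times> (complex^'n))" shows "square_integrable M (\<lambda>x. snd (U x) $ i)"
  by (rule square_integrable_bound[OF assms, of _ 1])
     (auto intro: norm_snd_nth_le_norm borel_measurable_continuous_on[OF
        continuous_on_component[OF continuous_on_snd[OF continuous_on_id]] square_integrable_meas[OF assms]])

lemma L2n_fst_le: "square_integrable M (U :: 'a \<Rightarrow> complex \<times> (complex^'n)) \<Longrightarrow> L2n M (\<lambda>x. fst (U x)) \<le> L2n M U"
  using L2n_bound[of M U "\<lambda>x. fst (U x)" 1] by (simp add: norm_fst_le_norm square_integrable_meas[OF square_integrable_fst])

lemma L2n_snd_nth_le: "square_integrable M (U :: 'a \<Rightarrow> complex \<times> (complex^'n)) \<Longrightarrow> L2n M (\<lambda>x. snd (U x) $ i) \<le> L2n M U"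
  using L2n_bound[of M U "\<lambda>x. snd (U x) $ i" 1] by (simp add: norm_snd_nth_le_norm square_integrable_meas[OF square_integrable_snd_nth])

lemma square_integrable_times:
  fixes f g :: "'a \<Rightarrow> complex"
  assumes "square_integrable M f" "square_integrable M g"
  shows "integrable M (\<lambda>x. f x * g x)"
  by (rule Bochner_Integration.integrable_bound[OF square_integrable_mult_integrable[OF assms]])
     (use assms in \<open>auto simp: norm_mult square_integrable_def\<close>)

lemma norm_integral_times_le:
  fixes f g :: "'a \<Rightarrow> complex"
  assumes "square_integrable M f" "square_integrable M g"
  shows "norm (\<integral>x. f x * g x \<partial>M) \<le> L2n M f * L2n M g"
proof -
  have "norm (\<integral>x. f x * g x \<partial>M) \<le> (\<integral>x. norm (f x * g x) \<partial>M)" by (rule integral_norm_bound)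
  also have "\<dots> \<le> L2n M f * L2n M g" using L2_Cauchy_Schwarz[OF assms] by (simp add: norm_mult)
  finally show ?thesis .
qed

lemma sjet_continuous: "smooth f \<Longrightarrow> continuous_on A (sjet f)"
  unfolding sjet_def by (intro continuous_on_Pair smooth_continuous grad_continuous)

lemma sjet_square_integrable: "smooth f \<Longrightarrow> square_integrable vol (sjet f)"
  by (rule continuous_square_integrable[OF sjet_continuous])

lemma sjet_add: "smooth f \<Longrightarrow> smooth g \<Longrightarrow> sjet (\<lambda>x. f x + g x) x = sjet f x + sjet g x"
  by (simp add: sjet_def grad_def partial_add smooth_differentiable prod_eq_iff vec_eq_iff)

lemma sjet_cmult: "smooth f \<Longrightarrow> sjet (\<lambda>x. c * f x) x = cmul c (sjet f x)"
  by (simp add: sjet_def grad_def partial_cmult prod_eq_iff vec_eq_iff)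

lemma sjet_diff: "smooth f \<Longrightarrow> smooth g \<Longrightarrow> sjet (\<lambda>x. f x - g x) x = sjet f x - sjet g x"
  using sjet_add[of f "\<lambda>x. (-1) * g x" x] sjet_cmult[of g "-1" x] smooth_cmult[of g "-1"] by (simp add: cmul_minus1)

lemma smooth_diff: "smooth f \<Longrightarrow> smooth g \<Longrightarrow> smooth (\<lambda>x. f x - g x)"
  using smooth_add[of f "\<lambda>x. (-1) * g x"] smooth_cmult[of g "-1"] by simp

lemma test_square_integrable:
  assumes "test_function \<phi>"
  shows "square_integrable vol \<phi>" "square_integrable vol (partial i \<phi>)"
  using test_function_smooth[OF assms] by (auto intro!: continuous_square_integrable smooth_continuous smooth_partial)

lemma smooth_wjet: "smooth f \<Longrightarrow> wjet (sjet f)"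
  unfolding wjet_def
  using integration_by_parts by (auto simp: sjet_square_integrable) (simp add: sjet_def grad_def)

lemma wjet_square_integrable: "wjet U \<Longrightarrow> square_integrable vol U" by (simp add: wjet_def)

lemma wjet_add:
  fixes U V :: "'n::finite jet"
  assumes "wjet U" "wjet V" shows "wjet (\<lambda>x. U x + V x)"
  unfolding wjet_def
proof (intro conjI allI impI)
  show "square_integrable vol (\<lambda>x. U x + V x)" using assms by (intro square_integrable_add) (auto simp: wjet_def)
  fix \<phi> :: "real^'n \<Rightarrow> complex" and i assume \<phi>: "test_function \<phi>"
  have sq: "square_integrable vol U" "square_integrable vol V" using assms by (auto simp: wjet_def)
  show "(\<integral>x. fst (U x + V x) * partial i \<phi> x \<partial>vol) = - (\<integral>x. snd (U x + V x) $ i * \<phi> x \<partial>vol)"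
    using assms \<phi> square_integrable_times[OF square_integrable_fst[OF sq(1)] test_square_integrable(2)[OF \<phi>, of i]]
      square_integrable_times[OF square_integrable_fst[OF sq(2)] test_square_integrable(2)[OF \<phi>, of i]]
      square_integrable_times[OF square_integrable_snd_nth[OF sq(1), of i] test_square_integrable(1)[OF \<phi>]]
      square_integrable_times[OF square_integrable_snd_nth[OF sq(2), of i] test_square_integrable(1)[OF \<phi>]]
    by (simp add: wjet_def distrib_right)
qed

lemma wjet_cmul:
  fixes U :: "'n::finite jet"
  assumes "wjet U" shows "wjet (\<lambda>x. cmul c (U x))"
  unfolding wjet_def
proof (intro conjI allI impI)
  show "square_integrable vol (\<lambda>x. cmul c (U x))" using assms by (intro square_integrable_cmul) (auto simp: wjet_def)
  fix \<phi> :: "real^'n \<Rightarrow> complex" and i assume \<phi>: "test_function \<phi>"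
  show "(\<integral>x. fst (cmul c (U x)) * partial i \<phi> x \<partial>vol) = - (\<integral>x. snd (cmul c (U x)) $ i * \<phi> x \<partial>vol)"
    using assms \<phi> by (simp add: wjet_def mult.assoc)
qed

lemma wjet_diff: "wjet U \<Longrightarrow> wjet V \<Longrightarrow> wjet (\<lambda>x. U x - V x)"
  using wjet_add[of U "\<lambda>x. cmul (-1) (V x)"] wjet_cmul[of V "-1"] by (simp add: cmul_minus1)

text \<open>For a fixed test function both sides of the defining identity are continuous in the L2
  norm of the jet.\<close>

lemma wjet_limit:
  fixes U :: "'n::finite jet"
  assumes W: "\<And>k. wjet (W k)" and U: "square_integrable vol U"
    and lim: "(\<lambda>k. L2n vol (\<lambda>x. W k x - U x)) \<longlonglongrightarrow> 0"
  shows "wjet U"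
  unfolding wjet_def
proof (intro conjI allI impI U)
  fix \<phi> :: "real^'n \<Rightarrow> complex" and i assume \<phi>: "test_function \<phi>"
  have sW: "square_integrable vol (W k)" for k using W by (simp add: wjet_def)
  have sD: "square_integrable vol (\<lambda>x. W k x - U x)" for k by (rule square_integrable_diff[OF sW U])
  note t = test_square_integrable[OF \<phi>]
  \<comment> \<open>Used for \<open>F\<close> the function component and for \<open>F\<close> one
    component of the gradient.\<close>
  have conv: "(\<lambda>k. \<integral>x. F (W k x) * g x \<partial>vol) \<longlonglongrightarrow> (\<integral>x. F (U x) * g x \<partial>vol)"
    if F: "\<And>p q. F (p - q) = F p - F q" "\<And>V :: 'n jet. square_integrable vol V \<Longrightarrow> square_integrable vol (\<lambda>x. F (V x))"
      "\<And>V :: 'n jet. square_integrable vol V \<Longrightarrow> L2n vol (\<lambda>x. F (V x)) \<le> L2n vol V" and g: "square_integrable vol g"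
    for F :: "complex \<times> (complex^'n) \<Rightarrow> complex" and g
  proof (rule LIM_zero_cancel, rule Lim_null_comparison)
    show "\<forall>\<^sub>F k in sequentially. norm ((\<integral>x. F (W k x) * g x \<partial>vol) - (\<integral>x. F (U x) * g x \<partial>vol))
       \<le> L2n vol (\<lambda>x. W k x - U x) * L2n vol g"
    proof (rule always_eventually, rule allI)
      fix k
      have "(\<integral>x. F (W k x) * g x \<partial>vol) - (\<integral>x. F (U x) * g x \<partial>vol) = (\<integral>x. F (W k x - U x) * g x \<partial>vol)"
        using square_integrable_times[OF F(2)[OF sW] g] square_integrable_times[OF F(2)[OF U] g]
        by (simp add: F(1) left_diff_distrib)
      also have "norm \<dots> \<le> L2n vol (\<lambda>x. F (W k x - U x)) * L2n vol g"
        by (rule norm_integral_times_le[OF F(2)[OF sD] g])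
      also have "\<dots> \<le> L2n vol (\<lambda>x. W k x - U x) * L2n vol g"
        by (rule mult_right_mono[OF F(3)[OF sD]]) simp
      finally show "norm ((\<integral>x. F (W k x) * g x \<partial>vol) - (\<integral>x. F (U x) * g x \<partial>vol))
         \<le> L2n vol (\<lambda>x. W k x - U x) * L2n vol g" .
    qed
    show "(\<lambda>k. L2n vol (\<lambda>x. W k x - U x) * L2n vol g) \<longlonglongrightarrow> 0"
      using tendsto_mult_right[OF lim, of "L2n vol g"] by simp
  qed
  have 1: "(\<lambda>k. \<integral>x. fst (W k x) * partial i \<phi> x \<partial>vol) \<longlonglongrightarrow> (\<integral>x. fst (U x) * partial i \<phi> x \<partial>vol)"
    by (rule conv[OF _ square_integrable_fst L2n_fst_le t(2)]) auto
  have 2: "(\<lambda>k. \<integral>x. snd (W k x) $ i * \<phi> x \<partial>vol) \<longlonglongrightarrow> (\<integral>x. snd (U x) $ i * \<phi> x \<partial>vol)"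
    by (rule conv[OF _ square_integrable_snd_nth L2n_snd_nth_le t(1)]) auto
  have "(\<lambda>k. \<integral>x. fst (W k x) * partial i \<phi> x \<partial>vol) \<longlonglongrightarrow> - (\<integral>x. snd (U x) $ i * \<phi> x \<partial>vol)"
    using tendsto_minus[OF 2] W \<phi> by (simp add: wjet_def)
  then show "(\<integral>x. fst (U x) * partial i \<phi> x \<partial>vol) = - (\<integral>x. snd (U x) $ i * \<phi> x \<partial>vol)"
    using 1 LIMSEQ_unique by blast
qed

text \<open>Each component of the difference of two weak gradients annihilates all test
  functions.\<close>

lemma weak_grad_unique:
  fixes G :: "real^'n \<Rightarrow> complex^'n"
  assumes G: "is_weak_grad u G" and G': "is_weak_grad u G'"
  shows "AE x in vol. G x = G' x"
proof -
  have sq: "square_integrable vol (\<lambda>x. G x $ i - G' x $ i)" for i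
  proof -
    have "square_integrable vol (\<lambda>x. G x - G' x)" using G G' by (intro square_integrable_diff) (auto simp: is_weak_grad_def)
    then have "square_integrable vol (\<lambda>x. snd ((0::complex), G x - G' x) $ i)"
      by (intro square_integrable_snd_nth square_integrable_bound[OF \<open>square_integrable vol (\<lambda>x. G x - G' x)\<close>, of _ 1])
         (auto intro!: borel_measurable_Pair simp: square_integrable_def norm_Pair)
    then show ?thesis by simp
  qed
  have comp: "square_integrable vol (\<lambda>x. H x $ i)" if "square_integrable vol H" for H :: "real^'n \<Rightarrow> complex^'n" and i
    by (rule square_integrable_bound[OF that, of _ 1])
       (auto intro: Finite_Cartesian_Product.norm_nth_le borel_measurable_continuous_on[OF
          continuous_on_component[OF continuous_on_id] square_integrable_meas[OF that]])
  have "AE x in vol. G x $ i - G' x $ i = 0" for i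
  proof (rule du_Bois_Reymond[OF square_integrable_vol_integrable[OF sq]])
    fix \<phi> :: "real^'n \<Rightarrow> complex" assume \<phi>: "test_function \<phi>"
    have "(\<integral>x. G x $ i * \<phi> x \<partial>vol) = (\<integral>x. G' x $ i * \<phi> x \<partial>vol)"
      using conjunct2[OF G[unfolded is_weak_grad_def], rule_format, OF \<phi>, of i]
        conjunct2[OF G'[unfolded is_weak_grad_def], rule_format, OF \<phi>, of i] by simp
    then show "(\<integral>x. (G x $ i - G' x $ i) * \<phi> x \<partial>vol) = 0"
      using square_integrable_times[OF comp test_square_integrable(1)[OF \<phi>], of G i]
        square_integrable_times[OF comp test_square_integrable(1)[OF \<phi>], of G' i] G G'
      by (simp add: left_diff_distrib is_weak_grad_def)
  qed
  then have "AE x in vol. \<forall>i\<in>UNIV. G x $ i - G' x $ i = 0" by (intro AE_finite_allI) auto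
  then show ?thesis by eventually_elim (simp add: vec_eq_iff)
qed

lemma square_integrable_Pair:
  fixes f :: "'a \<Rightarrow> 'b::euclidean_space" and g :: "'a \<Rightarrow> 'c::euclidean_space"
  assumes "square_integrable M f" "square_integrable M g"
  shows "square_integrable M (\<lambda>x. (f x, g x))"
  using assms by (auto simp: square_integrable_def power2_norm_Pair intro!: borel_measurable_Pair)

lemma wjet_iff_weak_grad:
  "wjet U \<longleftrightarrow> square_integrable vol (\<lambda>x. fst (U x)) \<and> is_weak_grad (\<lambda>x. fst (U x)) (\<lambda>x. snd (U x))"
  using square_integrable_fst[of vol U] square_integrable_snd[of vol U]
    square_integrable_Pair[of vol "\<lambda>x. fst (U x)" "\<lambda>x. snd (U x)"]
  by (auto simp: wjet_def is_weak_grad_def)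

lemma H1_wjet: assumes "u \<in> H1" shows "wjet (jet u)"
proof -
  have "\<exists>G. is_weak_grad u G" using assms by (auto simp: H1_def)
  then have "is_weak_grad u (weak_grad u)" unfolding weak_grad_def by (rule someI_ex)
  moreover have "square_integrable vol u" using assms by (simp add: H1_def)
  ultimately show ?thesis by (simp add: wjet_iff_weak_grad jet_def)
qed

text \<open>The way back from an arbitrary weak gradient to the chosen one: by uniqueness they
  differ on a null set only.\<close>

lemma wjet_H1:
  assumes "wjet U"
  shows "(\<lambda>x. fst (U x)) \<in> H1" "AE x in vol. jet (\<lambda>x. fst (U x)) x = U x"
proof -
  have U: "square_integrable vol (\<lambda>x. fst (U x))" "is_weak_grad (\<lambda>x. fst (U x)) (\<lambda>x. snd (U x))"
    using assms by (auto simp: wjet_iff_weak_grad)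
  then show H: "(\<lambda>x. fst (U x)) \<in> H1" unfolding H1_def by blast
  have "is_weak_grad (\<lambda>x. fst (U x)) (weak_grad (\<lambda>x. fst (U x)))"
    using H1_wjet[OF H] by (simp add: wjet_iff_weak_grad jet_def)
  from weak_grad_unique[OF this U(2)] show "AE x in vol. jet (\<lambda>x. fst (U x)) x = U x"
    by eventually_elim (simp add: jet_def prod_eq_iff)
qed

lemma H1_square_integrable: "u \<in> H1 \<Longrightarrow> square_integrable vol (jet u)"
  using H1_wjet wjet_def by blast

lemma H1_norm_eq: assumes "u \<in> H1" shows "H1_norm u = L2n vol (jet u)"
proof -
  have "integrable vol (\<lambda>x. (norm (u x))\<^sup>2)" "integrable vol (\<lambda>x. (norm (weak_grad u x))\<^sup>2)"
    using H1_wjet[OF assms] by (auto simp: wjet_iff_weak_grad jet_def is_weak_grad_def square_integrable_def)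
  then show ?thesis by (simp add: H1_norm_def L2n_def power2_norm_Pair jet_def)
qed

lemma H1_norm_wjet:
  assumes "wjet U" shows "H1_norm (\<lambda>x. fst (U x)) = L2n vol U"
  using H1_norm_eq[OF wjet_H1(1)[OF assms]]
    L2n_cong_AE[OF square_integrable_meas[OF H1_square_integrable[OF wjet_H1(1)[OF assms]]]
      square_integrable_meas[OF wjet_square_integrable[OF assms]] wjet_H1(2)[OF assms]] by simp

lemma smooth_H1: "smooth f \<Longrightarrow> f \<in> H1" "smooth f \<Longrightarrow> AE x in vol. jet f x = sjet f x"
  using wjet_H1[OF smooth_wjet, of f] by (auto simp: sjet_def)

section \<open>The energy form\<close>

definition energy_density :: "real \<Rightarrow> complex \<times> (complex^'n) \<Rightarrow> complex \<times> (complex^'n) \<Rightarrow> complex"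
  where "energy_density a p r = (\<Sum>i\<in>UNIV. snd p $ i * cnj (snd r $ i)) + complex_of_real a * fst p * cnj (fst r)"

definition en :: "(real^'n \<Rightarrow> real) \<Rightarrow> 'n jet \<Rightarrow> 'n jet \<Rightarrow> complex"
  where "en q U V = (\<integral>x. energy_density (q x) (U x) (V x) \<partial>vol)"

lemma energy_form_eq: "energy_form q u v = en q (jet u) (jet v)"
  by (simp add: energy_form_def en_def energy_density_def jet_def)

text \<open>The range is narrower than the [1/2, 3/2] of the class. The perturbed potentials take
  the values 1 and 3/2, and the lower bound 1 makes the energy form coercive in the H^1
  norm.\<close>

definition pot :: "(real^'n \<Rightarrow> real) \<Rightarrow> bool"
  where "pot q \<longleftrightarrow> q \<in> borel_measurable vol \<and> (\<forall>x\<in>Omega. 1 \<le> q x \<and> q x \<le> 3/2)"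

lemma potD: "pot q \<Longrightarrow> x \<in> Omega \<Longrightarrow> 1 \<le> q x" "pot q \<Longrightarrow> x \<in> Omega \<Longrightarrow> q x \<le> 3/2"
  unfolding pot_def by blast+

lemma pot_measurable: "pot q \<Longrightarrow> q \<in> borel_measurable vol"
  by (simp add: pot_def)

lemma pot_const: "pot (\<lambda>x. 1)" by (simp add: pot_def)

lemma norm_energy_density_le: "norm (energy_density a p r) \<le> (1 + \<bar>a\<bar>) * (norm p * norm r)"
proof -
  have "norm (\<Sum>i\<in>UNIV. snd p $ i * cnj (snd r $ i)) \<le> (\<Sum>i\<in>UNIV. \<bar>norm (snd p $ i)\<bar> * \<bar>norm (snd r $ i)\<bar>)"
    by (rule order_trans[OF norm_sum]) (simp add: norm_mult)
  also have "\<dots> \<le> norm (snd p) * norm (snd r)"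
    unfolding norm_vec_def by (rule L2_set_mult_ineq)
  also have "\<dots> \<le> norm p * norm r"
    by (intro mult_mono) (auto simp: norm_snd_le[of "snd p" "fst p", simplified] norm_snd_le[of "snd r" "fst r", simplified])
  finally have 1: "norm (\<Sum>i\<in>UNIV. snd p $ i * cnj (snd r $ i)) \<le> norm p * norm r" .
  have 2: "norm (fst p) * norm (fst r) \<le> norm p * norm r"
    by (intro mult_mono norm_fst_le_norm) auto
  have "norm (complex_of_real a * fst p * cnj (fst r)) = \<bar>a\<bar> * (norm (fst p) * norm (fst r))"
    by (simp add: norm_mult)
  also have "\<dots> \<le> \<bar>a\<bar> * (norm p * norm r)" by (rule mult_left_mono[OF 2]) simp
  finally have 3: "norm (complex_of_real a * fst p * cnj (fst r)) \<le> \<bar>a\<bar> * (norm p * norm r)" .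
  show ?thesis unfolding energy_density_def
    by (rule order_trans[OF norm_triangle_ineq]) (use 1 3 in \<open>simp add: distrib_right\<close>)
qed

lemma energy_density_measurable:
  assumes "q \<in> borel_measurable M" "U \<in> borel_measurable M" "V \<in> borel_measurable M"
  shows "(\<lambda>x. energy_density (q x) (U x) (V x)) \<in> borel_measurable M"
proof -
  have "continuous_on UNIV (\<lambda>z::real \<times> (complex \<times> (complex^'b)) \<times> (complex \<times> (complex^'b)). energy_density (fst z) (fst (snd z)) (snd (snd z)))"
    unfolding energy_density_def by (intro continuous_intros)
  from borel_measurable_continuous_on[OF this, of "\<lambda>x. (q x, U x, V x)" M]
  show ?thesis using assms by (simp add: borel_measurable_Pair)
qed

lemma en_integrable:
  assumes "pot q" "square_integrable vol U" "square_integrable vol V"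
  shows "integrable vol (\<lambda>x. energy_density (q x) (U x) (V x))"
proof (rule Bochner_Integration.integrable_bound)
  \<comment> \<open>1 + |q| is at most 5/2, rounded up to 3.\<close>
  show "integrable vol (\<lambda>x. 3 * (norm (U x) * norm (V x)))"
    using square_integrable_mult_integrable[OF assms(2,3)] by simp
  show "(\<lambda>x. energy_density (q x) (U x) (V x)) \<in> borel_measurable vol"
    using assms by (intro energy_density_measurable) (auto simp: pot_def square_integrable_def)
  show "AE x in vol. norm (energy_density (q x) (U x) (V x)) \<le> norm (3 * (norm (U x) * norm (V x)))"
  proof (rule AE_I2)
    fix x :: "real^'a" assume "x \<in> space vol"
    then have "\<bar>q x\<bar> \<le> 3/2" using potD[OF assms(1)] unfolding space_vol by force
    then have "(1 + \<bar>q x\<bar>) * (norm (U x) * norm (V x)) \<le> 3 * (norm (U x) * norm (V x))"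
      by (intro mult_right_mono) auto
    then show "norm (energy_density (q x) (U x) (V x)) \<le> norm (3 * (norm (U x) * norm (V x)))"
      using norm_energy_density_le[of "q x" "U x" "V x"] by simp
  qed
qed

lemma norm_en_le:
  assumes "pot q" "square_integrable vol U" "square_integrable vol V"
  shows "norm (en q U V) \<le> 3 * (L2n vol U * L2n vol V)"
proof -
  have "norm (en q U V) \<le> (\<integral>x. norm (energy_density (q x) (U x) (V x)) \<partial>vol)"
    unfolding en_def by (rule integral_norm_bound)
  also have "\<dots> \<le> (\<integral>x. 3 * (norm (U x) * norm (V x)) \<partial>vol)"
  proof (rule integral_mono)
    show "integrable vol (\<lambda>x. norm (energy_density (q x) (U x) (V x)))" using en_integrable[OF assms] by simp
    show "integrable vol (\<lambda>x. 3 * (norm (U x) * norm (V x)))"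
      using square_integrable_mult_integrable[OF assms(2,3)] by simp
    fix x :: "real^'a" assume "x \<in> space vol"
    then have "\<bar>q x\<bar> \<le> 3/2" using potD[OF assms(1)] unfolding space_vol by force
    then have "(1 + \<bar>q x\<bar>) * (norm (U x) * norm (V x)) \<le> 3 * (norm (U x) * norm (V x))"
      by (intro mult_right_mono) auto
    then show "norm (energy_density (q x) (U x) (V x)) \<le> 3 * (norm (U x) * norm (V x))"
      using norm_energy_density_le[of "q x" "U x" "V x"] by simp
  qed
  also have "\<dots> \<le> 3 * (L2n vol U * L2n vol V)"
    using L2_Cauchy_Schwarz[OF assms(2,3)] by simp
  finally show ?thesis .
qed

lemma en_cong_AE:
  assumes "pot q" "square_integrable vol U" "square_integrable vol V" "square_integrable vol U'" "square_integrable vol V'"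
    "AE x in vol. U x = U' x" "AE x in vol. V x = V' x"
  shows "en q U V = en q U' V'"
  unfolding en_def
proof (rule integral_cong_AE)
  show "AE x in vol. energy_density (q x) (U x) (V x) = energy_density (q x) (U' x) (V' x)"
    using assms(6,7) by eventually_elim simp
qed (use assms in \<open>auto intro!: borel_measurable_integrable en_integrable\<close>)

lemma en_add_left:
  assumes "pot q" "square_integrable vol U" "square_integrable vol U'" "square_integrable vol V"
  shows "en q (\<lambda>x. U x + U' x) V = en q U V + en q U' V"
proof -
  have "energy_density a (p + p') r = energy_density a p r + energy_density a p' r" for a and p p' r :: "complex \<times> (complex^'a)"
    by (simp add: energy_density_def algebra_simps sum.distrib)
  then show ?thesis unfolding en_def
    by (simp add: Bochner_Integration.integral_add[OF en_integrable[OF assms(1,2,4)] en_integrable[OF assms(1,3,4)]])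
qed

lemma en_commute: "en q V U = cnj (en q U V)"
proof -
  have c: "energy_density a r p = cnj (energy_density a p r)" for a and p r :: "complex \<times> (complex^'a)"
    by (simp add: energy_density_def mult.commute mult.left_commute)
  have "en q V U = (\<integral>x. cnj (energy_density (q x) (U x) (V x)) \<partial>vol)"
    unfolding en_def by (rule Bochner_Integration.integral_cong[OF refl c])
  then show ?thesis by (simp add: en_def)
qed

lemma en_cmul_left: "en q (\<lambda>x. cmul c (U x)) V = c * en q U V"
proof -
  have "energy_density a (cmul c p) r = c * energy_density a p r" for a and p r :: "complex \<times> (complex^'a)"
    by (simp add: energy_density_def distrib_left sum_distrib_left mult_ac)
  then show ?thesis unfolding en_def by simp
qed

lemma en_cmul_right: "en q U (\<lambda>x. cmul c (V x)) = cnj c * en q U V"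
  using en_cmul_left[of q c V U] en_commute[of q U] by simp

lemma en_add_right:
  assumes "pot q" "square_integrable vol U" "square_integrable vol V" "square_integrable vol V'"
  shows "en q U (\<lambda>x. V x + V' x) = en q U V + en q U V'"
  using en_add_left[OF assms(1,3,4,2)] en_commute[of q U] by simp

lemma en_diff_left:
  assumes "pot q" "square_integrable vol U" "square_integrable vol U'" "square_integrable vol V"
  shows "en q (\<lambda>x. U x - U' x) V = en q U V - en q U' V"
  using en_add_left[OF assms(1,2) square_integrable_cmul[OF assms(3), of "-1"] assms(4)] en_cmul_left[of q "-1" U' V]
  by (simp add: cmul_minus1)

lemma en_diff_right:
  assumes "pot q" "square_integrable vol U" "square_integrable vol V" "square_integrable vol V'"
  shows "en q U (\<lambda>x. V x - V' x) = en q U V - en q U V'"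
  using en_diff_left[OF assms(1,3,4,2)] en_commute[of q U] by simp

lemma en_self_real: "en q U U = complex_of_real (Re (en q U U))"
  using en_commute[of q U U] by (metis Reals_cnj_iff complex_is_Real_iff of_real_Re)

text \<open>Coercivity with constant 1, which stands in for a Poincare inequality. This is where q
  >= 1 enters.\<close>

lemma L2n_sq_le_en:
  assumes "pot q" "square_integrable vol U"
  shows "(L2n vol U)\<^sup>2 \<le> Re (en q U U)"
proof -
  have "Re (en q U U) = (\<integral>x. Re (energy_density (q x) (U x) (U x)) \<partial>vol)"
    unfolding en_def by (rule integral_Re[symmetric]) (rule en_integrable[OF assms assms(2)])
  moreover have "(L2n vol U)\<^sup>2 \<le> (\<integral>x. Re (energy_density (q x) (U x) (U x)) \<partial>vol)"
    unfolding L2n_sq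
  proof (rule integral_mono)
    show "integrable vol (\<lambda>x. (norm (U x))\<^sup>2)" by (rule square_integrable_int[OF assms(2)])
    show "integrable vol (\<lambda>x. Re (energy_density (q x) (U x) (U x)))" using en_integrable[OF assms assms(2)] by simp
    fix x :: "real^'a" assume "x \<in> space vol"
    then have q: "1 \<le> q x" using potD[OF assms(1)] unfolding space_vol by blast
    have "energy_density (q x) (U x) (U x) = complex_of_real ((\<Sum>i\<in>UNIV. (norm (snd (U x) $ i))\<^sup>2) + q x * (norm (fst (U x)))\<^sup>2)"
      unfolding energy_density_def by (simp add: complex_norm_square mult.assoc del: of_real_power)
    then have "Re (energy_density (q x) (U x) (U x)) = (\<Sum>i\<in>UNIV. (norm (snd (U x) $ i))\<^sup>2) + q x * (norm (fst (U x)))\<^sup>2"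
      by simp
    moreover have "1 * (norm (fst (U x)))\<^sup>2 \<le> q x * (norm (fst (U x)))\<^sup>2"
      by (rule mult_right_mono[OF q]) simp
    ultimately show "(norm (U x))\<^sup>2 \<le> Re (energy_density (q x) (U x) (U x))" by (simp add: power2_norm_jet)
  qed
  ultimately show ?thesis by simp
qed

text \<open>With c = 1 and c = -1 this yields the parallelogram law, with general c the first
  variation of the energy.\<close>

lemma en_add_cmul:
  assumes "pot q" "square_integrable vol U" "square_integrable vol V"
  shows "Re (en q (\<lambda>x. U x + cmul c (V x)) (\<lambda>x. U x + cmul c (V x)))
    = Re (en q U U) + 2 * Re (cnj c * en q U V) + (norm c)\<^sup>2 * Re (en q V V)"
proof -
  have s: "square_integrable vol (\<lambda>x. cmul c (V x))" "square_integrable vol (\<lambda>x. U x + cmul c (V x))"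
    using assms by (auto intro: square_integrable_add square_integrable_cmul)
  have "en q (\<lambda>x. U x + cmul c (V x)) (\<lambda>x. U x + cmul c (V x))
     = en q U U + cnj c * en q U V + (c * en q V U + c * cnj c * en q V V)"
    using assms s by (simp add: en_add_left en_add_right en_cmul_left en_cmul_right algebra_simps)
  moreover have "Re (c * en q V U) = Re (cnj c * en q U V)"
    using en_commute[of q V U] by simp
  moreover have "c * cnj c * en q V V = complex_of_real ((norm c)\<^sup>2 * Re (en q V V))"
    using en_self_real[of q V] complex_norm_square[of c] by (metis of_real_mult of_real_power)
  ultimately show ?thesis by simp
qed

section \<open>Solving the Dirichlet problem\<close>

text \<open>H^1_0 as the closure of the test functions; \<open>wtrace_zero_H10\<close> shows that
  every jet with zero trace belongs to it.\<close>

definition H10 :: "'n::finite jet \<Rightarrow> bool"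
  where "H10 Z \<longleftrightarrow> square_integrable vol Z \<and> (\<exists>\<phi> :: nat \<Rightarrow> real^'n \<Rightarrow> complex.
    (\<forall>k. test_function (\<phi> k)) \<and> (\<lambda>k. L2n vol (\<lambda>x. sjet (\<phi> k) x - Z x)) \<longlonglongrightarrow> 0)"

lemma test_sjet: "test_function \<phi> \<Longrightarrow> square_integrable vol (sjet \<phi>)"
  by (rule sjet_square_integrable[OF test_function_smooth])

lemma H10_square_integrable: "H10 Z \<Longrightarrow> square_integrable vol Z" by (simp add: H10_def)

lemma H10E:
  assumes "H10 Z"
  obtains \<phi> where "\<forall>k. test_function (\<phi> k)" "(\<lambda>k. L2n vol (\<lambda>x. sjet (\<phi> k) x - Z x)) \<longlonglongrightarrow> 0"
  using assms unfolding H10_def by blast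

lemma H10_wjet: assumes "H10 Z" shows "wjet Z"
proof -
  obtain \<phi> where *: "\<forall>k. test_function (\<phi> k)" "(\<lambda>k. L2n vol (\<lambda>x. sjet (\<phi> k) x - Z x)) \<longlonglongrightarrow> 0"
    by (rule H10E[OF assms])
  note \<phi> = *(1)[rule_format] *(2)
  show ?thesis
    by (rule wjet_limit[OF smooth_wjet[OF test_function_smooth[OF \<phi>(1)]] H10_square_integrable[OF assms] \<phi>(2)])
qed

lemma H10I:
  assumes Z: "square_integrable vol Z"
    and ap: "\<And>e. 0 < e \<Longrightarrow> \<exists>\<phi>. test_function \<phi> \<and> L2n vol (\<lambda>x. sjet \<phi> x - Z x) \<le> e"
  shows "H10 Z"
proof -
  have "\<forall>k. \<exists>\<phi>. test_function \<phi> \<and> L2n vol (\<lambda>x. sjet \<phi> x - Z x) \<le> 1 / real (Suc k)"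
    using ap by simp
  then obtain \<phi> where \<phi>: "\<And>k. test_function (\<phi> k)" "\<And>k. L2n vol (\<lambda>x. sjet (\<phi> k) x - Z x) \<le> 1 / real (Suc k)"
    by metis
  have "(\<lambda>k. L2n vol (\<lambda>x. sjet (\<phi> k) x - Z x)) \<longlonglongrightarrow> 0"
  proof (rule tendsto_sandwich[OF _ _ tendsto_const LIMSEQ_Suc[OF lim_1_over_n]])
    show "\<forall>\<^sub>F k in sequentially. L2n vol (\<lambda>x. sjet (\<phi> k) x - Z x) \<le> 1 / real (Suc k)"
      using \<phi>(2) by (intro always_eventually) blast
  qed simp
  then show ?thesis using Z \<phi>(1) unfolding H10_def by blast
qed

lemma H10_add:
  assumes "H10 Z" "H10 Y" shows "H10 (\<lambda>x. Z x + Y x)"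
proof -
  obtain \<phi> where *: "\<forall>k. test_function (\<phi> k)" "(\<lambda>k. L2n vol (\<lambda>x. sjet (\<phi> k) x - Z x)) \<longlonglongrightarrow> 0"
    by (rule H10E[OF assms(1)])
  note \<phi> = *(1)[rule_format] *(2)
  obtain \<psi> where *: "\<forall>k. test_function (\<psi> k)" "(\<lambda>k. L2n vol (\<lambda>x. sjet (\<psi> k) x - Y x)) \<longlonglongrightarrow> 0"
    by (rule H10E[OF assms(2)])
  note \<psi> = *(1)[rule_format] *(2)
  have sq: "square_integrable vol Z" "square_integrable vol Y" using assms by (auto simp: H10_def)
  have "(\<lambda>k. L2n vol (\<lambda>x. sjet (\<lambda>x. \<phi> k x + \<psi> k x) x - (Z x + Y x))) \<longlonglongrightarrow> 0"
  proof (rule Lim_null_comparison)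
    show "(\<lambda>k. L2n vol (\<lambda>x. sjet (\<phi> k) x - Z x) + L2n vol (\<lambda>x. sjet (\<psi> k) x - Y x)) \<longlonglongrightarrow> 0"
      using tendsto_add[OF \<phi>(2) \<psi>(2)] by simp
    show "\<forall>\<^sub>F k in sequentially. norm (L2n vol (\<lambda>x. sjet (\<lambda>x. \<phi> k x + \<psi> k x) x - (Z x + Y x)))
        \<le> L2n vol (\<lambda>x. sjet (\<phi> k) x - Z x) + L2n vol (\<lambda>x. sjet (\<psi> k) x - Y x)"
    proof (intro always_eventually allI)
      fix k
      have "(\<lambda>x. sjet (\<lambda>x. \<phi> k x + \<psi> k x) x - (Z x + Y x)) = (\<lambda>x. (sjet (\<phi> k) x - Z x) + (sjet (\<psi> k) x - Y x))"
        using \<phi>(1) \<psi>(1) by (simp add: sjet_add test_function_smooth fun_eq_iff)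
      then show "norm (L2n vol (\<lambda>x. sjet (\<lambda>x. \<phi> k x + \<psi> k x) x - (Z x + Y x)))
        \<le> L2n vol (\<lambda>x. sjet (\<phi> k) x - Z x) + L2n vol (\<lambda>x. sjet (\<psi> k) x - Y x)"
        using L2n_triangle[of vol "\<lambda>x. sjet (\<phi> k) x - Z x" "\<lambda>x. sjet (\<psi> k) x - Y x"] sq \<phi>(1) \<psi>(1)
        by (simp add: square_integrable_diff test_sjet)
    qed
  qed
  with test_function_add[OF \<phi>(1) \<psi>(1)]
  have "\<exists>\<theta>. (\<forall>k. test_function (\<theta> k)) \<and> (\<lambda>k. L2n vol (\<lambda>x. sjet (\<theta> k) x - (Z x + Y x))) \<longlonglongrightarrow> 0"
    by (intro exI[of _ "\<lambda>k x. \<phi> k x + \<psi> k x"] conjI allI)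
  then show ?thesis unfolding H10_def using square_integrable_add[OF sq] by simp
qed

lemma H10_cmul:
  assumes "H10 Z" shows "H10 (\<lambda>x. cmul c (Z x))"
proof -
  obtain \<phi> where *: "\<forall>k. test_function (\<phi> k)" "(\<lambda>k. L2n vol (\<lambda>x. sjet (\<phi> k) x - Z x)) \<longlonglongrightarrow> 0"
    by (rule H10E[OF assms])
  note \<phi> = *(1)[rule_format] *(2)
  have "cmul c (p - r) = cmul c p - cmul c r" for p r :: "complex \<times> (complex^'a)"
    by (simp add: cmul_def prod_eq_iff vec_eq_iff right_diff_distrib)
  then have "L2n vol (\<lambda>x. sjet (\<lambda>x. c * \<phi> k x) x - cmul c (Z x)) = norm c * L2n vol (\<lambda>x. sjet (\<phi> k) x - Z x)" for k
    using L2n_cmul[of vol c "\<lambda>x. sjet (\<phi> k) x - Z x"] \<phi>(1) by (simp add: sjet_cmult test_function_smooth)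
  then have "(\<lambda>k. L2n vol (\<lambda>x. sjet (\<lambda>x. c * \<phi> k x) x - cmul c (Z x))) \<longlonglongrightarrow> 0"
    using tendsto_mult_right_zero[OF \<phi>(2)] by simp
  with test_function_cmult[OF \<phi>(1)]
  have "\<exists>\<theta>. (\<forall>k. test_function (\<theta> k)) \<and> (\<lambda>k. L2n vol (\<lambda>x. sjet (\<theta> k) x - cmul c (Z x))) \<longlonglongrightarrow> 0"
    by (intro exI[of _ "\<lambda>k x. c * \<phi> k x"] conjI allI)
  then show ?thesis unfolding H10_def using square_integrable_cmul[OF H10_square_integrable[OF assms]] by simp
qed

lemma H10_zero: "H10 (\<lambda>x. 0)"
proof (rule H10I)
  have "test_function (\<lambda>x::real^'a. 0)" unfolding test_function_def by (auto intro!: exI[of _ "{}"] smooth_const)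
  moreover have "sjet (\<lambda>x::real^'a. 0) x = 0" for x
    by (simp add: sjet_def grad_def partial_eq[OF has_derivative_const] zero_prod_def vec_eq_iff)
  ultimately show "\<exists>\<phi>. test_function \<phi> \<and> L2n vol (\<lambda>x. sjet \<phi> x - (0::complex \<times> (complex^'a))) \<le> e" if "0 < e" for e
    using that by (intro exI[of _ "\<lambda>x. 0"]) simp
qed simp

lemma H10_sum: "(\<And>i. i \<in> I \<Longrightarrow> H10 (Z i)) \<Longrightarrow> H10 (\<lambda>x. \<Sum>i\<in>I. Z i x)"
  by (induction I rule: infinite_finite_induct) (auto intro: H10_add H10_zero)

lemma H10_diff: "H10 Z \<Longrightarrow> H10 Y \<Longrightarrow> H10 (\<lambda>x. Z x - Y x)"
  using H10_add[of Z "\<lambda>x. cmul (-1) (Y x)"] H10_cmul[of Y "-1"] by (simp add: cmul_minus1)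

lemma en_tendsto_right:
  assumes q: "pot q" and U: "square_integrable vol U" and V: "square_integrable vol V" and W: "\<And>k. square_integrable vol (W k)"
    and lim: "(\<lambda>k. L2n vol (\<lambda>x. W k x - V x)) \<longlonglongrightarrow> 0"
  shows "(\<lambda>k. en q U (W k)) \<longlonglongrightarrow> en q U V"
proof (rule LIM_zero_cancel, rule Lim_null_comparison)
  show "(\<lambda>k. 3 * (L2n vol U * L2n vol (\<lambda>x. W k x - V x))) \<longlonglongrightarrow> 0"
    by (intro tendsto_mult_right_zero lim)
  show "\<forall>\<^sub>F k in sequentially. norm (en q U (W k) - en q U V) \<le> 3 * (L2n vol U * L2n vol (\<lambda>x. W k x - V x))"
    using norm_en_le[OF q U square_integrable_diff[OF W V]] en_diff_right[OF q U W V] by (intro always_eventually) simp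
qed

lemma en_H10_eq_0:
  assumes q: "pot q" and U: "square_integrable vol U" and z: "\<And>\<psi>. test_function \<psi> \<Longrightarrow> en q U (sjet \<psi>) = 0"
    and Z: "H10 Z"
  shows "en q U Z = 0"
proof -
  obtain \<phi> where *: "\<forall>k. test_function (\<phi> k)" "(\<lambda>k. L2n vol (\<lambda>x. sjet (\<phi> k) x - Z x)) \<longlonglongrightarrow> 0"
    by (rule H10E[OF Z])
  note \<phi> = *(1)[rule_format] *(2)
  have "(\<lambda>k. en q U (sjet (\<phi> k))) \<longlonglongrightarrow> en q U Z"
    by (rule en_tendsto_right[OF q U H10_square_integrable[OF Z] test_sjet[OF \<phi>(1)] \<phi>(2)])
  then show ?thesis using z[OF \<phi>(1)] by (simp add: LIMSEQ_const_iff)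
qed

text \<open>The energy of \<open>U0 + \<phi>\<close> is minimized over test functions \<open>\<phi>\<close>; a minimizing sequence is Cauchy by
  the parallelogram law.\<close>

lemma H10_projection:
  fixes U0 :: "'n::finite jet"
  assumes q: "pot q" and U0: "square_integrable vol U0"
  shows "\<exists>Z. H10 Z \<and> (\<forall>\<psi>. test_function \<psi> \<longrightarrow> en q (\<lambda>x. U0 x + Z x) (sjet \<psi>) = 0)"
proof -
  define E where "E U = Re (en q U U)" for U :: "'n jet"
  define T where "T \<phi> = (\<lambda>x. U0 x + sjet \<phi> x)" for \<phi> :: "real^'n \<Rightarrow> complex"
  define S where "S = {E (T \<phi>) |\<phi>. test_function \<phi>}"
  define d where "d = Inf S"
  have sT: "square_integrable vol (T \<phi>)" if "test_function \<phi>" for \<phi>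
    unfolding T_def by (intro square_integrable_add U0 test_sjet that)
  have E0: "0 \<le> E U" if "square_integrable vol U" for U
    using L2n_sq_le_en[OF q that] zero_le_power2[of "L2n vol U"] unfolding E_def by linarith
  have bdd: "bdd_below S" unfolding S_def using E0[OF sT] by (intro bdd_belowI[of _ 0]) auto
  have ne: "S \<noteq> {}"
  proof -
    have "test_function (\<lambda>x::real^'n. 0)" unfolding test_function_def by (auto intro!: exI[of _ "{}"] smooth_const)
    then show ?thesis unfolding S_def by blast
  qed
  have dle: "d \<le> E (T \<phi>)" if "test_function \<phi>" for \<phi>
    unfolding d_def by (rule cInf_lower[OF _ bdd]) (use that in \<open>auto simp: S_def\<close>)
  have "\<exists>\<phi>. test_function \<phi> \<and> E (T \<phi>) < d + 1 / real (Suc k)" for k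
  proof -
    have "Inf S < d + 1 / real (Suc k)" by (simp add: d_def)
    from cInf_lessD[OF ne this] show ?thesis unfolding S_def by auto
  qed
  then obtain \<phi> where \<phi>: "\<And>k. test_function (\<phi> k)" "\<And>k. E (T (\<phi> k)) < d + 1 / real (Suc k)" by metis
  have par: "(L2n vol (\<lambda>x. sjet (\<phi> i) x - sjet (\<phi> j) x))\<^sup>2 \<le> 2 / real (Suc i) + 2 / real (Suc j)" for i j
  proof -
    let ?U = "T (\<phi> i)" and ?V = "T (\<phi> j)"
    have s: "square_integrable vol ?U" "square_integrable vol ?V" using sT \<phi>(1) by auto
    \<comment> \<open>The midpoint is again a test function, so the energy of \<open>T m\<close> is
      at least the infimum d.\<close>
    define m where "m = (\<lambda>x. (1/2) * (\<phi> i x + \<phi> j x))"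
    have m: "test_function m" unfolding m_def by (intro test_function_cmult test_function_add \<phi>(1))
    have sm: "smooth (\<phi> i)" "smooth (\<phi> j)" using \<phi>(1) by (auto intro: test_function_smooth)
    have half: "cmul 2 (cmul (1/2) p) = p" for p :: "complex \<times> (complex^'n)" by (simp add: cmul_def prod_eq_iff vec_eq_iff)
    have two: "cmul 2 (p + r) = p + p + cmul 2 r" for p r :: "complex \<times> (complex^'n)"
      by (simp add: cmul_def prod_eq_iff vec_eq_iff distrib_left)
    have "sjet m x = cmul (1/2) (sjet (\<phi> i) x + sjet (\<phi> j) x)" for x
      unfolding m_def by (simp only: sjet_cmult[OF smooth_add[OF sm]] sjet_add[OF sm])
    then have "?U x + cmul 1 (?V x) = cmul 2 (T m x)" for x
      unfolding T_def by (simp add: two half) (simp add: cmul_def prod_eq_iff vec_eq_iff)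
    then have "E (\<lambda>x. ?U x + cmul 1 (?V x)) = Re (en q (\<lambda>x. cmul 2 (T m x)) (\<lambda>x. cmul 2 (T m x)))"
      by (simp add: E_def)
    also have "\<dots> = 4 * E (T m)" by (simp add: en_cmul_left en_cmul_right E_def)
    finally have plus: "E ?U + 2 * Re (en q ?U ?V) + E ?V \<ge> 4 * d"
      using dle[OF m] en_add_cmul[OF q s, of 1] by (simp add: E_def)
    have "E (\<lambda>x. ?U x + cmul (-1) (?V x)) = E ?U - 2 * Re (en q ?U ?V) + E ?V"
      using en_add_cmul[OF q s, of "-1"] by (simp add: E_def)
    then have "E (\<lambda>x. ?U x + cmul (-1) (?V x)) \<le> 2 * E ?U + 2 * E ?V - 4 * d" using plus by simp
    also have "\<dots> \<le> 2 / real (Suc i) + 2 / real (Suc j)" using \<phi>(2)[of i] \<phi>(2)[of j] by simp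
    finally have "E (\<lambda>x. ?U x + cmul (-1) (?V x)) \<le> 2 / real (Suc i) + 2 / real (Suc j)" .
    moreover have "(\<lambda>x. ?U x + cmul (-1) (?V x)) = (\<lambda>x. sjet (\<phi> i) x - sjet (\<phi> j) x)"
      by (simp add: T_def cmul_minus1)
    moreover have "square_integrable vol (\<lambda>x. sjet (\<phi> i) x - sjet (\<phi> j) x)"
      by (intro square_integrable_diff test_sjet \<phi>(1))
    ultimately show ?thesis using L2n_sq_le_en[OF q, of "\<lambda>x. sjet (\<phi> i) x - sjet (\<phi> j) x"] by (simp add: E_def)
  qed
  have "\<exists>Z. square_integrable vol Z \<and> (\<lambda>k. L2n vol (\<lambda>x. sjet (\<phi> k) x - Z x)) \<longlonglongrightarrow> 0"
  proof (rule L2_complete)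
    show "square_integrable vol (sjet (\<phi> k))" for k by (rule test_sjet[OF \<phi>(1)])
    fix e :: real assume e: "0 < e"
    obtain K where K: "4 / e\<^sup>2 < real K" using reals_Archimedean2 by blast
    have "L2n vol (\<lambda>x. sjet (\<phi> i) x - sjet (\<phi> j) x) < e" if "K \<le> i" "K \<le> j" for i j
    proof (rule power2_less_imp_less)
      have K0: "0 < real K" using K e by (smt (verit) divide_nonneg_nonneg zero_le_power2)
      have "2 / real (Suc i) \<le> 2 / real K" "2 / real (Suc j) \<le> 2 / real K"
        using that K0 by (auto intro!: divide_left_mono)
      then have "(L2n vol (\<lambda>x. sjet (\<phi> i) x - sjet (\<phi> j) x))\<^sup>2 \<le> 4 / real K" using par[of i j] by simp
      also have "\<dots> < e\<^sup>2" using K K0 e by (simp add: field_simps)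
      finally show "(L2n vol (\<lambda>x. sjet (\<phi> i) x - sjet (\<phi> j) x))\<^sup>2 < e\<^sup>2" .
    qed (use e in simp)
    then show "\<exists>K. \<forall>i\<ge>K. \<forall>j\<ge>K. L2n vol (\<lambda>x. sjet (\<phi> i) x - sjet (\<phi> j) x) < e" by blast
  qed
  then obtain Z where Z: "square_integrable vol Z" "(\<lambda>k. L2n vol (\<lambda>x. sjet (\<phi> k) x - Z x)) \<longlonglongrightarrow> 0" by blast
  have HZ: "H10 Z" unfolding H10_def using Z \<phi>(1) by blast
  have "en q (\<lambda>x. U0 x + Z x) (sjet \<psi>) = 0" if \<psi>: "test_function \<psi>" for \<psi>
  proof -
    let ?W = "\<lambda>x. U0 x + Z x"
    have sW: "square_integrable vol ?W" by (rule square_integrable_add[OF U0 Z(1)])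
    define e where "e = en q ?W (sjet \<psi>)"
    have "(\<lambda>k. en q (sjet \<psi>) (T (\<phi> k))) \<longlonglongrightarrow> en q (sjet \<psi>) ?W"
      by (rule en_tendsto_right[OF q test_sjet[OF \<psi>] sW sT[OF \<phi>(1)]]) (use Z(2) in \<open>simp add: T_def\<close>)
    then have lim: "(\<lambda>k. en q (T (\<phi> k)) (sjet \<psi>)) \<longlonglongrightarrow> e"
      unfolding e_def using tendsto_cnj[of "\<lambda>k. en q (sjet \<psi>) (T (\<phi> k))"] by (simp add: en_commute[of q _ "sjet \<psi>"])
    \<comment> \<open>The energy of the k-th competitor exceeds the infimum by less than 1/(k+1), so
      adding a multiple of \<psi> cannot lower it by more. The inequality is the limit as k tends to
      infinity.\<close>
    have ineq: "0 \<le> 2 * Re (cnj c * e) + (norm c)\<^sup>2 * E (sjet \<psi>)" for c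
    proof (rule LIMSEQ_le_const)
      show "(\<lambda>k. 1 / real (Suc k) + (2 * Re (cnj c * en q (T (\<phi> k)) (sjet \<psi>)) + (norm c)\<^sup>2 * E (sjet \<psi>))) \<longlonglongrightarrow>
          2 * Re (cnj c * e) + (norm c)\<^sup>2 * E (sjet \<psi>)"
        by (rule tendsto_eq_rhs[OF tendsto_add[OF LIMSEQ_Suc[OF lim_1_over_n]
            tendsto_add[OF tendsto_mult[OF tendsto_const tendsto_Re[OF tendsto_mult[OF tendsto_const lim]]] tendsto_const]]])
          simp
      have "0 \<le> 1 / real (Suc k) + (2 * Re (cnj c * en q (T (\<phi> k)) (sjet \<psi>)) + (norm c)\<^sup>2 * E (sjet \<psi>))" for k
      proof -
        have t: "test_function (\<lambda>x. \<phi> k x + c * \<psi> x)" by (intro test_function_add test_function_cmult \<phi>(1) \<psi>)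
        have "T (\<lambda>x. \<phi> k x + c * \<psi> x) = (\<lambda>x. T (\<phi> k) x + cmul c (sjet \<psi> x))"
          using \<phi>(1) \<psi> by (simp add: T_def sjet_add sjet_cmult smooth_cmult test_function_smooth fun_eq_iff)
        then have "d \<le> E (T (\<phi> k)) + 2 * Re (cnj c * en q (T (\<phi> k)) (sjet \<psi>)) + (norm c)\<^sup>2 * E (sjet \<psi>)"
          using dle[OF t] en_add_cmul[OF q sT[OF \<phi>(1)] test_sjet[OF \<psi>], of k c] by (simp add: E_def)
        then show ?thesis using \<phi>(2)[of k] by linarith
      qed
      then show "\<exists>N. \<forall>k\<ge>N. 0 \<le> 1 / real (Suc k) + (2 * Re (cnj c * en q (T (\<phi> k)) (sjet \<psi>)) + (norm c)\<^sup>2 * E (sjet \<psi>))"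
        by blast
    qed
    define P where "P = E (sjet \<psi>)"
    have P0: "0 \<le> P" unfolding P_def by (rule E0[OF test_sjet[OF \<psi>]])
    \<comment> \<open>For c = -t e the two terms are -2t|e|^2 and t^2 |e|^2 P. As tP <= 1 their sum
      is at most -t|e|^2, which forces e = 0.\<close>
    define t where "t = 1 / (P + 1)"
    have t0: "0 < t" and tP: "t * P \<le> 1" using P0 by (auto simp: t_def)
    have R: "Re (cnj (- complex_of_real t * e) * e) = - (t * (norm e)\<^sup>2)"
      unfolding cmod_power2 by (simp add: power2_eq_square algebra_simps)
    have "0 \<le> - 2 * (t * (norm e)\<^sup>2) + (t * norm e)\<^sup>2 * P"
      using ineq[of "- complex_of_real t * e"] t0 unfolding R P_def[symmetric] by (simp add: norm_mult)
    also have "\<dots> = t * (norm e)\<^sup>2 * (t * P - 2)" by (simp add: power2_eq_square algebra_simps)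
    also have "\<dots> \<le> t * (norm e)\<^sup>2 * (-1)" using tP t0 by (intro mult_left_mono) auto
    finally have "t * (norm e)\<^sup>2 \<le> 0" by simp
    then have "norm e = 0" using t0 by (simp add: mult_le_0_iff)
    then show ?thesis by (simp add: e_def)
  qed
  then show ?thesis using HZ by blast
qed

section \<open>Functions with vanishing trace\<close>

lemma norm_add_sq_le: "(norm (a + b))\<^sup>2 \<le> 2 * (norm a)\<^sup>2 + 2 * (norm (b :: 'a::real_normed_vector))\<^sup>2"
proof -
  have "(norm (a + b))\<^sup>2 \<le> (norm a + norm b)\<^sup>2" by (intro power_mono norm_triangle_ineq) auto
  also have "\<dots> \<le> 2 * (norm a)\<^sup>2 + 2 * (norm b)\<^sup>2"
    using sum_squares_bound[of "norm a" "norm b"] by (simp add: power2_sum)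
  finally show ?thesis .
qed

text \<open>The Jacobian c^n is at least 1.\<close>

lemma nn_integral_dilate_le:
  fixes g :: "real^'n \<Rightarrow> ennreal"
  assumes [measurable]: "g \<in> borel_measurable borel" and c: "1 \<le> c"
  shows "(\<integral>\<^sup>+x. g (c *\<^sub>R x) \<partial>lborel) \<le> (\<integral>\<^sup>+x. g x \<partial>lborel)"
proof -
  have "(\<integral>\<^sup>+x. g x \<partial>lborel) = (\<integral>\<^sup>+x. g x \<partial>density (distr lborel borel (\<lambda>x. 0 + c *\<^sub>R x)) (\<lambda>_. \<bar>c\<bar>^DIM(real^'n)))"
    using lborel_affine[of c "0::real^'n"] c by simp
  also have "\<dots> = ennreal (\<bar>c\<bar>^DIM(real^'n)) * (\<integral>\<^sup>+x. g (c *\<^sub>R x) \<partial>lborel)"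
    by (simp add: nn_integral_density nn_integral_distr nn_integral_cmult)
  finally have "(\<integral>\<^sup>+x. g x \<partial>lborel) = ennreal (\<bar>c\<bar>^DIM(real^'n)) * (\<integral>\<^sup>+x. g (c *\<^sub>R x) \<partial>lborel)" .
  moreover have "1 * (\<integral>\<^sup>+x. g (c *\<^sub>R x) \<partial>lborel) \<le> ennreal (\<bar>c\<bar>^DIM(real^'n)) * (\<integral>\<^sup>+x. g (c *\<^sub>R x) \<partial>lborel)"
    by (rule mult_right_mono) (use c in \<open>auto intro!: one_le_power simp: ennreal_ge_1\<close>)
  ultimately show ?thesis by simp
qed

lemma norm_directional_le: "norm (\<Sum>i\<in>UNIV. (h $ i) *\<^sub>R partial i f x) \<le> norm h * norm (grad f x)"
proof -
  have "norm (\<Sum>i\<in>UNIV. (h $ i) *\<^sub>R partial i f x) \<le> (\<Sum>i\<in>UNIV. \<bar>h $ i\<bar> * \<bar>norm (partial i f x)\<bar>)"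
    by (rule order_trans[OF norm_sum]) simp
  also have "\<dots> \<le> L2_set (\<lambda>i. h $ i) UNIV * L2_set (\<lambda>i. norm (partial i f x)) UNIV"
    by (rule L2_set_mult_ineq)
  finally show ?thesis by (simp add: norm_vec_def grad_def L2_set_def)
qed

text \<open>The fundamental theorem along the ray from x to x/|x|, that is for l from 1 to 1/|x|,
  followed by Cauchy-Schwarz. The interval has length at most 2d.\<close>

lemma radial_increment:
  fixes f :: "real^'n \<Rightarrow> complex"
  assumes f: "smooth f" and d: "0 < d" "d \<le> 1/2" and x: "1 - d < norm x" "norm x < 1"
  shows "ennreal ((norm (f (x /\<^sub>R norm x) - f x))\<^sup>2)
    \<le> ennreal (2 * d) * (\<integral>\<^sup>+l. indicator {1..<1 / norm x} l * ennreal ((norm (grad f (l *\<^sub>R x)))\<^sup>2) \<partial>lborel)"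
proof -
  define r where "r = norm x"
  have r: "0 < r" "r < 1" "1 - d < r" using x d by (auto simp: r_def)
  define L where "L = 1 / r"
  have L1: "1 < L" using r by (simp add: L_def)
  have Ld: "L - 1 \<le> 2 * d"
  proof -
    have "1 - r \<le> d" using r by simp
    also have "d \<le> 2 * d * r" using r d by (simp add: mult_le_cancel_left1)
    finally show ?thesis using r by (simp add: L_def field_simps)
  qed
  define M where "M = restrict_space lborel {1..L}"
  define g where "g l = norm (grad f (l *\<^sub>R x))" for l
  have gc: "continuous_on A g" for A
    unfolding g_def by (intro continuous_on_norm continuous_on_compose2[OF grad_continuous[OF f, of UNIV]] continuous_intros) auto
  have "set_integrable lborel {1..L} g" unfolding set_integrable_def by (rule borel_integrable_compact[OF compact_Icc gc])
  moreover have "set_integrable lborel {1..L} (\<lambda>l. (g l)\<^sup>2)"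
    unfolding set_integrable_def by (rule borel_integrable_compact[OF compact_Icc continuous_on_power[OF gc]])
  ultimately have gi: "integrable M g" "integrable M (\<lambda>l. (g l)\<^sup>2)"
    unfolding M_def by (simp_all add: integrable_restrict_space set_integrable_def)
  have gm: "g \<in> borel_measurable M" using gi(1) by simp
  have sq: "square_integrable M g" "square_integrable M (\<lambda>l. 1::real)"
    using gi gm integrable_real_indicator[of "{1..L}" lborel]
    by (auto simp: square_integrable_def M_def integrable_restrict_space emeasure_lborel_Icc_eq)
  have one: "L2n M (\<lambda>l. 1::real) = sqrt (L - 1)"
    using L1 by (simp add: L2n_def M_def measure_restrict_space)
  have "norm (f (L *\<^sub>R x) - f (1 *\<^sub>R x)) \<le> (\<integral>l. g l \<partial>M)"
  proof -
    define F where "F l = (\<Sum>i\<in>UNIV. (x $ i) *\<^sub>R partial i f (l *\<^sub>R x))" for l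
    have Fc: "continuous_on A F" for A
      unfolding F_def by (intro continuous_intros continuous_on_compose2[OF smooth_continuous[OF smooth_partial[OF f], of UNIV]]) auto
    have "((\<lambda>l. f (l *\<^sub>R x)) has_vector_derivative F l) (at l within {1..L})" for l
    proof -
      have 1: "((\<lambda>l. l *\<^sub>R x) has_derivative (\<lambda>h. h *\<^sub>R x)) (at l)" by (auto intro!: derivative_eq_intros)
      have "((\<lambda>l. f (l *\<^sub>R x)) has_derivative (\<lambda>h. \<Sum>i\<in>UNIV. ((h *\<^sub>R x) $ i) *\<^sub>R partial i f (l *\<^sub>R x))) (at l)"
        by (rule has_derivative_compose[OF 1 smooth_has_derivative[OF f]])
      then have "((\<lambda>l. f (l *\<^sub>R x)) has_vector_derivative F l) (at l)"
        by (simp add: has_vector_derivative_def F_def scaleR_sum_right)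
      then show ?thesis by (rule has_vector_derivative_at_within)
    qed
    then have hi: "(F has_integral f (L *\<^sub>R x) - f (1 *\<^sub>R x)) {1..L}"
      using L1 by (intro fundamental_theorem_of_calculus) auto
    have ai: "set_integrable lborel {1..L} F" unfolding set_integrable_def by (rule borel_integrable_compact[OF compact_Icc Fc])
    have "f (L *\<^sub>R x) - f (1 *\<^sub>R x) = (\<integral>l. F l \<partial>M)"
      using hi set_borel_integral_eq_integral(2)[OF ai]
      by (simp add: integral_unique M_def integral_restrict_space set_lebesgue_integral_def)
    also have "norm \<dots> \<le> (\<integral>l. norm (F l) \<partial>M)" by (rule integral_norm_bound)
    also have "\<dots> \<le> (\<integral>l. g l \<partial>M)"
    proof (rule integral_mono)
      show "integrable M (\<lambda>l. norm (F l))" using ai by (simp add: M_def integrable_restrict_space set_integrable_def)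
      fix l
      have "norm (F l) \<le> r * g l" using norm_directional_le[of x f "l *\<^sub>R x"] by (simp add: F_def g_def r_def)
      also have "\<dots> \<le> 1 * g l" using r by (intro mult_right_mono) (auto simp: g_def)
      finally show "norm (F l) \<le> g l" by simp
    qed (rule gi)
    finally show ?thesis .
  qed
  also have "\<dots> \<le> L2n M g * L2n M (\<lambda>l. 1::real)"
    using L2_Cauchy_Schwarz[OF sq] by (simp add: g_def)
  finally have "(norm (f (L *\<^sub>R x) - f (1 *\<^sub>R x)))\<^sup>2 \<le> (L2n M g * sqrt (L - 1))\<^sup>2"
    unfolding one by (intro power_mono) auto
  also have "\<dots> = (L - 1) * (L2n M g)\<^sup>2" using L1 by (simp add: power_mult_distrib)
  also have "\<dots> \<le> 2 * d * (L2n M g)\<^sup>2" by (rule mult_right_mono[OF Ld]) simp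
  finally have "ennreal ((norm (f (L *\<^sub>R x) - f (1 *\<^sub>R x)))\<^sup>2) \<le> ennreal (2 * d) * ennreal ((L2n M g)\<^sup>2)"
    using d by (simp add: ennreal_mult[symmetric] ennreal_leI)
  also have "ennreal ((L2n M g)\<^sup>2) = (\<integral>\<^sup>+l. ennreal ((g l)\<^sup>2) \<partial>M)"
    using nn_integral_norm_eq_L2n[OF sq(1)] by simp
  also have "\<dots> = (\<integral>\<^sup>+l. ennreal ((g l)\<^sup>2) * indicator {1..L} l \<partial>lborel)"
    unfolding M_def by (rule nn_integral_restrict_space) simp
  \<comment> \<open>The endpoint l = 1/|x| is dropped so that l x stays in the open shell.\<close>
  also have "\<dots> = (\<integral>\<^sup>+l. indicator {1..<1 / norm x} l * ennreal ((norm (grad f (l *\<^sub>R x)))\<^sup>2) \<partial>lborel)"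
  proof (rule nn_integral_cong_AE)
    show "AE l in lborel. ennreal ((g l)\<^sup>2) * indicator {1..L} l = indicator {1..<1 / norm x} l * ennreal ((norm (grad f (l *\<^sub>R x)))\<^sup>2)"
      using AE_lborel_singleton[of L] by eventually_elim (auto simp: g_def L_def r_def indicator_def)
  qed
  finally show ?thesis by (simp add: L_def r_def divide_inverse)
qed


text \<open>Bound near the boundary by the values on the sphere and the gradient; the dilations
  \<open>x \<mapsto> l x\<close> replace polar coordinates.\<close>

lemma shell_bound_nn:
  fixes f :: "real^'n \<Rightarrow> complex"
  assumes f: "smooth f" and d: "0 < d" "d \<le> 1/2"
  defines "A \<equiv> {x :: real^'n. 1 - d < norm x \<and> norm x < 1}"
  shows "(\<integral>\<^sup>+x. indicator A x * ennreal ((norm (f x))\<^sup>2) \<partial>lborel)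
    \<le> 2 * (\<integral>\<^sup>+x. indicator Omega x * ennreal ((norm (f (x /\<^sub>R norm x)))\<^sup>2) \<partial>lborel)
      + ennreal (8 * d\<^sup>2) * (\<integral>\<^sup>+x. indicator A x * ennreal ((norm (grad f x))\<^sup>2) \<partial>lborel)"
proof -
  have A [measurable]: "A \<in> sets borel" unfolding A_def by measurable
  have fm [measurable]: "f \<in> borel_measurable borel"
    by (rule borel_measurable_continuous_onI[OF smooth_continuous[OF f]])
  have gm [measurable]: "grad f \<in> borel_measurable borel"
    by (rule borel_measurable_continuous_onI[OF grad_continuous[OF f]])
  define G where "G = (\<integral>\<^sup>+x. indicator A x * ennreal ((norm (grad f x))\<^sup>2) \<partial>lborel)"
  define k where "k l x = indicator A x * (indicator {1..<1 / norm x} l * ennreal ((norm (grad f (l *\<^sub>R x)))\<^sup>2))"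
    for l :: real and x :: "real^'n"
  have km: "(\<lambda>(l, x). k l x) \<in> borel_measurable (lborel \<Otimes>\<^sub>M lborel)"
  proof -
    have "k l x = indicator A x * (indicator {z. 1 \<le> fst z \<and> fst z < 1 / norm (snd z)} (l, x) * ennreal ((norm (grad f (l *\<^sub>R x)))\<^sup>2))" for l x
      by (simp add: k_def indicator_def)
    moreover have "(\<lambda>(l::real, x::real^'n). indicator A x * (indicator {z. 1 \<le> fst z \<and> fst z < 1 / norm (snd z)} (l, x) * ennreal ((norm (grad f (l *\<^sub>R x)))\<^sup>2)))
      \<in> borel_measurable (borel \<Otimes>\<^sub>M borel)"
      by measurable
    ultimately show ?thesis by (simp add: measurable_cong_sets[OF sets_pair_measure_cong[OF sets_lborel sets_lborel] refl] cong: measurable_cong_sets)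
  qed
  have inc: "indicator A x * ennreal ((norm (f x))\<^sup>2)
    \<le> 2 * (indicator Omega x * ennreal ((norm (f (x /\<^sub>R norm x)))\<^sup>2)) + 2 * (ennreal (2 * d) * (\<integral>\<^sup>+l. k l x \<partial>lborel))" for x
  proof (cases "x \<in> A")
    case True
    then have x: "1 - d < norm x" "norm x < 1" by (auto simp: A_def)
    have "(norm (f x))\<^sup>2 \<le> 2 * (norm (f (x /\<^sub>R norm x)))\<^sup>2 + 2 * (norm (f (x /\<^sub>R norm x) - f x))\<^sup>2"
      using norm_add_sq_le[of "f (x /\<^sub>R norm x)" "f x - f (x /\<^sub>R norm x)"] by (simp add: norm_minus_commute)
    then have "ennreal ((norm (f x))\<^sup>2) \<le> ennreal (2 * (norm (f (x /\<^sub>R norm x)))\<^sup>2 + 2 * (norm (f (x /\<^sub>R norm x) - f x))\<^sup>2)"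
      by (rule ennreal_leI)
    also have "\<dots> = 2 * ennreal ((norm (f (x /\<^sub>R norm x)))\<^sup>2) + 2 * ennreal ((norm (f (x /\<^sub>R norm x) - f x))\<^sup>2)"
      by (simp add: ennreal_mult)
    also have "\<dots> \<le> 2 * ennreal ((norm (f (x /\<^sub>R norm x)))\<^sup>2) + 2 * (ennreal (2 * d) * (\<integral>\<^sup>+l. k l x \<partial>lborel))"
      using radial_increment[OF f d x] True by (intro add_left_mono mult_left_mono) (auto simp: k_def)
    finally show ?thesis using True x by simp
  qed simp
  \<comment> \<open>For fixed l the dilation maps the relevant points x into the shell again, so the
    inner integral is at most the gradient integral over the shell. Since |x| > 1 - d, only l <=
    1/(1-d) contributes.\<close>
  have inner: "(\<integral>\<^sup>+x. k l x \<partial>lborel) \<le> indicator {1..1 / (1 - d)} l * G" for l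
  proof (cases "l \<in> {1..1 / (1 - d)}")
    case True
    then have l: "1 \<le> l" by simp
    have "(\<integral>\<^sup>+x. k l x \<partial>lborel) \<le> (\<integral>\<^sup>+x. indicator A (l *\<^sub>R x) * ennreal ((norm (grad f (l *\<^sub>R x)))\<^sup>2) \<partial>lborel)"
    proof (rule nn_integral_mono)
      fix x
      show "k l x \<le> indicator A (l *\<^sub>R x) * ennreal ((norm (grad f (l *\<^sub>R x)))\<^sup>2)"
      proof (cases "x \<in> A \<and> l < 1 / norm x")
        case t: True
        then have x: "1 - d < norm x" "norm x < 1" by (auto simp: A_def)
        have "0 < norm x" using x d by linarith
        then have "l * norm x < 1" using t by (simp add: field_simps)
        moreover have "norm x \<le> l * norm x" using l by (simp add: mult_le_cancel_right1)
        ultimately have "l *\<^sub>R x \<in> A" using x l by (simp add: A_def)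
        then show ?thesis using t by (simp add: k_def indicator_def)
      qed (auto simp: k_def indicator_def)
    qed
    also have "\<dots> \<le> G" unfolding G_def
      by (rule nn_integral_dilate_le[OF _ l, of "\<lambda>x. indicator A x * ennreal ((norm (grad f x))\<^sup>2)"]) measurable
    finally show ?thesis using True by simp
  next
    case False
    have "k l x = 0" for x
    proof (cases "x \<in> A")
      case True
      then have "1 / norm x \<le> 1 / (1 - d)" using d by (intro divide_left_mono) (auto simp: A_def intro!: mult_pos_pos)
      then show ?thesis using False by (auto simp: k_def indicator_def)
    qed (simp add: k_def)
    then show ?thesis by simp
  qed
  have "(\<integral>\<^sup>+x. (\<integral>\<^sup>+l. k l x \<partial>lborel) \<partial>lborel) = (\<integral>\<^sup>+l. (\<integral>\<^sup>+x. k l x \<partial>lborel) \<partial>lborel)"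
    by (rule lborel_pair.Fubini'[OF km])
  also have "\<dots> \<le> (\<integral>\<^sup>+l. indicator {1..1 / (1 - d)} l * G \<partial>lborel)"
    by (rule nn_integral_mono) (rule inner)
  also have "\<dots> = ennreal (1 / (1 - d) - 1) * G"
    using d by (subst nn_integral_multc) auto
  also have "\<dots> \<le> ennreal (2 * d) * G"
  proof (rule mult_right_mono[OF ennreal_leI])
    have "1 / (1 - d) - 1 = d / (1 - d)" using d by (simp add: field_simps)
    also have "\<dots> \<le> d / (1/2)" using d by (intro divide_left_mono) auto
    finally show "1 / (1 - d) - 1 \<le> 2 * d" by simp
  qed simp
  finally have K: "(\<integral>\<^sup>+x. (\<integral>\<^sup>+l. k l x \<partial>lborel) \<partial>lborel) \<le> ennreal (2 * d) * G" .
  have km2 [measurable]: "(\<lambda>x. \<integral>\<^sup>+l. k l x \<partial>lborel) \<in> borel_measurable borel"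
    using lborel.borel_measurable_nn_integral[OF measurable_pair_swap[OF km], simplified] by (simp add: case_prod_unfold)
  have "(\<integral>\<^sup>+x. indicator A x * ennreal ((norm (f x))\<^sup>2) \<partial>lborel)
    \<le> (\<integral>\<^sup>+x. 2 * (indicator Omega x * ennreal ((norm (f (x /\<^sub>R norm x)))\<^sup>2)) + 2 * (ennreal (2 * d) * (\<integral>\<^sup>+l. k l x \<partial>lborel)) \<partial>lborel)"
    by (rule nn_integral_mono) (rule inc)
  also have "\<dots> = 2 * (\<integral>\<^sup>+x. indicator Omega x * ennreal ((norm (f (x /\<^sub>R norm x)))\<^sup>2) \<partial>lborel)
      + 2 * (ennreal (2 * d) * (\<integral>\<^sup>+x. (\<integral>\<^sup>+l. k l x \<partial>lborel) \<partial>lborel))"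
    by (subst nn_integral_add) (auto simp: nn_integral_cmult)
  also have "\<dots> \<le> 2 * (\<integral>\<^sup>+x. indicator Omega x * ennreal ((norm (f (x /\<^sub>R norm x)))\<^sup>2) \<partial>lborel)
      + 2 * (ennreal (2 * d) * (ennreal (2 * d) * G))"
    by (intro add_left_mono mult_left_mono K) auto
  \<comment> \<open>One factor 2d comes from Cauchy-Schwarz on the ray, the other from the range of
    l, and the 2 from squaring a sum of two terms.\<close>
  also have "2 * (ennreal (2 * d) * (ennreal (2 * d) * G)) = ennreal (8 * d\<^sup>2) * G"
  proof -
    have "2 * (ennreal (2 * d) * (ennreal (2 * d) * G)) = (ennreal 2 * ennreal (2 * d) * ennreal (2 * d)) * G"
      by (simp add: mult.assoc)
    also have "ennreal 2 * ennreal (2 * d) * ennreal (2 * d) = ennreal (2 * (2 * d) * (2 * d))"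
      using d by (simp only: ennreal_mult mult_nonneg_nonneg less_imp_le zero_le_numeral)
    also have "2 * (2 * d) * (2 * d) = 8 * d\<^sup>2" by (simp add: power2_eq_square)
    finally show ?thesis .
  qed
  finally show ?thesis by (simp add: G_def)
qed

section \<open>Integrals over the sphere\<close>

lemma sets_surf [measurable_cong]: "sets (surf :: (real^'n) measure) = sets (restrict_space borel (sphere 0 1))"
  by (simp add: surf_def)

lemma space_surf: "space (surf :: (real^'n) measure) = sphere 0 1"
  using sets_eq_imp_space_eq[OF sets_surf[where 'n='n]] by (simp add: space_restrict_space)

lemma borel_measurable_surf: "f \<in> borel_measurable borel \<Longrightarrow> f \<in> borel_measurable (surf :: (real^'n) measure)"
  by (simp add: measurable_cong_sets[OF sets_surf refl] measurable_restrict_space1)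

text \<open>The cone formula written as an integral over the whole ball; the origin, which the
  definition leaves out, is a null set.\<close>

lemma nn_integral_surf:
  fixes g :: "real^'n \<Rightarrow> ennreal"
  assumes [measurable]: "g \<in> borel_measurable borel"
  shows "(\<integral>\<^sup>+x. g x \<partial>surf) = of_nat CARD('n) * (\<integral>\<^sup>+x. indicator Omega x * g (x /\<^sub>R norm x) \<partial>lborel)"
proof -
  let ?T = "\<lambda>x::real^'n. x /\<^sub>R norm x"
  have T: "?T \<in> restrict_space lborel (ball 0 1 - {0}) \<rightarrow>\<^sub>M restrict_space borel (sphere 0 1)"
  proof (rule measurable_restrict_space2)
    show "?T \<in> restrict_space lborel (ball 0 1 - {0}) \<rightarrow>\<^sub>M borel"
      by (rule measurable_restrict_space1) measurable
    show "?T \<in> space (restrict_space lborel (ball 0 1 - {0})) \<rightarrow> sphere 0 1"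
      by (auto simp: space_restrict_space)
  qed
  have g: "g \<in> borel_measurable (restrict_space borel (sphere 0 1))"
    by (rule measurable_restrict_space1) measurable
  have "(\<integral>\<^sup>+x. g x \<partial>surf) = of_nat CARD('n) * (\<integral>\<^sup>+x. g (?T x) \<partial>restrict_space lborel (ball 0 1 - {0}))"
    unfolding surf_def using g T by (simp add: nn_integral_scale_measure nn_integral_distr)
  also have "(\<integral>\<^sup>+x. g (?T x) \<partial>restrict_space lborel (ball 0 1 - {0})) = (\<integral>\<^sup>+x. g (?T x) * indicator (ball 0 1 - {0}) x \<partial>lborel)"
    by (rule nn_integral_restrict_space) simp
  also have "\<dots> = (\<integral>\<^sup>+x. indicator Omega x * g (?T x) \<partial>lborel)"
  proof (rule nn_integral_cong_AE)
    show "AE x in lborel. g (?T x) * indicator (ball 0 1 - {0}) x = indicator Omega x * g (?T x)"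
      using AE_lborel_singleton[of "0::real^'n"] by eventually_elim (simp add: indicator_def)
  qed
  finally show ?thesis .
qed

lemma continuous_square_integrable_surf:
  fixes f :: "real^'n \<Rightarrow> complex"
  assumes f: "continuous_on UNIV f"
  shows "square_integrable surf f"
proof -
  have fm [measurable]: "f \<in> borel_measurable borel" by (rule borel_measurable_continuous_onI[OF f])
  have "compact (f ` cball 0 1)"
    by (rule compact_continuous_image) (use f continuous_on_subset in auto)
  then obtain B where B: "\<forall>y\<in>f ` cball 0 1. norm y \<le> B"
    using compact_imp_bounded bounded_iff by metis
  have "(\<integral>\<^sup>+x. ennreal ((norm (f x))\<^sup>2) \<partial>surf)
      = of_nat CARD('n) * (\<integral>\<^sup>+x. indicator Omega x * ennreal ((norm (f (x /\<^sub>R norm x)))\<^sup>2) \<partial>lborel)"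
    by (rule nn_integral_surf) measurable
  also have "\<dots> \<le> of_nat CARD('n) * (\<integral>\<^sup>+x. ennreal (B\<^sup>2) * indicator (Omega :: (real^'n) set) x \<partial>lborel)"
  proof (intro mult_left_mono nn_integral_mono)
    fix x :: "real^'n"
    have "norm (x /\<^sub>R norm x) \<le> 1" by (cases "x = 0") auto
    then have "norm (f (x /\<^sub>R norm x)) \<le> B" using B by simp
    then have "(norm (f (x /\<^sub>R norm x)))\<^sup>2 \<le> B\<^sup>2" by (intro power_mono) auto
    then show "indicator Omega x * ennreal ((norm (f (x /\<^sub>R norm x)))\<^sup>2) \<le> ennreal (B\<^sup>2) * indicator Omega x"
      by (auto simp: indicator_def intro: ennreal_leI)
  qed simp
  also have "\<dots> < \<infinity>"
    using emeasure_bounded_finite[OF bounded_ball[of "0::real^'n" 1]]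
    by (simp add: nn_integral_cmult ennreal_mult_less_top of_nat_less_top)
  finally have fin: "(\<integral>\<^sup>+x. ennreal ((norm (f x))\<^sup>2) \<partial>surf) < \<infinity>" .
  have m: "f \<in> borel_measurable surf" by (rule borel_measurable_surf[OF fm])
  have "integrable surf (\<lambda>x. (norm (f x))\<^sup>2)"
    by (rule integrableI_bounded) (use fin m in auto)
  then show ?thesis using m by (simp add: square_integrable_def)
qed

lemma nn_integral_indicator_L2n:
  fixes f :: "real^'n \<Rightarrow> 'b::{real_normed_vector,second_countable_topology}"
  assumes f: "square_integrable vol f" and A: "A \<in> sets borel" "A \<subseteq> Omega"
  shows "square_integrable vol (\<lambda>x. indicator A x *\<^sub>R f x)"
    "(\<integral>\<^sup>+x. indicator A x * ennreal ((norm (f x))\<^sup>2) \<partial>lborel) = ennreal ((L2n vol (\<lambda>x. indicator A x *\<^sub>R f x))\<^sup>2)"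
proof -
  have m: "indicator A \<in> borel_measurable vol" by (rule borel_measurable_vol) (use A in simp)
  show s: "square_integrable vol (\<lambda>x. indicator A x *\<^sub>R f x)"
  proof (rule square_integrable_bound[OF f, of _ 1])
    show "(\<lambda>x. indicator A x *\<^sub>R f x) \<in> borel_measurable vol"
      by (rule borel_measurable_scaleR[OF m square_integrable_meas[OF f]])
  qed (simp add: indicator_def)
  have "ennreal ((L2n vol (\<lambda>x. indicator A x *\<^sub>R f x))\<^sup>2) = (\<integral>\<^sup>+x. ennreal ((norm (indicator A x *\<^sub>R f x :: 'b))\<^sup>2) \<partial>vol)"
    by (rule nn_integral_norm_eq_L2n[OF s, symmetric])
  also have "\<dots> = (\<integral>\<^sup>+x. ennreal ((norm (indicator A x *\<^sub>R f x :: 'b))\<^sup>2) * indicator Omega x \<partial>lborel)"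
    by (rule nn_integral_restrict_space) simp
  also have "\<dots> = (\<integral>\<^sup>+x. indicator A x * ennreal ((norm (f x))\<^sup>2) \<partial>lborel)"
    using A(2) by (intro nn_integral_cong) (auto simp: indicator_def)
  finally show "(\<integral>\<^sup>+x. indicator A x * ennreal ((norm (f x))\<^sup>2) \<partial>lborel) = ennreal ((L2n vol (\<lambda>x. indicator A x *\<^sub>R f x))\<^sup>2)" ..
qed

text \<open>What matters is the factor d in front of the jet term: it compensates the factor 1/d in
  the gradient of a cutoff function.\<close>

lemma shell_bound:
  fixes f :: "real^'n \<Rightarrow> complex"
  assumes f: "smooth f" and d: "0 < d" "d \<le> 1/2"
  defines "A \<equiv> {x :: real^'n. 1 - d < norm x \<and> norm x < 1}"
  shows "L2n vol (\<lambda>x. indicator A x *\<^sub>R f x) \<le> 2 * L2n surf f + 3 * d * L2n vol (\<lambda>x. indicator A x *\<^sub>R sjet f x)"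
proof -
  have A [measurable]: "A \<in> sets borel" unfolding A_def by measurable
  have AO: "A \<subseteq> Omega" by (auto simp: A_def)
  have fm [measurable]: "f \<in> borel_measurable borel"
    by (rule borel_measurable_continuous_onI[OF smooth_continuous[OF f]])
  define s where "s = L2n surf f"
  define w where "w = L2n vol (\<lambda>x. indicator A x *\<^sub>R sjet f x)"
  define v where "v = L2n vol (\<lambda>x. indicator A x *\<^sub>R f x)"
  have fs: "square_integrable vol f" "square_integrable vol (sjet f)"
    by (rule continuous_square_integrable[OF smooth_continuous[OF f]]) (rule sjet_square_integrable[OF f])
  have v: "(\<integral>\<^sup>+x. indicator A x * ennreal ((norm (f x))\<^sup>2) \<partial>lborel) = ennreal (v\<^sup>2)"
    unfolding v_def by (rule nn_integral_indicator_L2n(2)[OF fs(1) A AO])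
  have w: "(\<integral>\<^sup>+x. indicator A x * ennreal ((norm (grad f x))\<^sup>2) \<partial>lborel) \<le> ennreal (w\<^sup>2)"
  proof -
    have "(\<integral>\<^sup>+x. indicator A x * ennreal ((norm (grad f x))\<^sup>2) \<partial>lborel) \<le> (\<integral>\<^sup>+x. indicator A x * ennreal ((norm (sjet f x))\<^sup>2) \<partial>lborel)"
      by (intro nn_integral_mono mult_left_mono ennreal_leI) (auto simp: power2_norm_Pair sjet_def)
    then show ?thesis unfolding w_def using nn_integral_indicator_L2n(2)[OF fs(2) A AO] by simp
  qed
  have S: "(\<integral>\<^sup>+x. indicator Omega x * ennreal ((norm (f (x /\<^sub>R norm x)))\<^sup>2) \<partial>lborel) \<le> ennreal (s\<^sup>2)" (is "?I \<le> _")
  proof -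
    have "1 * ?I \<le> of_nat CARD('n) * ?I"
    proof (rule mult_right_mono)
      have "1 \<le> CARD('n)" by (simp add: Suc_leI)
      then show "1 \<le> (of_nat CARD('n) :: ennreal)" by (metis of_nat_1 of_nat_mono)
    qed simp
    also have "of_nat CARD('n) * ?I = (\<integral>\<^sup>+x. ennreal ((norm (f x))\<^sup>2) \<partial>surf)"
      by (rule nn_integral_surf[symmetric]) measurable
    also have "\<dots> = ennreal (s\<^sup>2)" unfolding s_def
      by (rule nn_integral_norm_eq_L2n[OF continuous_square_integrable_surf[OF smooth_continuous[OF f]]])
    finally show ?thesis by simp
  qed
  have "ennreal (v\<^sup>2) \<le> 2 * ?I + ennreal (8 * d\<^sup>2) * (\<integral>\<^sup>+x. indicator A x * ennreal ((norm (grad f x))\<^sup>2) \<partial>lborel)"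
    using shell_bound_nn[OF f d] unfolding v[symmetric] A_def .
  also have "\<dots> \<le> 2 * ennreal (s\<^sup>2) + ennreal (8 * d\<^sup>2) * ennreal (w\<^sup>2)"
    by (intro add_mono mult_left_mono S w) auto
  also have "\<dots> = ennreal (2 * s\<^sup>2 + 8 * d\<^sup>2 * w\<^sup>2)"
    by (simp add: ennreal_mult ennreal_plus)
  finally have "v\<^sup>2 \<le> 2 * s\<^sup>2 + 8 * d\<^sup>2 * w\<^sup>2" by (subst (asm) ennreal_le_iff) auto
  \<comment> \<open>The coefficients are rounded up to squares, so that the expression is at most
    (2s + 3dw)^2.\<close>
  also have "\<dots> \<le> 4 * s\<^sup>2 + 9 * d\<^sup>2 * w\<^sup>2" by (intro add_mono mult_right_mono) auto
  also have "\<dots> \<le> (2 * s + 3 * d * w)\<^sup>2"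
    using d by (simp add: power2_eq_square algebra_simps s_def w_def)
  finally have "v \<le> 2 * s + 3 * d * w"
    by (rule power2_le_imp_le) (use d in \<open>simp add: s_def w_def\<close>)
  then show ?thesis by (simp add: v_def s_def w_def)
qed

section \<open>Traces of jets\<close>

definition wtrace :: "'n::finite jet \<Rightarrow> (real^'n \<Rightarrow> complex) \<Rightarrow> bool"
  where "wtrace U g \<longleftrightarrow> wjet U \<and> square_integrable surf g \<and> (\<exists>\<phi> :: nat \<Rightarrow> real^'n \<Rightarrow> complex. (\<forall>k. smooth (\<phi> k)) \<and>
    (\<lambda>k. L2n vol (\<lambda>x. sjet (\<phi> k) x - U x)) \<longlonglongrightarrow> 0 \<and> (\<lambda>k. L2n surf (\<lambda>x. \<phi> k x - g x)) \<longlonglongrightarrow> 0)"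

lemma wtraceE:
  assumes "wtrace U g"
  obtains \<phi> where "\<forall>k. smooth (\<phi> k)" "(\<lambda>k. L2n vol (\<lambda>x. sjet (\<phi> k) x - U x)) \<longlonglongrightarrow> 0"
    "(\<lambda>k. L2n surf (\<lambda>x. \<phi> k x - g x)) \<longlonglongrightarrow> 0"
  using assms unfolding wtrace_def by blast

lemma wtraceI:
  assumes "wjet U" "square_integrable surf g" "\<And>k::nat. smooth (\<phi> k)" "(\<lambda>k. L2n vol (\<lambda>x. sjet (\<phi> k) x - U x)) \<longlonglongrightarrow> 0"
    "(\<lambda>k. L2n surf (\<lambda>x. \<phi> k x - g x)) \<longlonglongrightarrow> 0"
  shows "wtrace U g"
  unfolding wtrace_def by (intro conjI exI[of _ \<phi>] allI assms)

lemma wtrace_wjet: "wtrace U g \<Longrightarrow> wjet U" by (simp add: wtrace_def)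
lemma wtrace_square_integrable: "wtrace U g \<Longrightarrow> square_integrable vol U" by (simp add: wtrace_def wjet_def)

lemma tendsto_sq_iff: "(\<lambda>k. (F k :: real)\<^sup>2) \<longlonglongrightarrow> 0 \<longleftrightarrow> F \<longlonglongrightarrow> 0"
proof
  assume "(\<lambda>k. (F k)\<^sup>2) \<longlonglongrightarrow> 0"
  then have "(\<lambda>k. sqrt ((F k)\<^sup>2)) \<longlonglongrightarrow> sqrt 0" by (rule tendsto_real_sqrt)
  then show "F \<longlonglongrightarrow> 0" by (simp add: tendsto_rabs_zero_iff)
next
  assume "F \<longlonglongrightarrow> 0"
  then show "(\<lambda>k. (F k)\<^sup>2) \<longlonglongrightarrow> 0" using tendsto_power[of F 0 sequentially 2] by simp
qed

lemma has_trace_wtrace: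
  assumes "has_trace u g" shows "wtrace (jet u) g"
proof -
  have u: "u \<in> H1" and g: "square_integrable surf g" using assms by (auto simp: has_trace_def)
  obtain \<phi> where \<phi>: "\<forall>k. smooth (\<phi> k)" "(\<lambda>k. H1_norm (\<lambda>x. \<phi> k x - u x)) \<longlonglongrightarrow> 0"
      "(\<lambda>k. \<integral>x. (norm (\<phi> k x - g x))\<^sup>2 \<partial>surf) \<longlonglongrightarrow> 0"
    using assms unfolding has_trace_def by blast
  show ?thesis
  proof (rule wtraceI[OF H1_wjet[OF u] g])
    show "smooth (\<phi> k)" for k using \<phi>(1) by blast
    have "H1_norm (\<lambda>x. \<phi> k x - u x) = L2n vol (\<lambda>x. sjet (\<phi> k) x - jet u x)" for k
      using H1_norm_wjet[OF wjet_diff[OF smooth_wjet[OF \<phi>(1)[rule_format, of k]] H1_wjet[OF u]]] by (simp add: sjet_def jet_def)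
    then show "(\<lambda>k. L2n vol (\<lambda>x. sjet (\<phi> k) x - jet u x)) \<longlonglongrightarrow> 0" using \<phi>(2) by simp
    show "(\<lambda>k. L2n surf (\<lambda>x. \<phi> k x - g x)) \<longlonglongrightarrow> 0"
      using \<phi>(3) by (simp add: L2n_sq[symmetric] tendsto_sq_iff)
  qed
qed

lemma wtrace_has_trace:
  assumes "wtrace U g" shows "has_trace (\<lambda>x. fst (U x)) g"
proof -
  obtain \<phi> where \<phi>: "\<forall>k. smooth (\<phi> k)" "(\<lambda>k. L2n vol (\<lambda>x. sjet (\<phi> k) x - U x)) \<longlonglongrightarrow> 0"
    "(\<lambda>k. L2n surf (\<lambda>x. \<phi> k x - g x)) \<longlonglongrightarrow> 0"
    by (rule wtraceE[OF assms])
  have U: "wjet U" and g: "square_integrable surf g" using assms by (auto simp: wtrace_def)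
  have "H1_norm (\<lambda>x. \<phi> k x - fst (U x)) = L2n vol (\<lambda>x. sjet (\<phi> k) x - U x)" for k
    using H1_norm_wjet[OF wjet_diff[OF smooth_wjet[OF \<phi>(1)[rule_format, of k]] U]] by (simp add: sjet_def)
  moreover have "(\<lambda>k. \<integral>x. (norm (\<phi> k x - g x))\<^sup>2 \<partial>surf) \<longlonglongrightarrow> 0"
    using \<phi>(3) by (simp add: L2n_sq[symmetric] tendsto_sq_iff)
  ultimately show ?thesis unfolding has_trace_def
    using \<phi>(1,2) wjet_H1(1)[OF U] g by (intro conjI exI[of _ \<phi>]) simp_all
qed

lemma wtrace_diff:
  assumes U: "wtrace U g" and V: "wtrace V g"
  shows "wtrace (\<lambda>x. U x - V x) (\<lambda>x. 0)"
proof -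
  obtain \<phi> where *: "\<forall>k. smooth (\<phi> k)" "(\<lambda>k. L2n vol (\<lambda>x. sjet (\<phi> k) x - U x)) \<longlonglongrightarrow> 0"
    "(\<lambda>k. L2n surf (\<lambda>x. \<phi> k x - g x)) \<longlonglongrightarrow> 0"
    by (rule wtraceE[OF U])
  note \<phi> = *(1)[rule_format] *(2,3)
  obtain \<psi> where *: "\<forall>k. smooth (\<psi> k)" "(\<lambda>k. L2n vol (\<lambda>x. sjet (\<psi> k) x - V x)) \<longlonglongrightarrow> 0"
    "(\<lambda>k. L2n surf (\<lambda>x. \<psi> k x - g x)) \<longlonglongrightarrow> 0"
    by (rule wtraceE[OF V])
  note \<psi> = *(1)[rule_format] *(2,3)
  have sU: "square_integrable vol U" "square_integrable vol V" "square_integrable surf g"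
    using U V by (auto simp: wtrace_def wjet_def)
  have ss: "square_integrable surf (\<lambda>x. \<phi> k x - g x)" "square_integrable surf (\<lambda>x. \<psi> k x - g x)" for k
    by (intro square_integrable_diff continuous_square_integrable_surf smooth_continuous \<phi> \<psi> sU)+
  have sv: "square_integrable vol (\<lambda>x. sjet (\<phi> k) x - U x)" "square_integrable vol (\<lambda>x. sjet (\<psi> k) x - V x)" for k
    by (intro square_integrable_diff sjet_square_integrable \<phi> \<psi> sU)+
  show ?thesis
  proof (rule wtraceI)
    show "wjet (\<lambda>x. U x - V x)" by (intro wjet_diff wtrace_wjet[OF U] wtrace_wjet[OF V])
    show "smooth (\<lambda>x. \<phi> k x - \<psi> k x)" for k by (intro smooth_diff \<phi> \<psi>)
    show "(\<lambda>k. L2n vol (\<lambda>x. sjet (\<lambda>x. \<phi> k x - \<psi> k x) x - (U x - V x))) \<longlonglongrightarrow> 0"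
    proof (rule Lim_null_comparison)
      show "(\<lambda>k. L2n vol (\<lambda>x. sjet (\<phi> k) x - U x) + L2n vol (\<lambda>x. sjet (\<psi> k) x - V x)) \<longlonglongrightarrow> 0"
        using tendsto_add[OF \<phi>(2) \<psi>(2)] by simp
      show "\<forall>\<^sub>F k in sequentially. norm (L2n vol (\<lambda>x. sjet (\<lambda>x. \<phi> k x - \<psi> k x) x - (U x - V x)))
          \<le> L2n vol (\<lambda>x. sjet (\<phi> k) x - U x) + L2n vol (\<lambda>x. sjet (\<psi> k) x - V x)"
      proof (intro always_eventually allI)
        fix k
        have "(\<lambda>x. sjet (\<lambda>x. \<phi> k x - \<psi> k x) x - (U x - V x)) = (\<lambda>x. (sjet (\<phi> k) x - U x) + - (sjet (\<psi> k) x - V x))"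
          using \<phi>(1) \<psi>(1) by (simp add: sjet_diff fun_eq_iff)
        then show "norm (L2n vol (\<lambda>x. sjet (\<lambda>x. \<phi> k x - \<psi> k x) x - (U x - V x)))
          \<le> L2n vol (\<lambda>x. sjet (\<phi> k) x - U x) + L2n vol (\<lambda>x. sjet (\<psi> k) x - V x)"
          using L2n_triangle[OF sv(1)[of k] square_integrable_uminus[OF sv(2)[of k]]] by (simp add: L2n_uminus L2n_minus_commute[of _ "\<lambda>x. V x"])
      qed
    qed
    show "(\<lambda>k. L2n surf (\<lambda>x. \<phi> k x - \<psi> k x - 0)) \<longlonglongrightarrow> 0"
    proof (rule Lim_null_comparison)
      show "(\<lambda>k. L2n surf (\<lambda>x. \<phi> k x - g x) + L2n surf (\<lambda>x. \<psi> k x - g x)) \<longlonglongrightarrow> 0"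
        using tendsto_add[OF \<phi>(3) \<psi>(3)] by simp
      show "\<forall>\<^sub>F k in sequentially. norm (L2n surf (\<lambda>x. \<phi> k x - \<psi> k x - 0))
          \<le> L2n surf (\<lambda>x. \<phi> k x - g x) + L2n surf (\<lambda>x. \<psi> k x - g x)"
        using L2n_triangle[OF ss(1) square_integrable_uminus[OF ss(2)]]
        by (intro always_eventually) (simp add: L2n_minus_commute[of _ g])
    qed
  qed simp
qed

text \<open>Test functions vanish on the sphere, so adding them to an approximating sequence leaves
  its boundary values unchanged.\<close>

lemma wtrace_add_H10:
  assumes U: "wtrace U g" and Z: "H10 Z"
  shows "wtrace (\<lambda>x. U x + Z x) g"
proof -
  obtain \<phi> where *: "\<forall>k. smooth (\<phi> k)" "(\<lambda>k. L2n vol (\<lambda>x. sjet (\<phi> k) x - U x)) \<longlonglongrightarrow> 0"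
    "(\<lambda>k. L2n surf (\<lambda>x. \<phi> k x - g x)) \<longlonglongrightarrow> 0"
    by (rule wtraceE[OF U])
  note \<phi> = *(1)[rule_format] *(2,3)
  obtain \<psi> where *: "\<forall>k. test_function (\<psi> k)" "(\<lambda>k. L2n vol (\<lambda>x. sjet (\<psi> k) x - Z x)) \<longlonglongrightarrow> 0"
    by (rule H10E[OF Z])
  note \<psi> = *(1)[rule_format] *(2)
  have sm: "smooth (\<psi> k)" for k by (rule test_function_smooth[OF \<psi>(1)])
  have sU: "square_integrable vol U" "square_integrable vol Z" "square_integrable surf g"
    using U Z by (auto simp: wtrace_def wjet_def H10_def)
  have sv: "square_integrable vol (\<lambda>x. sjet (\<phi> k) x - U x)" "square_integrable vol (\<lambda>x. sjet (\<psi> k) x - Z x)" for k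
    by (intro square_integrable_diff sjet_square_integrable \<phi> sm sU)+
  show ?thesis
  proof (rule wtraceI)
    show "wjet (\<lambda>x. U x + Z x)" by (intro wjet_add wtrace_wjet[OF U] H10_wjet[OF Z])
    show "smooth (\<lambda>x. \<phi> k x + \<psi> k x)" for k by (intro smooth_add \<phi> sm)
    show "(\<lambda>k. L2n vol (\<lambda>x. sjet (\<lambda>x. \<phi> k x + \<psi> k x) x - (U x + Z x))) \<longlonglongrightarrow> 0"
    proof (rule Lim_null_comparison)
      show "(\<lambda>k. L2n vol (\<lambda>x. sjet (\<phi> k) x - U x) + L2n vol (\<lambda>x. sjet (\<psi> k) x - Z x)) \<longlonglongrightarrow> 0"
        using tendsto_add[OF \<phi>(2) \<psi>(2)] by simp
      show "\<forall>\<^sub>F k in sequentially. norm (L2n vol (\<lambda>x. sjet (\<lambda>x. \<phi> k x + \<psi> k x) x - (U x + Z x)))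
          \<le> L2n vol (\<lambda>x. sjet (\<phi> k) x - U x) + L2n vol (\<lambda>x. sjet (\<psi> k) x - Z x)"
      proof (intro always_eventually allI)
        fix k
        have "(\<lambda>x. sjet (\<lambda>x. \<phi> k x + \<psi> k x) x - (U x + Z x)) = (\<lambda>x. (sjet (\<phi> k) x - U x) + (sjet (\<psi> k) x - Z x))"
          using \<phi>(1) sm by (simp add: sjet_add fun_eq_iff)
        then show "norm (L2n vol (\<lambda>x. sjet (\<lambda>x. \<phi> k x + \<psi> k x) x - (U x + Z x)))
          \<le> L2n vol (\<lambda>x. sjet (\<phi> k) x - U x) + L2n vol (\<lambda>x. sjet (\<psi> k) x - Z x)"
          using L2n_triangle[OF sv(1)[of k] sv(2)[of k]] by simp
      qed
    qed
    have "L2n surf (\<lambda>x. \<phi> k x + \<psi> k x - g x) = L2n surf (\<lambda>x. \<phi> k x - g x)" for k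
    proof -
      have "\<psi> k x = 0" if "x \<in> sphere 0 1" for x
        using \<psi>(1)[of k] that unfolding test_function_def by (auto simp: subset_iff)
      then show ?thesis unfolding L2n_def
        by (intro arg_cong[where f=sqrt] Bochner_Integration.integral_cong) (auto simp: space_surf)
    qed
    then show "(\<lambda>k. L2n surf (\<lambda>x. \<phi> k x + \<psi> k x - g x)) \<longlonglongrightarrow> 0" using \<phi>(3) by simp
  qed (rule sU)
qed

section \<open>Cutting off functions with zero trace\<close>

lemma cutoff_has_derivative:
  assumes "deriv_seq h"
  shows "((\<lambda>x::real^'n. complex_of_real (h 0 ((1 - (norm x)\<^sup>2) / d))) has_derivative
    (\<lambda>v. complex_of_real (h 1 ((1 - (norm x)\<^sup>2) / d) * (- 2 * (x \<bullet> v) / d)))) (at x)"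
proof -
  have "((\<lambda>x::real^'n. (1 - x \<bullet> x) / d) has_derivative (\<lambda>v. (0 - (x \<bullet> v + v \<bullet> x)) / d)) (at x)"
    unfolding divide_inverse by (intro has_derivative_mult_left has_derivative_diff has_derivative_const has_derivative_inner has_derivative_ident)
  then have 1: "((\<lambda>x::real^'n. (1 - (norm x)\<^sup>2) / d) has_derivative (\<lambda>v. - 2 * (x \<bullet> v) / d)) (at x)"
    by (simp add: power2_norm_eq_inner inner_commute)
  have 2: "(h 0 has_derivative (\<lambda>v. h 1 ((1 - (norm x)\<^sup>2) / d) * v)) (at ((1 - (norm x)\<^sup>2) / d))"
    using deriv_seqD[OF assms, of 0] by (simp add: has_field_derivative_def)
  show ?thesis by (rule has_derivative_of_real[OF has_derivative_compose[OF 1 2]])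
qed

text \<open>The error is (c - 1) times the jet of f plus f times the gradient of c. The gradient is
  at most 2B/d, and in the ball both terms vanish outside the shell.\<close>

lemma cutoff_jet_bound:
  fixes f :: "real^'n \<Rightarrow> complex"
  assumes h: "deriv_seq h" "\<And>t. t \<le> 1/2 \<Longrightarrow> h 0 t = 0" "\<And>t. t \<ge> 1 \<Longrightarrow> h 0 t = 1" "\<And>t. 0 \<le> h 0 t" "\<And>t. h 0 t \<le> 1"
    and B: "\<And>t. \<bar>h 1 t\<bar> \<le> B" and f: "smooth f" and d: "0 < d" "d \<le> 1/2"
  defines "A \<equiv> {x :: real^'n. 1 - d < norm x \<and> norm x < 1}"
    and "c \<equiv> \<lambda>x::real^'n. complex_of_real (h 0 ((1 - (norm x)\<^sup>2) / d))"
  shows "L2n vol (\<lambda>x. sjet (\<lambda>x. f x * c x) x - sjet f x)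
    \<le> L2n vol (\<lambda>x. indicator A x *\<^sub>R sjet f x) + (2 * B / d) * L2n vol (\<lambda>x. indicator A x *\<^sub>R f x)"
proof -
  have A [measurable]: "A \<in> sets borel" unfolding A_def by measurable
  have AO: "A \<subseteq> Omega" by (auto simp: A_def)
  have c: "smooth c" unfolding c_def by (rule test_function_smooth[OF cutoff_test_function[OF h(1,2) d(1)]])
  have B0: "0 \<le> B" using B[of 0] by simp
  have gc: "grad c x = (\<chi> i. complex_of_real (h 1 ((1 - (norm x)\<^sup>2) / d) * (- 2 * (x $ i) / d)))" for x
    unfolding grad_def c_def by (simp add: partial_eq[OF cutoff_has_derivative[OF h(1)]] inner_axis)
  have ng: "norm (grad c x) \<le> 2 * B / d" if x: "x \<in> Omega" for x
  proof -
    define t where "t = h 1 ((1 - (norm x)\<^sup>2) / d) * (- 2 / d)"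
    have "grad c x $ i = complex_of_real (t * x $ i)" for i by (simp add: gc t_def)
    then have "norm (grad c x $ i) = \<bar>t\<bar> * norm (x $ i)" for i by (simp add: norm_mult)
    then have "(norm (grad c x))\<^sup>2 = (\<bar>t\<bar> * norm x)\<^sup>2"
      unfolding power_mult_distrib power2_norm_vec by (simp only: power_mult_distrib sum_distrib_left)
    then have "norm (grad c x) = \<bar>t\<bar> * norm x" by (simp add: power2_eq_iff_nonneg)
    also have "\<dots> \<le> \<bar>t\<bar> * 1" using x by (intro mult_left_mono) auto
    also have "\<dots> = \<bar>h 1 ((1 - (norm x)\<^sup>2) / d)\<bar> * (2 / d)" using d by (simp add: t_def abs_mult)
    also have "\<dots> \<le> B * (2 / d)" using d by (intro mult_right_mono B) auto
    finally show ?thesis by (simp add: mult.commute)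
  qed
  have eq: "sjet (\<lambda>x. f x * c x) x - sjet f x = cmul (c x - 1) (sjet f x) + (0, f x *s grad c x)" for x
    using smooth_differentiable[OF f, of x] smooth_differentiable[OF c, of x]
    by (simp add: sjet_def grad_def partial_mult prod_eq_iff vec_eq_iff cmul_def algebra_simps)
  have ns: "norm ((0, f x *s grad c x) :: complex \<times> (complex^'n)) = norm (f x) * norm (grad c x)" for x
    using norm_cmul[of "f x" "(0::complex, grad c x)"] by (simp add: cmul_def norm_Pair)
  have bd: "norm (sjet (\<lambda>x. f x * c x) x - sjet f x) \<le> norm (indicator A x *\<^sub>R sjet f x) + (2 * B / d) * norm (indicator A x *\<^sub>R f x)"
    if x: "x \<in> Omega" for x
  proof (cases "x \<in> A")
    case True
    have "c x - 1 = complex_of_real (h 0 ((1 - (norm x)\<^sup>2) / d) - 1)" by (simp add: c_def)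
    then have "norm (c x - 1) = \<bar>h 0 ((1 - (norm x)\<^sup>2) / d) - 1\<bar>" by (simp only: norm_of_real)
    also have "\<dots> \<le> 1" using h(4)[of "(1 - (norm x)\<^sup>2) / d"] h(5)[of "(1 - (norm x)\<^sup>2) / d"] by linarith
    finally have "norm (c x - 1) \<le> 1" .
    then have "norm (cmul (c x - 1) (sjet f x)) \<le> 1 * norm (sjet f x)"
      unfolding norm_cmul by (intro mult_right_mono) auto
    moreover have "norm (f x) * norm (grad c x) \<le> norm (f x) * (2 * B / d)"
      by (intro mult_left_mono ng x) auto
    ultimately show ?thesis using True norm_triangle_ineq[of "cmul (c x - 1) (sjet f x)" "(0, f x *s grad c x)"]
      unfolding eq ns by (simp add: mult.commute)
  next
    case False
    \<comment> \<open>Off the shell 1 - |x|^2 >= 2d - d^2 > d. The strict inequality places the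
      argument in the open region where the step is 1, so its derivative vanishes as well.\<close>
    then have nx: "norm x \<le> 1 - d" using x by (auto simp: A_def)
    have "(norm x)\<^sup>2 \<le> (1 - d)\<^sup>2" using nx by (intro power_mono) auto
    also have "\<dots> = 1 - 2 * d + d * d" by (simp add: power2_eq_square algebra_simps)
    also have "\<dots> < 1 - d" using d mult_strict_right_mono[of d 1 d] by simp
    finally have s: "1 < (1 - (norm x)\<^sup>2) / d" using d by (simp add: field_simps)
    have "h 1 ((1 - (norm x)\<^sup>2) / d) = 0"
    proof -
      have "((\<lambda>t. 1) has_real_derivative h (Suc 0) ((1 - (norm x)\<^sup>2) / d)) (at ((1 - (norm x)\<^sup>2) / d))"
        by (rule has_field_derivative_transform_within_open[OF deriv_seqD[OF h(1), of 0], where S="{1<..}"]) (use s h(3) in auto)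
      then show ?thesis using DERIV_unique DERIV_const One_nat_def by metis
    qed
    then have "grad c x = 0" by (simp add: gc vec_eq_iff)
    moreover have "c x = 1" using h(3) s by (simp add: c_def)
    ultimately have "sjet (\<lambda>x. f x * c x) x - sjet f x = 0" unfolding eq
      by (simp add: cmul_def zero_prod_def vec_eq_iff)
    then show ?thesis using B0 d by simp
  qed
  have s1: "square_integrable vol (\<lambda>x. indicator A x *\<^sub>R sjet f x)"
    by (rule nn_integral_indicator_L2n(1)[OF sjet_square_integrable[OF f] A AO])
  have s2: "square_integrable vol (\<lambda>x. indicator A x *\<^sub>R f x)"
    by (rule nn_integral_indicator_L2n(1)[OF continuous_square_integrable[OF smooth_continuous[OF f]] A AO])
  define R where "R x = norm (indicator A x *\<^sub>R sjet f x) + (2 * B / d) *\<^sub>R norm (indicator A x *\<^sub>R f x)" for x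
  have R: "square_integrable vol R"
    unfolding R_def by (intro square_integrable_add square_integrable_scaleR square_integrable_norm s1 s2)
  have m: "(\<lambda>x. sjet (\<lambda>x. f x * c x) x - sjet f x) \<in> borel_measurable vol"
    by (intro square_integrable_meas square_integrable_diff sjet_square_integrable smooth_mult f c)
  have "L2n vol (\<lambda>x. sjet (\<lambda>x. f x * c x) x - sjet f x) \<le> 1 * L2n vol R"
  proof (rule L2n_bound[OF R m])
    show "AE x in vol. norm (sjet (\<lambda>x. f x * c x) x - sjet f x) \<le> 1 * norm (R x)"
    proof (rule AE_I2)
      fix x :: "real^'n" assume "x \<in> space vol"
      then have "norm (sjet (\<lambda>x. f x * c x) x - sjet f x) \<le> R x" using bd unfolding space_vol R_def by simp
      then show "norm (sjet (\<lambda>x. f x * c x) x - sjet f x) \<le> 1 * norm (R x)" by simp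
    qed
  qed simp
  also have "1 * L2n vol R \<le> L2n vol (\<lambda>x. norm (indicator A x *\<^sub>R sjet f x)) + L2n vol (\<lambda>x. (2 * B / d) *\<^sub>R norm (indicator A x *\<^sub>R f x))"
    unfolding R_def mult_1 by (intro L2n_triangle square_integrable_scaleR square_integrable_norm s1 s2)
  also have "\<dots> = L2n vol (\<lambda>x. indicator A x *\<^sub>R sjet f x) + (2 * B / d) * L2n vol (\<lambda>x. indicator A x *\<^sub>R f x)"
    unfolding L2n_scaleR L2n_norm using B0 d by simp
  finally show ?thesis .
qed

lemma L2n_shell_tendsto_0:
  fixes D :: "real^'n \<Rightarrow> 'b::{real_normed_vector,second_countable_topology}"
  assumes D: "square_integrable vol D"
  shows "(\<lambda>m. L2n vol (\<lambda>x. indicator {x. 1 - 1 / real (Suc m) < norm x \<and> norm x < 1} x *\<^sub>R D x)) \<longlonglongrightarrow> 0"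
proof -
  let ?A = "\<lambda>m. {x :: real^'n. 1 - 1 / real (Suc m) < norm x \<and> norm x < 1}"
  have A [measurable]: "?A m \<in> sets borel" for m by measurable
  have "(\<lambda>m. \<integral>x. (norm (indicator (?A m) x *\<^sub>R D x))\<^sup>2 \<partial>vol) \<longlonglongrightarrow> (\<integral>x. 0 \<partial>(vol :: (real^'n) measure))"
  proof (rule integral_dominated_convergence[where w="\<lambda>x. (norm (D x))\<^sup>2"])
    show "integrable vol (\<lambda>x. (norm (D x))\<^sup>2)" by (rule square_integrable_int[OF D])
    show "(\<lambda>x. (norm (indicator (?A m) x *\<^sub>R D x))\<^sup>2) \<in> borel_measurable vol" for m
    proof -
      have "?A m \<subseteq> Omega" by auto
      from square_integrable_int[OF nn_integral_indicator_L2n(1)[OF D A[of m] this]]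
      show ?thesis by (rule borel_measurable_integrable)
    qed
    show "AE x in vol. (\<lambda>m. (norm (indicator (?A m) x *\<^sub>R D x))\<^sup>2) \<longlonglongrightarrow> 0"
    proof (rule AE_I2)
      fix x :: "real^'n" assume "x \<in> space vol"
      then have x: "norm x < 1" by simp
      have "(\<lambda>m. 1 - 1 / real (Suc m)) \<longlonglongrightarrow> 1 - 0" by (intro tendsto_intros LIMSEQ_Suc[OF lim_1_over_n])
      then have "\<forall>\<^sub>F m in sequentially. norm x < 1 - 1 / real (Suc m)"
        by (rule order_tendstoD) (use x in simp)
      then have "\<forall>\<^sub>F m in sequentially. (norm (indicator (?A m) x *\<^sub>R D x))\<^sup>2 = 0"
        by eventually_elim simp
      then show "(\<lambda>m. (norm (indicator (?A m) x *\<^sub>R D x))\<^sup>2) \<longlonglongrightarrow> 0" by (rule tendsto_eventually)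
    qed
  qed (auto simp: indicator_def)
  then have "(\<lambda>m. (L2n vol (\<lambda>x. indicator (?A m) x *\<^sub>R D x))\<^sup>2) \<longlonglongrightarrow> 0"
    unfolding L2n_sq by (simp only: Bochner_Integration.integral_zero)
  then show ?thesis by (simp only: tendsto_sq_iff)
qed

text \<open>A smooth approximation of D is multiplied by a cutoff that vanishes near the sphere. The
  gradient of the cutoff costs 1/d, but by \<open>shell_bound\<close> the approximation is
  controlled in the shell by its boundary values plus d times its jet there. So d is chosen first,
  to make the part of D in the shell small, and then the approximation, with boundary values small
  compared with d.\<close>

lemma wtrace_zero_H10:
  fixes D :: "'n::finite jet"
  assumes D: "wtrace D (\<lambda>x. 0)"
  shows "H10 D"
proof (rule H10I)
  show sD: "square_integrable vol D" by (rule wtrace_square_integrable[OF D])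
  fix e :: real assume e: "0 < e"
  obtain f where *: "\<forall>k. smooth (f k)" "(\<lambda>k. L2n vol (\<lambda>x. sjet (f k) x - D x)) \<longlonglongrightarrow> 0"
    "(\<lambda>k. L2n surf (\<lambda>x. f k x - 0)) \<longlonglongrightarrow> 0"
    by (rule wtraceE[OF D])
  note f = *(1)[rule_format] *(2) *(3)[unfolded diff_zero]
  obtain h where hh: "deriv_seq h \<and> (\<forall>t\<le>1/2. h 0 t = 0) \<and> (\<forall>t\<ge>1. h 0 t = 1) \<and> (\<forall>t. 0 \<le> h 0 t \<and> h 0 t \<le> 1)
    \<and> (\<exists>B. \<forall>t. \<bar>h 1 t\<bar> \<le> B)" by (rule exE[OF exists_step])
  then obtain B where "\<forall>t. \<bar>h 1 t\<bar> \<le> B" by (elim conjE exE)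
  then have B: "\<And>t. \<bar>h 1 t\<bar> \<le> B" by blast
  from hh have h: "deriv_seq h" "\<And>t. t \<le> 1/2 \<Longrightarrow> h 0 t = 0" "\<And>t. t \<ge> 1 \<Longrightarrow> h 0 t = 1" "\<And>t. 0 \<le> h 0 t" "\<And>t. h 0 t \<le> 1"
    by blast+
  have B0: "0 \<le> B" using B[of 0] by simp
  \<comment> \<open>The final error is 2 (1 + 6B) e' + e' + e' = (4 + 12B) e'.\<close>
  define e' where "e' = e / (4 + 12 * B)"
  have e': "0 < e'" using e B0 by (simp add: e'_def)
  have "\<forall>\<^sub>F m in sequentially. L2n vol (\<lambda>x. indicator {x. 1 - 1 / real (Suc m) < norm x \<and> norm x < 1} x *\<^sub>R D x) < e'"
    by (rule order_tendstoD(2)[OF L2n_shell_tendsto_0[OF sD] e'])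
  from eventually_happens'[OF sequentially_bot eventually_conj[OF eventually_ge_at_top[of 1] this]]
  obtain m where m: "1 \<le> m" "L2n vol (\<lambda>x. indicator {x. 1 - 1 / real (Suc m) < norm x \<and> norm x < 1} x *\<^sub>R D x) < e'"
    by (elim exE conjE)
  define d where "d = 1 / real (Suc m)"
  have d: "0 < d" "d \<le> 1/2" using m(1) by (auto simp: d_def field_simps)
  define A where "A = {x :: real^'n. 1 - d < norm x \<and> norm x < 1}"
  have A: "A \<in> sets borel" unfolding A_def by measurable
  have AO: "A \<subseteq> Omega" by (auto simp: A_def)
  have mA: "L2n vol (\<lambda>x. indicator A x *\<^sub>R D x) < e'" using m(2) by (simp add: A_def d_def)
  \<comment> \<open>Makes (4B/d) e2 <= e'; the summand d in the denominator covers B = 0.\<close>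
  define e2 where "e2 = e' * d / (4 * B + d)"
  have e2: "0 < e2" using e' d B0 by (auto simp: e2_def intro!: divide_pos_pos mult_pos_pos add_nonneg_pos)
  have "\<forall>\<^sub>F k in sequentially. L2n vol (\<lambda>x. sjet (f k) x - D x) < e' \<and> L2n surf (f k) < e2"
    using eventually_conj[OF order_tendstoD(2)[OF f(2) e'] order_tendstoD(2)[OF f(3) e2]] .
  from eventually_happens'[OF sequentially_bot this]
  obtain k where k: "L2n vol (\<lambda>x. sjet (f k) x - D x) < e'" "L2n surf (f k) < e2"
    by (elim exE conjE)
  define c where "c x = complex_of_real (h 0 ((1 - (norm x)\<^sup>2) / d))" for x :: "real^'n"
  have t: "test_function (\<lambda>x. f k x * c x)"
    unfolding c_def by (rule smooth_mult_test[OF f(1) cutoff_test_function[OF h(1,2) d(1)]])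
  define P where "P = L2n vol (\<lambda>x. indicator A x *\<^sub>R sjet (f k) x)"
  have sf: "square_integrable vol (sjet (f k))" by (rule sjet_square_integrable[OF f(1)])
  have P: "P \<le> 2 * e'"
  proof -
    have "P \<le> L2n vol (\<lambda>x. indicator A x *\<^sub>R sjet (f k) x - indicator A x *\<^sub>R D x) + L2n vol (\<lambda>x. indicator A x *\<^sub>R D x)"
      unfolding P_def by (intro L2n_triangle2 nn_integral_indicator_L2n(1)[OF _ A AO] sf sD)
    also have "L2n vol (\<lambda>x. indicator A x *\<^sub>R sjet (f k) x - indicator A x *\<^sub>R D x) \<le> 1 * L2n vol (\<lambda>x. sjet (f k) x - D x)"
    proof (rule L2n_bound)
      show "(\<lambda>x. indicator A x *\<^sub>R sjet (f k) x - indicator A x *\<^sub>R D x) \<in> borel_measurable vol"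
        by (intro square_integrable_meas square_integrable_diff nn_integral_indicator_L2n(1)[OF _ A AO] sf sD)
    qed (use sf sD in \<open>auto simp: square_integrable_diff scaleR_diff_right[symmetric] indicator_def\<close>)
    finally show ?thesis using k(1) mA by simp
  qed
  have "L2n vol (\<lambda>x. sjet (\<lambda>x. f k x * c x) x - sjet (f k) x) \<le> P + (2 * B / d) * L2n vol (\<lambda>x. indicator A x *\<^sub>R f k x)"
    using cutoff_jet_bound[OF h B f(1) d] unfolding P_def c_def A_def .
  also have "\<dots> \<le> P + (2 * B / d) * (2 * e2 + 3 * d * P)"
    using shell_bound[OF f(1) d, of k] k(2) B0 d unfolding A_def[symmetric] P_def[symmetric]
    by (intro add_left_mono mult_left_mono) auto
  also have "\<dots> = (1 + 6 * B) * P + (4 * B / d) * e2" using d by (simp add: field_simps)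
  also have "\<dots> \<le> (1 + 6 * B) * (2 * e') + e'"
  proof (intro add_mono mult_left_mono P)
    have "(4 * B / d) * e2 = e' * (4 * B / (4 * B + d))" using d B0 by (simp add: e2_def)
    also have "\<dots> \<le> e' * 1" using d B0 e' by (intro mult_left_mono) (auto simp: divide_le_eq)
    finally show "(4 * B / d) * e2 \<le> e'" by simp
  qed (use B0 in simp)
  finally have 1: "L2n vol (\<lambda>x. sjet (\<lambda>x. f k x * c x) x - sjet (f k) x) \<le> (1 + 6 * B) * (2 * e') + e'" .
  have "L2n vol (\<lambda>x. sjet (\<lambda>x. f k x * c x) x - D x) \<le>
      L2n vol (\<lambda>x. sjet (\<lambda>x. f k x * c x) x - sjet (f k) x) + L2n vol (\<lambda>x. sjet (f k) x - D x)"
    by (rule L2n_triangle_diff[OF test_sjet[OF t] sf sD])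
  also have "\<dots> \<le> (4 + 12 * B) * e'" using 1 k(1) by (simp add: algebra_simps)
  also have "\<dots> = e" using B0 by (simp add: e'_def)
  finally show "\<exists>\<phi>. test_function \<phi> \<and> L2n vol (\<lambda>x. sjet \<phi> x - D x) \<le> e" using t by blast
qed

section \<open>The Dirichlet-to-Neumann pairing\<close>

definition wsol :: "(real^'n \<Rightarrow> real) \<Rightarrow> 'n::finite jet \<Rightarrow> bool"
  where "wsol q U \<longleftrightarrow> wjet U \<and> (\<forall>\<psi>. test_function \<psi> \<longrightarrow> en q U (sjet \<psi>) = 0)"

lemma weak_solution_iff:
  assumes "pot q" shows "weak_solution q u \<longleftrightarrow> u \<in> H1 \<and> wsol q (jet u)"
proof -
  have "energy_form q u \<phi> = en q (jet u) (sjet \<phi>)" if "u \<in> H1" "test_function \<phi>" for \<phi>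
    unfolding energy_form_eq
    by (intro en_cong_AE assms H1_square_integrable smooth_H1 test_function_smooth test_sjet that AE_I2 refl)
  then show ?thesis by (auto simp: weak_solution_def wsol_def H1_wjet)
qed

lemma wsol_cong_AE:
  assumes "pot q" "wsol q U" "wjet V" "AE x in vol. U x = V x" shows "wsol q V"
proof -
  have "en q V (sjet \<psi>) = en q U (sjet \<psi>)" if "test_function \<psi>" for \<psi>
    by (rule en_cong_AE) (use assms that in \<open>auto simp: wsol_def wjet_square_integrable test_sjet\<close>)
  then show ?thesis using assms by (simp add: wsol_def)
qed

lemma wsol_H10_orth: "pot q \<Longrightarrow> wsol q U \<Longrightarrow> H10 Z \<Longrightarrow> en q U Z = 0"
  by (rule en_H10_eq_0) (auto simp: wsol_def wjet_square_integrable)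

text \<open>The description in \<open>DN_map\<close> determines a value. Two solutions with the same
  trace differ by an element of H^1_0 that is orthogonal to itself in the energy form, hence null by
  coercivity; and changing the extension of f by an element of H^1_0 does not affect its pairing
  with a solution.\<close>

lemma DN_map_eq:
  assumes q: "pot q" and U: "wsol q U" "wtrace U g" and V: "wtrace V f"
  shows "DN_map q g f = en q U V"
  unfolding DN_map_def
proof (rule the_equality)
  have sU: "square_integrable vol U" and sV: "square_integrable vol V"
    using U V by (auto intro: wtrace_square_integrable)
  let ?u = "\<lambda>x. fst (U x)" and ?v = "\<lambda>x. fst (V x)"
  have wU: "wjet U" "wjet V" using U V by (auto intro: wtrace_wjet)
  have J: "square_integrable vol (jet ?u)" "square_integrable vol (jet ?v)"
    by (intro H1_square_integrable wjet_H1 wU)+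
  have "wsol q (jet ?u)"
  proof (rule wsol_cong_AE[OF q U(1) H1_wjet[OF wjet_H1(1)[OF wU(1)]]])
    show "AE x in vol. U x = jet ?u x" using wjet_H1(2)[OF wU(1)] by eventually_elim simp
  qed
  then have "weak_solution q ?u" using wjet_H1(1)[OF wU(1)] by (simp add: weak_solution_iff[OF q])
  moreover have "energy_form q ?u ?v = en q U V"
    unfolding energy_form_eq by (rule en_cong_AE[OF q J sU sV wjet_H1(2)[OF wU(1)] wjet_H1(2)[OF wU(2)]])
  ultimately show "\<exists>u v. weak_solution q u \<and> has_trace u g \<and> has_trace v f \<and> en q U V = energy_form q u v"
    using wtrace_has_trace[OF U(2)] wtrace_has_trace[OF V] by metis
  fix z assume "\<exists>u v. weak_solution q u \<and> has_trace u g \<and> has_trace v f \<and> z = energy_form q u v"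
  then obtain u v where u: "weak_solution q u" "has_trace u g" and v: "has_trace v f" and z: "z = energy_form q u v"
    by blast
  have tu: "wtrace (jet u) g" and tv: "wtrace (jet v) f" using u v has_trace_wtrace by auto
  have su: "square_integrable vol (jet u)" "square_integrable vol (jet v)"
    using tu tv by (auto intro: wtrace_square_integrable)
  have wu: "wsol q (jet u)" using u(1) by (simp add: weak_solution_iff[OF q])
  have D: "H10 (\<lambda>x. jet u x - U x)" by (rule wtrace_zero_H10[OF wtrace_diff[OF tu U(2)]])
  have sD: "square_integrable vol (\<lambda>x. jet u x - U x)" by (rule H10_square_integrable[OF D])
  have "en q (\<lambda>x. jet u x - U x) (\<lambda>x. jet u x - U x) = 0"
    using en_diff_left[OF q su(1) sU sD] wsol_H10_orth[OF q wu D] wsol_H10_orth[OF q U(1) D] by simp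
  then have "L2n vol (\<lambda>x. jet u x - U x) = 0" using L2n_sq_le_en[OF q sD] by simp
  then have "norm (en q (\<lambda>x. jet u x - U x) V) \<le> 0" using norm_en_le[OF q sD sV] by simp
  then have "en q (jet u) V = en q U V" using en_diff_left[OF q su(1) sU sV] by simp
  moreover have "en q (jet u) (jet v) = en q (jet u) V"
    using en_diff_right[OF q su(1) su(2) sV] wsol_H10_orth[OF q wu wtrace_zero_H10[OF wtrace_diff[OF tv V]]] by simp
  ultimately show "z = en q U V" by (simp add: z energy_form_eq)
qed

section \<open>Interior estimates for \<open>\<Delta>v = v\<close>\<close>

text \<open>Otherwise the first derivative, which is 0 at the maximum, would be positive just to the
  right of it.\<close>

lemma second_derivative_local_max:
  fixes f f' :: "real \<Rightarrow> real"
  assumes e: "0 < e" and d1: "\<And>t. \<bar>t\<bar> < e \<Longrightarrow> (f has_real_derivative f' t) (at t)"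
    and d2: "(f' has_real_derivative m) (at 0)" and max: "\<And>t. \<bar>t\<bar> < e \<Longrightarrow> f t \<le> f 0"
  shows "m \<le> 0"
proof (rule ccontr)
  assume "\<not> m \<le> 0"
  then have m: "0 < m" by simp
  have f0: "f' 0 = 0"
    by (rule DERIV_local_max[OF d1[of 0], of e]) (use e max in \<open>auto simp: abs_minus_commute\<close>)
  obtain c where c: "0 < c" "\<And>h. 0 < h \<Longrightarrow> h < c \<Longrightarrow> f' 0 < f' (0 + h)"
    using DERIV_pos_inc_right[OF d2 m] by blast
  define t where "t = min e c / 2"
  have t: "0 < t" "t < e" "t < c" using e c by (auto simp: t_def)
  have "\<exists>z>0. z < t \<and> f t - f 0 = (t - 0) * f' z"
    by (rule MVT2) (use t d1 in auto)
  then obtain z where z: "0 < z" "z < t" "f t - f 0 = t * f' z" by auto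
  then have "0 < f' z" using c(2)[of z] t f0 by simp
  then have "f 0 < f t" using z t by (metis diff_gt_0_iff_gt mult_pos_pos)
  then show False using max[of t] t by simp
qed

lemma sum_axis_shift: "(y + t *\<^sub>R axis j 1) $ k = y $ k + (if k = j then t else (0::real))"
  by (simp add: axis_def)

text \<open>Comparison of the odd part of \<open>w\<close> in the direction \<open>i\<close> with the harmonic barrier
  \<open>M/d\<^sup>2 (\<Sum>j\<noteq>i y\<^sub>j\<^sup>2 + n d y\<^sub>i - (n-1) y\<^sub>i\<^sup>2)\<close> on a half cube.\<close>

lemma directional_derivative_upper_bound:
  fixes w :: "real^'n \<Rightarrow> real" and c :: "real^'n"
  assumes d: "0 < d"
    and cont: "continuous_on {y. \<forall>j. \<bar>y $ j - c $ j\<bar> \<le> d} w"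
    and d1: "\<And>y j. (\<And>k. \<bar>y $ k - c $ k\<bar> < d) \<Longrightarrow> ((\<lambda>t. w (y + t *\<^sub>R axis j 1)) has_real_derivative w1 j y) (at 0)"
    and d2: "\<And>y j. (\<And>k. \<bar>y $ k - c $ k\<bar> < d) \<Longrightarrow> ((\<lambda>t. w1 j (y + t *\<^sub>R axis j 1)) has_real_derivative w2 j y) (at 0)"
    and pde: "\<And>y. (\<And>k. \<bar>y $ k - c $ k\<bar> < d) \<Longrightarrow> (\<Sum>j\<in>UNIV. w2 j y) = w y"
    and bd: "\<And>y. (\<And>k. \<bar>y $ k - c $ k\<bar> \<le> d) \<Longrightarrow> \<bar>w y\<bar> \<le> M"
  shows "w1 i c \<le> real CARD('n) * M / d"
proof -
  define n where "n = real CARD('n)"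
  have n1: "1 \<le> n" unfolding n_def by (simp add: Suc_leI)
  have M0: "0 \<le> M" using bd[of c] d by force
  define R where "R y = (\<chi> j. if j = i then - (y $ i) else y $ j)" for y :: "real^'n"
  have Rc: "\<bar>(c + R y) $ k - c $ k\<bar> = \<bar>y $ k\<bar>" for y k by (simp add: R_def)
  have Rs: "R (y + t *\<^sub>R axis j 1) = R y + (if j = i then - t else t) *\<^sub>R axis j 1" for y t j
    by (auto simp: R_def vec_eq_iff axis_def)
  \<comment> \<open>The odd part of w in the i-th coordinate: it vanishes on y_i = 0, and its i-th
    derivative at the centre is that of w.\<close>
  define \<phi> where "\<phi> y = (w (c + y) - w (c + R y)) / 2" for y
  define \<psi> where "\<psi> y = M / d\<^sup>2 * ((\<Sum>j\<in>UNIV - {i}. (y $ j)\<^sup>2) + n * d * y $ i - (n - 1) * (y $ i)\<^sup>2)" for y :: "real^'n"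
  define K where "K = {y :: real^'n. (\<forall>j. \<bar>y $ j\<bar> \<le> d) \<and> 0 \<le> y $ i}"
  \<comment> \<open>The part of the barrier that depends on y_i is nonnegative for 0 <= y_i <= d; at
    y_i = d it equals d^2.\<close>
  have quad: "0 \<le> n * d * y $ i - (n - 1) * (y $ i)\<^sup>2" if "0 \<le> y $ i" "y $ i \<le> d" for y :: "real^'n"
  proof -
    have "(n - 1) * (y $ i)\<^sup>2 \<le> n * (d * y $ i)"
      unfolding power2_eq_square using that n1 by (intro mult_mono mult_right_mono) auto
    then show ?thesis by (simp add: mult.assoc)
  qed
  have \<psi>0: "0 \<le> \<psi> y" if "y \<in> K" for y
  proof -
    have "0 \<le> (\<Sum>j\<in>UNIV - {i}. (y $ j)\<^sup>2)" by (intro sum_nonneg) simp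
    moreover have "0 \<le> n * d * y $ i - (n - 1) * (y $ i)\<^sup>2"
      using that by (intro quad) (auto simp: K_def abs_le_iff)
    ultimately have "0 \<le> (\<Sum>j\<in>UNIV - {i}. (y $ j)\<^sup>2) + n * d * y $ i - (n - 1) * (y $ i)\<^sup>2" by linarith
    then show ?thesis unfolding \<psi>_def using M0 by (intro mult_nonneg_nonneg) auto
  qed
  have \<phi>M: "\<phi> y \<le> M" if "y \<in> K" for y
  proof -
    have "\<bar>w (c + y)\<bar> \<le> M" "\<bar>w (c + R y)\<bar> \<le> M"
      by (rule bd, use that in \<open>simp add: K_def\<close>) (rule bd, use that in \<open>simp add: Rc K_def del: vector_add_component\<close>)
    then show ?thesis by (simp add: \<phi>_def abs_le_iff)
  qed
  have Kc: "compact K"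
  proof -
    have "K = cbox (\<chi> j. if j = i then 0 else - d) (\<chi> j. d)"
      using d by (auto simp: K_def mem_box_cart abs_le_iff split: if_splits) (metis minus_le_iff order.trans neg_le_0_iff_le less_imp_le)+
    then show ?thesis by simp
  qed
  have cw: "continuous_on K (\<lambda>y. w (c + y))"
    by (rule continuous_on_compose2[OF cont]) (auto simp: K_def intro!: continuous_intros)
  have cR: "continuous_on K (\<lambda>y. w (c + R y))"
  proof (rule continuous_on_compose2[OF cont])
    have "continuous_on K (\<lambda>y. if j = i then - (y $ i) else y $ j)" for j
      by (cases "j = i") (auto intro!: continuous_intros)
    then show "continuous_on K (\<lambda>y. c + R y)" unfolding R_def
      by (intro continuous_on_add continuous_on_const continuous_on_vec_lambda)
    show "(\<lambda>y. c + R y) ` K \<subseteq> {y. \<forall>j. \<bar>y $ j - c $ j\<bar> \<le> d}"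
      using Rc by (auto simp: K_def simp del: vector_add_component)
  qed
  have gc: "continuous_on K (\<lambda>y. \<phi> y - \<psi> y)"
    unfolding \<phi>_def \<psi>_def by (intro continuous_intros cw cR) auto
  \<comment> \<open>Maximum principle. A positive maximum of \<phi> - \<psi> over the half cube
    would be attained in the interior: on y_i = 0 one has \<phi> = 0 <= \<psi>, and on the other
    faces \<psi> >= M >= \<phi>.\<close>
  have le: "\<phi> y \<le> \<psi> y" if y: "y \<in> K" for y
  proof (rule ccontr)
    assume "\<not> \<phi> y \<le> \<psi> y"
    then have pos: "0 < \<phi> y - \<psi> y" by simp
    obtain z where z: "z \<in> K" "\<And>y. y \<in> K \<Longrightarrow> \<phi> y - \<psi> y \<le> \<phi> z - \<psi> z"
      using continuous_attains_sup[OF Kc _ gc] y by blast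
    have zpos: "0 < \<phi> z - \<psi> z" using z(2)[OF y] pos by linarith
    have zi0: "z $ i \<noteq> 0"
    proof
      assume "z $ i = 0"
      then have "R z = z" by (simp add: R_def vec_eq_iff)
      then have "\<phi> z = 0" by (simp add: \<phi>_def)
      then show False using zpos \<psi>0[OF z(1)] by simp
    qed
    have zK: "\<bar>z $ j\<bar> \<le> d" "0 \<le> z $ i" for j using z(1) by (auto simp: K_def)
    have zj: "\<bar>z $ j\<bar> < d" for j
    proof (rule ccontr)
      assume "\<not> \<bar>z $ j\<bar> < d"
      then have j: "\<bar>z $ j\<bar> = d" using zK(1)[of j] by simp
      have "d\<^sup>2 \<le> (\<Sum>j\<in>UNIV - {i}. (z $ j)\<^sup>2) + n * d * z $ i - (n - 1) * (z $ i)\<^sup>2"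
      proof (cases "j = i")
        case True
        then have "z $ i = d" using j zK by simp
        then have "n * d * z $ i - (n - 1) * (z $ i)\<^sup>2 = d\<^sup>2" by (simp add: power2_eq_square algebra_simps)
        moreover have "0 \<le> (\<Sum>j\<in>UNIV - {i}. (z $ j)\<^sup>2)" by (intro sum_nonneg) simp
        ultimately show ?thesis by linarith
      next
        case False
        have "(z $ j)\<^sup>2 \<le> (\<Sum>j\<in>UNIV - {i}. (z $ j)\<^sup>2)"
          by (rule member_le_sum) (use False in auto)
        moreover have "(z $ j)\<^sup>2 = d\<^sup>2" using j by (metis power2_abs)
        ultimately show ?thesis using quad[of z] zK(2) zK(1)[of i] by linarith
      qed
      then have "M / d\<^sup>2 * d\<^sup>2 \<le> \<psi> z" unfolding \<psi>_def using M0 by (intro mult_left_mono) auto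
      then show False using zpos \<phi>M[OF z(1)] d by simp
    qed
    have zin: "0 < z $ i" using zi0 zK by (simp add: order.order_iff_strict)
    have "\<exists>e>0. \<forall>j t. \<bar>t\<bar> < e \<longrightarrow> z + t *\<^sub>R axis j 1 \<in> K \<and> (\<forall>k. \<bar>(z + t *\<^sub>R axis j 1) $ k\<bar> < d)"
    proof -
      define e where "e = min (z $ i) (Min (range (\<lambda>j. d - \<bar>z $ j\<bar>)))"
      have e0: "0 < e" unfolding e_def using zin zj by (auto simp: Min_gr_iff)
      have ej: "e \<le> d - \<bar>z $ j\<bar>" for j unfolding e_def by (rule min.coboundedI2) simp
      have ei: "e \<le> z $ i" by (simp add: e_def)
      have "z + t *\<^sub>R axis j 1 \<in> K \<and> (\<forall>k. \<bar>(z + t *\<^sub>R axis j 1) $ k\<bar> < d)" if t: "\<bar>t\<bar> < e" for j t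
      proof -
        have 1: "\<bar>(z + t *\<^sub>R axis j 1) $ k\<bar> < d" for k
          using ej[of k] t zj[of k] unfolding sum_axis_shift by (auto simp: abs_less_iff)
        moreover have "0 \<le> (z + t *\<^sub>R axis j 1) $ i" using ei t zK(2) unfolding sum_axis_shift by auto
        ultimately show ?thesis unfolding K_def by (auto intro: less_imp_le)
      qed
      then show ?thesis using e0 by blast
    qed
    then obtain e where e: "0 < e" "\<And>j t. \<bar>t\<bar> < e \<Longrightarrow> z + t *\<^sub>R axis j 1 \<in> K"
      "\<And>j t k. \<bar>t\<bar> < e \<Longrightarrow> \<bar>(z + t *\<^sub>R axis j 1) $ k\<bar> < d" by metis
    \<comment> \<open>The second derivatives of the barrier. Up to the factor M/d^2 they are 2 in
      the n - 1 other directions and -2(n-1) in direction i, so they add up to 0.\<close>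
    define b where "b j = M / d\<^sup>2 * (if j = i then - (2 * (n - 1)) else 2)" for j
    have second: "(w2 j (c + z) - w2 j (c + R z)) / 2 - b j \<le> 0" for j
    proof -
      define sg where "sg = (if j = i then -1 else (1::real))"
      have sg: "sg * sg = 1" by (simp add: sg_def)
      \<comment> \<open>The hypotheses give derivatives along a line at parameter 0 only. This moves
        them to any t0 and records the sign that the reflection gives to direction i.\<close>
      have shw: "((\<lambda>t. F (u + (sgn * t) *\<^sub>R axis j 1)) has_real_derivative sgn * D) (at t0)"
        if "((\<lambda>t. F ((u + (sgn * t0) *\<^sub>R axis j 1) + t *\<^sub>R axis j 1)) has_real_derivative D) (at 0)" for F :: "real^'n \<Rightarrow> real" and D u t0 sgn
      proof -
        have "((\<lambda>t. sgn * (t - t0)) has_real_derivative sgn) (at t0)" by (auto intro!: derivative_eq_intros)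
        from DERIV_chain'[OF this, of "\<lambda>t. F ((u + (sgn * t0) *\<^sub>R axis j 1) + t *\<^sub>R axis j 1)" D] that
        show ?thesis by (simp add: algebra_simps)
      qed
      define q where "q t = c + z + (1 * t) *\<^sub>R axis j 1" for t :: real
      define q' where "q' t = c + R z + (sg * t) *\<^sub>R axis j 1" for t :: real
      have qR: "q' t = c + R (z + t *\<^sub>R axis j 1)" for t by (simp add: q'_def Rs sg_def)
      have q: "\<bar>q t $ k - c $ k\<bar> < d" if "\<bar>t\<bar> < e" for t k
        using e(3)[OF that, of j k] by (simp add: q_def add.commute add.left_commute)
      have q': "\<bar>q' t $ k - c $ k\<bar> < d" if "\<bar>t\<bar> < e" for t k
        unfolding qR Rc using e(3)[OF that, of j k] .
      define P where "P t = M / d\<^sup>2 * ((\<Sum>l\<in>UNIV - {i}. ((z + t *\<^sub>R axis j 1) $ l)\<^sup>2) + n * d * (z + t *\<^sub>R axis j 1) $ i - (n - 1) * ((z + t *\<^sub>R axis j 1) $ i)\<^sup>2)" for t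
      define P1 where "P1 t = M / d\<^sup>2 * (if j = i then n * d - 2 * (n - 1) * (z $ i + t) else 2 * (z $ j + t))" for t
      have Pd: "(P has_real_derivative P1 t) (at t)" for t
      proof (cases "j = i")
        case True
        have "P = (\<lambda>t. M / d\<^sup>2 * ((\<Sum>l\<in>UNIV - {i}. (z $ l)\<^sup>2) + n * d * (z $ i + t) - (n - 1) * (z $ i + t)\<^sup>2))"
        proof
          fix t
          have "(\<Sum>l\<in>UNIV - {i}. ((z + t *\<^sub>R axis j 1) $ l)\<^sup>2) = (\<Sum>l\<in>UNIV - {i}. (z $ l)\<^sup>2)"
            by (rule sum.cong) (use True in \<open>auto simp: sum_axis_shift simp del: vector_add_component\<close>)
          then show "P t = M / d\<^sup>2 * ((\<Sum>l\<in>UNIV - {i}. (z $ l)\<^sup>2) + n * d * (z $ i + t) - (n - 1) * (z $ i + t)\<^sup>2)"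
            using True unfolding P_def sum_axis_shift[of z t j i] by simp
        qed
        moreover have "((\<lambda>t. C * (S + n * d * (z $ i + t) - (n - 1) * (z $ i + t)\<^sup>2)) has_real_derivative
            C * (n * d - 2 * (n - 1) * (z $ i + t))) (at t)" for C S
          by (auto intro!: derivative_eq_intros simp: algebra_simps)
        ultimately show ?thesis unfolding P1_def using True by (simp only: if_True refl)
      next
        case False
        have "(\<Sum>l\<in>UNIV - {i}. ((z + t *\<^sub>R axis j 1) $ l)\<^sup>2) = (\<Sum>l\<in>UNIV - {i} - {j}. (z $ l)\<^sup>2) + (z $ j + t)\<^sup>2" for t
          using False by (subst sum.remove[of _ j]) (auto simp: sum_axis_shift simp del: vector_add_component intro!: sum.cong)
        then have "P = (\<lambda>t. M / d\<^sup>2 * ((\<Sum>l\<in>UNIV - {i} - {j}. (z $ l)\<^sup>2) + (z $ j + t)\<^sup>2 + n * d * (z $ i) - (n - 1) * (z $ i)\<^sup>2))"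
          using False False[symmetric] by (intro ext) (simp only: P_def sum_axis_shift[of z _ j i] if_False add_0_right)
        moreover have "((\<lambda>t. C * (S + (z $ j + t)\<^sup>2 + n * d * (z $ i) - (n - 1) * (z $ i)\<^sup>2)) has_real_derivative
            C * (2 * (z $ j + t))) (at t)" for C S
          by (auto intro!: derivative_eq_intros simp: algebra_simps)
        ultimately show ?thesis unfolding P1_def using False by (simp only: if_False)
      qed
      have P1d: "(P1 has_real_derivative b j) (at t)" for t
      proof (cases "j = i")
        case True
        have "((\<lambda>t. C * (n * d - 2 * (n - 1) * (z $ i + t))) has_real_derivative C * (- (2 * (n - 1)))) (at t)" for C
          by (auto intro!: derivative_eq_intros simp: algebra_simps)
        then show ?thesis unfolding P1_def b_def using True by (simp only: if_True refl)
      next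
        case False
        have "((\<lambda>t. C * (2 * (z $ j + t))) has_real_derivative C * 2) (at t)" for C
          by (auto intro!: derivative_eq_intros simp: algebra_simps)
        then show ?thesis unfolding P1_def b_def using False by (simp only: if_False)
      qed
      have "(w2 j (q 0) - w2 j (q' 0)) / 2 - b j \<le> 0"
      proof (rule second_derivative_local_max[OF e(1)])
        show "((\<lambda>t. (w (q t) - w (q' t)) / 2 - P t) has_real_derivative ((1 * w1 j (q t) - sg * w1 j (q' t)) / 2 - P1 t)) (at t)"
          if t: "\<bar>t\<bar> < e" for t
          unfolding q_def q'_def
          by (intro DERIV_diff DERIV_cdivide shw Pd d1 q[OF t, unfolded q_def] q'[OF t, unfolded q'_def])
        have "((\<lambda>t. (1 * w1 j (q t) - sg * w1 j (q' t)) / 2 - P1 t) has_real_derivative ((1 * (1 * w2 j (q 0)) - sg * (sg * w2 j (q' 0))) / 2 - b j)) (at 0)"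
          unfolding q_def q'_def
          by (intro DERIV_diff DERIV_cdivide DERIV_cmult shw P1d d2 q[of 0, unfolded q_def] q'[of 0, unfolded q'_def]) (use e in auto)
        then show "((\<lambda>t. (1 * w1 j (q t) - sg * w1 j (q' t)) / 2 - P1 t) has_real_derivative ((w2 j (q 0) - w2 j (q' 0)) / 2 - b j)) (at 0)"
          using sg by (simp add: mult.assoc[symmetric])
        show "(w (q t) - w (q' t)) / 2 - P t \<le> (w (q 0) - w (q' 0)) / 2 - P 0" if t: "\<bar>t\<bar> < e" for t
          using z(2)[OF e(2)[OF t, of j]] unfolding qR \<phi>_def \<psi>_def P_def q_def by (simp add: add.assoc)
      qed
      then show ?thesis by (simp add: q_def q'_def)
    qed
    have "(\<Sum>j\<in>UNIV. (w2 j (c + z) - w2 j (c + R z)) / 2 - b j) \<le> 0"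
      by (rule sum_nonpos) (rule second)
    moreover have "(\<Sum>j\<in>UNIV. b j) = 0"
    proof -
      have "(\<Sum>j\<in>UNIV. b j) = M / d\<^sup>2 * (- (2 * (n - 1)) + (\<Sum>j\<in>UNIV - {i}. 2))"
        unfolding b_def sum_distrib_left[symmetric] by (subst sum.remove[of _ i]) auto
      also have "(\<Sum>j\<in>UNIV - {i}. (2::real)) = 2 * (n - 1)"
        by (simp add: n_def card_Diff_singleton of_nat_diff Suc_leI)
      finally show ?thesis by simp
    qed
    moreover have "(\<Sum>j\<in>UNIV. w2 j (c + z)) = w (c + z)"
      by (rule pde) (use zj in simp)
    moreover have "(\<Sum>j\<in>UNIV. w2 j (c + R z)) = w (c + R z)"
      by (rule pde) (use zj in \<open>simp add: Rc del: vector_add_component\<close>)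
    \<comment> \<open>The Laplacian of \<phi> is \<phi> itself and that of \<psi> is 0, so
      nonpositive second derivatives at z give \<phi>(z) <= 0, against \<phi>(z) > \<psi>(z) >=
      0.\<close>
    ultimately have "\<phi> z \<le> 0" by (simp add: \<phi>_def sum_subtractf sum_divide_distrib[symmetric])
    then show False using zpos \<psi>0[OF z(1)] by simp
  qed
  \<comment> \<open>On the i-th axis the barrier is at most (nM/d) t, so this function is
    nonnegative on [0, d] and 0 at t = 0. Its derivative at 0 is therefore not negative.\<close>
  define f where "f t = n * M / d * t - (w (c + (1 * t) *\<^sub>R axis i 1) - w (c + (- 1 * t) *\<^sub>R axis i 1)) / 2" for t
  have fd: "(f has_real_derivative n * M / d * 1 - (w1 i c * 1 - w1 i c * (- 1)) / 2) (at 0)"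
  proof -
    have 1: "((\<lambda>t. w (c + t *\<^sub>R axis i 1)) has_real_derivative w1 i c) (at (s * 0))" for s
      using d1[of c i] d by simp
    have 2: "((\<lambda>t. w (c + (s * t) *\<^sub>R axis i 1)) has_real_derivative w1 i c * s) (at 0)" for s
      by (rule DERIV_chain'[of "\<lambda>t. s * t" s 0 UNIV "\<lambda>t. w (c + t *\<^sub>R axis i 1)" "w1 i c", OF _ 1]) (auto intro!: derivative_eq_intros)
    show ?thesis unfolding f_def
      by (intro DERIV_diff DERIV_cmult DERIV_cdivide 2 DERIV_ident)
  qed
  have f0: "0 \<le> f t" if t: "0 \<le> t" "t \<le> d" for t
  proof -
    define y :: "real^'n" where "y = t *\<^sub>R axis i 1"
    have yi: "y $ j = (if j = i then t else 0)" for j by (simp add: y_def axis_def)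
    have yK: "y \<in> K" using t d by (auto simp: K_def yi)
    have "R y = - y" by (simp add: R_def vec_eq_iff yi)
    then have "\<phi> y = (w (c + (1 * t) *\<^sub>R axis i 1) - w (c + (- 1 * t) *\<^sub>R axis i 1)) / 2"
      by (simp add: \<phi>_def y_def)
    moreover have "\<psi> y \<le> n * M / d * t"
    proof -
      have "\<psi> y = M / d\<^sup>2 * (n * d * t - (n - 1) * t\<^sup>2)" by (simp add: \<psi>_def yi)
      also have "\<dots> \<le> M / d\<^sup>2 * (n * d * t)" using M0 n1 by (intro mult_left_mono) auto
      also have "\<dots> = n * M / d * t" using d by (simp add: power2_eq_square)
      finally show ?thesis .
    qed
    ultimately show ?thesis using le[OF yK] unfolding f_def by linarith
  qed
  show ?thesis
  proof (rule ccontr)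
    assume "\<not> ?thesis"
    then have neg: "n * M / d * 1 - (w1 i c * 1 - w1 i c * (- 1)) / 2 < 0" by (simp add: n_def)
    obtain e where e: "0 < e" "\<And>h. 0 < h \<Longrightarrow> h < e \<Longrightarrow> f (0 + h) < f 0"
      using DERIV_neg_dec_right[OF fd neg] by blast
    define h where "h = min e d / 2"
    have "0 < h" "h < e" "h \<le> d" using e d by (auto simp: h_def)
    then have "f h < f 0" "0 \<le> f h" using e(2)[of h] f0[of h] by auto
    then show False by (simp add: f_def)
  qed
qed

section \<open>Multi-indices and derivative estimates for families of solutions\<close>

definition inc :: "('n \<Rightarrow> nat) \<Rightarrow> 'n \<Rightarrow> 'n \<Rightarrow> nat"
  where "inc \<alpha> i = \<alpha>(i := Suc (\<alpha> i))"

definition msize :: "('n::finite \<Rightarrow> nat) \<Rightarrow> nat"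
  where "msize \<alpha> = (\<Sum>i\<in>UNIV. \<alpha> i)"

lemma msize_inc [simp]: "msize (inc \<alpha> i) = Suc (msize \<alpha>)"
  by (simp add: msize_def inc_def sum.remove[of UNIV i])

lemma msize_zero [simp]: "msize (\<lambda>_. 0) = 0" by (simp add: msize_def)

lemma le_msize: "\<alpha> i \<le> msize \<alpha>"
  unfolding msize_def by (rule member_le_sum) auto

text \<open>\<open>v \<alpha>\<close> plays the role of the derivative \<open>\<partial>\<^sup>\<alpha> v\<close> of a solution of \<open>\<Delta>v = v\<close> on an open cube.\<close>

definition solfam :: "real \<Rightarrow> (('n::finite \<Rightarrow> nat) \<Rightarrow> real^'n \<Rightarrow> complex) \<Rightarrow> bool"
  where "solfam s v \<longleftrightarrow> (\<forall>\<alpha> x. (\<forall>j. \<bar>x $ j\<bar> < s) \<longrightarrow>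
    (v \<alpha> has_derivative (\<lambda>h. \<Sum>i\<in>UNIV. (h $ i) *\<^sub>R v (inc \<alpha> i) x)) (at x) \<and>
    (\<Sum>i\<in>UNIV. v (inc (inc \<alpha> i) i) x) = v \<alpha> x)"

lemma solfam_derivative:
  assumes "solfam s v" "\<And>j. \<bar>x $ j\<bar> < s"
  shows "(v \<alpha> has_derivative (\<lambda>h. \<Sum>i\<in>UNIV. (h $ i) *\<^sub>R v (inc \<alpha> i) x)) (at x)"
  using assms by (simp add: solfam_def)

lemma solfam_line:
  assumes "solfam s v" "\<And>k. \<bar>x $ k\<bar> < s"
  shows "((\<lambda>t. v \<alpha> (x + t *\<^sub>R axis j 1)) has_vector_derivative v (inc \<alpha> j) x) (at 0)"
proof -
  have 1: "((\<lambda>t. x + t *\<^sub>R axis j 1) has_derivative (\<lambda>h. h *\<^sub>R axis j 1)) (at 0)"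
    by (auto intro!: derivative_eq_intros)
  have 2: "(v \<alpha> has_derivative (\<lambda>h. \<Sum>i\<in>UNIV. (h $ i) *\<^sub>R v (inc \<alpha> i) x)) (at (x + 0 *\<^sub>R axis j 1))"
    using solfam_derivative[OF assms] by simp
  have "((\<lambda>t. v \<alpha> (x + t *\<^sub>R axis j 1)) has_derivative (\<lambda>h. \<Sum>i\<in>UNIV. ((h *\<^sub>R axis j 1 :: real^'a) $ i) *\<^sub>R v (inc \<alpha> i) x)) (at 0)"
    by (rule has_derivative_compose[OF 1 2])
  then show ?thesis
    by (simp add: has_vector_derivative_def axis_def if_distrib[of "\<lambda>c. c *\<^sub>R _"] if_distrib[of "\<lambda>c. _ * c"] cong: if_cong)
qed

text \<open>The one-sided real bound is applied to the real and the imaginary part and to their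
  negatives. The factor 2 comes from bounding the modulus by the sum of the two parts.\<close>

lemma solfam_gradient_bound:
  fixes v :: "('n::finite \<Rightarrow> nat) \<Rightarrow> real^'n \<Rightarrow> complex"
  assumes v: "solfam s v" and d: "0 < d" and cs: "\<And>k. \<bar>c $ k\<bar> + d < s"
    and bd: "\<And>y. (\<And>k. \<bar>y $ k - c $ k\<bar> \<le> d) \<Longrightarrow> norm (v \<alpha> y) \<le> M"
  shows "norm (v (inc \<alpha> i) c) \<le> 2 * real CARD('n) / d * M"
proof -
  have ins: "\<bar>y $ k\<bar> < s" if "\<And>k. \<bar>y $ k - c $ k\<bar> \<le> d" for y k
    using that[of k] cs[of k] by linarith
  have cont: "continuous_on {y. \<forall>j. \<bar>y $ j - c $ j\<bar> \<le> d} (v \<alpha>)"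
    by (intro continuous_at_imp_continuous_on ballI has_derivative_continuous[OF solfam_derivative[OF v]])
       (use ins in blast)
  have main: "F (v (inc \<alpha> i) c) \<le> real CARD('n) * M / d"
    if F: "bounded_linear F" "\<And>z. \<bar>F z\<bar> \<le> norm z" for F :: "complex \<Rightarrow> real"
  proof (rule directional_derivative_upper_bound[where w="\<lambda>y. F (v \<alpha> y)" and ?w1.0="\<lambda>j y. F (v (inc \<alpha> j) y)" and ?w2.0="\<lambda>j y. F (v (inc (inc \<alpha> j) j) y)", OF d])
    show "continuous_on {y. \<forall>j. \<bar>y $ j - c $ j\<bar> \<le> d} (\<lambda>y. F (v \<alpha> y))"
      by (rule bounded_linear.continuous_on[OF F(1) cont])
    have ld: "((\<lambda>t. F (v \<beta> (y + t *\<^sub>R axis j 1))) has_real_derivative F (v (inc \<beta> j) y)) (at 0)"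
      if "\<And>k. \<bar>y $ k - c $ k\<bar> < d" for y j \<beta>
      unfolding has_real_derivative_iff_has_vector_derivative
      by (rule bounded_linear.has_vector_derivative[OF F(1) solfam_line[OF v]]) (use that ins less_imp_le in blast)
    show "((\<lambda>t. F (v \<alpha> (y + t *\<^sub>R axis j 1))) has_real_derivative F (v (inc \<alpha> j) y)) (at 0)"
      if "\<And>k. \<bar>y $ k - c $ k\<bar> < d" for y j by (rule ld[OF that])
    show "((\<lambda>t. F (v (inc \<alpha> j) (y + t *\<^sub>R axis j 1))) has_real_derivative F (v (inc (inc \<alpha> j) j) y)) (at 0)"
      if "\<And>k. \<bar>y $ k - c $ k\<bar> < d" for y j by (rule ld[OF that])
    show "(\<Sum>j\<in>UNIV. F (v (inc (inc \<alpha> j) j) y)) = F (v \<alpha> y)" if "\<And>k. \<bar>y $ k - c $ k\<bar> < d" for y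
    proof -
      have "\<forall>j. \<bar>y $ j\<bar> < s" using that ins less_imp_le by blast
      then have "(\<Sum>i\<in>UNIV. v (inc (inc \<alpha> i) i) y) = v \<alpha> y" using v by (simp add: solfam_def)
      then show ?thesis using linear_sum[OF bounded_linear.linear[OF F(1)], of "\<lambda>j. v (inc (inc \<alpha> j) j) y" UNIV] by simp
    qed
    show "\<bar>F (v \<alpha> y)\<bar> \<le> M" if "\<And>k. \<bar>y $ k - c $ k\<bar> \<le> d" for y
      using F(2)[of "v \<alpha> y"] bd[OF that] by linarith
  qed
  have "\<bar>Re (v (inc \<alpha> i) c)\<bar> \<le> real CARD('n) * M / d"
    using main[OF bounded_linear_Re] main[OF bounded_linear_minus[OF bounded_linear_Re]] abs_Re_le_cmod by (simp add: abs_le_iff)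
  moreover have "\<bar>Im (v (inc \<alpha> i) c)\<bar> \<le> real CARD('n) * M / d"
    using main[OF bounded_linear_Im] main[OF bounded_linear_minus[OF bounded_linear_Im]] abs_Im_le_cmod by (simp add: abs_le_iff)
  moreover have "2 * real CARD('n) / d * M = real CARD('n) * M / d + real CARD('n) * M / d"
    by (simp add: add_divide_distrib[symmetric])
  ultimately show ?thesis using cmod_le[of "v (inc \<alpha> i) c"] by linarith
qed

lemma msize_SucE:
  assumes "msize \<alpha> = Suc k"
  obtains \<beta> i where "\<alpha> = inc \<beta> i" "msize \<beta> = k"
proof -
  have "\<exists>i. \<alpha> i \<noteq> 0"
  proof (rule ccontr)
    assume "\<nexists>i. \<alpha> i \<noteq> 0"
    then show False using assms by (simp add: msize_def)
  qed
  then obtain i where i: "\<alpha> i \<noteq> 0" by blast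
  define \<beta> where "\<beta> = \<alpha>(i := \<alpha> i - 1)"
  have a: "\<alpha> = inc \<beta> i" using i by (simp add: inc_def \<beta>_def fun_eq_iff)
  then have "msize \<beta> = k" using assms msize_inc[of \<beta> i] by simp
  with a show ?thesis using that by blast
qed

text \<open>Each derivative costs a layer of width d of the cube, so after k of them the cube of
  half-side s - kd is left.\<close>

lemma solfam_derivative_bound_aux:
  fixes v :: "('n::finite \<Rightarrow> nat) \<Rightarrow> real^'n \<Rightarrow> complex"
  assumes v: "solfam s v" and d: "0 < d"
    and bd: "\<And>y. (\<And>k. \<bar>y $ k\<bar> < s) \<Longrightarrow> norm (v (\<lambda>_. 0) y) \<le> M"
  shows "msize \<alpha> = k \<Longrightarrow> (\<And>j. \<bar>x $ j\<bar> < s - real k * d) \<Longrightarrow> norm (v \<alpha> x) \<le> (2 * real CARD('n) / d) ^ k * M"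
proof (induction k arbitrary: \<alpha> x)
  case 0
  then have "\<alpha> = (\<lambda>_. 0)" by (simp add: msize_def fun_eq_iff)
  then show ?case using bd[of x] 0 by simp
next
  case (Suc k)
  obtain \<beta> i where \<beta>: "\<alpha> = inc \<beta> i" "msize \<beta> = k" using msize_SucE[OF Suc.prems(1)] by blast
  have x: "\<bar>x $ j\<bar> + d < s - real k * d" for j using Suc.prems(2)[of j] by (simp add: algebra_simps)
  have "norm (v (inc \<beta> i) x) \<le> 2 * real CARD('n) / d * ((2 * real CARD('n) / d) ^ k * M)"
  proof (rule solfam_gradient_bound[OF v d])
    show "\<bar>x $ j\<bar> + d < s" for j using x[of j] d by (smt (verit) mult_nonneg_nonneg of_nat_0_le_iff)
    show "norm (v \<beta> y) \<le> (2 * real CARD('n) / d) ^ k * M" if "\<And>k. \<bar>y $ k - x $ k\<bar> \<le> d" for y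
    proof (rule Suc.IH[OF \<beta>(2)])
      show "\<bar>y $ j\<bar> < s - real k * d" for j using that[of j] x[of j] by linarith
    qed
  qed
  then show ?case by (simp add: \<beta>(1) mult.assoc)
qed

text \<open>For order k the choice d = s/(2k) lets the k layers use up half of the cube. The
  resulting growth k^k is that of an analytic function.\<close>

lemma solfam_derivative_bound:
  fixes v :: "('n::finite \<Rightarrow> nat) \<Rightarrow> real^'n \<Rightarrow> complex"
  assumes v: "solfam s v" and s: "0 < s"
    and bd: "\<And>y. (\<And>k. \<bar>y $ k\<bar> < s) \<Longrightarrow> norm (v (\<lambda>_. 0) y) \<le> M"
    and x: "\<And>j. \<bar>x $ j\<bar> < s / 2"
  shows "norm (v \<alpha> x) \<le> (4 * real CARD('n) / s * real (msize \<alpha>)) ^ msize \<alpha> * M"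
\<comment> \<open>Order 0 is treated apart because d = s/(2k) has no meaning there.\<close>
proof (cases "msize \<alpha> = 0")
  case True
  then have "\<alpha> = (\<lambda>_. 0)" by (simp add: msize_def fun_eq_iff)
  moreover have "norm (v (\<lambda>_. 0) x) \<le> M"
  proof (rule bd)
    show "\<bar>x $ k\<bar> < s" for k using x[of k] s by linarith
  qed
  ultimately show ?thesis by simp
next
  case False
  define d where "d = s / (2 * real (msize \<alpha>))"
  have d: "0 < d" using s False by (simp add: d_def)
  have "norm (v \<alpha> x) \<le> (2 * real CARD('n) / d) ^ msize \<alpha> * M"
  proof (rule solfam_derivative_bound_aux[OF v d bd refl])
    show "\<bar>x $ j\<bar> < s - real (msize \<alpha>) * d" for j using x[of j] False by (simp add: d_def)
  qed
  also have "2 * real CARD('n) / d = 4 * real CARD('n) / s * real (msize \<alpha>)"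
    using s False by (simp add: d_def)
  finally show ?thesis .
qed

subsection \<open>Taylor expansion along rays\<close>

text \<open>The k-th power of the directional derivative along x, applied to the member \<alpha> of
  the family at the point y. Summing over ordered sequences of directions avoids multinomial
  coefficients.\<close>

fun ray_deriv :: "nat \<Rightarrow> (('n::finite \<Rightarrow> nat) \<Rightarrow> real^'n \<Rightarrow> complex) \<Rightarrow> ('n \<Rightarrow> nat) \<Rightarrow> real^'n \<Rightarrow> real^'n \<Rightarrow> complex" where
  "ray_deriv 0 v \<alpha> x y = v \<alpha> y"
| "ray_deriv (Suc k) v \<alpha> x y = (\<Sum>i\<in>UNIV. (x $ i) *\<^sub>R ray_deriv k v (inc \<alpha> i) x y)"

lemma ray_deriv_has_vector_derivative:
  assumes v: "solfam s v" and t: "\<And>j. \<bar>t * x $ j\<bar> < s"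
  shows "((\<lambda>t. ray_deriv k v \<alpha> x (t *\<^sub>R x)) has_vector_derivative ray_deriv (Suc k) v \<alpha> x (t *\<^sub>R x)) (at t)"
proof (induction k arbitrary: \<alpha>)
  case 0
  have 1: "((\<lambda>t. t *\<^sub>R x) has_derivative (\<lambda>h. h *\<^sub>R x)) (at t)" by (auto intro!: derivative_eq_intros)
  have "((\<lambda>t. v \<alpha> (t *\<^sub>R x)) has_derivative (\<lambda>h. \<Sum>i\<in>UNIV. ((h *\<^sub>R x) $ i) *\<^sub>R v (inc \<alpha> i) (t *\<^sub>R x))) (at t)"
    by (rule has_derivative_compose[OF 1 solfam_derivative[OF v]]) (use t in simp)
  then show ?case by (simp add: has_vector_derivative_def scaleR_sum_right)
next
  case (Suc k)
  show ?case unfolding ray_deriv.simps(2)[of "Suc k"] unfolding ray_deriv.simps(2)[of k]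
    by (rule has_vector_derivative_sum) (rule bounded_linear.has_vector_derivative[OF bounded_linear_scaleR_right], rule Suc[unfolded ray_deriv.simps(2)])
qed

lemma ray_deriv_bound:
  assumes "\<And>\<beta>. msize \<beta> = msize \<alpha> + k \<Longrightarrow> norm (v \<beta> y) \<le> B"
  shows "norm (ray_deriv k v \<alpha> x y) \<le> (\<Sum>i\<in>UNIV. \<bar>x $ i\<bar>) ^ k * B"
  using assms
proof (induction k arbitrary: \<alpha>)
  case (Suc k)
  have "norm (ray_deriv (Suc k) v \<alpha> x y) \<le> (\<Sum>i\<in>UNIV. \<bar>x $ i\<bar> * norm (ray_deriv k v (inc \<alpha> i) x y))"
    by (simp add: order_trans[OF norm_sum])
  also have "\<dots> \<le> (\<Sum>i\<in>UNIV. \<bar>x $ i\<bar> * ((\<Sum>i\<in>UNIV. \<bar>x $ i\<bar>) ^ k * B))"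
    by (intro sum_mono mult_left_mono Suc.IH) (use Suc.prems in auto)
  also have "\<dots> = (\<Sum>i\<in>UNIV. \<bar>x $ i\<bar>) ^ Suc k * B" by (simp add: sum_distrib_right mult.assoc)
  finally show ?case .
qed auto

text \<open>Taylor's formula with Lagrange remainder holds for real functions, so it is used for the
  real and the imaginary part separately; hence the factor 2.\<close>

lemma solfam_taylor:
  fixes v :: "('n::finite \<Rightarrow> nat) \<Rightarrow> real^'n \<Rightarrow> complex"
  assumes v: "solfam s v" and s: "0 < s" and l: "0 < l"
    and bd: "\<And>y. (\<And>k. \<bar>y $ k\<bar> < s) \<Longrightarrow> norm (v (\<lambda>_. 0) y) \<le> M"
    and x: "\<And>j. \<bar>x $ j\<bar> \<le> r" and r: "r < s / 2"
  shows "norm (v (\<lambda>_. 0) x - (\<Sum>k<l. ray_deriv k v (\<lambda>_. 0) x 0 /\<^sub>R fact k))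
    \<le> 2 * ((real CARD('n) * r) ^ l * ((4 * real CARD('n) / s * real l) ^ l * M) / fact l)"
proof -
  define B where "B = (real CARD('n) * r) ^ l * ((4 * real CARD('n) / s * real l) ^ l * M)"
  have M0: "0 \<le> M" using bd[of 0] s by (metis abs_zero norm_ge_zero order_trans zero_index)
  have tx: "\<bar>t * x $ j\<bar> < s / 2" if "0 \<le> t" "t \<le> 1" for t j
  proof -
    have "\<bar>t\<bar> * \<bar>x $ j\<bar> \<le> 1 * r" using that x[of j] by (intro mult_mono) auto
    then show ?thesis using r by (simp add: abs_mult)
  qed
  have RB: "norm (ray_deriv l v (\<lambda>_. 0) x (t *\<^sub>R x)) \<le> B" if t: "0 \<le> t" "t \<le> 1" for t
  proof -
    have "norm (ray_deriv l v (\<lambda>_. 0) x (t *\<^sub>R x)) \<le> (\<Sum>i\<in>UNIV. \<bar>x $ i\<bar>) ^ l * ((4 * real CARD('n) / s * real l) ^ l * M)"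
    proof (rule ray_deriv_bound)
      fix \<beta> :: "'n \<Rightarrow> nat" assume "msize \<beta> = msize (\<lambda>_::'n. 0) + l"
      then show "norm (v \<beta> (t *\<^sub>R x)) \<le> (4 * real CARD('n) / s * real l) ^ l * M"
        using solfam_derivative_bound[OF v s bd, of "t *\<^sub>R x" \<beta>] tx[OF t] by simp
    qed
    also have "\<dots> \<le> B" unfolding B_def
    proof (intro mult_right_mono power_mono)
      show "(\<Sum>i\<in>UNIV. \<bar>x $ i\<bar>) \<le> real CARD('n) * r"
        using sum_bounded_above[of UNIV "\<lambda>i. \<bar>x $ i\<bar>" r] x by simp
    qed (use M0 s in \<open>auto intro!: sum_nonneg mult_nonneg_nonneg\<close>)
    finally show ?thesis .
  qed
  have main: "\<bar>F (v (\<lambda>_. 0) x - (\<Sum>k<l. ray_deriv k v (\<lambda>_. 0) x 0 /\<^sub>R fact k))\<bar> \<le> B / fact l"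
    if F: "bounded_linear F" "\<And>z. \<bar>F z\<bar> \<le> norm z" for F :: "complex \<Rightarrow> real"
  proof -
    have "\<exists>t>0. t < 1 \<and> F (v (\<lambda>_. 0) (1 *\<^sub>R x)) = (\<Sum>m<l. F (ray_deriv m v (\<lambda>_. 0) x (0 *\<^sub>R x)) / fact m * 1 ^ m)
        + F (ray_deriv l v (\<lambda>_. 0) x (t *\<^sub>R x)) / fact l * 1 ^ l"
    proof (rule Maclaurin[where diff="\<lambda>m t. F (ray_deriv m v (\<lambda>_. 0) x (t *\<^sub>R x))"])
      show "\<forall>m t. m < l \<and> 0 \<le> t \<and> t \<le> 1 \<longrightarrow>
        ((\<lambda>t. F (ray_deriv m v (\<lambda>_. 0) x (t *\<^sub>R x))) has_real_derivative F (ray_deriv (Suc m) v (\<lambda>_. 0) x (t *\<^sub>R x))) (at t)"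
      proof (intro allI impI)
        fix m and t :: real assume "m < l \<and> 0 \<le> t \<and> t \<le> 1"
        then have t: "0 \<le> t" "t \<le> 1" by auto
        have "\<bar>t * x $ j\<bar> < s" for j using tx[OF t, of j] s by linarith
        then show "((\<lambda>t. F (ray_deriv m v (\<lambda>_. 0) x (t *\<^sub>R x))) has_real_derivative F (ray_deriv (Suc m) v (\<lambda>_. 0) x (t *\<^sub>R x))) (at t)"
          unfolding has_real_derivative_iff_has_vector_derivative
          by (intro bounded_linear.has_vector_derivative[OF F(1)] ray_deriv_has_vector_derivative[OF v])
      qed
    qed (use l in auto)
    then obtain t where t: "0 < t" "t < 1" "F (v (\<lambda>_. 0) x) = (\<Sum>m<l. F (ray_deriv m v (\<lambda>_. 0) x 0) / fact m)
        + F (ray_deriv l v (\<lambda>_. 0) x (t *\<^sub>R x)) / fact l" by auto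
    have "F (v (\<lambda>_. 0) x - (\<Sum>k<l. ray_deriv k v (\<lambda>_. 0) x 0 /\<^sub>R fact k)) = F (ray_deriv l v (\<lambda>_. 0) x (t *\<^sub>R x)) / fact l"
      using t(3) bounded_linear.linear[OF F(1)]
      by (simp add: linear_diff linear_sum linear_scale divide_inverse mult.commute)
    also have "\<bar>\<dots>\<bar> \<le> B / fact l"
      using order_trans[OF F(2) RB[of t]] t by (simp add: divide_right_mono)
    finally show ?thesis .
  qed
  show ?thesis
    using cmod_le[of "v (\<lambda>_. 0) x - (\<Sum>k<l. ray_deriv k v (\<lambda>_. 0) x 0 /\<^sub>R fact k)"]
      main[OF bounded_linear_Re abs_Re_le_cmod] main[OF bounded_linear_Im abs_Im_le_cmod]
    unfolding B_def by linarith
qed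

subsection \<open>Reduction to Cauchy data on a hyperplane\<close>

text \<open>The equation \<open>\<Delta>v = v\<close> expresses all derivatives of order less than \<open>l\<close> at the origin through
  those of order at most one in a fixed direction; there are only \<open>O(l\<^sup>n\<^sup>-\<^sup>1)\<close> of these.\<close>

definition cauchy_index :: "'n::finite \<Rightarrow> nat \<Rightarrow> ('n \<Rightarrow> nat) set"
  where "cauchy_index p l = {\<beta>. \<beta> p \<le> 1 \<and> msize \<beta> < l}"

lemma finite_cauchy_index: "finite (cauchy_index p l :: ('n::finite \<Rightarrow> nat) set)"
  and card_cauchy_index: "card (cauchy_index p l :: ('n::finite \<Rightarrow> nat) set) \<le> 2 * l ^ (CARD('n) - 1)"
proof -
  define S where "S = PiE (UNIV :: 'n set) (\<lambda>i. if i = p then {..<2} else {..<l})"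
  have sub: "cauchy_index p l \<subseteq> S"
  proof
    fix \<beta> :: "'n \<Rightarrow> nat" assume "\<beta> \<in> cauchy_index p l"
    then have "\<beta> p < 2" "\<beta> i < l" for i using le_msize[of \<beta> i] by (auto simp: cauchy_index_def)
    then show "\<beta> \<in> S" by (auto simp: S_def PiE_def extensional_def)
  qed
  have fS: "finite S" unfolding S_def by (rule finite_PiE) auto
  then show "finite (cauchy_index p l)" using sub finite_subset by blast
  have "card (cauchy_index p l) \<le> card S" by (rule card_mono[OF fS sub])
  also have "card S = (\<Prod>i\<in>UNIV. if i = p then 2 else l)"
    unfolding S_def by (subst card_PiE) (auto intro!: prod.cong)
  also have "\<dots> = 2 * l ^ (CARD('n) - 1)"
    by (subst prod.remove[of _ p]) (auto simp: card_Diff_singleton intro!: prod.cong)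
  finally show "card (cauchy_index p l) \<le> 2 * l ^ (CARD('n) - 1)" .
qed

text \<open>The relations that the equation imposes on the derivatives of a solution at one
  point.\<close>

definition helmholtz :: "(('n::finite \<Rightarrow> nat) \<Rightarrow> complex) \<Rightarrow> bool"
  where "helmholtz c \<longleftrightarrow> (\<forall>\<gamma>. (\<Sum>i\<in>UNIV. c (inc (inc \<gamma> i) i)) = c \<gamma>)"

text \<open>The relation at \<gamma> expresses the index \<gamma> + 2e_p through \<gamma> and the
  indices \<gamma> + 2e_j with j \<noteq> p. These are n indices whose order in p is lower by two,
  whence the bound by a power of n. The total order never increases, and the conditioning estimate
  in \<open>solution_approximation\<close> depends on that.\<close>

lemma reduce_to_cauchy_index:
  fixes p :: "'n::finite"
  shows "msize \<alpha> < l \<Longrightarrow> \<exists>a :: ('n \<Rightarrow> nat) \<Rightarrow> real. (\<forall>\<beta>\<in>cauchy_index p l. a \<beta> \<noteq> 0 \<longrightarrow> msize \<beta> \<le> msize \<alpha>) \<and>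
    (\<Sum>\<beta>\<in>cauchy_index p l. \<bar>a \<beta>\<bar>) \<le> real CARD('n) ^ \<alpha> p \<and>
    (\<forall>c. helmholtz c \<longrightarrow> c \<alpha> = (\<Sum>\<beta>\<in>cauchy_index p l. a \<beta> *\<^sub>R c \<beta>))"
proof (induction "\<alpha> p" arbitrary: \<alpha> rule: less_induct)
  case less
  let ?I = "cauchy_index p l :: ('n \<Rightarrow> nat) set"
  note fin = finite_cauchy_index[of p l]
  show ?case
  proof (cases "\<alpha> p \<le> 1")
    case True
    then have \<alpha>: "\<alpha> \<in> ?I" using less.prems by (simp add: cauchy_index_def)
    have one: "1 \<le> real CARD('n) ^ \<alpha> p" by (intro one_le_power) (simp add: Suc_leI)
    show ?thesis
    proof (intro exI[of _ "\<lambda>\<beta>. if \<beta> = \<alpha> then 1 else 0"] conjI ballI allI impI)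
      show "(\<Sum>\<beta>\<in>?I. \<bar>if \<beta> = \<alpha> then 1 else 0\<bar>) \<le> real CARD('n) ^ \<alpha> p"
        using \<alpha> fin one by (simp add: if_distrib[of abs] cong: if_cong)
      show "c \<alpha> = (\<Sum>\<beta>\<in>?I. (if \<beta> = \<alpha> then 1 else 0) *\<^sub>R c \<beta>)" for c :: "('n \<Rightarrow> nat) \<Rightarrow> complex"
        using \<alpha> fin by (simp add: if_distrib[of "\<lambda>x. x *\<^sub>R _"] cong: if_cong)
    qed (auto split: if_splits)
  next
    case False
    define \<gamma> where "\<gamma> = \<alpha>(p := \<alpha> p - 2)"
    have \<alpha>\<gamma>: "\<alpha> = inc (inc \<gamma> p) p" using False by (auto simp: \<gamma>_def inc_def fun_eq_iff)
    have \<gamma>p: "\<gamma> p = \<alpha> p - 2" by (simp add: \<gamma>_def)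
    have ms: "msize \<alpha> = msize \<gamma> + 2" unfolding \<alpha>\<gamma> by simp
    define N where "N = real CARD('n)"
    have N1: "1 \<le> N" by (simp add: N_def Suc_leI)
    have lt: "\<gamma> p < \<alpha> p" "msize \<gamma> < l" using \<gamma>p False ms less.prems by auto
    obtain a where a': "(\<forall>\<beta>\<in>?I. a \<beta> \<noteq> 0 \<longrightarrow> msize \<beta> \<le> msize \<gamma>) \<and> (\<Sum>\<beta>\<in>?I. \<bar>a \<beta>\<bar>) \<le> real CARD('n) ^ \<gamma> p \<and>
      (\<forall>c. helmholtz c \<longrightarrow> c \<gamma> = (\<Sum>\<beta>\<in>?I. a \<beta> *\<^sub>R c \<beta>))"
      by (rule exE[OF less.hyps[of \<gamma>, OF lt]])
    then have a: "\<forall>\<beta>\<in>?I. a \<beta> \<noteq> 0 \<longrightarrow> msize \<beta> \<le> msize \<gamma>" "(\<Sum>\<beta>\<in>?I. \<bar>a \<beta>\<bar>) \<le> N ^ \<gamma> p"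
      "\<And>c. helmholtz c \<Longrightarrow> c \<gamma> = (\<Sum>\<beta>\<in>?I. a \<beta> *\<^sub>R c \<beta>)"
      unfolding N_def by blast+
    have "\<forall>j. \<exists>b. j \<noteq> p \<longrightarrow> (\<forall>\<beta>\<in>?I. b \<beta> \<noteq> 0 \<longrightarrow> msize \<beta> \<le> msize \<alpha>) \<and> (\<Sum>\<beta>\<in>?I. \<bar>b \<beta>\<bar>) \<le> N ^ \<gamma> p \<and>
      (\<forall>c. helmholtz c \<longrightarrow> c (inc (inc \<gamma> j) j) = (\<Sum>\<beta>\<in>?I. b \<beta> *\<^sub>R c \<beta>))"
    proof
      fix j
      show "\<exists>b. j \<noteq> p \<longrightarrow> (\<forall>\<beta>\<in>?I. b \<beta> \<noteq> 0 \<longrightarrow> msize \<beta> \<le> msize \<alpha>) \<and> (\<Sum>\<beta>\<in>?I. \<bar>b \<beta>\<bar>) \<le> N ^ \<gamma> p \<and>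
        (\<forall>c. helmholtz c \<longrightarrow> c (inc (inc \<gamma> j) j) = (\<Sum>\<beta>\<in>?I. b \<beta> *\<^sub>R c \<beta>))"
      proof (cases "j = p")
        case False
        then have e: "inc (inc \<gamma> j) j p = \<gamma> p" by (simp add: inc_def)
        have lt: "inc (inc \<gamma> j) j p < \<alpha> p" using e \<gamma>p \<open>\<not> \<alpha> p \<le> 1\<close> by simp
        have ms': "msize (inc (inc \<gamma> j) j) = msize \<alpha>" using ms by simp
        show ?thesis using less.hyps[of "inc (inc \<gamma> j) j", OF lt] less.prems unfolding e ms' N_def by blast
      qed simp
    qed
    then obtain b where b': "\<forall>j. j \<noteq> p \<longrightarrow> (\<forall>\<beta>\<in>?I. b j \<beta> \<noteq> 0 \<longrightarrow> msize \<beta> \<le> msize \<alpha>) \<and> (\<Sum>\<beta>\<in>?I. \<bar>b j \<beta>\<bar>) \<le> N ^ \<gamma> p \<and>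
      (\<forall>c. helmholtz c \<longrightarrow> c (inc (inc \<gamma> j) j) = (\<Sum>\<beta>\<in>?I. b j \<beta> *\<^sub>R c \<beta>))"
      by (rule exE[OF choice])
    have b: "\<And>j. j \<noteq> p \<Longrightarrow> \<forall>\<beta>\<in>?I. b j \<beta> \<noteq> 0 \<longrightarrow> msize \<beta> \<le> msize \<alpha>"
      "\<And>j. j \<noteq> p \<Longrightarrow> (\<Sum>\<beta>\<in>?I. \<bar>b j \<beta>\<bar>) \<le> N ^ \<gamma> p"
      "\<And>j c. j \<noteq> p \<Longrightarrow> helmholtz c \<Longrightarrow> c (inc (inc \<gamma> j) j) = (\<Sum>\<beta>\<in>?I. b j \<beta> *\<^sub>R c \<beta>)"
      using b' by blast+
    define f where "f \<beta> = a \<beta> - (\<Sum>j\<in>UNIV - {p}. b j \<beta>)" for \<beta>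
    show ?thesis
    proof (intro exI[of _ f] conjI ballI allI impI)
      fix \<beta> assume \<beta>: "\<beta> \<in> ?I" and f: "f \<beta> \<noteq> 0"
      show "msize \<beta> \<le> msize \<alpha>"
      proof (rule ccontr)
        assume n: "\<not> msize \<beta> \<le> msize \<alpha>"
        then have "a \<beta> = 0" using a(1) \<beta> ms by fastforce
        moreover have "b j \<beta> = 0" if "j \<noteq> p" for j using b(1)[OF that] \<beta> n by blast
        ultimately show False using f by (simp add: f_def)
      qed
    next
      have "(\<Sum>\<beta>\<in>?I. \<bar>f \<beta>\<bar>) \<le> (\<Sum>\<beta>\<in>?I. \<bar>a \<beta>\<bar> + (\<Sum>j\<in>UNIV - {p}. \<bar>b j \<beta>\<bar>))"
        unfolding f_def by (intro sum_mono order_trans[OF abs_triangle_ineq4] add_left_mono sum_abs)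
      also have "\<dots> = (\<Sum>\<beta>\<in>?I. \<bar>a \<beta>\<bar>) + (\<Sum>j\<in>UNIV - {p}. \<Sum>\<beta>\<in>?I. \<bar>b j \<beta>\<bar>)"
        by (simp add: sum.distrib sum.swap[of _ "UNIV - {p}"])
      also have "\<dots> \<le> N ^ \<gamma> p + (\<Sum>j\<in>UNIV - {p}. N ^ \<gamma> p)"
        by (intro add_mono a(2) sum_mono b(2)) auto
      also have "\<dots> = N ^ Suc (\<gamma> p)"
        by (simp add: card_Diff_singleton of_nat_diff Suc_leI N_def algebra_simps)
      also have "\<dots> \<le> N ^ \<alpha> p" by (rule power_increasing) (use False N1 \<gamma>p in auto)
      finally show "(\<Sum>\<beta>\<in>?I. \<bar>f \<beta>\<bar>) \<le> real CARD('n) ^ \<alpha> p" by (simp add: N_def)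
    next
      fix c :: "('n \<Rightarrow> nat) \<Rightarrow> complex" assume c: "helmholtz c"
      have "c \<gamma> = (\<Sum>i\<in>UNIV. c (inc (inc \<gamma> i) i))" using c by (simp add: helmholtz_def)
      also have "\<dots> = c \<alpha> + (\<Sum>j\<in>UNIV - {p}. c (inc (inc \<gamma> j) j))"
        unfolding \<alpha>\<gamma> by (rule sum.remove) auto
      finally have "c \<alpha> = c \<gamma> - (\<Sum>j\<in>UNIV - {p}. c (inc (inc \<gamma> j) j))" by simp
      also have "\<dots> = (\<Sum>\<beta>\<in>?I. a \<beta> *\<^sub>R c \<beta>) - (\<Sum>j\<in>UNIV - {p}. \<Sum>\<beta>\<in>?I. b j \<beta> *\<^sub>R c \<beta>)"
        using a(3)[OF c] b(3)[OF _ c] by simp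
      also have "\<dots> = (\<Sum>\<beta>\<in>?I. f \<beta> *\<^sub>R c \<beta>)"
        by (simp add: f_def scaleR_diff_left scaleR_sum_left sum_subtractf sum.swap[of _ "UNIV - {p}"])
      finally show "c \<alpha> = (\<Sum>\<beta>\<in>?I. f \<beta> *\<^sub>R c \<beta>)" .
    qed
  qed
qed

text \<open>The recursion of \<open>ray_deriv\<close> applied to the reduction coefficients. The
  results are homogeneous polynomials in x of degree k that do not depend on the solution.\<close>

fun ray_coeff :: "(('n::finite \<Rightarrow> nat) \<Rightarrow> ('n \<Rightarrow> nat) \<Rightarrow> real) \<Rightarrow> nat \<Rightarrow> ('n \<Rightarrow> nat) \<Rightarrow> ('n \<Rightarrow> nat) \<Rightarrow> real^'n \<Rightarrow> real" where
  "ray_coeff a 0 \<alpha> \<beta> x = a \<alpha> \<beta>"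
| "ray_coeff a (Suc k) \<alpha> \<beta> x = (\<Sum>i\<in>UNIV. x $ i * ray_coeff a k (inc \<alpha> i) \<beta> x)"

lemma ray_coeff_continuous: "continuous_on UNIV (ray_coeff a k \<alpha> \<beta>)"
proof (induction k arbitrary: \<alpha>)
  case (Suc k)
  have "ray_coeff a (Suc k) \<alpha> \<beta> = (\<lambda>x. \<Sum>i\<in>UNIV. x $ i * ray_coeff a k (inc \<alpha> i) \<beta> x)" by (simp add: fun_eq_iff)
  then show ?case using Suc by (auto intro!: continuous_intros)
qed (simp add: fun_eq_iff[symmetric, of _ "\<lambda>x. a \<alpha> \<beta>"])

lemma ray_coeff_bound:
  assumes "\<And>\<gamma>. msize \<gamma> = msize \<alpha> + k \<Longrightarrow> \<bar>a \<gamma> \<beta>\<bar> \<le> B"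
  shows "\<bar>ray_coeff a k \<alpha> \<beta> x\<bar> \<le> (\<Sum>i\<in>UNIV. \<bar>x $ i\<bar>) ^ k * B"
  using assms
proof (induction k arbitrary: \<alpha>)
  case (Suc k)
  have "\<bar>ray_coeff a (Suc k) \<alpha> \<beta> x\<bar> \<le> (\<Sum>i\<in>UNIV. \<bar>x $ i\<bar> * \<bar>ray_coeff a k (inc \<alpha> i) \<beta> x\<bar>)"
    by (simp add: order_trans[OF sum_abs] abs_mult)
  also have "\<dots> \<le> (\<Sum>i\<in>UNIV. \<bar>x $ i\<bar> * ((\<Sum>i\<in>UNIV. \<bar>x $ i\<bar>) ^ k * B))"
    by (intro sum_mono mult_left_mono Suc.IH) (use Suc.prems in auto)
  also have "\<dots> = (\<Sum>i\<in>UNIV. \<bar>x $ i\<bar>) ^ Suc k * B" by (simp add: sum_distrib_right mult.assoc)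
  finally show ?case .
qed auto

lemma ray_deriv_eq_ray_coeff:
  assumes "\<And>\<gamma>. msize \<gamma> = msize \<alpha> + k \<Longrightarrow> v \<gamma> y = (\<Sum>\<beta>\<in>I. a \<gamma> \<beta> *\<^sub>R v \<beta> y)"
  shows "ray_deriv k v \<alpha> x y = (\<Sum>\<beta>\<in>I. ray_coeff a k \<alpha> \<beta> x *\<^sub>R v \<beta> y)"
  using assms
proof (induction k arbitrary: \<alpha>)
  case (Suc k)
  have "ray_deriv (Suc k) v \<alpha> x y = (\<Sum>i\<in>UNIV. (x $ i) *\<^sub>R (\<Sum>\<beta>\<in>I. ray_coeff a k (inc \<alpha> i) \<beta> x *\<^sub>R v \<beta> y))"
    unfolding ray_deriv.simps by (intro sum.cong refl arg_cong2[where f=scaleR] Suc.IH) (use Suc.prems in auto)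
  also have "\<dots> = (\<Sum>\<beta>\<in>I. ray_coeff a (Suc k) \<alpha> \<beta> x *\<^sub>R v \<beta> y)"
    by (simp add: scaleR_sum_right scaleR_sum_left sum.swap[of _ UNIV I])
  finally show ?case .
qed simp

text \<open>k^k/k! is one term of the series of e^k. This turns the growth k^k of the derivatives,
  divided by k!, into a geometric factor.\<close>

lemma power_self_le_fact_exp: "real k ^ k \<le> fact k * exp (real k)"
proof -
  have "(\<Sum>j\<in>{k}. real k ^ j /\<^sub>R fact j) \<le> exp (real k)"
    unfolding exp_def by (rule sum_le_suminf[OF summable_exp_generic]) auto
  then show ?thesis by (simp add: field_simps)
qed

text \<open>\<open>P \<beta>\<close> is the approximating polynomial attached to the Cauchy datum \<open>\<partial>\<^sup>\<beta>v(0)\<close>; the second bound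
  is the one relevant for its conditioning, the factor being the size of \<open>\<partial>\<^sup>\<beta>v(0)\<close>.\<close>

lemma solution_approximation:
  fixes p :: "'n::finite"
  assumes s: "0 < s" "s \<le> 1" and l: "0 < l" and r: "0 < r" "r < s / 2"
    and small: "4 * real CARD('n) ^ 3 * exp 1 * r / s \<le> 1"
  shows "\<exists>P :: ('n \<Rightarrow> nat) \<Rightarrow> real^'n \<Rightarrow> real. (\<forall>\<beta>. continuous_on UNIV (P \<beta>)) \<and>
    (\<forall>\<beta>\<in>cauchy_index p l. \<forall>x. (\<forall>j. \<bar>x $ j\<bar> \<le> r) \<longrightarrow>
       (4 * real CARD('n) / s * real (msize \<beta>)) ^ msize \<beta> * \<bar>P \<beta> x\<bar> \<le> real l) \<and>
    (\<forall>v M x. solfam s v \<longrightarrow> (\<forall>y. (\<forall>k. \<bar>y $ k\<bar> < s) \<longrightarrow> norm (v (\<lambda>_. 0) y) \<le> M) \<longrightarrow> (\<forall>j. \<bar>x $ j\<bar> \<le> r) \<longrightarrow>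
       norm (v (\<lambda>_. 0) x - (\<Sum>\<beta>\<in>cauchy_index p l. P \<beta> x *\<^sub>R v \<beta> 0)) \<le> 2 * (4 * real CARD('n) ^ 2 * exp 1 * r / s) ^ l * M)"
proof -
  define n where "n = real CARD('n)"
  have n1: "1 \<le> n" by (simp add: n_def Suc_leI)
  let ?I = "cauchy_index p l :: ('n \<Rightarrow> nat) set"
  have "\<forall>\<alpha>. \<exists>a :: ('n \<Rightarrow> nat) \<Rightarrow> real. msize \<alpha> < l \<longrightarrow> (\<forall>\<beta>\<in>?I. a \<beta> \<noteq> 0 \<longrightarrow> msize \<beta> \<le> msize \<alpha>) \<and>
    (\<Sum>\<beta>\<in>?I. \<bar>a \<beta>\<bar>) \<le> real CARD('n) ^ \<alpha> p \<and>
    (\<forall>c. helmholtz c \<longrightarrow> c \<alpha> = (\<Sum>\<beta>\<in>?I. a \<beta> *\<^sub>R c \<beta>))"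
    using reduce_to_cauchy_index[of _ l p] by blast
  then obtain a where a': "\<forall>\<alpha>. msize \<alpha> < l \<longrightarrow> (\<forall>\<beta>\<in>?I. a \<alpha> \<beta> \<noteq> 0 \<longrightarrow> msize \<beta> \<le> msize \<alpha>) \<and>
    (\<Sum>\<beta>\<in>?I. \<bar>a \<alpha> \<beta>\<bar>) \<le> real CARD('n) ^ \<alpha> p \<and>
    (\<forall>c. helmholtz c \<longrightarrow> c \<alpha> = (\<Sum>\<beta>\<in>?I. a \<alpha> \<beta> *\<^sub>R c \<beta>))"
    by (rule exE[OF choice])
  have a0: "a \<alpha> \<beta> = 0" if "msize \<alpha> < l" "\<beta> \<in> ?I" "msize \<alpha> < msize \<beta>" for \<alpha> \<beta>
    using a' that by fastforce
  have aB: "\<bar>a \<alpha> \<beta>\<bar> \<le> n ^ msize \<alpha>" if "msize \<alpha> < l" "\<beta> \<in> ?I" for \<alpha> \<beta>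
  proof -
    have "\<bar>a \<alpha> \<beta>\<bar> \<le> (\<Sum>\<beta>\<in>?I. \<bar>a \<alpha> \<beta>\<bar>)"
      by (rule member_le_sum[OF that(2)]) (use finite_cauchy_index in auto)
    also have "\<dots> \<le> n ^ \<alpha> p" using a' that(1) by (simp add: n_def)
    also have "\<dots> \<le> n ^ msize \<alpha>" by (rule power_increasing[OF le_msize n1])
    finally show ?thesis .
  qed
  have aS: "c \<alpha> = (\<Sum>\<beta>\<in>?I. a \<alpha> \<beta> *\<^sub>R c \<beta>)" if "msize \<alpha> < l" "helmholtz c" for \<alpha> c
    using a' that by blast
  define P where "P \<beta> x = (\<Sum>k<l. ray_coeff a k (\<lambda>_. 0) \<beta> x / fact k)" for \<beta> x
  show ?thesis
  proof (intro exI[of _ P] conjI allI ballI impI)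
    show "continuous_on UNIV (P \<beta>)" for \<beta>
      unfolding P_def by (intro continuous_intros ray_coeff_continuous) auto
  next
    fix \<beta> and x :: "real^'n" assume \<beta>: "\<beta> \<in> ?I" and x: "\<forall>j. \<bar>x $ j\<bar> \<le> r"
    define b where "b = msize \<beta>"
    define A where "A = 4 * n / s"
    have A1: "1 \<le> A" using s n1 by (simp add: A_def field_simps)
    have nr: "(\<Sum>i\<in>UNIV. \<bar>x $ i\<bar>) \<le> n * r"
      using sum_bounded_above[of UNIV "\<lambda>i. \<bar>x $ i\<bar>" r] x by (simp add: n_def)
    have sm: "A * exp 1 * (n * r * n) \<le> 1"
      using small by (simp add: A_def n_def power3_eq_cube mult_ac)
    \<comment> \<open>If k is below the order b of the Cauchy datum, the coefficient is 0, since the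
      reduction does not raise orders. If k >= b, then b^b <= k^k, and the division by k! absorbs
      this up to e^k.\<close>
    have tm: "(A * real b) ^ b * \<bar>ray_coeff a k (\<lambda>_. 0) \<beta> x / fact k\<bar> \<le> 1" if k: "k < l" for k
    proof (cases "b \<le> k")
      case False
      have "\<bar>ray_coeff a k (\<lambda>_. 0) \<beta> x\<bar> \<le> (\<Sum>i\<in>UNIV. \<bar>x $ i\<bar>) ^ k * 0"
        by (rule ray_coeff_bound) (use False k a0 \<beta> in \<open>auto simp: b_def\<close>)
      then show ?thesis by simp
    next
      case True
      have "\<bar>ray_coeff a k (\<lambda>_. 0) \<beta> x\<bar> \<le> (\<Sum>i\<in>UNIV. \<bar>x $ i\<bar>) ^ k * n ^ k"
      proof (rule ray_coeff_bound)
        fix \<gamma> :: "'n \<Rightarrow> nat" assume "msize \<gamma> = msize (\<lambda>_::'n. 0) + k"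
        then show "\<bar>a \<gamma> \<beta>\<bar> \<le> n ^ k" using aB[of \<gamma> \<beta>] k \<beta> by simp
      qed
      also have "\<dots> \<le> (n * r) ^ k * n ^ k"
        using n1 by (intro mult_right_mono power_mono nr sum_nonneg) auto
      finally have rc: "\<bar>ray_coeff a k (\<lambda>_. 0) \<beta> x\<bar> \<le> (n * r * n) ^ k" by (simp add: power_mult_distrib)
      have "(A * real b) ^ b \<le> A ^ k * real k ^ k"
      proof -
        have "real b ^ b \<le> real k ^ k"
        \<comment> \<open>For b = 0 the left side is 0^0 = 1, and so is the right side when k =
          0.\<close>
        proof (cases "b = 0")
          case True
          then show ?thesis by (cases "k = 0") (auto simp: Suc_leI)
        next
          case False
          have "real b ^ b \<le> real b ^ k" by (rule power_increasing) (use False True in auto)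
          also have "\<dots> \<le> real k ^ k" by (rule power_mono) (use True in auto)
          finally show ?thesis .
        qed
        moreover have "A ^ b \<le> A ^ k" by (rule power_increasing[OF True A1])
        ultimately show ?thesis unfolding power_mult_distrib using A1 by (intro mult_mono) auto
      qed
      also have "\<dots> \<le> A ^ k * (fact k * exp (real k))"
        using A1 by (intro mult_left_mono power_self_le_fact_exp) auto
      finally have "(A * real b) ^ b * \<bar>ray_coeff a k (\<lambda>_. 0) \<beta> x / fact k\<bar> \<le> A ^ k * (fact k * exp (real k)) * ((n * r * n) ^ k / fact k)"
        using rc A1 by (intro mult_mono) (auto simp: divide_right_mono)
      also have "\<dots> = (A * exp 1 * (n * r * n)) ^ k"
        by (simp add: power_mult_distrib exp_of_nat_mult[symmetric] mult_ac)
      also have "\<dots> \<le> 1"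
        using sm A1 n1 r by (intro power_le_one) auto
      finally show ?thesis .
    qed
    have "(A * real b) ^ b * \<bar>P \<beta> x\<bar> \<le> (A * real b) ^ b * (\<Sum>k<l. \<bar>ray_coeff a k (\<lambda>_. 0) \<beta> x / fact k\<bar>)"
      unfolding P_def using A1 by (intro mult_left_mono sum_abs) auto
    also have "\<dots> = (\<Sum>k<l. (A * real b) ^ b * \<bar>ray_coeff a k (\<lambda>_. 0) \<beta> x / fact k\<bar>)" by (rule sum_distrib_left)
    also have "\<dots> \<le> (\<Sum>k<l. 1)" by (rule sum_mono) (use tm in auto)
    finally show "(4 * real CARD('n) / s * real (msize \<beta>)) ^ msize \<beta> * \<bar>P \<beta> x\<bar> \<le> real l"
      by (simp add: A_def n_def b_def)
  next
    fix v :: "('n \<Rightarrow> nat) \<Rightarrow> real^'n \<Rightarrow> complex" and M and x :: "real^'n"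
    assume v: "solfam s v" and M: "\<forall>y. (\<forall>k. \<bar>y $ k\<bar> < s) \<longrightarrow> norm (v (\<lambda>_. 0) y) \<le> M" and x: "\<forall>j. \<bar>x $ j\<bar> \<le> r"
    have bd: "norm (v (\<lambda>_. 0) y) \<le> M" if "\<And>k. \<bar>y $ k\<bar> < s" for y using M that by blast
    have M0: "0 \<le> M" using bd[of 0] s by (metis abs_zero norm_ge_zero order_trans zero_index)
    have hv: "helmholtz (\<lambda>\<gamma>. v \<gamma> 0)" using v s by (simp add: solfam_def helmholtz_def)
    have "ray_deriv k v (\<lambda>_. 0) x 0 = (\<Sum>\<beta>\<in>?I. ray_coeff a k (\<lambda>_. 0) \<beta> x *\<^sub>R v \<beta> 0)" if "k < l" for k
      by (rule ray_deriv_eq_ray_coeff) (use aS[OF _ hv] that in auto)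
    then have "(\<Sum>k<l. ray_deriv k v (\<lambda>_. 0) x 0 /\<^sub>R fact k) = (\<Sum>k<l. \<Sum>\<beta>\<in>?I. (ray_coeff a k (\<lambda>_. 0) \<beta> x / fact k) *\<^sub>R v \<beta> 0)"
      by (simp add: scaleR_sum_right divide_inverse mult.commute)
    also have "\<dots> = (\<Sum>\<beta>\<in>?I. P \<beta> x *\<^sub>R v \<beta> 0)"
      by (simp add: P_def scaleR_sum_left sum.swap[of _ ?I])
    finally have eq: "(\<Sum>k<l. ray_deriv k v (\<lambda>_. 0) x 0 /\<^sub>R fact k) = (\<Sum>\<beta>\<in>?I. P \<beta> x *\<^sub>R v \<beta> 0)" .
    have "norm (v (\<lambda>_. 0) x - (\<Sum>\<beta>\<in>?I. P \<beta> x *\<^sub>R v \<beta> 0)) \<le> 2 * ((n * r) ^ l * ((4 * n / s * real l) ^ l * M) / fact l)"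
      using solfam_taylor[OF v s(1) l bd, of x r] x r unfolding eq n_def by blast
    also have "\<dots> = 2 * ((n * r) ^ l * (4 * n / s) ^ l * M) * (real l ^ l / fact l)"
      unfolding power_mult_distrib[of "4 * n / s" "real l" l] by simp
    also have "\<dots> \<le> 2 * ((n * r) ^ l * (4 * n / s) ^ l * M) * exp (real l)"
    proof (rule mult_left_mono)
      show "real l ^ l / fact l \<le> exp (real l)" using power_self_le_fact_exp[of l] by (simp add: field_simps)
    qed (use M0 n1 r s in simp)
    also have "\<dots> = 2 * (4 * n ^ 2 * exp 1 * r / s) ^ l * M"
    proof -
      have e1: "exp (real l) = exp 1 ^ l" by (simp add: exp_of_nat_mult[symmetric])
      have e2: "n * r * (4 * n / s) * exp 1 = 4 * n ^ 2 * exp 1 * r / s" by (simp add: power2_eq_square)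
      have "2 * (A ^ l * C ^ l * M) * E ^ l = 2 * (A * C * E) ^ l * M" for A C E :: real
        by (simp add: power_mult_distrib)
      from this[of "n * r" "4 * n / s" "exp 1"] show ?thesis unfolding e1 e2 .
    qed
    finally show "norm (v (\<lambda>_. 0) x - (\<Sum>\<beta>\<in>?I. P \<beta> x *\<^sub>R v \<beta> 0)) \<le> 2 * (4 * real CARD('n) ^ 2 * exp 1 * r / s) ^ l * M"
      by (simp add: n_def)
  qed
qed

section \<open>Mollification of weak solutions\<close>

definition bump :: "nat \<Rightarrow> real \<Rightarrow> real"
  where "bump = (SOME b. deriv_seq b \<and> (\<forall>t. 0 \<le> b 0 t) \<and> (\<forall>t. \<bar>t\<bar> < 1 \<longrightarrow> 0 < b 0 t) \<and> (\<forall>k t. 1 \<le> \<bar>t\<bar> \<longrightarrow> b k t = 0))"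

lemma bump: "deriv_seq bump" "0 \<le> bump 0 t" "\<bar>t\<bar> < 1 \<Longrightarrow> 0 < bump 0 t" "1 \<le> \<bar>t\<bar> \<Longrightarrow> bump k t = 0"
  using someI_ex[OF exists_bump] unfolding bump_def[symmetric] by blast+

lemma bump_bounded: "\<exists>B\<ge>1. \<forall>t. \<bar>bump k t\<bar> \<le> B"
proof -
  have "\<exists>B\<ge>0. \<forall>t. norm (bump k t) \<le> B"
    by (rule continuous_compact_support_bounded[of _ "{-1..1}"])
       (use bump(4) deriv_seq_continuous[OF bump(1)] in auto)
  then obtain B where "\<forall>t. norm (bump k t) \<le> B" by blast
  then show ?thesis by (intro exI[of _ "max B 1"]) (auto intro: max.coboundedI1)
qed

text \<open>\<open>pker d \<alpha>\<close> and \<open>nker d \<alpha>\<close> are the derivatives \<open>\<partial>\<^sup>\<alpha>\<close> of a product bump function at scale \<open>d\<close>, before and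
  after normalization.\<close>

definition pker :: "real \<Rightarrow> ('n::finite \<Rightarrow> nat) \<Rightarrow> real^'n \<Rightarrow> real"
  where "pker d \<alpha> z = (\<Prod>i\<in>UNIV. bump (\<alpha> i) (z $ i / d) / d ^ \<alpha> i)"

lemma pker_has_derivative:
  assumes d: "0 < d"
  shows "(pker d \<alpha> has_derivative (\<lambda>h. \<Sum>i\<in>UNIV. h $ i * pker d (inc \<alpha> i) z)) (at z)"
proof -
  have 1: "((\<lambda>z. bump (\<alpha> i) (z $ i / d) / d ^ \<alpha> i) has_derivative
      (\<lambda>h. bump (Suc (\<alpha> i)) (z $ i / d) / d ^ Suc (\<alpha> i) * h $ i)) (at z)" for i
  proof -
    have a: "((\<lambda>z::real^'a. z $ i / d) has_derivative (\<lambda>h. h $ i / d)) (at z)"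
      unfolding divide_inverse by (intro has_derivative_mult_left bounded_linear_imp_has_derivative bounded_linear_vec_nth)
    have b: "(bump (\<alpha> i) has_derivative (\<lambda>h. bump (Suc (\<alpha> i)) (z $ i / d) * h)) (at (z $ i / d))"
      using deriv_seqD[OF bump(1), of "\<alpha> i"] by (simp add: has_field_derivative_def)
    from has_derivative_mult_left[OF has_derivative_compose[OF a b], of "inverse (d ^ \<alpha> i)"]
    show ?thesis by (simp add: divide_inverse mult_ac)
  qed
  have "(pker d \<alpha> has_derivative (\<lambda>h. \<Sum>i\<in>UNIV. (bump (Suc (\<alpha> i)) (z $ i / d) / d ^ Suc (\<alpha> i) * h $ i) *
      (\<Prod>j\<in>UNIV - {i}. bump (\<alpha> j) (z $ j / d) / d ^ \<alpha> j))) (at z)"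
    unfolding pker_def by (rule has_derivative_prod) (rule 1)
  moreover have "(bump (Suc (\<alpha> i)) (z $ i / d) / d ^ Suc (\<alpha> i) * h) * (\<Prod>j\<in>UNIV - {i}. bump (\<alpha> j) (z $ j / d) / d ^ \<alpha> j)
      = h * pker d (inc \<alpha> i) z" for i h
  proof -
    have "pker d (inc \<alpha> i) z = bump (Suc (\<alpha> i)) (z $ i / d) / d ^ Suc (\<alpha> i) *
        (\<Prod>j\<in>UNIV - {i}. bump (\<alpha> j) (z $ j / d) / d ^ \<alpha> j)"
      unfolding pker_def by (subst prod.remove[of _ i]) (auto simp: inc_def intro!: prod.cong)
    then show ?thesis by simp
  qed
  ultimately show ?thesis by simp
qed

lemma pker_continuous: "0 < d \<Longrightarrow> continuous_on A (pker d \<alpha>)"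
  by (intro continuous_at_imp_continuous_on ballI has_derivative_continuous[OF pker_has_derivative])

lemma pker_outside:
  assumes "0 < d" "d \<le> \<bar>z $ i\<bar>" shows "pker d \<alpha> z = 0"
proof -
  have "bump (\<alpha> i) (z $ i / d) = 0" by (rule bump(4)) (use assms in \<open>simp add: abs_divide\<close>)
  then show ?thesis unfolding pker_def by (intro prod_zero bexI[of _ i]) auto
qed

lemma pker_nonneg: "0 < d \<Longrightarrow> 0 \<le> pker d (\<lambda>_. 0) z"
  unfolding pker_def by (intro prod_nonneg) (auto simp: bump(2))

lemma pker_bound:
  assumes "0 < d" shows "\<exists>B. \<forall>z::real^'n. \<bar>pker d \<alpha> z\<bar> \<le> B"
proof -
  obtain B where B: "\<And>k t. \<bar>bump k t\<bar> \<le> B k" using bump_bounded by metis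
  have "\<bar>pker d \<alpha> z\<bar> \<le> (\<Prod>i\<in>UNIV. B (\<alpha> i) / d ^ \<alpha> i)" for z :: "real^'n"
    unfolding pker_def abs_prod by (intro prod_mono) (use assms B in \<open>auto simp: abs_divide divide_right_mono\<close>)
  then show ?thesis by blast
qed

lemma pker_0_bound: "\<exists>B\<ge>1. \<forall>d z. 0 < d \<longrightarrow> \<bar>pker d (\<lambda>_. 0) (z::real^'n)\<bar> \<le> B"
proof -
  obtain B where B: "1 \<le> B" "\<And>t. \<bar>bump 0 t\<bar> \<le> B" using bump_bounded by metis
  have "\<bar>pker d (\<lambda>_. 0) z\<bar> \<le> (\<Prod>i\<in>(UNIV::'n set). B)" for d and z :: "real^'n"
    unfolding pker_def abs_prod by (intro prod_mono) (use B in auto)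
  then show ?thesis using B(1) by (intro exI[of _ "\<Prod>i\<in>(UNIV::'n set). B"]) auto
qed

lemma pker_integrable: assumes "0 < d" shows "integrable lborel (pker d \<alpha> :: real^'n \<Rightarrow> real)"
proof (rule continuous_compact_support_integrable[OF pker_continuous[OF assms]])
  show "compact (cbox (\<chi> i. - d) (\<chi> i. d) :: (real^'n) set)" by simp
  fix x :: "real^'n" assume "x \<notin> cbox (\<chi> i. - d) (\<chi> i. d)"
  then obtain i where "x $ i < - d \<or> d < x $ i" unfolding mem_box_cart by (auto simp: not_le)
  then have "d \<le> \<bar>x $ i\<bar>" by linarith
  then show "pker d \<alpha> x = 0" by (rule pker_outside[OF assms])
qed

text \<open>The integral of the unnormalized kernel. The type argument fixes the dimension, which d
  alone does not determine.\<close>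

definition kmass :: "('n::finite) itself \<Rightarrow> real \<Rightarrow> real"
  where "kmass _ d = (\<integral>z. pker d (\<lambda>_. 0) (z::real^'n) \<partial>lborel)"

lemma kmass_scale:
  assumes d: "0 < d" shows "kmass TYPE('n::finite) d = d ^ CARD('n) * kmass TYPE('n) 1"
proof -
  have m: "pker d (\<lambda>_. 0) \<in> borel_measurable (borel :: (real^'n) measure)"
    by (rule borel_measurable_continuous_onI[OF pker_continuous[OF d]])
  have "(\<integral>z. pker d (\<lambda>_. 0) (z::real^'n) \<partial>lborel) = (\<integral>z. pker d (\<lambda>_. 0) z \<partial>density (distr lborel borel (\<lambda>x::real^'n. 0 + d *\<^sub>R x)) (\<lambda>_. \<bar>d\<bar>^DIM(real^'n)))"
    using lborel_affine[of d "0::real^'n"] d by simp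
  also have "\<dots> = (\<integral>z. \<bar>d\<bar>^DIM(real^'n) *\<^sub>R pker d (\<lambda>_. 0) z \<partial>distr lborel borel (\<lambda>x::real^'n. 0 + d *\<^sub>R x))"
    by (rule integral_density) (use m d in auto)
  also have "\<dots> = (\<integral>z. \<bar>d\<bar>^DIM(real^'n) *\<^sub>R pker d (\<lambda>_. 0) (0 + d *\<^sub>R (z::real^'n)) \<partial>lborel)"
    by (subst integral_distr) (use m in auto)
  also have "\<dots> = d ^ CARD('n) * (\<integral>z. pker 1 (\<lambda>_. 0) (z::real^'n) \<partial>lborel)"
    using d by (simp add: pker_def)
  finally show ?thesis by (simp add: kmass_def)
qed

text \<open>The kernel is positive on a ball, a set of positive measure.\<close>

lemma kmass_pos:
  assumes d: "0 < d" shows "0 < kmass TYPE('n::finite) d"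
proof -
  have i: "integrable lborel (pker d (\<lambda>_. 0) :: real^'n \<Rightarrow> real)" by (rule pker_integrable[OF d])
  have nn: "AE z in lborel. 0 \<le> pker d (\<lambda>_. 0) (z::real^'n)" by (simp add: pker_nonneg[OF d])
  have "kmass TYPE('n) d \<noteq> 0"
  proof
    assume "kmass TYPE('n) d = 0"
    then have "AE z in lborel. pker d (\<lambda>_. 0) (z::real^'n) = 0"
      using integral_nonneg_eq_0_iff_AE[OF i nn] by (simp add: kmass_def)
    moreover have "pker d (\<lambda>_. 0) z \<noteq> 0" if "z \<in> ball 0 d" for z :: "real^'n"
    proof -
      have "0 < bump 0 (z $ i / d)" for i
      proof (rule bump(3))
        have "\<bar>z $ i\<bar> < d" using component_le_norm_cart[of z i] that by simp
        then show "\<bar>z $ i / d\<bar> < 1" using d by (simp add: abs_divide)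
      qed
      then show ?thesis unfolding pker_def by (simp add: less_imp_neq[symmetric])
    qed
    ultimately have "AE z in lborel. z \<notin> (ball 0 d :: (real^'n) set)" by (auto elim!: eventually_mono)
    then have "emeasure lborel (ball 0 d :: (real^'n) set) = 0"
      using AE_iff_null_sets[of "ball 0 d :: (real^'n) set" lborel] null_setsD1 by auto
    then show False using content_ball_pos[OF d, of "0::real^'n"] by (simp add: measure_def)
  qed
  moreover have "0 \<le> kmass TYPE('n) d" unfolding kmass_def by (rule integral_nonneg_AE[OF nn])
  ultimately show ?thesis by simp
qed

section \<open>The normalized kernel\<close>

definition nker :: "real \<Rightarrow> ('n::finite \<Rightarrow> nat) \<Rightarrow> real^'n \<Rightarrow> real"
  where "nker d \<alpha> z = pker d \<alpha> z / kmass TYPE('n) d"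

lemma nker_has_derivative:
  assumes "0 < d"
  shows "(nker d \<alpha> has_derivative (\<lambda>h. \<Sum>i\<in>UNIV. h $ i * nker d (inc \<alpha> i) z)) (at z)"
proof -
  from has_derivative_mult_left[OF pker_has_derivative[OF assms, of \<alpha> z], of "inverse (kmass TYPE('a) d)"]
  show ?thesis by (simp add: nker_def[abs_def] divide_inverse sum_distrib_right mult.assoc)
qed

lemma nker_continuous: "0 < d \<Longrightarrow> continuous_on A (nker d \<alpha>)"
  by (intro continuous_at_imp_continuous_on ballI has_derivative_continuous[OF nker_has_derivative])

lemma nker_outside: "0 < d \<Longrightarrow> d \<le> \<bar>z $ i\<bar> \<Longrightarrow> nker d \<alpha> z = 0"
  by (simp add: nker_def pker_outside)

lemma nker_nonneg: "0 < d \<Longrightarrow> 0 \<le> nker d (\<lambda>_. 0) z"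
  unfolding nker_def using pker_nonneg[of d z] kmass_pos[of d, where 'n='a] by (intro divide_nonneg_pos) auto

lemma nker_bound:
  assumes "0 < d" shows "\<exists>B\<ge>0. \<forall>z::real^'n. \<bar>nker d \<alpha> z\<bar> \<le> B"
proof -
  obtain B where "\<forall>z::real^'n. \<bar>pker d \<alpha> z\<bar> \<le> B" using pker_bound[OF assms] by blast
  then have "\<bar>nker d \<alpha> z\<bar> \<le> max 0 B / kmass TYPE('n) d" for z :: "real^'n"
    using kmass_pos[OF assms, where 'n='n] by (simp add: nker_def abs_divide divide_right_mono max.coboundedI2)
  then show ?thesis using kmass_pos[OF assms, where 'n='n] by (intro exI[of _ "max 0 B / kmass TYPE('n) d"]) auto
qed

text \<open>The mass scales like d^n while the bump stays bounded. For d of order e^-l this power of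
  d is the loss e^(nl) in the supremum.\<close>

lemma nker_0_bound: "\<exists>B>0. \<forall>d z. 0 < d \<longrightarrow> \<bar>nker d (\<lambda>_. 0) (z::real^'n)\<bar> \<le> B / d ^ CARD('n)"
proof -
  obtain B where B: "1 \<le> B" "\<And>d z. 0 < d \<Longrightarrow> \<bar>pker d (\<lambda>_. 0) (z::real^'n)\<bar> \<le> B" using pker_0_bound by metis
  have k: "0 < kmass TYPE('n) 1" by (rule kmass_pos) simp
  have "\<bar>nker d (\<lambda>_. 0) z\<bar> \<le> (B / kmass TYPE('n) 1) / d ^ CARD('n)" if d: "0 < d" for d and z :: "real^'n"
  proof -
    have "\<bar>nker d (\<lambda>_. 0) z\<bar> = \<bar>pker d (\<lambda>_. 0) z\<bar> / (d ^ CARD('n) * kmass TYPE('n) 1)"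
      using kmass_scale[OF d, where 'n='n] k d by (simp add: nker_def abs_divide abs_mult)
    also have "\<dots> \<le> B / (d ^ CARD('n) * kmass TYPE('n) 1)"
      using B(2)[OF d] k d by (intro divide_right_mono) auto
    finally show ?thesis by (simp add: mult.commute)
  qed
  then show ?thesis using B(1) k by (intro exI[of _ "B / kmass TYPE('n) 1"]) auto
qed

lemma nker_integral: "0 < d \<Longrightarrow> integrable lborel (nker d (\<lambda>_. 0) :: real^'n \<Rightarrow> real)"
  "0 < d \<Longrightarrow> (\<integral>z. nker d (\<lambda>_. 0) (z::real^'n) \<partial>lborel) = 1"
proof -
  assume d: "0 < d"
  show "integrable lborel (nker d (\<lambda>_. 0) :: real^'n \<Rightarrow> real)"
    unfolding nker_def[abs_def] by (simp add: pker_integrable[OF d])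
  show "(\<integral>z. nker d (\<lambda>_. 0) (z::real^'n) \<partial>lborel) = 1"
    using kmass_pos[OF d, where 'n='n] by (simp add: nker_def kmass_def)
qed

lemma nker_lipschitz:
  assumes d: "0 < d" shows "\<exists>L\<ge>0. \<forall>z z'::real^'n. \<bar>nker d \<alpha> z' - nker d \<alpha> z\<bar> \<le> L * norm (z' - z)"
proof -
  have "\<forall>i. \<exists>B. 0 \<le> B \<and> (\<forall>z::real^'n. \<bar>nker d (inc \<alpha> i) z\<bar> \<le> B)"
  proof
    show "\<exists>B. 0 \<le> B \<and> (\<forall>z::real^'n. \<bar>nker d (inc \<alpha> i) z\<bar> \<le> B)" for i
      using nker_bound[OF d, where 'n='n and \<alpha>="inc \<alpha> i"] by blast
  qed
  then obtain B where "\<forall>i. 0 \<le> B i \<and> (\<forall>z::real^'n. \<bar>nker d (inc \<alpha> i) z\<bar> \<le> B i)"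
    by (rule exE[OF choice])
  then have B: "\<And>i. 0 \<le> B i" "\<And>i z. \<bar>nker d (inc \<alpha> i) (z::real^'n)\<bar> \<le> B i" by blast+
  have "norm (nker d \<alpha> z' - nker d \<alpha> z) \<le> (\<Sum>i\<in>UNIV. B i) * norm (z' - z)" for z z' :: "real^'n"
  proof (rule differentiable_bound[of UNIV])
    show "(nker d \<alpha> has_derivative (\<lambda>h. \<Sum>i\<in>UNIV. h $ i * nker d (inc \<alpha> i) x)) (at x within UNIV)" for x :: "real^'n"
      by (rule nker_has_derivative[OF d])
    show "onorm (\<lambda>h::real^'n. \<Sum>i\<in>UNIV. h $ i * nker d (inc \<alpha> i) x) \<le> (\<Sum>i\<in>UNIV. B i)" for x :: "real^'n"
    proof (rule onorm_le)
      fix h :: "real^'n"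
      have "norm (\<Sum>i\<in>UNIV. h $ i * nker d (inc \<alpha> i) x) \<le> (\<Sum>i\<in>UNIV. norm h * B i)"
        by (rule order_trans[OF norm_sum]) (auto simp: abs_mult intro!: sum_mono mult_mono component_le_norm_cart B)
      then show "norm (\<Sum>i\<in>UNIV. h $ i * nker d (inc \<alpha> i) x) \<le> (\<Sum>i\<in>UNIV. B i) * norm h"
        unfolding sum_distrib_left[symmetric] by (simp only: mult.commute)
    qed
  qed auto
  then show ?thesis using B(1) by (intro exI[of _ "\<Sum>i\<in>UNIV. B i"]) (auto intro: sum_nonneg)
qed

text \<open>A quadratic remainder that is uniform in z allows differentiation under the integral in
  \<open>mol_has_derivative\<close>.\<close>

lemma nker_second_order:
  assumes d: "0 < d" shows "\<exists>L\<ge>0. \<forall>z h::real^'n.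
    \<bar>nker d \<alpha> (z + h) - nker d \<alpha> z - (\<Sum>i\<in>UNIV. h $ i * nker d (inc \<alpha> i) z)\<bar> \<le> L * (norm h)\<^sup>2"
proof -
  have "\<forall>i. \<exists>L. 0 \<le> L \<and> (\<forall>z z'::real^'n. \<bar>nker d (inc \<alpha> i) z' - nker d (inc \<alpha> i) z\<bar> \<le> L * norm (z' - z))"
  proof
    show "\<exists>L. 0 \<le> L \<and> (\<forall>z z'::real^'n. \<bar>nker d (inc \<alpha> i) z' - nker d (inc \<alpha> i) z\<bar> \<le> L * norm (z' - z))" for i
      using nker_lipschitz[OF d, where 'n='n and \<alpha>="inc \<alpha> i"] by blast
  qed
  then obtain L where "\<forall>i. 0 \<le> L i \<and> (\<forall>z z'::real^'n. \<bar>nker d (inc \<alpha> i) z' - nker d (inc \<alpha> i) z\<bar> \<le> L i * norm (z' - z))"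
    by (rule exE[OF choice])
  then have L: "\<And>i. 0 \<le> L i" "\<And>i z z'. \<bar>nker d (inc \<alpha> i) (z'::real^'n) - nker d (inc \<alpha> i) z\<bar> \<le> L i * norm (z' - z)" by blast+
  have "\<bar>nker d \<alpha> (z + h) - nker d \<alpha> z - (\<Sum>i\<in>UNIV. h $ i * nker d (inc \<alpha> i) z)\<bar> \<le> (\<Sum>i\<in>UNIV. L i) * (norm h)\<^sup>2" for z h :: "real^'n"
  proof -
    \<comment> \<open>Subtracting the linear part at z leaves a function whose derivative on the
      ball of radius |h| around z is O(|h|), by the Lipschitz bound on the first
      derivatives.\<close>
    define g where "g y = nker d \<alpha> y - (\<Sum>i\<in>UNIV. y $ i * nker d (inc \<alpha> i) z)" for y
    have "norm (g (z + h) - g z) \<le> ((\<Sum>i\<in>UNIV. L i) * norm h) * norm (z + h - z)"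
    proof (rule differentiable_bound[of "cball z (norm h)"])
      show "(g has_derivative (\<lambda>k. (\<Sum>i\<in>UNIV. k $ i * nker d (inc \<alpha> i) y) - (\<Sum>i\<in>UNIV. k $ i * nker d (inc \<alpha> i) z))) (at y within cball z (norm h))" for y
        unfolding g_def
        by (intro has_derivative_diff has_derivative_at_withinI[OF nker_has_derivative[OF d]] has_derivative_sum
            has_derivative_mult_left bounded_linear_imp_has_derivative bounded_linear_vec_nth)
      fix y assume y: "y \<in> cball z (norm h)"
      show "onorm (\<lambda>k. (\<Sum>i\<in>UNIV. k $ i * nker d (inc \<alpha> i) y) - (\<Sum>i\<in>UNIV. k $ i * nker d (inc \<alpha> i) z)) \<le> (\<Sum>i\<in>UNIV. L i) * norm h"
      proof (rule onorm_le)
        fix k :: "real^'n"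
        have "(\<Sum>i\<in>UNIV. k $ i * nker d (inc \<alpha> i) y) - (\<Sum>i\<in>UNIV. k $ i * nker d (inc \<alpha> i) z)
            = (\<Sum>i\<in>UNIV. k $ i * (nker d (inc \<alpha> i) y - nker d (inc \<alpha> i) z))"
          by (simp add: sum_subtractf right_diff_distrib)
        also have "norm \<dots> \<le> (\<Sum>i\<in>UNIV. norm k * (L i * norm h))"
        proof (rule order_trans[OF norm_sum], rule sum_mono)
          fix i
          have "\<bar>nker d (inc \<alpha> i) y - nker d (inc \<alpha> i) z\<bar> \<le> L i * norm h"
            using L(2)[of i y z] y mult_left_mono[OF _ L(1)[of i], of "norm (y - z)" "norm h"]
            by (simp add: dist_norm norm_minus_commute)
          then show "norm (k $ i * (nker d (inc \<alpha> i) y - nker d (inc \<alpha> i) z)) \<le> norm k * (L i * norm h)"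
            by (simp add: abs_mult mult_mono component_le_norm_cart)
        qed
        finally show "norm ((\<Sum>i\<in>UNIV. k $ i * nker d (inc \<alpha> i) y) - (\<Sum>i\<in>UNIV. k $ i * nker d (inc \<alpha> i) z)) \<le> (\<Sum>i\<in>UNIV. L i) * norm h * norm k"
          by (simp add: sum_distrib_left[symmetric] sum_distrib_right[symmetric] mult_ac)
      qed
    qed (auto simp: dist_norm)
    then show ?thesis by (simp add: g_def algebra_simps sum.distrib power2_eq_square)
  qed
  then show ?thesis using L(1) by (intro exI[of _ "\<Sum>i\<in>UNIV. L i"]) (auto intro: sum_nonneg)
qed

lemma nker_smooth:
  assumes d: "0 < d" shows "smooth (\<lambda>y::real^'n. complex_of_real (nker d \<alpha> (x - y)))"
proof -
  have aff: "smooth (\<lambda>y::real^'n. complex_of_real ((x $ i - y $ i) / d))" for i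
    using smooth_add[OF smooth_const[of "complex_of_real (x $ i / d)"] smooth_cmult[OF smooth_coord[of i], of "complex_of_real (- 1 / d)"]]
    by (simp add: diff_divide_distrib)
  have "smooth (\<lambda>y::real^'n. complex_of_real (1 / kmass TYPE('n) d) *
      (\<Prod>i\<in>UNIV. complex_of_real (1 / d ^ \<alpha> i) * complex_of_real (bump (\<alpha> i) ((x $ i - y $ i) / d))))"
    by (intro smooth_cmult smooth_prod smooth_compose_deriv_seq[OF bump(1)] aff)
  then show ?thesis by (simp add: nker_def pker_def of_real_prod)
qed

lemma nker_partial:
  assumes d: "0 < d"
  shows "partial i (\<lambda>y::real^'n. complex_of_real (nker d \<alpha> (x - y))) y = - complex_of_real (nker d (inc \<alpha> i) (x - y))"
proof -
  have 1: "((\<lambda>y. x - y) has_derivative (\<lambda>h. - h)) (at y)" by (auto intro!: derivative_eq_intros)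
  have "((\<lambda>y. complex_of_real (nker d \<alpha> (x - y))) has_derivative
      (\<lambda>h. complex_of_real (\<Sum>i\<in>UNIV. (- h) $ i * nker d (inc \<alpha> i) (x - y)))) (at y)"
    by (rule has_derivative_of_real[OF has_derivative_compose[OF 1 nker_has_derivative[OF d]]])
  moreover have "(\<Sum>j\<in>UNIV. (- axis i 1 :: real^'n) $ j * K j) = - K i" for K
    by (simp add: axis_def if_distrib[of "\<lambda>c. c * _"] sum_negf cong: if_cong)
  ultimately show ?thesis by (simp only: partial_eq of_real_minus)
qed

text \<open>n coordinates of size at most 1/n give |y|^2 <= 1/n, which is below 1 as n >= 2.\<close>

lemma small_cube_subset_Omega:
  assumes "\<And>i. \<bar>(y :: real^'n) $ i\<bar> \<le> 1 / real CARD('n)" and n: "2 \<le> CARD('n)"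
  shows "y \<in> Omega"
proof -
  have "(norm y)\<^sup>2 = (\<Sum>i\<in>UNIV. (y $ i)\<^sup>2)" by (simp add: power2_norm_vec)
  also have "\<dots> \<le> (\<Sum>i\<in>(UNIV :: 'n set). (1 / real CARD('n))\<^sup>2)"
  proof (rule sum_mono)
    fix i
    show "(y $ i)\<^sup>2 \<le> (1 / real CARD('n))\<^sup>2" using power_mono[OF assms(1)[of i], of 2] by simp
  qed
  also have "\<dots> = 1 / real CARD('n)" using n by (simp add: power2_eq_square)
  also have "\<dots> < 1" using n by simp
  finally show ?thesis by (simp add: power_less_one_iff abs_square_less_1)
qed

lemma nker_test_function:
  fixes x :: "real^'n"
  assumes d: "0 < d" and x: "\<And>i. \<bar>x $ i\<bar> + d \<le> 1 / real CARD('n)" and n: "2 \<le> CARD('n)"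
  shows "test_function (\<lambda>y. complex_of_real (nker d \<alpha> (x - y)))"
  unfolding test_function_def
proof (intro conjI exI[of _ "cbox (\<chi> i. x $ i - d) (\<chi> i. x $ i + d)"] allI impI nker_smooth[OF d])
  show "compact (cbox (\<chi> i. x $ i - d) (\<chi> i. x $ i + d))" by simp
  show "cbox (\<chi> i. x $ i - d) (\<chi> i. x $ i + d) \<subseteq> Omega"
  proof
    fix y assume "y \<in> cbox (\<chi> i. x $ i - d) (\<chi> i. x $ i + d)"
    then have yi: "x $ i - d \<le> y $ i \<and> y $ i \<le> x $ i + d" for i by (auto simp: mem_box_cart)
    show "y \<in> Omega"
    proof (rule small_cube_subset_Omega[OF _ n])
      show "\<bar>y $ i\<bar> \<le> 1 / real CARD('n)" for i using yi[of i] x[of i] by linarith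
    qed
  qed
  fix y assume "y \<notin> cbox (\<chi> i. x $ i - d) (\<chi> i. x $ i + d)"
  then obtain i where "y $ i < x $ i - d \<or> x $ i + d < y $ i" unfolding mem_box_cart by (auto simp: not_le)
  then have "d \<le> \<bar>(x - y) $ i\<bar>" unfolding vector_minus_component by linarith
  then show "complex_of_real (nker d \<alpha> (x - y)) = 0" by (simp add: nker_outside[OF d, of "x - y" i])
qed

section \<open>Mollified functions and their equation\<close>

lemma norm_integral_le:
  fixes f :: "'a \<Rightarrow> 'b::{banach,second_countable_topology}"
  assumes "integrable M f" "integrable M g" "\<And>x. norm (f x) \<le> g x"
  shows "norm (\<integral>x. f x \<partial>M) \<le> (\<integral>x. g x \<partial>M)"
  by (rule order_trans[OF integral_norm_bound integral_mono]) (use assms in auto)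

text \<open>The derivative of order \<alpha> of the convolution of u with the kernel, placed on the
  kernel. Integrating over the ball makes no difference as long as the kernel around x is supported
  there.\<close>

definition mol :: "real \<Rightarrow> (real^'n::finite \<Rightarrow> complex) \<Rightarrow> ('n \<Rightarrow> nat) \<Rightarrow> real^'n \<Rightarrow> complex"
  where "mol d u \<alpha> x = (\<integral>y. u y * complex_of_real (nker d \<alpha> (x - y)) \<partial>vol)"

lemma mol_continuous_ker: "0 < d \<Longrightarrow> continuous_on UNIV (\<lambda>y. complex_of_real (nker d \<alpha> (x - y)))"
  by (rule smooth_continuous[OF nker_smooth])

lemma mol_integrable:
  assumes "0 < d" "square_integrable vol u"
  shows "integrable vol (\<lambda>y. u y * complex_of_real (nker d \<alpha> (x - y)))"
  by (rule square_integrable_times[OF assms(2) continuous_square_integrable[OF mol_continuous_ker[OF assms(1)]]])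

text \<open>The uniform remainder estimate for the kernel is integrated against |u|, which is
  integrable on the ball.\<close>

lemma mol_has_derivative:
  assumes d: "0 < d" and u: "square_integrable vol u"
  shows "(mol d u \<alpha> has_derivative (\<lambda>h. \<Sum>i\<in>UNIV. (h $ i) *\<^sub>R mol d u (inc \<alpha> i) x)) (at x)"
proof -
  obtain L where L: "0 \<le> L" "\<And>z h::real^'a. \<bar>nker d \<alpha> (z + h) - nker d \<alpha> z - (\<Sum>i\<in>UNIV. h $ i * nker d (inc \<alpha> i) z)\<bar> \<le> L * (norm h)\<^sup>2"
    using nker_second_order[OF d, where 'n='a and \<alpha>=\<alpha>] by blast
  define I where "I = (\<integral>y. norm (u y) \<partial>vol)"
  have ui: "integrable vol (\<lambda>y. norm (u y))" using square_integrable_vol_integrable[OF u] by simp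
  note mi = mol_integrable[OF d u]
  have bl: "bounded_linear (\<lambda>h. \<Sum>i\<in>UNIV. (h $ i) *\<^sub>R mol d u (inc \<alpha> i) x)"
    by (intro bounded_linear_sum bounded_linear_scaleR_left[THEN bounded_linear_compose] bounded_linear_vec_nth)
  have main: "norm (mol d u \<alpha> (x + h) - mol d u \<alpha> x - (\<Sum>i\<in>UNIV. (h $ i) *\<^sub>R mol d u (inc \<alpha> i) x)) \<le> L * I * (norm h)\<^sup>2" for h
  proof -
    have "(\<Sum>i\<in>UNIV. (h $ i) *\<^sub>R mol d u (inc \<alpha> i) x) = (\<integral>y. (\<Sum>i\<in>UNIV. (h $ i) *\<^sub>R (u y * complex_of_real (nker d (inc \<alpha> i) (x - y)))) \<partial>vol)"
      unfolding mol_def by (simp add: Bochner_Integration.integral_sum mi)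
    then have "mol d u \<alpha> (x + h) - mol d u \<alpha> x - (\<Sum>i\<in>UNIV. (h $ i) *\<^sub>R mol d u (inc \<alpha> i) x)
      = (\<integral>y. u y * complex_of_real (nker d \<alpha> (x + h - y)) - u y * complex_of_real (nker d \<alpha> (x - y))
          - (\<Sum>i\<in>UNIV. (h $ i) *\<^sub>R (u y * complex_of_real (nker d (inc \<alpha> i) (x - y)))) \<partial>vol)"
      unfolding mol_def using mi by simp
    also have "\<dots> = (\<integral>y. u y * complex_of_real (nker d \<alpha> ((x - y) + h) - nker d \<alpha> (x - y) - (\<Sum>i\<in>UNIV. h $ i * nker d (inc \<alpha> i) (x - y))) \<partial>vol)"
      by (rule Bochner_Integration.integral_cong)
         (auto simp: algebra_simps sum_distrib_left scaleR_conv_of_real)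
    also have "norm \<dots> \<le> (\<integral>y. norm (u y) * (L * (norm h)\<^sup>2) \<partial>vol)"
    proof (rule norm_integral_le)
      show "integrable vol (\<lambda>y. norm (u y) * (L * (norm h)\<^sup>2))" using ui by simp
      show "norm (u y * complex_of_real (nker d \<alpha> ((x - y) + h) - nker d \<alpha> (x - y) - (\<Sum>i\<in>UNIV. h $ i * nker d (inc \<alpha> i) (x - y))))
          \<le> norm (u y) * (L * (norm h)\<^sup>2)" for y
        unfolding norm_mult norm_of_real by (intro mult_left_mono L(2)) simp
      have "integrable vol (\<lambda>y. u y * complex_of_real (nker d \<alpha> (x + h - y)) - u y * complex_of_real (nker d \<alpha> (x - y))
          - (\<Sum>i\<in>UNIV. (h $ i) *\<^sub>R (u y * complex_of_real (nker d (inc \<alpha> i) (x - y)))))"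
        using mi by simp
      then show "integrable vol (\<lambda>y. u y * complex_of_real (nker d \<alpha> ((x - y) + h) - nker d \<alpha> (x - y) - (\<Sum>i\<in>UNIV. h $ i * nker d (inc \<alpha> i) (x - y))))"
        by (rule Bochner_Integration.integrable_cong[THEN iffD1, rotated 2])
           (auto simp: algebra_simps sum_distrib_left scaleR_conv_of_real)
    qed
    also have "\<dots> = L * I * (norm h)\<^sup>2" by (simp add: I_def)
    finally show ?thesis .
  qed
  show ?thesis
  proof (rule has_derivativeI_sandwich[of 1])
    show "bounded_linear (\<lambda>h. \<Sum>i\<in>UNIV. (h $ i) *\<^sub>R mol d u (inc \<alpha> i) x)" by (rule bl)
    show "norm (mol d u \<alpha> y - mol d u \<alpha> x - (\<Sum>i\<in>UNIV. ((y - x) $ i) *\<^sub>R mol d u (inc \<alpha> i) x)) / norm (y - x) \<le> L * I * norm (y - x)"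
      if "y \<noteq> x" for y
    proof -
      have "norm (mol d u \<alpha> y - mol d u \<alpha> x - (\<Sum>i\<in>UNIV. ((y - x) $ i) *\<^sub>R mol d u (inc \<alpha> i) x)) \<le> L * I * norm (y - x) * norm (y - x)"
        using main[of "y - x"] by (simp add: power2_eq_square mult.assoc)
      then show ?thesis using that by (simp add: divide_le_eq)
    qed
    have "((\<lambda>y. L * I * norm (y - x)) \<longlongrightarrow> L * I * norm (x - x)) (at x)" by (intro tendsto_intros)
    then show "((\<lambda>y. L * I * norm (y - x)) \<longlongrightarrow> 0) (at x)" by simp
  qed simp
qed

text \<open>The kernel centred at x is a test function. One of the two derivatives of each
  second-order term is moved onto the weak gradient, and the sum over all directions is then the
  weak equation tested with the kernel.\<close>

lemma mol_equation:
  fixes U :: "'n::finite jet"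
  assumes U: "wsol (\<lambda>x. 1) U" and d: "0 < d" and x: "\<And>i. \<bar>x $ i\<bar> + d \<le> 1 / real CARD('n)" and n: "2 \<le> CARD('n)"
  shows "(\<Sum>i\<in>UNIV. mol d (\<lambda>y. fst (U y)) (inc (inc \<alpha> i) i) x) = mol d (\<lambda>y. fst (U y)) \<alpha> x"
proof -
  have W: "wjet U" and sU: "square_integrable vol U" using U by (auto simp: wsol_def wjet_def)
  note t = nker_test_function[OF d x n]
  note ks = continuous_square_integrable[OF mol_continuous_ker[OF d]]
  note su = square_integrable_fst[OF sU]
  note sg = square_integrable_snd_nth[OF sU]
  have 1: "mol d (\<lambda>y. fst (U y)) (inc (inc \<alpha> i) i) x = (\<integral>y. snd (U y) $ i * complex_of_real (nker d (inc \<alpha> i) (x - y)) \<partial>vol)" for i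
  proof -
    have "(\<integral>y. fst (U y) * partial i (\<lambda>y. complex_of_real (nker d (inc \<alpha> i) (x - y))) y \<partial>vol)
        = - (\<integral>y. snd (U y) $ i * complex_of_real (nker d (inc \<alpha> i) (x - y)) \<partial>vol)"
      using W t[of "inc \<alpha> i"] unfolding wjet_def by blast
    then show ?thesis by (simp add: nker_partial[OF d] mol_def)
  qed
  have "0 = en (\<lambda>x. 1) U (sjet (\<lambda>y. complex_of_real (nker d \<alpha> (x - y))))"
    using U t[of \<alpha>] unfolding wsol_def by simp
  also have "\<dots> = (\<integral>y. (\<Sum>i\<in>UNIV. - (snd (U y) $ i * complex_of_real (nker d (inc \<alpha> i) (x - y)))) + fst (U y) * complex_of_real (nker d \<alpha> (x - y)) \<partial>vol)"
    unfolding en_def by (rule Bochner_Integration.integral_cong) (auto simp: energy_density_def sjet_def grad_def nker_partial[OF d])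
  also have "\<dots> = (\<Sum>i\<in>UNIV. - (\<integral>y. snd (U y) $ i * complex_of_real (nker d (inc \<alpha> i) (x - y)) \<partial>vol)) + mol d (\<lambda>y. fst (U y)) \<alpha> x"
    unfolding mol_def using square_integrable_times[OF sg ks] square_integrable_times[OF su ks]
    by (simp add: Bochner_Integration.integral_sum)
  finally show ?thesis by (simp add: 1 sum_negf)
qed

lemma mol_solfam:
  fixes U :: "'n::finite jet"
  assumes U: "wsol (\<lambda>x. 1) U" and d: "0 < d" and s: "s + d \<le> 1 / real CARD('n)" and n: "2 \<le> CARD('n)"
  shows "solfam s (mol d (\<lambda>y. fst (U y)))"
  unfolding solfam_def
proof (intro allI impI conjI)
  fix \<alpha> :: "'n \<Rightarrow> nat" and x :: "real^'n" assume x: "\<forall>j. \<bar>x $ j\<bar> < s"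
  have sU: "square_integrable vol U" using U by (simp add: wsol_def wjet_def)
  show "(mol d (\<lambda>y. fst (U y)) \<alpha> has_derivative (\<lambda>h. \<Sum>i\<in>UNIV. (h $ i) *\<^sub>R mol d (\<lambda>y. fst (U y)) (inc \<alpha> i) x)) (at x)"
    by (rule mol_has_derivative[OF d square_integrable_fst[OF sU]])
  show "(\<Sum>i\<in>UNIV. mol d (\<lambda>y. fst (U y)) (inc (inc \<alpha> i) i) x) = mol d (\<lambda>y. fst (U y)) \<alpha> x"
  proof (rule mol_equation[OF U d _ n])
    show "\<bar>x $ i\<bar> + d \<le> 1 / real CARD('n)" for i using x[rule_format, of i] s by linarith
  qed
qed

text \<open>The kernel is at most a multiple of d^-n, and on the ball the L1 norm of u is at most a
  multiple of its L2 norm.\<close>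

lemma mol_sup_bound:
  "\<exists>B>0. \<forall>d u x. 0 < d \<longrightarrow> square_integrable vol u \<longrightarrow> norm (mol d u (\<lambda>_. 0) (x::real^'n)) \<le> B / d ^ CARD('n) * L2n vol u"
proof -
  obtain B where B: "0 < B" "\<And>d z. 0 < d \<Longrightarrow> \<bar>nker d (\<lambda>_. 0) (z::real^'n)\<bar> \<le> B / d ^ CARD('n)" using nker_0_bound by metis
  define V where "V = L2n (vol :: (real^'n) measure) (\<lambda>x. 1 :: complex)"
  have one: "square_integrable (vol :: (real^'n) measure) (\<lambda>x. 1 :: complex)"
    by (rule square_integrable_vol_bounded[of _ 1]) auto
  \<comment> \<open>V + 1 in place of V makes the constant visibly positive.\<close>
  have "norm (mol d u (\<lambda>_. 0) x) \<le> (B * (V + 1)) / d ^ CARD('n) * L2n vol u" if d: "0 < d" and u: "square_integrable vol u" for d u and x :: "real^'n"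
  proof -
    have "norm (mol d u (\<lambda>_. 0) x) \<le> (\<integral>y. norm (u y) * (B / d ^ CARD('n)) \<partial>vol)"
      unfolding mol_def
    proof (rule norm_integral_le[OF mol_integrable[OF d u]])
      show "integrable vol (\<lambda>y. norm (u y) * (B / d ^ CARD('n)))" using square_integrable_vol_integrable[OF u] by simp
      show "norm (u y * complex_of_real (nker d (\<lambda>_. 0) (x - y))) \<le> norm (u y) * (B / d ^ CARD('n))" for y
        unfolding norm_mult norm_of_real by (intro mult_left_mono B(2)[OF d]) simp
    qed
    also have "\<dots> = (\<integral>y. norm (u y) * norm (1::complex) \<partial>vol) * (B / d ^ CARD('n))" by simp
    also have "\<dots> \<le> (L2n vol u * V) * (B / d ^ CARD('n))"
      unfolding V_def using B(1) d by (intro mult_right_mono L2_Cauchy_Schwarz[OF u one]) auto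
    also have "\<dots> \<le> (L2n vol u * (V + 1)) * (B / d ^ CARD('n))"
      using B(1) d by (intro mult_right_mono mult_left_mono) auto
    finally show ?thesis by (simp add: mult_ac)
  qed
  moreover have "0 < B * (V + 1)" using B(1) by (simp add: V_def add_nonneg_pos)
  ultimately show ?thesis by blast
qed

section \<open>The mollification error in L2\<close>

lemma segment_increment:
  fixes f :: "real^'n \<Rightarrow> complex"
  assumes f: "smooth f"
  shows "ennreal ((norm (f x - f (x - z)))\<^sup>2)
    \<le> ennreal ((norm z)\<^sup>2) * (\<integral>\<^sup>+t. indicator {0..1} t * ennreal ((norm (grad f (x - t *\<^sub>R z)))\<^sup>2) \<partial>lborel)"
proof -
  define M where "M = restrict_space lborel {0..1::real}"
  define g where "g t = norm (grad f (x - t *\<^sub>R z))" for t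
  have gc: "continuous_on A g" for A
    unfolding g_def by (intro continuous_on_norm continuous_on_compose2[OF grad_continuous[OF f, of UNIV]] continuous_intros) auto
  have "set_integrable lborel {0..1} g" unfolding set_integrable_def by (rule borel_integrable_compact[OF compact_Icc gc])
  moreover have "set_integrable lborel {0..1} (\<lambda>t. (g t)\<^sup>2)"
    unfolding set_integrable_def by (rule borel_integrable_compact[OF compact_Icc continuous_on_power[OF gc]])
  ultimately have gi: "integrable M g" "integrable M (\<lambda>t. (g t)\<^sup>2)"
    unfolding M_def by (simp_all add: integrable_restrict_space set_integrable_def)
  have gm: "g \<in> borel_measurable M" using gi(1) by simp
  have sq: "square_integrable M g" "square_integrable M (\<lambda>t. 1::real)"
    using gi gm integrable_real_indicator[of "{0..1::real}" lborel]
    by (auto simp: square_integrable_def M_def integrable_restrict_space emeasure_lborel_Icc_eq)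
  have one: "L2n M (\<lambda>t. 1::real) = 1"
    by (simp add: L2n_def M_def measure_restrict_space)
  have "norm (f (x - 1 *\<^sub>R z) - f (x - 0 *\<^sub>R z)) \<le> norm z * (\<integral>t. g t \<partial>M)"
  proof -
    define F where "F t = (\<Sum>i\<in>UNIV. (- z $ i) *\<^sub>R partial i f (x - t *\<^sub>R z))" for t
    have Fc: "continuous_on A F" for A
      unfolding F_def by (intro continuous_intros continuous_on_compose2[OF smooth_continuous[OF smooth_partial[OF f], of UNIV]]) auto
    have "((\<lambda>t. f (x - t *\<^sub>R z)) has_vector_derivative F t) (at t within {0..1})" for t
    proof -
      have 1: "((\<lambda>t. x - t *\<^sub>R z) has_derivative (\<lambda>h. - (h *\<^sub>R z))) (at t)" by (auto intro!: derivative_eq_intros)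
      have "((\<lambda>t. f (x - t *\<^sub>R z)) has_derivative (\<lambda>h. \<Sum>i\<in>UNIV. ((- (h *\<^sub>R z)) $ i) *\<^sub>R partial i f (x - t *\<^sub>R z))) (at t)"
        by (rule has_derivative_compose[OF 1 smooth_has_derivative[OF f]])
      moreover have "(\<lambda>h. \<Sum>i\<in>UNIV. ((- (h *\<^sub>R z)) $ i) *\<^sub>R partial i f (x - t *\<^sub>R z)) = (\<lambda>h. h *\<^sub>R F t)"
        by (rule ext) (simp add: F_def scaleR_sum_right)
      ultimately have "((\<lambda>t. f (x - t *\<^sub>R z)) has_vector_derivative F t) (at t)"
        by (simp only: has_vector_derivative_def)
      then show ?thesis by (rule has_vector_derivative_at_within)
    qed
    then have hi: "(F has_integral f (x - 1 *\<^sub>R z) - f (x - 0 *\<^sub>R z)) {0..1}"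
      by (intro fundamental_theorem_of_calculus) auto
    have ai: "set_integrable lborel {0..1} F" unfolding set_integrable_def by (rule borel_integrable_compact[OF compact_Icc Fc])
    have "f (x - 1 *\<^sub>R z) - f (x - 0 *\<^sub>R z) = (\<integral>t. F t \<partial>M)"
      using hi set_borel_integral_eq_integral(2)[OF ai]
      by (simp add: integral_unique M_def integral_restrict_space set_lebesgue_integral_def)
    also have "norm \<dots> \<le> (\<integral>t. norm z * g t \<partial>M)"
    proof (rule norm_integral_le)
      show "integrable M F" using ai by (simp add: M_def integrable_restrict_space set_integrable_def)
      show "norm (F t) \<le> norm z * g t" for t using norm_directional_le[of "- z" f "x - t *\<^sub>R z"] by (simp add: F_def g_def)
    qed (use gi in simp)
    finally show ?thesis by simp
  qed
  also have "(\<integral>t. g t \<partial>M) \<le> L2n M g * L2n M (\<lambda>t. 1::real)"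
    using L2_Cauchy_Schwarz[OF sq] by (simp add: g_def)
  finally have "norm (f x - f (x - z)) \<le> norm z * L2n M g"
    unfolding one by (simp add: mult_left_mono norm_minus_commute)
  then have "(norm (f x - f (x - z)))\<^sup>2 \<le> (norm z * L2n M g)\<^sup>2"
    by (intro power_mono) auto
  then have "ennreal ((norm (f x - f (x - z)))\<^sup>2) \<le> ennreal ((norm z)\<^sup>2) * ennreal ((L2n M g)\<^sup>2)"
    by (simp add: power_mult_distrib ennreal_mult[symmetric] ennreal_leI)
  also have "ennreal ((L2n M g)\<^sup>2) = (\<integral>\<^sup>+t. ennreal ((g t)\<^sup>2) \<partial>M)"
    using nn_integral_norm_eq_L2n[OF sq(1)] by simp
  also have "\<dots> = (\<integral>\<^sup>+t. ennreal ((g t)\<^sup>2) * indicator {0..1} t \<partial>lborel)"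
    unfolding M_def by (rule nn_integral_restrict_space) simp
  finally show ?thesis by (simp add: g_def mult.commute)
qed

lemma nn_integral_translate:
  fixes g :: "real^'n \<Rightarrow> ennreal"
  assumes [measurable]: "g \<in> borel_measurable borel"
  shows "(\<integral>\<^sup>+x. g (x - a) \<partial>lborel) = (\<integral>\<^sup>+x. g x \<partial>lborel)"
proof -
  have "(\<integral>\<^sup>+x. g x \<partial>lborel) = (\<integral>\<^sup>+x. g x \<partial>distr lborel borel ((+) (- a)))" by (simp add: lborel_distr_plus)
  also have "\<dots> = (\<integral>\<^sup>+x. g (- a + x) \<partial>lborel)" by (rule nn_integral_distr) auto
  finally show ?thesis by (simp add: add.commute)
qed

definition cubeQ :: "real \<Rightarrow> (real^'n) set"
  where "cubeQ r = {x. \<forall>j. \<bar>x $ j\<bar> \<le> r}"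

lemma cubeQ_sets [measurable]: "(cubeQ r :: (real^'n) set) \<in> sets borel"
proof -
  have "(cubeQ r :: (real^'n) set) = cbox (\<chi> j. - r) (\<chi> j. r)" by (auto simp: cubeQ_def mem_box_cart abs_le_iff minus_le_iff)
  then show ?thesis by simp
qed

lemma cubeQ_subset_Omega:
  assumes "r \<le> 1 / real CARD('n)" "2 \<le> CARD('n)" shows "(cubeQ r :: (real^'n) set) \<subseteq> Omega"
  using small_cube_subset_Omega[OF _ assms(2)] assms(1) order_trans unfolding cubeQ_def by blast

text \<open>Integrates \<open>segment_increment\<close> over the cube. Thanks to the margin d all
  points x - t z stay in the ball, so by translation invariance each slice in t is at most the
  gradient integral over the ball.\<close>

lemma translation_bound_nn:
  fixes f :: "real^'n \<Rightarrow> complex"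
  assumes f: "smooth f" and n: "2 \<le> CARD('n)" and r: "r + d \<le> 1 / real CARD('n)" and z: "\<And>i. \<bar>z $ i\<bar> \<le> d"
  shows "(\<integral>\<^sup>+x. indicator (cubeQ r) x * ennreal ((norm (f x - f (x - z)))\<^sup>2) \<partial>lborel)
    \<le> ennreal ((norm z)\<^sup>2) * (\<integral>\<^sup>+x. indicator Omega x * ennreal ((norm (grad f x))\<^sup>2) \<partial>lborel)"
proof -
  have gm [measurable]: "grad f \<in> borel_measurable borel"
    by (rule borel_measurable_continuous_onI[OF grad_continuous[OF f]])
  define G where "G = (\<integral>\<^sup>+x. indicator Omega x * ennreal ((norm (grad f x))\<^sup>2) \<partial>lborel)"
  define k where "k t x = indicator (cubeQ r) x * (indicator {0..1} t * ennreal ((norm (grad f (x - t *\<^sub>R z)))\<^sup>2))"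
    for t :: real and x :: "real^'n"
  have km: "(\<lambda>(t, x). k t x) \<in> borel_measurable (lborel \<Otimes>\<^sub>M lborel)"
  proof -
    have "(\<lambda>(t::real, x::real^'n). k t x) \<in> borel_measurable (borel \<Otimes>\<^sub>M borel)"
      unfolding k_def by measurable
    then show ?thesis by (simp add: measurable_cong_sets[OF sets_pair_measure_cong[OF sets_lborel sets_lborel] refl] cong: measurable_cong_sets)
  qed
  have km2 [measurable]: "(\<lambda>x. \<integral>\<^sup>+t. k t x \<partial>lborel) \<in> borel_measurable borel"
    using lborel.borel_measurable_nn_integral[OF measurable_pair_swap[OF km], simplified] by (simp add: case_prod_unfold)
  have "(\<integral>\<^sup>+x. indicator (cubeQ r) x * ennreal ((norm (f x - f (x - z)))\<^sup>2) \<partial>lborel)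
      \<le> (\<integral>\<^sup>+x. ennreal ((norm z)\<^sup>2) * (\<integral>\<^sup>+t. k t x \<partial>lborel) \<partial>lborel)"
  proof (rule nn_integral_mono)
    fix x :: "real^'n"
    show "indicator (cubeQ r) x * ennreal ((norm (f x - f (x - z)))\<^sup>2) \<le> ennreal ((norm z)\<^sup>2) * (\<integral>\<^sup>+t. k t x \<partial>lborel)"
      using segment_increment[OF f, of x z] by (cases "x \<in> cubeQ r") (simp_all add: k_def)
  qed
  also have "\<dots> = ennreal ((norm z)\<^sup>2) * (\<integral>\<^sup>+x. (\<integral>\<^sup>+t. k t x \<partial>lborel) \<partial>lborel)"
    by (rule nn_integral_cmult) simp
  also have "(\<integral>\<^sup>+x. (\<integral>\<^sup>+t. k t x \<partial>lborel) \<partial>lborel) = (\<integral>\<^sup>+t. (\<integral>\<^sup>+x. k t x \<partial>lborel) \<partial>lborel)"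
    by (rule lborel_pair.Fubini'[OF km])
  also have "\<dots> \<le> (\<integral>\<^sup>+t. indicator {0..1::real} t * G \<partial>lborel)"
  proof (rule nn_integral_mono)
    fix t :: real
    show "(\<integral>\<^sup>+x. k t x \<partial>lborel) \<le> indicator {0..1} t * G"
    proof (cases "t \<in> {0..1}")
      case True
      have "(\<integral>\<^sup>+x. k t x \<partial>lborel) \<le> (\<integral>\<^sup>+x. indicator Omega (x - t *\<^sub>R z) * ennreal ((norm (grad f (x - t *\<^sub>R z)))\<^sup>2) \<partial>lborel)"
      proof (rule nn_integral_mono)
        fix x
        have "x - t *\<^sub>R z \<in> Omega" if x: "x \<in> cubeQ r"
        proof (rule small_cube_subset_Omega[OF _ n])
          fix i
          have "\<bar>t\<bar> * \<bar>z $ i\<bar> \<le> 1 * d" using True z[of i] by (intro mult_mono) auto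
          then have "\<bar>t * z $ i\<bar> \<le> d" by (simp add: abs_mult)
          moreover have "\<bar>x $ i\<bar> \<le> r" using x by (simp add: cubeQ_def)
          ultimately show "\<bar>(x - t *\<^sub>R z) $ i\<bar> \<le> 1 / real CARD('n)" using r by simp
        qed
        then show "k t x \<le> indicator Omega (x - t *\<^sub>R z) * ennreal ((norm (grad f (x - t *\<^sub>R z)))\<^sup>2)"
          using True by (cases "x \<in> cubeQ r") (simp_all add: k_def)
      qed
      also have "\<dots> = G" unfolding G_def
        by (rule nn_integral_translate[of "\<lambda>x. indicator Omega x * ennreal ((norm (grad f x))\<^sup>2)"]) measurable
      finally show ?thesis using True by simp
    qed (simp add: k_def)
  qed
  also have "\<dots> = G" by (simp add: nn_integral_multc)
  finally show ?thesis by (simp add: G_def mult_left_mono)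
qed

lemma integral_reflect:
  fixes f :: "real^'n \<Rightarrow> 'b::{banach,second_countable_topology}"
  assumes [measurable]: "f \<in> borel_measurable borel"
  shows "(\<integral>z. f (x - z) \<partial>lborel) = (\<integral>y. f y \<partial>lborel)"
proof -
  have "lborel = distr lborel borel (\<lambda>z::real^'n. x + (-1) *\<^sub>R z)"
    using lborel_affine[of "-1" x] by (simp add: density_1)
  then have "(\<integral>y. f y \<partial>lborel) = (\<integral>y. f y \<partial>distr lborel borel (\<lambda>z::real^'n. x + (-1) *\<^sub>R z))"
    by simp
  also have "\<dots> = (\<integral>z. f (x + (-1) *\<^sub>R z) \<partial>lborel)" by (rule integral_distr) auto
  finally show ?thesis by simp
qed

text \<open>The kernel is a probability density; Cauchy-Schwarz, with its square root in both
  factors, bounds the square of an average by the average of the squares.\<close>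

lemma mol_difference:
  fixes f :: "real^'n \<Rightarrow> complex"
  assumes f: "smooth f" and n: "2 \<le> CARD('n)" and d: "0 < d" and x: "\<And>i. \<bar>x $ i\<bar> + d \<le> 1 / real CARD('n)"
  shows "ennreal ((norm (f x - mol d f (\<lambda>_. 0) x))\<^sup>2)
    \<le> (\<integral>\<^sup>+z. ennreal (nker d (\<lambda>_. 0) z) * ennreal ((norm (f x - f (x - z)))\<^sup>2) \<partial>lborel)"
proof -
  let ?k = "nker d (\<lambda>_. 0) :: real^'n \<Rightarrow> real"
  have kc: "continuous_on UNIV ?k" by (rule nker_continuous[OF d])
  have fc: "continuous_on UNIV (\<lambda>z. f (x - z))"
    by (rule continuous_on_compose2[OF smooth_continuous[OF f, of UNIV]]) (auto intro!: continuous_intros)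
  define K where "K = (cbox (\<chi> i. - d) (\<chi> i. d) :: (real^'n) set)"
  have K: "compact K" by (simp add: K_def)
  have kK: "?k z = 0" if zK: "z \<notin> K" for z
  proof -
    obtain i where "\<not> (- d \<le> z $ i \<and> z $ i \<le> d)" using zK unfolding K_def mem_box_cart by auto
    then have "d \<le> \<bar>z $ i\<bar>" by arith
    then show ?thesis by (rule nker_outside[OF d])
  qed
  have "mol d f (\<lambda>_. 0) x = (\<integral>y. f y * complex_of_real (?k (x - y)) \<partial>lborel)"
    unfolding mol_def
  proof (rule integral_vol_eq_lborel)
    fix y :: "real^'n" assume y: "y \<notin> Omega"
    \<comment> \<open>A point outside the ball has a coordinate above 1/n in modulus, farther than d
      from that of x, so extending the integral to the whole space adds nothing.\<close>
    then obtain i where i: "1 / real CARD('n) < \<bar>y $ i\<bar>"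
      using small_cube_subset_Omega[OF _ n, of y] not_le by blast
    have "d \<le> \<bar>(x - y) $ i\<bar>" using i x[of i] by simp
    then show "f y * complex_of_real (?k (x - y)) = 0" using nker_outside[OF d, of "x - y" i] by simp
  qed
  also have "\<dots> = (\<integral>z. f (x - z) * complex_of_real (?k (x - (x - z))) \<partial>lborel)"
  proof (rule integral_reflect[symmetric])
    show "(\<lambda>y. f y * complex_of_real (?k (x - y))) \<in> borel_measurable borel"
      by (intro borel_measurable_continuous_onI continuous_on_mult smooth_continuous f mol_continuous_ker d)
  qed
  also have "\<dots> = (\<integral>z. f (x - z) * complex_of_real (?k z) \<partial>lborel)" by simp
  finally have m: "mol d f (\<lambda>_. 0) x = (\<integral>z. f (x - z) * complex_of_real (?k z) \<partial>lborel)" .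
  have i1: "integrable lborel (\<lambda>z. f (x - z) * complex_of_real (?k z))"
    by (rule continuous_compact_support_integrable[OF _ K]) (auto intro!: continuous_intros fc kc simp: kK)
  have i2: "integrable lborel (\<lambda>z. f x * complex_of_real (?k z))"
    by (rule continuous_compact_support_integrable[OF _ K]) (auto intro!: continuous_intros fc kc simp: kK)
  have "(\<integral>z. f x * complex_of_real (?k z) \<partial>lborel) = f x"
    using nker_integral(2)[OF d, where 'n='n] by simp
  then have eq: "f x - mol d f (\<lambda>_. 0) x = (\<integral>z. f x * complex_of_real (?k z) - f (x - z) * complex_of_real (?k z) \<partial>lborel)"
    unfolding m using i1 i2 by simp
  define A where "A z = sqrt (?k z)" for z
  define C where "C z = sqrt (?k z) * norm (f x - f (x - z))" for z
  have k0: "0 \<le> ?k z" for z by (rule nker_nonneg[OF d])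
  have c: "continuous_on UNIV A" "continuous_on UNIV C"
    unfolding A_def C_def by (auto intro!: continuous_intros kc fc)
  have A2: "integrable lborel (\<lambda>z. (norm (A z))\<^sup>2)" and C2: "integrable lborel (\<lambda>z. (norm (C z))\<^sup>2)"
    by (rule continuous_compact_support_integrable[OF _ K]; use kK c in \<open>auto intro!: continuous_intros simp: A_def C_def\<close>)+
  have sq: "square_integrable lborel A" "square_integrable lborel C"
    using A2 C2 borel_measurable_continuous_onI[OF c(1)] borel_measurable_continuous_onI[OF c(2)] by (auto simp: square_integrable_def)
  have "norm (f x - mol d f (\<lambda>_. 0) x) \<le> (\<integral>z. norm (A z) * norm (C z) \<partial>lborel)"
    unfolding eq
  proof (rule norm_integral_le)
    show "norm (f x * complex_of_real (?k z) - f (x - z) * complex_of_real (?k z)) \<le> norm (A z) * norm (C z)" for z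
    proof -
      have "f x * complex_of_real (?k z) - f (x - z) * complex_of_real (?k z) = complex_of_real (?k z) * (f x - f (x - z))"
        by (simp add: algebra_simps)
      then have "norm (f x * complex_of_real (?k z) - f (x - z) * complex_of_real (?k z)) = ?k z * norm (f x - f (x - z))"
        using k0[of z] by (simp add: norm_mult)
      also have "\<dots> = norm (A z) * norm (C z)" using k0[of z] by (simp add: A_def C_def)
      finally show ?thesis by simp
    qed
  qed (use i1 i2 square_integrable_mult_integrable[OF sq] in auto)
  also have "\<dots> \<le> L2n lborel A * L2n lborel C" by (rule L2_Cauchy_Schwarz[OF sq])
  also have "L2n lborel A = 1"
    using nker_integral(2)[OF d, where 'n='n] k0 by (simp add: L2n_def A_def)
  finally have "(norm (f x - mol d f (\<lambda>_. 0) x))\<^sup>2 \<le> (L2n lborel C)\<^sup>2" by (intro power_mono) auto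
  then have "ennreal ((norm (f x - mol d f (\<lambda>_. 0) x))\<^sup>2) \<le> ennreal ((L2n lborel C)\<^sup>2)" by (rule ennreal_leI)
  also have "\<dots> = (\<integral>\<^sup>+z. ennreal ((norm (C z))\<^sup>2) \<partial>lborel)" by (rule nn_integral_norm_eq_L2n[OF sq(2), symmetric])
  also have "\<dots> = (\<integral>\<^sup>+z. ennreal (?k z) * ennreal ((norm (f x - f (x - z)))\<^sup>2) \<partial>lborel)"
    using k0 by (simp add: C_def power_mult_distrib ennreal_mult)
  finally show ?thesis .
qed

text \<open>On the support of the kernel |z|^2 <= n d^2. Exchanging the integrals leaves the
  translation bound averaged over z; the first power of d is the gain from one derivative in
  L2.\<close>

lemma mol_error_smooth:
  fixes f :: "real^'n \<Rightarrow> complex"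
  assumes f: "smooth f" and n: "2 \<le> CARD('n)" and d: "0 < d" and r: "r + d \<le> 1 / real CARD('n)"
  shows "L2n vol (\<lambda>x. indicator (cubeQ r) x *\<^sub>R (f x - mol d f (\<lambda>_. 0) x)) \<le> sqrt (real CARD('n)) * d * L2n vol (sjet f)"
proof -
  let ?k = "nker d (\<lambda>_. 0) :: real^'n \<Rightarrow> real"
  have fs: "square_integrable vol f" by (rule continuous_square_integrable[OF smooth_continuous[OF f]])
  have mc: "continuous_on UNIV (mol d f (\<lambda>_. 0))"
    by (intro continuous_at_imp_continuous_on ballI has_derivative_continuous[OF mol_has_derivative[OF d fs]])
  have km [measurable]: "?k \<in> borel_measurable borel" by (rule borel_measurable_continuous_onI[OF nker_continuous[OF d]])
  have fm [measurable]: "f \<in> borel_measurable borel" by (rule borel_measurable_continuous_onI[OF smooth_continuous[OF f]])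
  have QO: "(cubeQ r :: (real^'n) set) \<subseteq> Omega" by (rule cubeQ_subset_Omega[OF _ n]) (use r d in simp)
  define G where "G = (\<integral>\<^sup>+x. indicator Omega x * ennreal ((norm (grad f x))\<^sup>2) \<partial>lborel)"
  define N where "N = real CARD('n) * d\<^sup>2"
  define h where "h x z = indicator (cubeQ r) x * (ennreal (?k z) * ennreal ((norm (f x - f (x - z)))\<^sup>2))" for x z
  have hm: "(\<lambda>(x, z). h x z) \<in> borel_measurable (lborel \<Otimes>\<^sub>M lborel)"
  proof -
    have "(\<lambda>(x::real^'n, z::real^'n). h x z) \<in> borel_measurable (borel \<Otimes>\<^sub>M borel)"
      unfolding h_def by measurable
    then show ?thesis by (simp add: measurable_cong_sets[OF sets_pair_measure_cong[OF sets_lborel sets_lborel] refl] cong: measurable_cong_sets)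
  qed
  have "(\<integral>\<^sup>+x. indicator (cubeQ r) x * ennreal ((norm (f x - mol d f (\<lambda>_. 0) x))\<^sup>2) \<partial>lborel)
      \<le> (\<integral>\<^sup>+x. (\<integral>\<^sup>+z. h x z \<partial>lborel) \<partial>lborel)"
  proof (rule nn_integral_mono)
    fix x :: "real^'n"
    show "indicator (cubeQ r) x * ennreal ((norm (f x - mol d f (\<lambda>_. 0) x))\<^sup>2) \<le> (\<integral>\<^sup>+z. h x z \<partial>lborel)"
    proof (cases "x \<in> cubeQ r")
      case True
      have "\<bar>x $ i\<bar> + d \<le> 1 / real CARD('n)" for i
      proof -
        have "\<bar>x $ i\<bar> \<le> r" using True by (simp add: cubeQ_def)
        then show ?thesis using r by linarith
      qed
      then show ?thesis using mol_difference[OF f n d, of x] True by (simp add: h_def)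
    qed simp
  qed
  also have "\<dots> = (\<integral>\<^sup>+z. (\<integral>\<^sup>+x. h x z \<partial>lborel) \<partial>lborel)"
    by (rule lborel_pair.Fubini'[OF hm, symmetric])
  also have "\<dots> \<le> (\<integral>\<^sup>+z. ennreal (?k z) * (ennreal N * G) \<partial>lborel)"
  proof (rule nn_integral_mono)
    fix z :: "real^'n"
    show "(\<integral>\<^sup>+x. h x z \<partial>lborel) \<le> ennreal (?k z) * (ennreal N * G)"
    proof (cases "?k z = 0")
      case False
      have zi: "\<bar>z $ i\<bar> \<le> d" for i
      proof (rule ccontr)
        assume "\<not> \<bar>z $ i\<bar> \<le> d"
        then show False using nker_outside[OF d, of z i "\<lambda>_. 0"] False by simp
      qed
      have zN: "(norm z)\<^sup>2 \<le> N"
      proof -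
        have "(norm z)\<^sup>2 = (\<Sum>i\<in>UNIV. \<bar>z $ i\<bar>\<^sup>2)" by (simp add: power2_norm_vec)
        also have "\<dots> \<le> (\<Sum>i\<in>(UNIV::'n set). d\<^sup>2)" by (intro sum_mono power_mono zi) simp
        finally show ?thesis by (simp add: N_def)
      qed
      have "(\<integral>\<^sup>+x. h x z \<partial>lborel) = ennreal (?k z) * (\<integral>\<^sup>+x. indicator (cubeQ r) x * ennreal ((norm (f x - f (x - z)))\<^sup>2) \<partial>lborel)"
        unfolding h_def by (subst nn_integral_cmult[symmetric]) (auto simp: mult_ac)
      also have "\<dots> \<le> ennreal (?k z) * (ennreal ((norm z)\<^sup>2) * G)"
        unfolding G_def by (intro mult_left_mono translation_bound_nn[OF f n r zi]) simp
      also have "\<dots> \<le> ennreal (?k z) * (ennreal N * G)"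
        by (intro mult_left_mono mult_right_mono ennreal_leI zN) auto
      finally show ?thesis .
    qed (simp add: h_def)
  qed
  also have "\<dots> = (\<integral>\<^sup>+z. ennreal (?k z) \<partial>lborel) * (ennreal N * G)"
    by (rule nn_integral_multc) simp
  also have "(\<integral>\<^sup>+z. ennreal (?k z) \<partial>lborel) = 1"
    using nn_integral_eq_integral[OF nker_integral(1)[OF d, where 'n='n] AE_I2[OF nker_nonneg[OF d]]] nker_integral(2)[OF d, where 'n='n] by simp
  also have "1 * (ennreal N * G) \<le> ennreal N * ennreal ((L2n vol (sjet f))\<^sup>2)"
  proof -
    have "G \<le> (\<integral>\<^sup>+x. indicator Omega x * ennreal ((norm (sjet f x))\<^sup>2) \<partial>lborel)"
      unfolding G_def by (intro nn_integral_mono mult_left_mono ennreal_leI) (auto simp: power2_norm_Pair sjet_def)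
    also have "\<dots> = (\<integral>\<^sup>+x. ennreal ((norm (sjet f x))\<^sup>2) \<partial>vol)"
      by (subst nn_integral_restrict_space) (auto simp: mult.commute)
    also have "\<dots> = ennreal ((L2n vol (sjet f))\<^sup>2)" by (rule nn_integral_norm_eq_L2n[OF sjet_square_integrable[OF f]])
    finally show ?thesis by (simp add: mult_left_mono)
  qed
  also have "\<dots> = ennreal ((sqrt (real CARD('n)) * d * L2n vol (sjet f))\<^sup>2)"
    using d by (simp add: N_def ennreal_mult[symmetric] power_mult_distrib)
  finally have *: "(\<integral>\<^sup>+x. indicator (cubeQ r) x * ennreal ((norm (f x - mol d f (\<lambda>_. 0) x))\<^sup>2) \<partial>lborel)
      \<le> ennreal ((sqrt (real CARD('n)) * d * L2n vol (sjet f))\<^sup>2)" .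
  have fmS: "square_integrable vol (\<lambda>x. f x - mol d f (\<lambda>_. 0) x)"
    by (intro square_integrable_diff fs continuous_square_integrable mc)
  have "ennreal ((L2n vol (\<lambda>x. indicator (cubeQ r) x *\<^sub>R (f x - mol d f (\<lambda>_. 0) x)))\<^sup>2) \<le> ennreal ((sqrt (real CARD('n)) * d * L2n vol (sjet f))\<^sup>2)"
    using * nn_integral_indicator_L2n(2)[OF fmS cubeQ_sets QO] by simp
  then have "(L2n vol (\<lambda>x. indicator (cubeQ r) x *\<^sub>R (f x - mol d f (\<lambda>_. 0) x)))\<^sup>2 \<le> (sqrt (real CARD('n)) * d * L2n vol (sjet f))\<^sup>2"
    by (subst (asm) ennreal_le_iff) auto
  then show ?thesis by (rule power2_le_imp_le) (use d in simp)
qed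

lemma mol_diff:
  assumes "0 < d" "square_integrable vol u" "square_integrable vol w"
  shows "mol d (\<lambda>y. u y - w y) \<alpha> x = mol d u \<alpha> x - mol d w \<alpha> x"
  unfolding mol_def using mol_integrable[OF assms(1,2)] mol_integrable[OF assms(1,3)] by (simp add: left_diff_distrib)

lemma L2n_indicator_le:
  fixes f :: "real^'n \<Rightarrow> 'b::{real_normed_vector,second_countable_topology}"
  assumes "square_integrable vol f" "A \<in> sets borel"
  shows "L2n vol (\<lambda>x. indicator A x *\<^sub>R f x) \<le> L2n vol f" "square_integrable vol (\<lambda>x. indicator A x *\<^sub>R f x)"
proof -
  have m: "(\<lambda>x. indicator A x *\<^sub>R f x) \<in> borel_measurable vol"
    by (intro borel_measurable_scaleR borel_measurable_vol square_integrable_meas[OF assms(1)]) (use assms(2) in simp)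
  show "L2n vol (\<lambda>x. indicator A x *\<^sub>R f x) \<le> L2n vol f"
    using L2n_bound[OF assms(1) m, of 1] by (simp add: indicator_def)
  show "square_integrable vol (\<lambda>x. indicator A x *\<^sub>R f x)"
    by (rule square_integrable_bound[OF assms(1) m, of 1]) (simp add: indicator_def)
qed

lemma mol_continuous: "0 < d \<Longrightarrow> square_integrable vol u \<Longrightarrow> continuous_on A (mol d u \<alpha>)"
  by (intro continuous_at_imp_continuous_on ballI has_derivative_continuous[OF mol_has_derivative])

text \<open>By density from the smooth case. The constant C contains d^-n, but it multiplies
  \<open>e k\<close>, which tends to 0 while d is fixed.\<close>

lemma mol_error:
  fixes U :: "'n::finite jet"
  assumes U: "wtrace U g" and n: "2 \<le> CARD('n)" and d: "0 < d" and r: "r + d \<le> 1 / real CARD('n)"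
  shows "L2n vol (\<lambda>x. indicator (cubeQ r) x *\<^sub>R (fst (U x) - mol d (\<lambda>y. fst (U y)) (\<lambda>_. 0) x))
    \<le> sqrt (real CARD('n)) * d * L2n vol U"
proof -
  obtain \<phi> where *: "\<forall>k. smooth (\<phi> k)" "(\<lambda>k. L2n vol (\<lambda>x. sjet (\<phi> k) x - U x)) \<longlonglongrightarrow> 0"
    "(\<lambda>k. L2n surf (\<lambda>x. \<phi> k x - g x)) \<longlonglongrightarrow> 0"
    by (rule wtraceE[OF U])
  note \<phi> = *(1)[rule_format] *(2)
  have sU: "square_integrable vol U" by (rule wtrace_square_integrable[OF U])
  define u where "u = (\<lambda>y. fst (U y))"
  have su: "square_integrable vol u" unfolding u_def by (rule square_integrable_fst[OF sU])
  have sf: "square_integrable vol (\<phi> k)" for k by (rule continuous_square_integrable[OF smooth_continuous[OF \<phi>(1)]])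
  obtain B where B: "0 < B" "\<And>w x. square_integrable vol w \<Longrightarrow> norm (mol d w (\<lambda>_. 0) (x::real^'n)) \<le> B / d ^ CARD('n) * L2n vol w"
    using mol_sup_bound[where 'n='n] d by metis
  define C where "C = B / d ^ CARD('n) * L2n (vol :: (real^'n) measure) (\<lambda>x. 1 :: real)"
  define S where "S = sqrt (real CARD('n)) * d"
  define e where "e k = L2n vol (\<lambda>x. sjet (\<phi> k) x - U x)" for k
  let ?m = "\<lambda>w. mol d w (\<lambda>_. 0)"
  let ?Q = "indicator (cubeQ r) :: real^'n \<Rightarrow> real"
  have sm: "square_integrable vol (?m w)" if "square_integrable vol w" for w
    by (rule continuous_square_integrable[OF mol_continuous[OF d that]])
  have sd: "square_integrable vol (\<lambda>x. u x - \<phi> k x)" for k by (intro square_integrable_diff su sf)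
  have ek: "L2n vol (\<lambda>x. u x - \<phi> k x) \<le> e k" for k
    using L2n_fst_le[OF square_integrable_diff[OF sjet_square_integrable[OF \<phi>(1)] sU], of k]
    unfolding e_def u_def by (simp add: sjet_def L2n_minus_commute[of _ "\<phi> k"])
  have bound: "L2n vol (\<lambda>x. ?Q x *\<^sub>R (u x - ?m u x)) \<le> S * L2n vol U + (1 + S + C) * e k" for k
  proof -
    \<comment> \<open>Three parts: the distance of u to a smooth approximation, the mollification
      error of the latter, and the mollified distance.\<close>
    have eq: "(\<lambda>x. ?Q x *\<^sub>R (u x - ?m u x)) = (\<lambda>x. ?Q x *\<^sub>R (u x - \<phi> k x) + (?Q x *\<^sub>R (\<phi> k x - ?m (\<phi> k) x) + ?Q x *\<^sub>R (?m (\<lambda>y. \<phi> k y - u y) x)))"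
      by (rule ext) (simp add: mol_diff[OF d sf su] scaleR_diff_right)
    have s1: "square_integrable vol (\<lambda>x. ?Q x *\<^sub>R (u x - \<phi> k x))"
      by (rule L2n_indicator_le(2)[OF sd cubeQ_sets])
    have s2: "square_integrable vol (\<lambda>x. ?Q x *\<^sub>R (\<phi> k x - ?m (\<phi> k) x))"
      by (rule L2n_indicator_le(2)[OF square_integrable_diff[OF sf sm[OF sf]] cubeQ_sets])
    have sd': "square_integrable vol (\<lambda>y. \<phi> k y - u y)" by (intro square_integrable_diff su sf)
    have s3: "square_integrable vol (\<lambda>x. ?Q x *\<^sub>R (?m (\<lambda>y. \<phi> k y - u y) x))"
      by (rule L2n_indicator_le(2)[OF sm[OF sd'] cubeQ_sets])
    have one: "square_integrable (vol :: (real^'n) measure) (\<lambda>x. 1 :: real)"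
      by (rule square_integrable_vol_bounded[of _ 1]) auto
    have "L2n vol (\<lambda>x. ?Q x *\<^sub>R (u x - ?m u x)) \<le> L2n vol (\<lambda>x. ?Q x *\<^sub>R (u x - \<phi> k x)) +
        (L2n vol (\<lambda>x. ?Q x *\<^sub>R (\<phi> k x - ?m (\<phi> k) x)) + L2n vol (\<lambda>x. ?Q x *\<^sub>R (?m (\<lambda>y. \<phi> k y - u y) x)))"
      unfolding eq
      by (rule order_trans[OF L2n_triangle[OF s1 square_integrable_add[OF s2 s3]] add_left_mono[OF L2n_triangle[OF s2 s3]]])
    also have "L2n vol (\<lambda>x. ?Q x *\<^sub>R (u x - \<phi> k x)) \<le> e k"
      by (rule order_trans[OF L2n_indicator_le(1)[OF sd cubeQ_sets] ek])
    also have "L2n vol (\<lambda>x. ?Q x *\<^sub>R (\<phi> k x - ?m (\<phi> k) x)) \<le> S * (e k + L2n vol U)"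
    proof -
      have "L2n vol (sjet (\<phi> k)) \<le> e k + L2n vol U"
        unfolding e_def by (rule L2n_triangle2[OF sjet_square_integrable[OF \<phi>(1)] sU])
      then show ?thesis using mol_error_smooth[OF \<phi>(1) n d r, of k] d unfolding S_def
        by (meson mult_left_mono mult_nonneg_nonneg less_imp_le order_trans real_sqrt_ge_zero of_nat_0_le_iff)
    qed
    also have "L2n vol (\<lambda>x. ?Q x *\<^sub>R (?m (\<lambda>y. \<phi> k y - u y) x)) \<le> C * e k"
    proof -
      have "L2n vol (\<lambda>x. ?m (\<lambda>y. \<phi> k y - u y) x) \<le> (B / d ^ CARD('n) * L2n vol (\<lambda>y. \<phi> k y - u y)) * L2n (vol :: (real^'n) measure) (\<lambda>x. 1 :: real)"
        by (rule L2n_bound[OF one square_integrable_meas[OF sm[OF sd']]]) (use B(2)[OF sd'] B(1) d in auto)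
      also have "\<dots> \<le> (B / d ^ CARD('n) * e k) * L2n (vol :: (real^'n) measure) (\<lambda>x. 1 :: real)"
        using ek[of k] B(1) d by (intro mult_right_mono mult_left_mono) (auto simp: L2n_minus_commute[of _ "\<phi> k"])
      finally have "L2n vol (\<lambda>x. ?m (\<lambda>y. \<phi> k y - u y) x) \<le> C * e k" by (simp add: C_def mult_ac)
      then show ?thesis using L2n_indicator_le(1)[OF sm[OF sd'] cubeQ_sets] by (rule order_trans[rotated])
    qed
    finally show ?thesis by (simp add: algebra_simps)
  qed
  have lim: "(\<lambda>k. S * L2n vol U + (1 + S + C) * e k) \<longlonglongrightarrow> S * L2n vol U"
    using tendsto_add[OF tendsto_const tendsto_mult_right_zero[OF \<phi>(2)], of "S * L2n vol U" "1 + S + C"] by (simp add: e_def)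
  have "L2n vol (\<lambda>x. ?Q x *\<^sub>R (u x - ?m u x)) \<le> S * L2n vol U"
    by (rule LIMSEQ_le_const[OF lim]) (use bound in blast)
  then show ?thesis by (simp add: u_def S_def)
qed

section \<open>Low-rank approximation of the Dirichlet-to-Neumann map\<close>

text \<open>The functions \<open>P \<beta>\<close> are scaled so that the coefficients, multiples of \<open>\<partial>\<^sup>\<beta>u(0)\<close> for a mollified
  solution \<open>u\<close>, are at most 1.\<close>

definition cauchy_basis :: "real \<Rightarrow> real \<Rightarrow> 'n::finite \<Rightarrow> nat \<Rightarrow> (('n \<Rightarrow> nat) \<Rightarrow> real^'n \<Rightarrow> real) \<Rightarrow> bool"
  where "cauchy_basis r C p l P \<longleftrightarrow> (\<forall>\<beta>. continuous_on UNIV (P \<beta>)) \<and>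
    (\<forall>\<beta>\<in>cauchy_index p l. \<forall>x\<in>cubeQ r. \<bar>P \<beta> x\<bar> \<le> C * exp ((real CARD('n) + 1) * real l)) \<and>
    (\<forall>U g. wsol (\<lambda>x. 1) U \<longrightarrow> wtrace U g \<longrightarrow> L2n vol U \<le> 6 \<longrightarrow> (\<exists>c :: ('n \<Rightarrow> nat) \<Rightarrow> complex.
      (\<forall>\<beta>\<in>cauchy_index p l. norm (c \<beta>) \<le> 1) \<and>
      L2n vol (\<lambda>x. indicator (cubeQ r) x *\<^sub>R (fst (U x) - (\<Sum>\<beta>\<in>cauchy_index p l. P \<beta> x *\<^sub>R c \<beta>))) \<le> C * exp (- real l)))"

text \<open>Mollification at scale d = e^-l/(2n) has error O(e^-l) and bounds the supremum by A
  e^(nl). The cube is so small that the Taylor remainder gains e^(-(n+1)l), which leaves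
  e^-l.\<close>

lemma solution_low_rank:
  assumes n2: "2 \<le> CARD('n::finite)"
  shows "\<exists>r>0. \<exists>C>0. r \<le> 1 / real CARD('n) \<and>
    (\<forall>l p. 0 < l \<longrightarrow> (\<exists>P :: ('n \<Rightarrow> nat) \<Rightarrow> real^'n \<Rightarrow> real. cauchy_basis r C p l P))"
proof -
  define N where "N = CARD('n)"
  define n where "n = real N"
  have n: "2 \<le> n" using n2 by (simp add: n_def N_def)
  obtain B where B: "0 < B" "\<And>d u x. 0 < d \<Longrightarrow> square_integrable vol u \<Longrightarrow> norm (mol d u (\<lambda>_. 0) (x::real^'n)) \<le> B / d ^ N * L2n vol u"
    unfolding N_def using mol_sup_bound[where 'n='n] by metis
  define V where "V = L2n (vol :: (real^'n) measure) (\<lambda>x. 1 :: real)"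
  have V0: "0 \<le> V" by (simp add: V_def)
  have one: "square_integrable (vol :: (real^'n) measure) (\<lambda>x. 1 :: real)"
    by (rule square_integrable_vol_bounded[of _ 1]) auto
  \<comment> \<open>Half of 1/n: kernels of radius at most 1/(2n) then stay in the cube of half-side
    1/n, which lies in the ball.\<close>
  define s where "s = 1 / (2 * n)"
  \<comment> \<open>Makes 4 n^3 e r/s, the ratio that governs the conditioning, equal to e^(-(n+1)).
    The ratio in the Taylor remainder is smaller by the factor n.\<close>
  define r where "r = exp (- (n + 2)) / (8 * n ^ 4)"
  define A where "A = 6 * B * (2 * n) ^ N"
  define C where "C = 6 * sqrt n + 2 * A * V + A"
  have A0: "0 < A" using B(1) n by (simp add: A_def)
  have C0: "0 < C" unfolding C_def using A0 V0 n by (intro add_nonneg_pos add_nonneg_nonneg) auto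
  have s: "0 < s" "s \<le> 1" using n by (auto simp: s_def)
  have n4: "n \<le> n ^ 4" using n power_increasing[of 1 4 n] by simp
  have r0: "0 < r" using n by (simp add: r_def)
  have "r \<le> 1 / (8 * n ^ 4)" unfolding r_def using n by (intro divide_right_mono) auto
  also have "\<dots> \<le> 1 / (8 * n)" using n n4 by (intro divide_left_mono) auto
  finally have r8: "r \<le> 1 / (8 * n)" .
  have rs: "r < s / 2"
  proof -
    have "1 / (8 * n) < 1 / (4 * n)" using n by (intro divide_strict_left_mono) auto
    then show ?thesis using r8 by (simp add: s_def)
  qed
  have "r \<le> s" using rs s by linarith
  then have r2: "r \<le> 1 / (2 * n)" by (simp add: s_def)
  have ex: "exp (1::real) * exp (- (n + 2)) = exp (- (n + 1))" by (simp add: exp_add[symmetric])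
  have q3: "4 * n ^ 3 * exp 1 * r / s = exp (- (n + 1))"
  proof -
    have "4 * n ^ 3 * exp 1 * r / s = exp 1 * exp (- (n + 2)) * (8 * n ^ 4 / (8 * n ^ 4))"
      by (simp add: s_def r_def power3_eq_cube power4_eq_xxxx)
    also have "\<dots> = exp 1 * exp (- (n + 2))" using n by simp
    also have "\<dots> = exp (- (n + 1))" by (rule ex)
    finally show ?thesis .
  qed
  have q2: "4 * n ^ 2 * exp 1 * r / s \<le> exp (- (n + 1))"
  proof -
    have "4 * n ^ 2 * exp 1 * r / s = (4 * n ^ 3 * exp 1 * r / s) / n" using n by (simp add: power2_eq_square power3_eq_cube)
    also have "\<dots> = exp (- (n + 1)) / n" by (simp only: q3)
    also have "\<dots> \<le> exp (- (n + 1)) / 1" using n by (intro divide_left_mono) auto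
    finally show ?thesis by simp
  qed
  have q20: "0 \<le> 4 * n ^ 2 * exp 1 * r / s" using n r0 s by simp
  have rn: "r \<le> 1 / n" using r2 n by (simp add: field_simps)
  show ?thesis
  proof (rule exI[of _ r], rule conjI[OF r0], rule exI[of _ C], rule conjI[OF C0], intro conjI allI impI)
    show "r \<le> 1 / real CARD('n)" using rn by (simp add: n_def N_def)
    fix l :: nat and p :: 'n assume l: "0 < l"
    let ?I = "cauchy_index p l :: ('n \<Rightarrow> nat) set"
    have small: "4 * real CARD('n) ^ 3 * exp 1 * r / s \<le> 1"
      using q3 n unfolding n_def N_def by simp
    obtain P :: "('n \<Rightarrow> nat) \<Rightarrow> real^'n \<Rightarrow> real" where
      P: "(\<forall>\<beta>. continuous_on UNIV (P \<beta>)) \<and>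
      (\<forall>\<beta>\<in>?I. \<forall>x. (\<forall>j. \<bar>x $ j\<bar> \<le> r) \<longrightarrow>
         (4 * real CARD('n) / s * real (msize \<beta>)) ^ msize \<beta> * \<bar>P \<beta> x\<bar> \<le> real l) \<and>
      (\<forall>v M x. solfam s v \<longrightarrow> (\<forall>y. (\<forall>k. \<bar>y $ k\<bar> < s) \<longrightarrow> norm (v (\<lambda>_. 0) y) \<le> M) \<longrightarrow> (\<forall>j. \<bar>x $ j\<bar> \<le> r) \<longrightarrow>
         norm (v (\<lambda>_. 0) x - (\<Sum>\<beta>\<in>?I. P \<beta> x *\<^sub>R v \<beta> 0)) \<le> 2 * (4 * real CARD('n) ^ 2 * exp 1 * r / s) ^ l * M)"
      by (rule exE[OF solution_approximation[OF s l r0 rs small]])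
    have P2: "(4 * n / s * real (msize \<beta>)) ^ msize \<beta> * \<bar>P \<beta> x\<bar> \<le> real l" if "\<beta> \<in> ?I" "x \<in> cubeQ r" for \<beta> x
      using P that unfolding cubeQ_def n_def N_def by blast
    have P3: "norm (v (\<lambda>_. 0) x - (\<Sum>\<beta>\<in>?I. P \<beta> x *\<^sub>R v \<beta> 0)) \<le> 2 * (4 * n ^ 2 * exp 1 * r / s) ^ l * M"
      if "solfam s v" "\<And>y. (\<And>k. \<bar>y $ k\<bar> < s) \<Longrightarrow> norm (v (\<lambda>_. 0) y) \<le> M" "x \<in> cubeQ r" for v M x
      using P that unfolding cubeQ_def n_def N_def by blast
    define d where "d = exp (- real l) / (2 * n)"
    have d0: "0 < d" using n by (simp add: d_def)
    have d1: "d \<le> 1 / (2 * n)" unfolding d_def using n by (intro divide_right_mono) auto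
    have half: "1 / (2 * n) + 1 / (2 * n) = 1 / n" by simp
    have sd: "s + d \<le> 1 / real CARD('n)" and rd: "r + d \<le> 1 / real CARD('n)"
      using d1 r2 half unfolding s_def n_def[unfolded N_def, symmetric] by linarith+
    define M where "M = A * exp (n * real l)"
    have M0: "0 < M" using A0 by (simp add: M_def)
    \<comment> \<open>6 is the bound on the jet norm built into \<open>cauchy_basis\<close>.\<close>
    have dN: "B / d ^ N * 6 = M"
      using n by (simp add: d_def M_def A_def power_divide exp_minus exp_of_nat_mult[symmetric] n_def power_inverse field_simps)
    \<comment> \<open>The a priori bound for the derivative of order \<beta> at the origin. Dividing
      by it makes the coefficients at most 1 and shifts the size to the basis functions.\<close>
    define b where "b \<beta> = (4 * n / s * real (msize \<beta>)) ^ msize \<beta> * M" for \<beta> :: "'n \<Rightarrow> nat"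
    have b0: "0 < b \<beta>" for \<beta> using M0 n s by (cases "msize \<beta> = 0") (auto simp: b_def)
    show "\<exists>P :: ('n \<Rightarrow> nat) \<Rightarrow> real^'n \<Rightarrow> real. cauchy_basis r C p l P"
      unfolding cauchy_basis_def
    proof (intro exI[of _ "\<lambda>\<beta> x. b \<beta> * P \<beta> x"] conjI allI ballI impI)
      show "continuous_on UNIV (\<lambda>x. b \<beta> * P \<beta> x)" for \<beta>
        using P by (intro continuous_intros) blast
    next
      fix \<beta> :: "'n \<Rightarrow> nat" and x :: "real^'n" assume *: "\<beta> \<in> ?I" "x \<in> cubeQ r"
      have "\<bar>b \<beta> * P \<beta> x\<bar> = ((4 * n / s * real (msize \<beta>)) ^ msize \<beta> * \<bar>P \<beta> x\<bar>) * M"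
        using b0[of \<beta>] by (simp add: abs_mult) (simp add: b_def)
      also have "\<dots> \<le> real l * M" using P2[OF *] M0 by (intro mult_right_mono) auto
      \<comment> \<open>The factor l is absorbed by one more exponential; hence n + 1 in the
        exponent of \<open>cauchy_basis\<close>.\<close>
      also have "\<dots> \<le> exp (real l) * M"
      proof (rule mult_right_mono)
        show "real l \<le> exp (real l)" using exp_ge_add_one_self[of "real l"] by linarith
      qed (use M0 in simp)
      also have "\<dots> = A * exp ((n + 1) * real l)" by (simp add: M_def exp_add[symmetric] algebra_simps)
      also have "\<dots> \<le> C * exp ((n + 1) * real l)"
        unfolding C_def using A0 V0 n by (intro mult_right_mono) auto
      finally show "\<bar>b \<beta> * P \<beta> x\<bar> \<le> C * exp ((real CARD('n) + 1) * real l)" by (simp add: n_def N_def)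
    next
      fix U :: "'n jet" and g :: "real^'n \<Rightarrow> complex" assume U: "wsol (\<lambda>x. 1) U" "wtrace U g" "L2n vol U \<le> 6"
      have sU: "square_integrable vol U" by (rule wtrace_square_integrable[OF U(2)])
      define u where "u = (\<lambda>y. fst (U y))"
      have su: "square_integrable vol u" unfolding u_def by (rule square_integrable_fst[OF sU])
      define v where "v = mol d u"
      have vf: "solfam s v" unfolding v_def u_def by (rule mol_solfam[OF U(1) d0 sd n2])
      have vM: "norm (v (\<lambda>_. 0) y) \<le> M" for y
      proof -
        have "norm (v (\<lambda>_. 0) y) \<le> B / d ^ N * L2n vol u" unfolding v_def by (rule B(2)[OF d0 su])
        also have "\<dots> \<le> B / d ^ N * 6"
          using L2n_fst_le[OF sU] U(3) B(1) d0 unfolding u_def by (intro mult_left_mono) auto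
        finally show ?thesis by (simp only: dN)
      qed
      define c where "c \<beta> = v \<beta> 0 / complex_of_real (b \<beta>)" for \<beta>
      show "\<exists>c :: ('n \<Rightarrow> nat) \<Rightarrow> complex. (\<forall>\<beta>\<in>?I. norm (c \<beta>) \<le> 1) \<and>
        L2n vol (\<lambda>x. indicator (cubeQ r) x *\<^sub>R (fst (U x) - (\<Sum>\<beta>\<in>?I. (b \<beta> * P \<beta> x) *\<^sub>R c \<beta>))) \<le> C * exp (- real l)"
      proof (intro exI[of _ c] conjI ballI)
        fix \<beta> :: "'n \<Rightarrow> nat" assume "\<beta> \<in> ?I"
        have "norm (v \<beta> 0) \<le> b \<beta>"
          using solfam_derivative_bound[OF vf s(1) vM, of 0 \<beta>] s unfolding b_def n_def N_def by simp
        then show "norm (c \<beta>) \<le> 1" using b0[of \<beta>] by (simp add: c_def norm_divide)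
      next
        define S where "S x = (\<Sum>\<beta>\<in>?I. P \<beta> x *\<^sub>R v \<beta> 0)" for x
        have Sc: "continuous_on UNIV S" unfolding S_def using P by (intro continuous_intros) blast
        have eqS: "(\<Sum>\<beta>\<in>?I. (b \<beta> * P \<beta> x) *\<^sub>R c \<beta>) = S x" for x
          unfolding S_def
        proof (rule sum.cong[OF refl])
          fix \<beta>
          have "complex_of_real (b \<beta>) \<noteq> 0" using b0[of \<beta>] by simp
          then show "(b \<beta> * P \<beta> x) *\<^sub>R c \<beta> = P \<beta> x *\<^sub>R v \<beta> 0"
            by (simp add: c_def scaleR_conv_of_real)
        qed
        let ?Q = "indicator (cubeQ r) :: real^'n \<Rightarrow> real"
        have sv: "square_integrable vol (v (\<lambda>_. 0))" "square_integrable vol S"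
          unfolding v_def by (intro continuous_square_integrable mol_continuous d0 su Sc)+
        have s1: "square_integrable vol (\<lambda>x. ?Q x *\<^sub>R (u x - v (\<lambda>_. 0) x))"
          by (rule L2n_indicator_le(2)[OF square_integrable_diff[OF su sv(1)] cubeQ_sets])
        have s2: "square_integrable vol (\<lambda>x. ?Q x *\<^sub>R (v (\<lambda>_. 0) x - S x))"
          by (rule L2n_indicator_le(2)[OF square_integrable_diff[OF sv] cubeQ_sets])
        have "(\<lambda>x. ?Q x *\<^sub>R (u x - S x)) = (\<lambda>x. ?Q x *\<^sub>R (u x - v (\<lambda>_. 0) x) + ?Q x *\<^sub>R (v (\<lambda>_. 0) x - S x))"
          by (rule ext) (simp add: scaleR_diff_right)
        then have "L2n vol (\<lambda>x. ?Q x *\<^sub>R (u x - S x)) \<le> L2n vol (\<lambda>x. ?Q x *\<^sub>R (u x - v (\<lambda>_. 0) x)) + L2n vol (\<lambda>x. ?Q x *\<^sub>R (v (\<lambda>_. 0) x - S x))"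
          using L2n_triangle[OF s1 s2] by simp
        also have "L2n vol (\<lambda>x. ?Q x *\<^sub>R (u x - v (\<lambda>_. 0) x)) \<le> sqrt n * d * 6"
        proof -
          have "L2n vol (\<lambda>x. ?Q x *\<^sub>R (u x - v (\<lambda>_. 0) x)) \<le> sqrt n * d * L2n vol U"
            using mol_error[OF U(2) n2 d0 rd] unfolding u_def v_def n_def N_def .
          also have "\<dots> \<le> sqrt n * d * 6" using U(3) d0 n by (intro mult_left_mono) auto
          finally show ?thesis .
        qed
        also have "sqrt n * d * 6 \<le> 6 * sqrt n * exp (- real l)"
        proof -
          have "d \<le> exp (- real l) / 1" unfolding d_def using n by (intro divide_left_mono) auto
          then have "(6 * sqrt n) * d \<le> (6 * sqrt n) * exp (- real l)" using n by (intro mult_left_mono) auto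
          then show ?thesis by (simp add: mult_ac)
        qed
        also have "L2n vol (\<lambda>x. ?Q x *\<^sub>R (v (\<lambda>_. 0) x - S x)) \<le> (2 * A * exp (- real l)) * V"
          unfolding V_def
        proof (rule L2n_bound[OF one square_integrable_meas[OF s2]])
          show "0 \<le> 2 * A * exp (- real l)" using A0 by simp
          show "AE x in vol. norm (?Q x *\<^sub>R (v (\<lambda>_. 0) x - S x)) \<le> (2 * A * exp (- real l)) * norm (1::real)"
          proof (rule AE_I2)
            fix x :: "real^'n"
            show "norm (?Q x *\<^sub>R (v (\<lambda>_. 0) x - S x)) \<le> (2 * A * exp (- real l)) * norm (1::real)"
            proof (cases "x \<in> cubeQ r")
              case True
              have "norm (v (\<lambda>_. 0) x - S x) \<le> 2 * (4 * n ^ 2 * exp 1 * r / s) ^ l * M"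
                unfolding S_def by (rule P3[OF vf vM True])
              also have "\<dots> \<le> 2 * exp (- (n + 1)) ^ l * M"
                using q2 q20 M0 by (intro mult_right_mono mult_left_mono power_mono) auto
              also have "\<dots> = 2 * A * exp (- real l)"
              proof -
                have "exp (- (n + 1)) ^ l = exp (real l * (- (n + 1)))" by (rule exp_of_nat_mult[symmetric])
                then show ?thesis by (simp add: M_def exp_add[symmetric] algebra_simps)
              qed
              finally show ?thesis using True by simp
            qed (use A0 in simp)
          qed
        qed
        also have "6 * sqrt n * exp (- real l) + 2 * A * exp (- real l) * V \<le> C * exp (- real l)"
          using A0 by (simp add: C_def algebra_simps)
        finally show "L2n vol (\<lambda>x. ?Q x *\<^sub>R (fst (U x) - (\<Sum>\<beta>\<in>?I. (b \<beta> * P \<beta> x) *\<^sub>R c \<beta>))) \<le> C * exp (- real l)"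
          unfolding eqS u_def by simp
      qed
    qed
  qed
qed

subsection \<open>Perturbations of the potential supported in a cube\<close>

text \<open>The difference between the energy forms of q and of the constant 1, see
  \<open>en_minus_en_1\<close>.\<close>

definition qpair :: "(real^'n \<Rightarrow> real) \<Rightarrow> (real^'n \<Rightarrow> complex) \<Rightarrow> (real^'n \<Rightarrow> complex) \<Rightarrow> complex"
  where "qpair q w v = (\<integral>x. complex_of_real (q x - 1) * w x * cnj (v x) \<partial>vol)"

text \<open>\<open>qsource q w\<close> represents the functional \<open>qpair q w\<close> with respect to the energy form of \<open>q\<close>.\<close>

definition qsource :: "(real^'n \<Rightarrow> real) \<Rightarrow> (real^'n \<Rightarrow> complex) \<Rightarrow> 'n::finite jet"
  where "qsource q w x = (complex_of_real ((q x - 1) / q x) * w x, 0)"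

definition local_pot :: "real \<Rightarrow> (real^'n \<Rightarrow> real) \<Rightarrow> bool"
  where "local_pot r q \<longleftrightarrow> pot q \<and> (\<forall>x\<in>Omega. x \<notin> cubeQ r \<longrightarrow> q x = 1)"

lemma local_pot_pot: "local_pot r q \<Longrightarrow> pot q" by (simp add: local_pot_def)

lemma local_pot_bound:
  assumes "local_pot r q" "x \<in> Omega"
  shows "\<bar>q x - 1\<bar> \<le> indicator (cubeQ r) x"
  using potD[OF local_pot_pot[OF assms(1)] assms(2)] assms by (cases "x \<in> cubeQ r") (auto simp: local_pot_def)

lemma complex_of_real_measurable: "f \<in> borel_measurable M \<Longrightarrow> (\<lambda>x. complex_of_real (f x)) \<in> borel_measurable M"
  by (rule borel_measurable_continuous_on[OF continuous_on_of_real[OF continuous_on_id]])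

lemma qsource_measurable:
  assumes "pot q" "w \<in> borel_measurable vol" shows "qsource q w \<in> borel_measurable vol"
  unfolding qsource_def[abs_def]
  by (intro borel_measurable_Pair borel_measurable_times complex_of_real_measurable borel_measurable_divide
      borel_measurable_diff borel_measurable_const pot_measurable[OF assms(1)] assms(2))

lemma norm_qsource_le:
  assumes "local_pot r q" "x \<in> Omega"
  shows "norm (qsource q w x) \<le> norm (indicator (cubeQ r) x *\<^sub>R w x)"
proof -
  have q: "1 \<le> q x" using potD[OF local_pot_pot[OF assms(1)] assms(2)] by simp
  have "\<bar>(q x - 1) / q x\<bar> \<le> indicator (cubeQ r) x"
  proof -
    have "\<bar>(q x - 1) / q x\<bar> \<le> \<bar>q x - 1\<bar> / 1"
      unfolding abs_divide using q by (intro divide_left_mono) auto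
    also have "\<dots> \<le> indicator (cubeQ r) x" using local_pot_bound[OF assms] by simp
    finally show ?thesis .
  qed
  then have "\<bar>(q x - 1) / q x\<bar> * norm (w x) \<le> indicator (cubeQ r) x * norm (w x)" by (rule mult_right_mono) simp
  moreover have "norm (qsource q w x) = norm (complex_of_real ((q x - 1) / q x) * w x)"
    unfolding qsource_def norm_Pair by simp
  ultimately show ?thesis unfolding norm_mult norm_of_real norm_scaleR by simp
qed

lemma qsource_square_integrable:
  assumes q: "local_pot r q" and w: "square_integrable vol (\<lambda>x. indicator (cubeQ r) x *\<^sub>R w x)" "w \<in> borel_measurable vol"
  shows "square_integrable vol (qsource q w)" "L2n vol (qsource q w) \<le> L2n vol (\<lambda>x. indicator (cubeQ r) x *\<^sub>R w x)"
proof -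
  have m: "qsource q w \<in> borel_measurable vol" by (rule qsource_measurable[OF local_pot_pot[OF q] w(2)])
  have b: "AE x in vol. norm (qsource q w x) \<le> 1 * norm (indicator (cubeQ r) x *\<^sub>R w x)"
    using norm_qsource_le[OF q] by (intro AE_I2) simp
  show "square_integrable vol (qsource q w)" by (rule square_integrable_bound[OF w(1) m b])
  show "L2n vol (qsource q w) \<le> L2n vol (\<lambda>x. indicator (cubeQ r) x *\<^sub>R w x)"
    using L2n_bound[OF w(1) m _ b] by simp
qed

lemma en_qsource:
  assumes "pot q" shows "en q (qsource q w) V = qpair q w (\<lambda>x. fst (V x))"
  unfolding en_def qpair_def
proof (rule Bochner_Integration.integral_cong[OF refl])
  fix x :: "real^'a" assume "x \<in> space vol"
  then have "1 \<le> q x" using potD[OF assms] unfolding space_vol by blast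
  then have q0: "q x \<noteq> 0" by auto
  then have "q x * ((q x - 1) / q x) = q x - 1" by simp
  then have "complex_of_real (q x) * complex_of_real ((q x - 1) / q x) = complex_of_real (q x - 1)"
    by (metis of_real_mult)
  then show "energy_density (q x) (qsource q w x) (V x) = complex_of_real (q x - 1) * w x * cnj (fst (V x))"
    using q0 by (simp add: energy_density_def qsource_def mult.assoc[symmetric])
qed

lemma qpair_integrable:
  assumes q: "local_pot r q" and w: "square_integrable vol w" and v: "square_integrable vol v"
  shows "integrable vol (\<lambda>x. complex_of_real (q x - 1) * w x * cnj (v x))"
proof (rule Bochner_Integration.integrable_bound[OF square_integrable_mult_integrable[OF w v]])
  show "(\<lambda>x. complex_of_real (q x - 1) * w x * cnj (v x)) \<in> borel_measurable vol"
    by (intro borel_measurable_times complex_of_real_measurable borel_measurable_diff borel_measurable_const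
        pot_measurable[OF local_pot_pot[OF q]] square_integrable_meas[OF w]
        borel_measurable_continuous_on[OF continuous_on_cnj[OF continuous_on_id] square_integrable_meas[OF v]])
  show "AE x in vol. norm (complex_of_real (q x - 1) * w x * cnj (v x)) \<le> norm (norm (w x) * norm (v x))"
  proof (rule AE_I2)
    fix x :: "real^'a" assume "x \<in> space vol"
    then have "\<bar>q x - 1\<bar> \<le> indicator (cubeQ r) x" using local_pot_bound[OF q] unfolding space_vol by blast
    then have "\<bar>q x - 1\<bar> \<le> 1" by (cases "x \<in> cubeQ r") auto
    then have "\<bar>q x - 1\<bar> * (norm (w x) * norm (v x)) \<le> 1 * (norm (w x) * norm (v x))"
      by (intro mult_right_mono) auto
    then show "norm (complex_of_real (q x - 1) * w x * cnj (v x)) \<le> norm (norm (w x) * norm (v x))"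
      unfolding norm_mult norm_of_real complex_mod_cnj by (simp add: mult.assoc)
  qed
qed

lemma norm_qpair_le:
  assumes q: "local_pot r q" and w: "square_integrable vol w" and v: "square_integrable vol v"
  shows "norm (qpair q w v) \<le> L2n vol (\<lambda>x. indicator (cubeQ r) x *\<^sub>R w x) * L2n vol (\<lambda>x. indicator (cubeQ r) x *\<^sub>R v x)"
proof -
  let ?Q = "indicator (cubeQ r) :: real^'a \<Rightarrow> real"
  have s: "square_integrable vol (\<lambda>x. ?Q x *\<^sub>R w x)" "square_integrable vol (\<lambda>x. ?Q x *\<^sub>R v x)"
    by (rule L2n_indicator_le(2)[OF _ cubeQ_sets], fact)+
  have "norm (qpair q w v) \<le> (\<integral>x. norm (complex_of_real (q x - 1) * w x * cnj (v x)) \<partial>vol)"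
    unfolding qpair_def by (rule integral_norm_bound)
  also have "\<dots> \<le> (\<integral>x. norm (?Q x *\<^sub>R w x) * norm (?Q x *\<^sub>R v x) \<partial>vol)"
  proof (rule integral_mono)
    show "integrable vol (\<lambda>x. norm (complex_of_real (q x - 1) * w x * cnj (v x)))"
      using qpair_integrable[OF assms] by simp
    show "integrable vol (\<lambda>x. norm (?Q x *\<^sub>R w x) * norm (?Q x *\<^sub>R v x))"
      by (rule square_integrable_mult_integrable[OF s])
    fix x :: "real^'a" assume "x \<in> space vol"
    then have "\<bar>q x - 1\<bar> \<le> ?Q x" using local_pot_bound[OF q] unfolding space_vol by blast
    then have "\<bar>q x - 1\<bar> * (norm (w x) * norm (v x)) \<le> ?Q x * (norm (w x) * norm (v x))"
      by (intro mult_right_mono) auto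
    also have "\<dots> = norm (?Q x *\<^sub>R w x) * norm (?Q x *\<^sub>R v x)" by (simp add: indicator_def)
    finally show "norm (complex_of_real (q x - 1) * w x * cnj (v x)) \<le> norm (?Q x *\<^sub>R w x) * norm (?Q x *\<^sub>R v x)"
      unfolding norm_mult[of _ "cnj _"] norm_mult[of "complex_of_real _"] norm_of_real complex_mod_cnj by (simp only: mult.assoc)
  qed
  also have "\<dots> \<le> L2n vol (\<lambda>x. ?Q x *\<^sub>R w x) * L2n vol (\<lambda>x. ?Q x *\<^sub>R v x)"
    by (rule L2_Cauchy_Schwarz[OF s])
  finally show ?thesis .
qed

lemma en_minus_en_1:
  assumes q: "local_pot r q" and W: "square_integrable vol W" and V: "square_integrable vol V"
  shows "en q W V - en (\<lambda>x. 1) W V = qpair q (\<lambda>x. fst (W x)) (\<lambda>x. fst (V x))"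
proof -
  have "en q W V - en (\<lambda>x. 1) W V = (\<integral>x. energy_density (q x) (W x) (V x) - energy_density 1 (W x) (V x) \<partial>vol)"
    unfolding en_def using en_integrable[OF local_pot_pot[OF q] W V] en_integrable[OF pot_const W V] by simp
  also have "\<dots> = qpair q (\<lambda>x. fst (W x)) (\<lambda>x. fst (V x))"
    unfolding qpair_def by (rule Bochner_Integration.integral_cong) (auto simp: energy_density_def algebra_simps)
  finally show ?thesis .
qed

lemma le_of_square_le:
  fixes x a :: real
  assumes "x\<^sup>2 \<le> 3 * (a * x)" "0 \<le> x" "0 \<le> a" shows "x \<le> 3 * a"
proof (cases "x = 0")
  case False
  then show ?thesis using assms by (simp add: power2_eq_square mult.assoc[symmetric])
qed (use assms in simp)

text \<open>The equation is tested with Z itself, a limit of test functions, and combined with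
  coercivity.\<close>

lemma H10_solution_bound:
  assumes q: "pot q" and R: "square_integrable vol R" and Z: "H10 Z"
    and eq: "\<And>\<psi>. test_function \<psi> \<Longrightarrow> en q (\<lambda>x. R x + Z x) (sjet \<psi>) = 0"
  shows "L2n vol Z \<le> 3 * L2n vol R"
proof -
  have sZ: "square_integrable vol Z" by (rule H10_square_integrable[OF Z])
  have "en q (\<lambda>x. R x + Z x) Z = 0" by (rule en_H10_eq_0[OF q square_integrable_add[OF R sZ] eq Z])
  then have "en q Z Z = - en q R Z" using en_add_left[OF q R sZ sZ] by (simp add: eq_neg_iff_add_eq_0 add.commute)
  then have "Re (en q Z Z) \<le> norm (en q R Z)" using complex_Re_le_cmod[of "- en q R Z"] by simp
  then have "(L2n vol Z)\<^sup>2 \<le> 3 * (L2n vol R * L2n vol Z)"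
    using L2n_sq_le_en[OF q sZ] norm_en_le[OF q R sZ] by linarith
  then show ?thesis by (rule le_of_square_le) auto
qed

text \<open>An extension of the boundary data is corrected by an element of H^1_0. The constant 3 is
  the one in \<open>norm_en_le\<close>.\<close>

lemma dirichlet_solution:
  assumes q: "pot q" and U0: "wtrace U0 g"
  shows "\<exists>Z. H10 Z \<and> wsol q (\<lambda>x. U0 x + Z x) \<and> wtrace (\<lambda>x. U0 x + Z x) g \<and> L2n vol (\<lambda>x. U0 x + Z x) \<le> 3 * L2n vol U0"
proof -
  have s0: "square_integrable vol U0" by (rule wtrace_square_integrable[OF U0])
  obtain Z where Z: "H10 Z" "\<forall>\<psi>. test_function \<psi> \<longrightarrow> en q (\<lambda>x. U0 x + Z x) (sjet \<psi>) = 0"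
    using H10_projection[OF q s0] by blast
  let ?U = "\<lambda>x. U0 x + Z x"
  have t: "wtrace ?U g" by (rule wtrace_add_H10[OF U0 Z(1)])
  have sZ: "square_integrable vol Z" by (rule H10_square_integrable[OF Z(1)])
  have sU: "square_integrable vol ?U" by (rule square_integrable_add[OF s0 sZ])
  have w: "wsol q ?U" using Z(2) wtrace_wjet[OF t] by (simp add: wsol_def)
  have "en q ?U ?U = en q ?U U0" using en_add_right[OF q sU s0 sZ] wsol_H10_orth[OF q w Z(1)] by simp
  then have "Re (en q ?U ?U) \<le> norm (en q ?U U0)" using complex_Re_le_cmod by metis
  then have "(L2n vol ?U)\<^sup>2 \<le> 3 * (L2n vol U0 * L2n vol ?U)"
    using L2n_sq_le_en[OF q sU] norm_en_le[OF q sU s0] by (simp add: mult.commute)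
  then have "L2n vol ?U \<le> 3 * L2n vol U0" by (rule le_of_square_le) auto
  then show ?thesis using Z(1) w t by blast
qed

text \<open>The quotient norm is an infimum that may not be attained, so an extension of norm below
  2 is used; passing to the solution multiplies the bound by 3.\<close>

lemma H_half_extension:
  assumes "g \<in> H_half" "H_half_norm g \<le> 1"
  shows "\<exists>U. wsol (\<lambda>x. 1) U \<and> wtrace U g \<and> L2n vol U \<le> 6"
proof -
  have ne: "{H1_norm u |u. has_trace u g} \<noteq> {}" using assms(1) by (auto simp: H_half_def)
  have "Inf {H1_norm u |u. has_trace u g} < 2" using assms(2) by (simp add: H_half_norm_def)
  from cInf_lessD[OF ne this] obtain u where u: "has_trace u g" "H1_norm u < 2" by auto
  have t: "wtrace (jet u) g" by (rule has_trace_wtrace[OF u(1)])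
  have "L2n vol (jet u) < 2" using u H1_norm_eq[of u] by (simp add: has_trace_def)
  then show ?thesis using dirichlet_solution[OF pot_const t] by fastforce
qed

lemma qpair_add_left:
  assumes "local_pot r q" "square_integrable vol w" "square_integrable vol w'" "square_integrable vol v"
  shows "qpair q (\<lambda>x. w x + w' x) v = qpair q w v + qpair q w' v"
  using qpair_integrable[OF assms(1,2,4)] qpair_integrable[OF assms(1,3,4)]
  unfolding qpair_def by (simp add: algebra_simps flip: Bochner_Integration.integral_add)

lemma qpair_add_right:
  assumes "local_pot r q" "square_integrable vol w" "square_integrable vol v" "square_integrable vol v'"
  shows "qpair q w (\<lambda>x. v x + v' x) = qpair q w v + qpair q w v'"
  using qpair_integrable[OF assms(1,2,3)] qpair_integrable[OF assms(1,2,4)]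
  unfolding qpair_def by (simp add: algebra_simps flip: Bochner_Integration.integral_add)

lemma square_integrable_cmult:
  fixes w :: "'a \<Rightarrow> complex"
  shows "square_integrable M w \<Longrightarrow> square_integrable M (\<lambda>x. c * w x)"
  by (rule square_integrable_bound[of M w _ "norm c"]) (auto simp: square_integrable_def norm_mult)

lemma qpair_cmult_left: "qpair q (\<lambda>x. c * w x) v = c * qpair q w v"
  unfolding qpair_def by (simp add: mult.left_commute mult.assoc flip: integral_mult_right_zero)

lemma qpair_cmult_right: "qpair q w (\<lambda>x. c * v x) = cnj c * qpair q w v"
  unfolding qpair_def by (simp add: mult.left_commute mult.assoc flip: integral_mult_right_zero)

lemma qpair_zero [simp]: "qpair q (\<lambda>x. 0) v = 0" "qpair q w (\<lambda>x. 0) = 0"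
  by (simp_all add: qpair_def)

lemma square_integrable_sum_on:
  assumes "\<And>i. i \<in> I \<Longrightarrow> square_integrable M (w i)"
  shows "square_integrable M (\<lambda>x. \<Sum>i\<in>I. c i * w i x :: complex)"
  by (intro square_integrable_sum square_integrable_cmult assms)

lemma qpair_sum_left:
  assumes "local_pot r q" "\<And>i. i \<in> I \<Longrightarrow> square_integrable vol (w i)" "square_integrable vol v"
  shows "qpair q (\<lambda>x. \<Sum>i\<in>I. c i * w i x) v = (\<Sum>i\<in>I. c i * qpair q (w i) v)"
  using assms(2)
proof (induction I rule: infinite_finite_induct)
  case (insert i I)
  have "qpair q (\<lambda>x. c i * w i x + (\<Sum>i\<in>I. c i * w i x)) v = qpair q (\<lambda>x. c i * w i x) v + qpair q (\<lambda>x. \<Sum>i\<in>I. c i * w i x) v"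
    by (rule qpair_add_left[OF assms(1) _ _ assms(3)]) (use insert in \<open>auto intro: square_integrable_cmult square_integrable_sum_on\<close>)
  then show ?case using insert by (simp add: qpair_cmult_left)
qed auto

lemma qpair_sum_right:
  assumes "local_pot r q" "square_integrable vol w" "\<And>i. i \<in> I \<Longrightarrow> square_integrable vol (v i)"
  shows "qpair q w (\<lambda>x. \<Sum>i\<in>I. c i * v i x) = (\<Sum>i\<in>I. cnj (c i) * qpair q w (v i))"
  using assms(3)
proof (induction I rule: infinite_finite_induct)
  case (insert i I)
  have "qpair q w (\<lambda>x. c i * v i x + (\<Sum>i\<in>I. c i * v i x)) = qpair q w (\<lambda>x. c i * v i x) + qpair q w (\<lambda>x. \<Sum>i\<in>I. c i * v i x)"
    by (rule qpair_add_right[OF assms(1) assms(2)]) (use insert in \<open>auto intro: square_integrable_cmult square_integrable_sum_on\<close>)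
  then show ?case using insert by (simp add: qpair_cmult_right)
qed auto

lemma fst_sum_cmul: "fst (\<Sum>i\<in>I. cmul (c i) (Z i)) = (\<Sum>i\<in>I. c i * fst (Z i))"
  by (induction I rule: infinite_finite_induct) auto

text \<open>An identity of Alessandrini type. The solution for q is U + Z. In the form of the
  potential 1, Z is orthogonal to V because Z lies in H^1_0 and V is a solution; so both pairings
  can be written with U + Z and V, and only q - 1 remains.\<close>

lemma DN_map_difference:
  assumes q: "local_pot r q" and U: "wsol (\<lambda>x. 1) U" "wtrace U g" and V: "wsol (\<lambda>x. 1) V" "wtrace V f"
    and Z: "H10 Z" "\<And>\<psi>. test_function \<psi> \<Longrightarrow> en q (\<lambda>x. qsource q (\<lambda>x. fst (U x)) x + Z x) (sjet \<psi>) = 0"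
  shows "DN_map q g f - DN_map (\<lambda>x. 1) g f = qpair q (\<lambda>x. fst (U x) + fst (Z x)) (\<lambda>x. fst (V x))"
proof -
  note p = local_pot_pot[OF q]
  have sU: "square_integrable vol U" and sV: "square_integrable vol V" and sZ: "square_integrable vol Z"
    using U V Z by (auto intro: wtrace_square_integrable H10_square_integrable)
  let ?W = "\<lambda>x. U x + Z x"
  have sW: "square_integrable vol ?W" by (rule square_integrable_add[OF sU sZ])
  have sfU: "square_integrable vol (\<lambda>x. indicator (cubeQ r) x *\<^sub>R fst (U x))"
    by (rule L2n_indicator_le(2)[OF square_integrable_fst[OF sU] cubeQ_sets])
  have sR: "square_integrable vol (qsource q (\<lambda>x. fst (U x)))"
    by (rule qsource_square_integrable(1)[OF q sfU square_integrable_meas[OF square_integrable_fst[OF sU]]])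
  have tW: "wtrace ?W g" by (rule wtrace_add_H10[OF U(2) Z(1)])
  have "en q ?W (sjet \<psi>) = 0" if \<psi>: "test_function \<psi>" for \<psi>
  proof -
    have "en (\<lambda>x. 1) U (sjet \<psi>) = 0" using U(1) \<psi> by (simp add: wsol_def)
    then have "en q U (sjet \<psi>) = en q (qsource q (\<lambda>x. fst (U x))) (sjet \<psi>)"
      using en_minus_en_1[OF q sU test_sjet[OF \<psi>]] en_qsource[OF p, of "\<lambda>x. fst (U x)" "sjet \<psi>"] by simp
    then show ?thesis
      using Z(2)[OF \<psi>] en_add_left[OF p sU sZ test_sjet[OF \<psi>]] en_add_left[OF p sR sZ test_sjet[OF \<psi>]] by simp
  qed
  then have W: "wsol q ?W" using wtrace_wjet[OF tW] by (simp add: wsol_def)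
  have "en (\<lambda>x. 1) Z V = 0"
    using en_commute[of "\<lambda>x. 1" Z V] wsol_H10_orth[OF pot_const V(1) Z(1)] by simp
  then have "en (\<lambda>x. 1) ?W V = en (\<lambda>x. 1) U V" using en_add_left[OF pot_const sU sZ sV] by simp
  moreover have "DN_map q g f = en q ?W V" by (rule DN_map_eq[OF p W tW V(2)])
  moreover have "DN_map (\<lambda>x. 1) g f = en (\<lambda>x. 1) U V" by (rule DN_map_eq[OF pot_const U V(2)])
  ultimately show ?thesis using en_minus_en_1[OF q sW sV] by simp
qed

text \<open>The coefficients \<open>a\<close>, \<open>b\<close> do not depend on \<open>q\<close>, so that potentials are told apart only by \<open>M\<close>.\<close>

definition low_rank_DN ::
    "real \<Rightarrow> real \<Rightarrow> 'n::finite \<Rightarrow> nat \<Rightarrow> ((real^'n \<Rightarrow> real) \<Rightarrow> ('n \<Rightarrow> nat) \<Rightarrow> ('n \<Rightarrow> nat) \<Rightarrow> complex) \<Rightarrow> bool"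
  where "low_rank_DN r K p l M \<longleftrightarrow>
    (\<forall>q. local_pot r q \<longrightarrow> (\<forall>\<beta>\<in>cauchy_index p l. \<forall>\<gamma>\<in>cauchy_index p l.
      norm (M q \<beta> \<gamma>) \<le> K * exp (2 * (real CARD('n) + 1) * real l))) \<and>
    (\<forall>g f. g \<in> H_half \<longrightarrow> H_half_norm g \<le> 1 \<longrightarrow> f \<in> H_half \<longrightarrow> H_half_norm f \<le> 1 \<longrightarrow>
      (\<exists>a b. (\<forall>\<beta>\<in>cauchy_index p l. norm (a \<beta>) \<le> 1 \<and> norm (b \<beta>) \<le> 1) \<and>
        (\<forall>q. local_pot r q \<longrightarrow> norm (DN_map q g f - DN_map (\<lambda>x. 1) g f -
          (\<Sum>\<beta>\<in>cauchy_index p l. \<Sum>\<gamma>\<in>cauchy_index p l. a \<beta> * cnj (b \<gamma>) * M q \<beta> \<gamma>)) \<le> K * exp (- real l))))"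

text \<open>For fixed q, a function w is corrected to w plus the first component of Z, where Z
  solves the equation with source \<open>qsource q w\<close>. The correction is compatible with
  linear combinations, and its size is controlled by w on the cube alone. Corrected basis functions
  paired with basis functions give the matrix; what the basis misses of the two solutions
  contributes O(e^-l).\<close>

lemma DN_low_rank:
  assumes n2: "2 \<le> CARD('n::finite)"
  shows "\<exists>r>0. \<exists>K>0. r \<le> 1 / real CARD('n) \<and> (\<forall>l (p::'n). 0 < l \<longrightarrow> (\<exists>M. low_rank_DN r K p l M))"
proof -
  obtain r C where r: "0 < r" "r \<le> 1 / real CARD('n)" and C: "0 < C"
    and LR: "\<forall>l (p::'n). 0 < l \<longrightarrow> (\<exists>P. cauchy_basis r C p l P)"
    using solution_low_rank[OF n2] by (elim exE conjE)
  define V where "V = L2n (vol :: (real^'n) measure) (\<lambda>x. 1 :: real)"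
  have V0: "0 \<le> V" by (simp add: V_def)
  have one: "square_integrable (vol :: (real^'n) measure) (\<lambda>x. 1 :: real)"
    by (rule square_integrable_vol_bounded[of _ 1]) auto
  define K where "K = 4 * (C * V)\<^sup>2 + C * (48 + 4 * C)"
  have K0: "0 < K" unfolding K_def using C by (intro add_nonneg_pos mult_pos_pos) auto
  have "\<exists>M. low_rank_DN r K p l M"
    if l: "0 < l" for l and p :: 'n
  proof -
    let ?I = "cauchy_index p l :: ('n \<Rightarrow> nat) set"
    let ?Q = "indicator (cubeQ r) :: real^'n \<Rightarrow> real"
    obtain P where "cauchy_basis r C p l P" by (rule exE[OF LR[rule_format, OF l, of p]])
    note P' = this[unfolded cauchy_basis_def]
    define p' where "p' \<beta> x = complex_of_real (P \<beta> x)" for \<beta> and x :: "real^'n"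
    define E where "E = C * exp ((real CARD('n) + 1) * real l)"
    have E0: "0 < E" using C by (simp add: E_def)
    have pc: "continuous_on UNIV (p' \<beta>)" for \<beta> unfolding p'_def using P' by (intro continuous_intros) blast
    have ps: "square_integrable vol (p' \<beta>)" for \<beta> by (rule continuous_square_integrable[OF pc])
    have psQ: "square_integrable vol (\<lambda>x. ?Q x *\<^sub>R p' \<beta> x)" for \<beta> by (rule L2n_indicator_le(2)[OF ps cubeQ_sets])
    have pE: "L2n vol (\<lambda>x. ?Q x *\<^sub>R p' \<beta> x) \<le> E * V" if \<beta>: "\<beta> \<in> ?I" for \<beta>
      unfolding V_def
    proof (rule L2n_bound[OF one square_integrable_meas[OF psQ]])
      show "AE x in vol. norm (?Q x *\<^sub>R p' \<beta> x) \<le> E * norm (1::real)"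
      proof (rule AE_I2)
        fix x show "norm (?Q x *\<^sub>R p' \<beta> x) \<le> E * norm (1::real)"
          using P' \<beta> E0 by (cases "x \<in> cubeQ r") (auto simp: p'_def E_def)
      qed
    qed (use E0 in simp)
    have sol: "\<exists>Z. H10 Z \<and> (\<forall>\<psi>. test_function \<psi> \<longrightarrow> en q (\<lambda>x. qsource q w x + Z x) (sjet \<psi>) = 0) \<and>
        L2n vol Z \<le> 3 * L2n vol (\<lambda>x. ?Q x *\<^sub>R w x)"
      if q: "local_pot r q" and w: "square_integrable vol w" for q :: "real^'n \<Rightarrow> real" and w
    proof -
      have wQ: "square_integrable vol (\<lambda>x. ?Q x *\<^sub>R w x)" by (rule L2n_indicator_le(2)[OF w cubeQ_sets])
      note qs = qsource_square_integrable[OF q wQ square_integrable_meas[OF w]]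
      obtain Z where Z: "H10 Z" "\<forall>\<psi>. test_function \<psi> \<longrightarrow> en q (\<lambda>x. qsource q w x + Z x) (sjet \<psi>) = 0"
        using H10_projection[OF local_pot_pot[OF q] qs(1)] by blast
      have "L2n vol Z \<le> 3 * L2n vol (qsource q w)"
        by (rule H10_solution_bound[OF local_pot_pot[OF q] qs(1) Z(1)]) (use Z(2) in blast)
      then show ?thesis using Z qs(2) by fastforce
    qed
    \<comment> \<open>One correction per basis function is fixed before the boundary data are given,
      so that the matrix depends on q and not on the data.\<close>
    define Zp where "Zp q \<beta> = (SOME Z. H10 Z \<and> (\<forall>\<psi>. test_function \<psi> \<longrightarrow> en q (\<lambda>x. qsource q (p' \<beta>) x + Z x) (sjet \<psi>) = 0) \<and>
        L2n vol Z \<le> 3 * L2n vol (\<lambda>x. ?Q x *\<^sub>R p' \<beta> x))" for q :: "real^'n \<Rightarrow> real" and \<beta>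
    have Zp: "H10 (Zp q \<beta>)" "\<And>\<psi>. test_function \<psi> \<Longrightarrow> en q (\<lambda>x. qsource q (p' \<beta>) x + Zp q \<beta> x) (sjet \<psi>) = 0"
      "L2n vol (Zp q \<beta>) \<le> 3 * L2n vol (\<lambda>x. ?Q x *\<^sub>R p' \<beta> x)" if q: "local_pot r q" for q \<beta>
      using someI_ex[OF sol[OF q ps[of \<beta>]]] unfolding Zp_def[symmetric] by blast+
    have sZp: "square_integrable vol (Zp q \<beta>)" if q: "local_pot r q" for q \<beta>
      by (rule H10_square_integrable[OF Zp(1)[OF q]])
    define y where "y q \<beta> x = p' \<beta> x + fst (Zp q \<beta> x)" for q :: "real^'n \<Rightarrow> real" and \<beta> x
    have ys: "square_integrable vol (y q \<beta>)" if q: "local_pot r q" for q \<beta>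
      unfolding y_def by (intro square_integrable_add ps square_integrable_fst sZp q)
    define M where "M q \<beta> \<gamma> = qpair q (y q \<beta>) (p' \<gamma>)" for q :: "real^'n \<Rightarrow> real" and \<beta> \<gamma>
    show ?thesis
      unfolding low_rank_DN_def
    proof (rule exI[of _ M], intro conjI allI impI ballI)
      fix q :: "real^'n \<Rightarrow> real" and \<beta> \<gamma> :: "'n \<Rightarrow> nat" assume q: "local_pot r q" and \<beta>: "\<beta> \<in> ?I" and \<gamma>: "\<gamma> \<in> ?I"
      have "L2n vol (\<lambda>x. ?Q x *\<^sub>R y q \<beta> x) \<le> 4 * (E * V)"
      proof -
        have sz: "square_integrable vol (\<lambda>x. fst (Zp q \<beta> x))" by (rule square_integrable_fst[OF sZp[OF q]])
        have szQ: "square_integrable vol (\<lambda>x. ?Q x *\<^sub>R fst (Zp q \<beta> x))" by (rule L2n_indicator_le(2)[OF sz cubeQ_sets])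
        have "L2n vol (\<lambda>x. ?Q x *\<^sub>R y q \<beta> x) \<le> L2n vol (\<lambda>x. ?Q x *\<^sub>R p' \<beta> x) + L2n vol (\<lambda>x. ?Q x *\<^sub>R fst (Zp q \<beta> x))"
          using L2n_triangle[OF psQ szQ] by (simp add: y_def scaleR_add_right)
        also have "L2n vol (\<lambda>x. ?Q x *\<^sub>R fst (Zp q \<beta> x)) \<le> L2n vol (Zp q \<beta>)"
          by (rule order_trans[OF L2n_indicator_le(1)[OF sz cubeQ_sets] L2n_fst_le[OF sZp[OF q]]])
        finally show ?thesis using Zp(3)[OF q, of \<beta>] pE[OF \<beta>] by linarith
      qed
      then have "norm (M q \<beta> \<gamma>) \<le> (4 * (E * V)) * (E * V)"
        unfolding M_def
        by (intro order_trans[OF norm_qpair_le[OF q ys[OF q] ps] mult_mono] pE[OF \<gamma>]) (use E0 V0 in auto)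
      also have "\<dots> = 4 * (C * V)\<^sup>2 * exp (2 * (real CARD('n) + 1) * real l)"
      proof -
        have "exp ((real CARD('n) + 1) * real l) * exp ((real CARD('n) + 1) * real l) = exp (2 * (real CARD('n) + 1) * real l)"
          by (simp add: exp_add[symmetric] algebra_simps)
        then show ?thesis by (simp add: E_def power2_eq_square mult_ac)
      qed
      also have "\<dots> \<le> K * exp (2 * (real CARD('n) + 1) * real l)"
        unfolding K_def using C by (intro mult_right_mono) auto
      finally show "norm (M q \<beta> \<gamma>) \<le> K * exp (2 * (real CARD('n) + 1) * real l)" .
    next
      fix g f :: "real^'n \<Rightarrow> complex"
      assume g: "g \<in> H_half" "H_half_norm g \<le> 1" and f: "f \<in> H_half" "H_half_norm f \<le> 1"
      define th where "th = C * exp (- real l)"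
      have th0: "0 \<le> th" using C by (simp add: th_def)
      have thC: "th \<le> C" using C by (simp add: th_def mult_le_cancel_left1)
      obtain U where U: "wsol (\<lambda>x. 1) U" "wtrace U g" "L2n vol U \<le> 6" using H_half_extension[OF g] by blast
      obtain W where W: "wsol (\<lambda>x. 1) W" "wtrace W f" "L2n vol W \<le> 6" using H_half_extension[OF f] by blast
      have sU: "square_integrable vol U" "square_integrable vol W" using U W by (auto intro: wtrace_square_integrable)
      define u where "u = (\<lambda>x. fst (U x))"
      define w where "w = (\<lambda>x. fst (W x))"
      have su: "square_integrable vol u" "square_integrable vol w" unfolding u_def w_def by (intro square_integrable_fst sU)+
      obtain a where a: "\<forall>\<beta>\<in>?I. norm (a \<beta>) \<le> 1" "L2n vol (\<lambda>x. ?Q x *\<^sub>R (u x - (\<Sum>\<beta>\<in>?I. P \<beta> x *\<^sub>R a \<beta>))) \<le> th"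
        unfolding u_def th_def using P' U by blast
      obtain b where b: "\<forall>\<beta>\<in>?I. norm (b \<beta>) \<le> 1" "L2n vol (\<lambda>x. ?Q x *\<^sub>R (w x - (\<Sum>\<beta>\<in>?I. P \<beta> x *\<^sub>R b \<beta>))) \<le> th"
        unfolding w_def th_def using P' W by blast
      have pa: "(\<Sum>\<beta>\<in>?I. P \<beta> x *\<^sub>R c \<beta>) = (\<Sum>\<beta>\<in>?I. c \<beta> * p' \<beta> x)" for c x
        by (simp add: p'_def scaleR_conv_of_real mult.commute)
      \<comment> \<open>\<open>ru\<close> and \<open>rw\<close> are what the basis misses of u and
        w, at most \<open>th\<close> in L2 of the cube.\<close>
      define ru where "ru x = u x - (\<Sum>\<beta>\<in>?I. a \<beta> * p' \<beta> x)" for x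
      define rw where "rw x = w x - (\<Sum>\<beta>\<in>?I. b \<beta> * p' \<beta> x)" for x
      have ru: "L2n vol (\<lambda>x. ?Q x *\<^sub>R ru x) \<le> th" and rw: "L2n vol (\<lambda>x. ?Q x *\<^sub>R rw x) \<le> th"
        using a(2) b(2) unfolding ru_def rw_def pa by simp_all
      have ss: "square_integrable vol (\<lambda>x. \<Sum>\<beta>\<in>?I. c \<beta> * p' \<beta> x)" for c
        by (intro square_integrable_sum square_integrable_cmult ps)
      have sr: "square_integrable vol ru" "square_integrable vol rw"
        unfolding ru_def rw_def by (intro square_integrable_diff su ss)+
      show "\<exists>a b. (\<forall>\<beta>\<in>?I. norm (a \<beta>) \<le> 1 \<and> norm (b \<beta>) \<le> 1) \<and>
        (\<forall>q. local_pot r q \<longrightarrow> norm (DN_map q g f - DN_map (\<lambda>x. 1) g f -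
          (\<Sum>\<beta>\<in>?I. \<Sum>\<gamma>\<in>?I. a \<beta> * cnj (b \<gamma>) * M q \<beta> \<gamma>)) \<le> K * exp (- real l))"
      proof (rule exI[of _ a], rule exI[of _ b], intro conjI allI impI ballI)
        fix q :: "real^'n \<Rightarrow> real" assume q: "local_pot r q"
        note pq = local_pot_pot[OF q]
        obtain Z where Z: "H10 Z" "\<forall>\<psi>. test_function \<psi> \<longrightarrow> en q (\<lambda>x. qsource q u x + Z x) (sjet \<psi>) = 0"
          "L2n vol Z \<le> 3 * L2n vol (\<lambda>x. ?Q x *\<^sub>R u x)" using sol[OF q su(1)] by blast
        have sZ: "square_integrable vol Z" by (rule H10_square_integrable[OF Z(1)])
        define Y where "Y x = (\<Sum>\<beta>\<in>?I. cmul (a \<beta>) (Zp q \<beta> x))" for x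
        have HY: "H10 Y" unfolding Y_def by (intro H10_sum H10_cmul Zp(1)[OF q])
        \<comment> \<open>By linearity this is a correction for the residual \<open>ru\<close>, so
          its size follows from \<open>H10_solution_bound\<close>.\<close>
        define X where "X x = Z x - Y x" for x
        have HX: "H10 X" unfolding X_def by (rule H10_diff[OF Z(1) HY])
        have sX: "square_integrable vol X" by (rule H10_square_integrable[OF HX])
        have srQ: "square_integrable vol (\<lambda>x. ?Q x *\<^sub>R ru x)" by (rule L2n_indicator_le(2)[OF sr(1) cubeQ_sets])
        note qr = qsource_square_integrable[OF q srQ square_integrable_meas[OF sr(1)]]
        have sq: "square_integrable vol (qsource q v)" if "square_integrable vol v" for v
          by (rule qsource_square_integrable(1)[OF q L2n_indicator_le(2)[OF that cubeQ_sets] square_integrable_meas[OF that]])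
        have Xeq: "en q (\<lambda>x. qsource q ru x + X x) (sjet \<psi>) = 0" if \<psi>: "test_function \<psi>" for \<psi>
        proof -
          note t = test_sjet[OF \<psi>]
          have e: "en q (\<lambda>x. qsource q v x + G x) (sjet \<psi>) = qpair q v \<psi> + en q G (sjet \<psi>)"
            if "square_integrable vol v" "square_integrable vol G" for v G
            using en_add_left[OF pq sq[OF that(1)] that(2) t] en_qsource[OF pq, of v "sjet \<psi>"] by (simp add: sjet_def)
          have enY: "en q Y (sjet \<psi>) = (\<Sum>\<beta>\<in>?I. a \<beta> * en q (Zp q \<beta>) (sjet \<psi>))"
          proof -
            have "en q (\<lambda>x. \<Sum>\<beta>\<in>J. cmul (a \<beta>) (Zp q \<beta> x)) (sjet \<psi>) = (\<Sum>\<beta>\<in>J. a \<beta> * en q (Zp q \<beta>) (sjet \<psi>))" if "finite J" for J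
              using that
            proof (induction J rule: finite_induct)
              case empty
              show ?case by (simp add: en_def energy_density_def)
            next
              case (insert \<beta> J)
              then show ?case
                using en_add_left[OF pq square_integrable_cmul[OF sZp[OF q]] square_integrable_sum[OF square_integrable_cmul[OF sZp[OF q]]] t, of "a \<beta>" \<beta> a "\<lambda>\<beta>. \<beta>" J]
                by (simp add: en_cmul_left)
            qed
            then show ?thesis unfolding Y_def using finite_cauchy_index by blast
          qed
          have ts: "square_integrable vol \<psi>" by (rule test_square_integrable(1)[OF \<psi>])
          have zb: "qpair q (p' \<beta>) \<psi> = - en q (Zp q \<beta>) (sjet \<psi>)" for \<beta>
            using e[OF ps sZp[OF q]] Zp(2)[OF q \<psi>, of \<beta>] by (simp add: eq_neg_iff_add_eq_0)
          have zu: "qpair q u \<psi> = - en q Z (sjet \<psi>)"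
            using e[OF su(1) sZ] Z(2) \<psi> by (simp add: eq_neg_iff_add_eq_0)
          have "u = (\<lambda>x. ru x + (\<Sum>\<beta>\<in>?I. a \<beta> * p' \<beta> x))" by (simp add: ru_def)
          then have "qpair q u \<psi> = qpair q ru \<psi> + (\<Sum>\<beta>\<in>?I. a \<beta> * qpair q (p' \<beta>) \<psi>)"
            using qpair_add_left[OF q sr(1) ss ts, of a] qpair_sum_left[where I="?I" and c=a and w=p', OF q ps ts] by metis
          then have "qpair q ru \<psi> = - en q Z (sjet \<psi>) + en q Y (sjet \<psi>)"
            by (simp add: zu zb enY sum_negf)
          moreover have "en q X (sjet \<psi>) = en q Z (sjet \<psi>) - en q Y (sjet \<psi>)"
            unfolding X_def by (rule en_diff_left[OF pq sZ H10_square_integrable[OF HY] t])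
          ultimately show ?thesis using e[OF sr(1) sX] by simp
        qed
        have Xth: "L2n vol X \<le> 3 * th"
          using H10_solution_bound[OF pq qr(1) HX Xeq] qr(2) ru by linarith
        have fX: "fst (X x) = fst (Z x) - (\<Sum>\<beta>\<in>?I. a \<beta> * fst (Zp q \<beta> x))" for x
          by (simp add: X_def Y_def fst_sum_cmul)
        define h where "h x = u x + fst (Z x)" for x
        define k where "k x = ru x + fst (X x)" for x
        have sfX: "square_integrable vol (\<lambda>x. fst (X x))" by (rule square_integrable_fst[OF sX])
        have sh: "square_integrable vol h" unfolding h_def by (intro square_integrable_add su square_integrable_fst[OF sZ])
        have sk: "square_integrable vol k" unfolding k_def by (intro square_integrable_add sr sfX)
        have kn: "L2n vol (\<lambda>x. ?Q x *\<^sub>R k x) \<le> 4 * th"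
        proof -
          have "L2n vol (\<lambda>x. ?Q x *\<^sub>R k x) \<le> L2n vol (\<lambda>x. ?Q x *\<^sub>R ru x) + L2n vol (\<lambda>x. ?Q x *\<^sub>R fst (X x))"
            using L2n_triangle[OF srQ L2n_indicator_le(2)[OF sfX cubeQ_sets]] by (simp add: k_def scaleR_add_right)
          also have "L2n vol (\<lambda>x. ?Q x *\<^sub>R fst (X x)) \<le> L2n vol X"
            by (rule order_trans[OF L2n_indicator_le(1)[OF sfX cubeQ_sets] L2n_fst_le[OF sX]])
          finally show ?thesis using ru Xth by linarith
        qed
        have un: "L2n vol (\<lambda>x. ?Q x *\<^sub>R u x) \<le> 6"
          using L2n_indicator_le(1)[OF su(1) cubeQ_sets, of r] L2n_fst_le[OF sU(1)] U(3) unfolding u_def by linarith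
        have wn: "L2n vol (\<lambda>x. ?Q x *\<^sub>R w x) \<le> 6"
          using L2n_indicator_le(1)[OF su(2) cubeQ_sets, of r] L2n_fst_le[OF sU(2)] W(3) unfolding w_def by linarith
        \<comment> \<open>24 = 6 + 18: the solution for the potential 1, and its correction at three
          times that size.\<close>
        have hn: "L2n vol (\<lambda>x. ?Q x *\<^sub>R h x) \<le> 24"
        proof -
          have sfZ: "square_integrable vol (\<lambda>x. fst (Z x))" by (rule square_integrable_fst[OF sZ])
          have "L2n vol (\<lambda>x. ?Q x *\<^sub>R h x) \<le> L2n vol (\<lambda>x. ?Q x *\<^sub>R u x) + L2n vol (\<lambda>x. ?Q x *\<^sub>R fst (Z x))"
            using L2n_triangle[OF L2n_indicator_le(2)[OF su(1) cubeQ_sets] L2n_indicator_le(2)[OF sfZ cubeQ_sets]]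
            by (simp add: h_def scaleR_add_right)
          also have "L2n vol (\<lambda>x. ?Q x *\<^sub>R fst (Z x)) \<le> L2n vol Z"
            by (rule order_trans[OF L2n_indicator_le(1)[OF sfZ cubeQ_sets] L2n_fst_le[OF sZ]])
          finally show ?thesis using un Z(3) by linarith
        qed
        define s where "s x = (\<Sum>\<beta>\<in>?I. a \<beta> * y q \<beta> x)" for x
        have ssq: "square_integrable vol s" unfolding s_def by (intro square_integrable_sum square_integrable_cmult ys[OF q])
        \<comment> \<open>h is the solution for q, s its part built from corrected basis functions,
          and k the corrected residual.\<close>
        have hsk: "h x = s x + k x" for x
          by (simp add: h_def s_def k_def y_def ru_def fX distrib_left sum.distrib)
        have sn: "L2n vol (\<lambda>x. ?Q x *\<^sub>R s x) \<le> 24 + 4 * th"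
        proof -
          have "(\<lambda>x. ?Q x *\<^sub>R s x) = (\<lambda>x. ?Q x *\<^sub>R h x + - (?Q x *\<^sub>R k x))" by (rule ext) (simp add: hsk scaleR_add_right)
          then have "L2n vol (\<lambda>x. ?Q x *\<^sub>R s x) \<le> L2n vol (\<lambda>x. ?Q x *\<^sub>R h x) + L2n vol (\<lambda>x. - (?Q x *\<^sub>R k x))"
            using L2n_triangle[OF L2n_indicator_le(2)[OF sh cubeQ_sets] square_integrable_uminus[OF L2n_indicator_le(2)[OF sk cubeQ_sets]]] by simp
          then show ?thesis using hn kn by (simp add: L2n_uminus)
        qed
        have "DN_map q g f - DN_map (\<lambda>x. 1) g f = qpair q h w"
          using DN_map_difference[OF q U(1,2) W(1,2) Z(1)] Z(2) unfolding h_def u_def w_def by blast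
        also have "\<dots> = qpair q s w + qpair q k w"
        proof -
          have "h = (\<lambda>x. s x + k x)" by (rule ext) (rule hsk)
          then show ?thesis using qpair_add_left[OF q ssq sk su(2)] by simp
        qed
        also have "qpair q s w = qpair q s rw + qpair q s (\<lambda>x. \<Sum>\<gamma>\<in>?I. b \<gamma> * p' \<gamma> x)"
        proof -
          have "w = (\<lambda>x. rw x + (\<Sum>\<gamma>\<in>?I. b \<gamma> * p' \<gamma> x))" by (simp add: rw_def)
          then show ?thesis using qpair_add_right[OF q ssq sr(2) ss, of b] by simp
        qed
        also have "qpair q s (\<lambda>x. \<Sum>\<gamma>\<in>?I. b \<gamma> * p' \<gamma> x) = (\<Sum>\<beta>\<in>?I. \<Sum>\<gamma>\<in>?I. a \<beta> * cnj (b \<gamma>) * M q \<beta> \<gamma>)"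
        proof -
          have "qpair q s v = (\<Sum>\<beta>\<in>?I. a \<beta> * qpair q (y q \<beta>) v)" if "square_integrable vol v" for v
            unfolding s_def by (rule qpair_sum_left[OF q ys[OF q] that])
          then have "qpair q s (\<lambda>x. \<Sum>\<gamma>\<in>?I. b \<gamma> * p' \<gamma> x) = (\<Sum>\<beta>\<in>?I. a \<beta> * qpair q (y q \<beta>) (\<lambda>x. \<Sum>\<gamma>\<in>?I. b \<gamma> * p' \<gamma> x))"
            using ss by blast
          also have "\<dots> = (\<Sum>\<beta>\<in>?I. \<Sum>\<gamma>\<in>?I. a \<beta> * cnj (b \<gamma>) * M q \<beta> \<gamma>)"
            by (simp add: qpair_sum_right[OF q ys[OF q] ps] sum_distrib_left M_def mult.assoc)
          finally show ?thesis .
        qed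
        finally have "DN_map q g f - DN_map (\<lambda>x. 1) g f - (\<Sum>\<beta>\<in>?I. \<Sum>\<gamma>\<in>?I. a \<beta> * cnj (b \<gamma>) * M q \<beta> \<gamma>) = qpair q s rw + qpair q k w"
          by simp
        also have "norm \<dots> \<le> (24 + 4 * th) * th + (4 * th) * 6"
        proof (rule order_trans[OF norm_triangle_ineq add_mono])
          show "norm (qpair q s rw) \<le> (24 + 4 * th) * th"
            by (rule order_trans[OF norm_qpair_le[OF q ssq sr(2)] mult_mono[OF sn rw]]) (use th0 in auto)
          show "norm (qpair q k w) \<le> (4 * th) * 6"
            by (rule order_trans[OF norm_qpair_le[OF q sk su(2)] mult_mono[OF kn wn]]) (use th0 in auto)
        qed
        also have "\<dots> = (48 + 4 * th) * th" by (simp add: algebra_simps)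
        also have "\<dots> \<le> (48 + 4 * C) * th" using thC th0 by (intro mult_right_mono) auto
        also have "\<dots> = C * (48 + 4 * C) * exp (- real l)" by (simp add: th_def)
        also have "\<dots> \<le> K * exp (- real l)" unfolding K_def by (intro mult_right_mono) auto
        finally show "norm (DN_map q g f - DN_map (\<lambda>x. 1) g f -
          (\<Sum>\<beta>\<in>?I. \<Sum>\<gamma>\<in>?I. a \<beta> * cnj (b \<gamma>) * M q \<beta> \<gamma>)) \<le> K * exp (- real l)" .
      qed (use a b in auto)
    qed
  qed
  then show ?thesis using r K0 by blast
qed

section \<open>Counting\<close>

text \<open>Rounding real and imaginary parts down to integers leaves (2T+1)^2 values per entry.
  Entries with equal rounding differ by at most 1 in each part, hence by at most 2 in
  modulus.\<close>

lemma finite_precision_pigeonhole: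
  fixes v :: "'q \<Rightarrow> 'j \<Rightarrow> complex"
  assumes J: "finite J" and bound: "\<And>q j. q \<in> Q \<Longrightarrow> j \<in> J \<Longrightarrow> norm (v q j) \<le> real T"
    and card: "((2 * T + 1)\<^sup>2) ^ card J < card Q"
  shows "\<exists>q1\<in>Q. \<exists>q2\<in>Q. q1 \<noteq> q2 \<and> (\<forall>j\<in>J. norm (v q1 j - v q2 j) \<le> 2)"
proof -
  define code where "code q = restrict (\<lambda>j. (\<lfloor>Re (v q j)\<rfloor>, \<lfloor>Im (v q j)\<rfloor>)) J" for q
  define B where "B = {- int T .. int T}"
  define R where "R = (\<Pi>\<^sub>E j\<in>J. B \<times> B)"
  have fl: "\<lfloor>x\<rfloor> \<in> B" if "\<bar>x\<bar> \<le> real T" for x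
    using that unfolding B_def by (simp add: abs_le_iff le_floor_iff) linarith
  have sub: "code ` Q \<subseteq> R"
  proof
    fix y assume "y \<in> code ` Q"
    then obtain q where q: "q \<in> Q" "y = code q" by blast
    have "\<lfloor>Re (v q j)\<rfloor> \<in> B" "\<lfloor>Im (v q j)\<rfloor> \<in> B" if "j \<in> J" for j
      using bound[OF q(1) that] abs_Re_le_cmod[of "v q j"] abs_Im_le_cmod[of "v q j"] by (intro fl; linarith)+
    then show "y \<in> R" unfolding q(2) code_def R_def by auto
  qed
  have "card R = (card B * card B) ^ card J" by (simp add: R_def card_funcsetE[OF J] card_cartesian_product)
  also have "card B = 2 * T + 1" by (simp add: B_def)
  finally have cR: "card R = ((2 * T + 1)\<^sup>2) ^ card J" by (simp add: power2_eq_square)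
  have "finite R" unfolding R_def by (intro finite_PiE J) (simp add: B_def)
  then have "card (code ` Q) < card Q" using card_mono[OF _ sub] cR card by simp
  then have "\<not> inj_on code Q" by (rule pigeonhole)
  then obtain q1 q2 where q: "q1 \<in> Q" "q2 \<in> Q" "q1 \<noteq> q2" "code q1 = code q2" unfolding inj_on_def by blast
  have "norm (v q1 j - v q2 j) \<le> 2" if "j \<in> J" for j
  proof -
    have e: "\<lfloor>Re (v q1 j)\<rfloor> = \<lfloor>Re (v q2 j)\<rfloor>" "\<lfloor>Im (v q1 j)\<rfloor> = \<lfloor>Im (v q2 j)\<rfloor>"
      using fun_cong[OF q(4), of j] that by (simp_all add: code_def)
    have "\<bar>Re (v q1 j - v q2 j)\<bar> \<le> 1" "\<bar>Im (v q1 j - v q2 j)\<bar> \<le> 1"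
      using e by (simp_all, linarith+)
    then show ?thesis using cmod_le[of "v q1 j - v q2 j"] by linarith
  qed
  then show ?thesis using q by blast
qed

lemma DN_dist_le:
  assumes "\<And>g f. g \<in> H_half \<Longrightarrow> H_half_norm g \<le> 1 \<Longrightarrow> f \<in> H_half \<Longrightarrow> H_half_norm f \<le> 1 \<Longrightarrow>
    norm (DN_map q1 g f - DN_map q2 g f) \<le> e"
  shows "DN_dist q1 q2 \<le> ennreal e"
  unfolding DN_dist_def operator_norm_def H_minus_half_norm_def
  using assms by (intro SUP_least ennreal_leI) auto

text \<open>Two potentials whose matrices round to the same values have close maps for all boundary
  data at once, because the data enter only through coefficients of modulus at most 1.\<close>

lemma DN_pigeonhole:
  assumes n2: "2 \<le> CARD('n::finite)"
  shows "\<exists>r>0. \<exists>K>0. r \<le> 1 / real CARD('n) \<and> (\<forall>l Q. 0 < l \<longrightarrow>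
    (\<forall>q\<in>Q. local_pot r (q :: real^'n \<Rightarrow> real)) \<longrightarrow> exp (K * real l ^ (2 * CARD('n) - 1)) < real (card Q) \<longrightarrow>
    (\<exists>q1\<in>Q. \<exists>q2\<in>Q. q1 \<noteq> q2 \<and> DN_dist q1 q2 \<le> ennreal (K * exp (- real l))))"
proof -
  define n where "n = CARD('n)"
  \<comment> \<open>The distinguished coordinate is arbitrary.\<close>
  define p :: 'n where "p = undefined"
  from DN_low_rank[OF n2] obtain r K where r: "0 < r" "r \<le> 1 / real n" and K: "0 < K"
    and LR: "\<forall>l (p::'n). 0 < l \<longrightarrow> (\<exists>M. low_rank_DN r K p l M)"
    unfolding n_def by (elim exE conjE)
  define d where "d = 8 * K + 4 * real n + 5"
  define K' where "K' = 2 * K + 2 + 8 * d"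
  have d0: "0 < d" using K by (simp add: d_def)
  have K'0: "0 < K'" using K d0 by (simp add: K'_def)
  have main: "\<exists>q1\<in>Q. \<exists>q2\<in>Q. q1 \<noteq> q2 \<and> DN_dist q1 q2 \<le> ennreal (K' * exp (- real l))"
    if l: "0 < l" and Q: "\<forall>q\<in>Q. local_pot r q" and cQ: "exp (K' * real l ^ (2 * n - 1)) < real (card Q)"
    for l and Q :: "(real^'n \<Rightarrow> real) set"
  proof -
    let ?I = "cauchy_index p l :: ('n \<Rightarrow> nat) set"
    obtain M where "low_rank_DN r K p l M" by (rule exE[OF LR[rule_format, OF l, of p]])
    note M = this[unfolded low_rank_DN_def, folded n_def]
    define A where "A = 2 * real l ^ (n - 1)"
    have l1: "1 \<le> real l" using l by simp
    have lp: "1 \<le> real l ^ k" for k using l1 by (rule one_le_power)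
    have A2: "2 \<le> A" using lp by (simp add: A_def)
    have cI: "real (card ?I) \<le> A"
      using card_cauchy_index[of p l] unfolding A_def n_def by (metis of_nat_le_iff of_nat_mult of_nat_numeral of_nat_power)
    \<comment> \<open>Scaling before rounding to integers: the error 2/\<kappa> per entry, summed
      over at most A^2 entries, is 2e^-l.\<close>
    define \<kappa> where "\<kappa> = A\<^sup>2 * exp (real l)"
    have \<kappa>0: "0 < \<kappa>" using A2 by (simp add: \<kappa>_def)
    have el: "real l ^ k \<le> exp (real k * real l)" for k
    proof -
      have "real l ^ k \<le> exp (real l) ^ k"
        using exp_ge_add_one_self[of "real l"] by (intro power_mono) linarith+
      then show ?thesis by (simp add: exp_of_nat_mult)
    qed
    have nn: "(n - 1) * 2 = 2 * n - 2" by simp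
    have A4: "A\<^sup>2 = 4 * real l ^ (2 * n - 2)" unfolding A_def by (simp only: power_mult_distrib power_mult[symmetric] nn) simp
    \<comment> \<open>The exponent 4n + 1 collects 2(n+1) for the size of the entries, 1 for the
      precision e^-l and 2n - 2 for A^2.\<close>
    define T where "T = nat \<lceil>4 * K * exp ((4 * real n + 1) * real l)\<rceil> + 1"
    have Tl: "4 * K * exp ((4 * real n + 1) * real l) \<le> real T" unfolding T_def by linarith
    have Tu: "real T \<le> 4 * K * exp ((4 * real n + 1) * real l) + 2"
    proof -
      have "0 < 4 * K * exp ((4 * real n + 1) * real l)" using K by simp
      then show ?thesis unfolding T_def by linarith
    qed
    define v where "v q \<beta>\<gamma> = complex_of_real \<kappa> * M q (fst \<beta>\<gamma>) (snd \<beta>\<gamma>)" for q \<beta>\<gamma>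
    have bound: "norm (v q j) \<le> real T" if "q \<in> Q" "j \<in> ?I \<times> ?I" for q j
    proof -
      have "norm (M q (fst j) (snd j)) \<le> K * exp (2 * (real n + 1) * real l)" using M Q that by auto
      then have "norm (v q j) \<le> \<kappa> * (K * exp (2 * (real n + 1) * real l))"
        unfolding v_def using \<kappa>0 by (simp add: norm_mult)
      also have "\<dots> = 4 * K * (real l ^ (2 * n - 2) * exp (real l) * exp (2 * (real n + 1) * real l))"
        by (simp add: \<kappa>_def A4)
      also have "\<dots> \<le> 4 * K * (exp (real (2 * n - 2) * real l) * exp (real l) * exp (2 * (real n + 1) * real l))"
        using K by (intro mult_left_mono mult_right_mono el) auto
      also have "exp (real (2 * n - 2) * real l) * exp (real l) * exp (2 * (real n + 1) * real l) = exp ((4 * real n + 1) * real l)"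
        using n2 by (simp add: exp_add[symmetric] n_def of_nat_diff algebra_simps)
      finally show ?thesis using Tl by simp
    qed
    have step: "real (2 * T + 1) \<le> exp (d * real l)"
    proof -
      let ?e = "exp ((4 * real n + 1) * real l)"
      have "real (2 * T + 1) \<le> 8 * K * ?e + 5" using Tu by simp
      also have "\<dots> \<le> (8 * K + 5) * ?e" by (simp add: algebra_simps)
      also have "\<dots> \<le> exp ((8 * K + 4) * real l) * ?e"
      proof (rule mult_right_mono)
        have "8 * K + 5 \<le> exp (8 * K + 4)" using exp_ge_add_one_self[of "8 * K + 4"] by linarith
        also have "\<dots> \<le> exp ((8 * K + 4) * real l)" using K l1 by simp
        finally show "8 * K + 5 \<le> exp ((8 * K + 4) * real l)" .
      qed simp
      also have "\<dots> = exp (d * real l)" by (simp add: exp_add[symmetric] d_def algebra_simps)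
      finally show ?thesis .
    qed
    have cIA: "real (card (?I \<times> ?I)) \<le> A\<^sup>2"
      using mult_mono[OF cI cI] A2 by (simp add: card_cartesian_product power2_eq_square)
    have "real (((2 * T + 1)\<^sup>2) ^ card (?I \<times> ?I)) = real (2 * T + 1) ^ (2 * card (?I \<times> ?I))"
      by (simp only: of_nat_power power_mult)
    also have "\<dots> \<le> exp (d * real l) ^ (2 * card (?I \<times> ?I))" by (intro power_mono step) simp
    also have "\<dots> = exp (2 * real (card (?I \<times> ?I)) * (d * real l))" by (simp add: exp_of_nat_mult[symmetric])
    also have "\<dots> \<le> exp (2 * A\<^sup>2 * (d * real l))"
      using cIA d0 by (simp only: exp_le_cancel_iff) (intro mult_right_mono, auto)
    \<comment> \<open>Here the exponent 2n - 1 arises: A^2 is of order l^(2n-2), and each entry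
      contributes O(l) to the logarithm.\<close>
    also have "2 * A\<^sup>2 * (d * real l) = 8 * d * real l ^ (2 * n - 1)"
    proof -
      have "2 * n - 1 = Suc (2 * n - 2)" using n2 by (simp add: n_def)
      then show ?thesis by (simp add: A4)
    qed
    also have "exp \<dots> \<le> exp (K' * real l ^ (2 * n - 1))"
      using K by (simp only: exp_le_cancel_iff) (intro mult_right_mono, auto simp: K'_def)
    also note cQ
    finally have "((2 * T + 1)\<^sup>2) ^ card (?I \<times> ?I) < card Q" by (simp only: of_nat_less_iff)
    then obtain q1 q2 where q: "q1 \<in> Q" "q2 \<in> Q" "q1 \<noteq> q2" and close: "\<forall>j\<in>?I \<times> ?I. norm (v q1 j - v q2 j) \<le> 2"
      using finite_precision_pigeonhole[of "?I \<times> ?I" Q v T] bound finite_cauchy_index[of p l] by blast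
    have close': "norm (M q1 \<beta> \<gamma> - M q2 \<beta> \<gamma>) \<le> 2 / \<kappa>" if "\<beta> \<in> ?I" "\<gamma> \<in> ?I" for \<beta> \<gamma>
    proof -
      have "\<kappa> * norm (M q1 \<beta> \<gamma> - M q2 \<beta> \<gamma>) = norm (v q1 (\<beta>, \<gamma>) - v q2 (\<beta>, \<gamma>))"
        using \<kappa>0 by (simp add: v_def norm_mult flip: right_diff_distrib)
      also have "\<dots> \<le> 2" using close that by blast
      finally show ?thesis using \<kappa>0 by (simp add: field_simps)
    qed
    have "DN_dist q1 q2 \<le> ennreal (K' * exp (- real l))"
    proof (rule DN_dist_le)
      fix g f :: "real^'n \<Rightarrow> complex"
      assume gf: "g \<in> H_half" "H_half_norm g \<le> 1" "f \<in> H_half" "H_half_norm f \<le> 1"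
      have "\<exists>a b. (\<forall>\<beta>\<in>?I. norm (a \<beta>) \<le> 1 \<and> norm (b \<beta>) \<le> 1) \<and>
        (\<forall>q. local_pot r q \<longrightarrow> norm (DN_map q g f - DN_map (\<lambda>x. 1) g f -
          (\<Sum>\<beta>\<in>?I. \<Sum>\<gamma>\<in>?I. a \<beta> * cnj (b \<gamma>) * M q \<beta> \<gamma>)) \<le> K * exp (- real l))"
        using M gf by blast
      then obtain a b where ab: "\<forall>\<beta>\<in>?I. norm (a \<beta>) \<le> 1 \<and> norm (b \<beta>) \<le> 1" and
        app: "\<forall>q. local_pot r q \<longrightarrow> norm (DN_map q g f - DN_map (\<lambda>x. 1) g f -
          (\<Sum>\<beta>\<in>?I. \<Sum>\<gamma>\<in>?I. a \<beta> * cnj (b \<gamma>) * M q \<beta> \<gamma>)) \<le> K * exp (- real l)"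
        by (elim exE conjE)
      define S where "S q = (\<Sum>\<beta>\<in>?I. \<Sum>\<gamma>\<in>?I. a \<beta> * cnj (b \<gamma>) * M q \<beta> \<gamma>)" for q
      have E: "norm (DN_map q g f - DN_map (\<lambda>x. 1) g f - S q) \<le> K * exp (- real l)" if "q \<in> Q" for q
        unfolding S_def using app Q that by blast
      have "norm (S q1 - S q2) \<le> (\<Sum>\<beta>\<in>?I. \<Sum>\<gamma>\<in>?I. 2 / \<kappa>)"
      proof -
        have "S q1 - S q2 = (\<Sum>\<beta>\<in>?I. \<Sum>\<gamma>\<in>?I. a \<beta> * cnj (b \<gamma>) * (M q1 \<beta> \<gamma> - M q2 \<beta> \<gamma>))"
          by (simp add: S_def right_diff_distrib sum_subtractf)
        also have "norm \<dots> \<le> (\<Sum>\<beta>\<in>?I. \<Sum>\<gamma>\<in>?I. 2 / \<kappa>)"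
        proof (intro sum_norm_le)
          fix \<beta> \<gamma> assume *: "\<beta> \<in> ?I" "\<gamma> \<in> ?I"
          have "norm (a \<beta>) * norm (b \<gamma>) \<le> 1 * 1" using ab * by (intro mult_mono) auto
          then have "norm (a \<beta>) * norm (b \<gamma>) * norm (M q1 \<beta> \<gamma> - M q2 \<beta> \<gamma>) \<le> 1 * (2 / \<kappa>)"
            by (intro mult_mono close' *) auto
          then show "norm (a \<beta> * cnj (b \<gamma>) * (M q1 \<beta> \<gamma> - M q2 \<beta> \<gamma>)) \<le> 2 / \<kappa>" by (simp add: norm_mult)
        qed
        finally show ?thesis .
      qed
      also have "\<dots> = real (card (?I \<times> ?I)) * (2 / \<kappa>)" by (simp add: card_cartesian_product)
      also have "\<dots> \<le> A\<^sup>2 * (2 / \<kappa>)" using \<kappa>0 by (intro mult_right_mono cIA) auto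
      also have "\<dots> = 2 * exp (- real l)" using A2 by (simp add: \<kappa>_def exp_minus field_simps)
      finally have SS: "norm (S q1 - S q2) \<le> 2 * exp (- real l)" .
      have "DN_map q1 g f - DN_map q2 g f = (DN_map q1 g f - DN_map (\<lambda>x. 1) g f - S q1)
          - (DN_map q2 g f - DN_map (\<lambda>x. 1) g f - S q2) + (S q1 - S q2)" by simp
      then have "norm (DN_map q1 g f - DN_map q2 g f) \<le> K * exp (- real l) + K * exp (- real l) + 2 * exp (- real l)"
        using E[OF q(1)] E[OF q(2)] SS by (smt (verit) norm_triangle_ineq norm_triangle_ineq4)
      also have "\<dots> \<le> K' * exp (- real l)" using d0 by (simp add: K'_def algebra_simps)
      finally show "norm (DN_map q1 g f - DN_map q2 g f) \<le> K' * exp (- real l)" .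
    qed
    then show ?thesis using q by blast
  qed
  show ?thesis
    by (rule exI[of _ r], rule conjI[OF r(1)], rule exI[of _ K'], rule conjI[OF K'0], rule conjI)
      (use r main in \<open>simp_all add: n_def\<close>)
qed

section \<open>Piecewise constant potentials\<close>

text \<open>By minimality (m-1)^n < N, so for large N the first N cubes make up almost the whole
  grid.\<close>

lemma side_count_bounds:
  assumes "1 \<le> N" "1 \<le> n"
  shows "N \<le> side_count n N ^ n" "1 \<le> side_count n N" "(side_count n N - 1) ^ n < N"
proof -
  have "N \<le> N ^ n" using assms by (intro self_le_power) auto
  then show 1: "N \<le> side_count n N ^ n" unfolding side_count_def by (rule LeastI)
  then show 2: "1 \<le> side_count n N" using assms by (cases "side_count n N = 0") (auto simp: zero_power)
  then show "(side_count n N - 1) ^ n < N"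
    using not_less_Least[of "side_count n N - 1" "\<lambda>m. N \<le> m ^ n"] unfolding side_count_def by linarith
qed

text \<open>The least coordinate is the one compared first.\<close>

lemma less_fun_Min:
  fixes j k :: "'n::{finite,linorder} \<Rightarrow> nat"
  assumes "less_fun k j"
  shows "k (Min UNIV) \<le> j (Min UNIV)"
proof -
  obtain i where i: "k i < j i" "\<forall>i'<i. k i' = j i'" using assms unfolding less_fun_def by blast
  have "Min UNIV \<le> i" by simp
  then show ?thesis using i by (cases "i = Min UNIV") (auto simp: le_less)
qed

lemma cube_disjoint:
  assumes m: "0 < m" and "x \<in> cube m j" "x \<in> cube m k"
  shows "j = k"
proof
  fix i
  have m': "0 < real m" using m by simp
  have *: "- 1/2 + (real (j i) - 1) * (1 / real m) < - 1/2 + real (k i) * (1 / real m)"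
    "- 1/2 + (real (k i) - 1) * (1 / real m) < - 1/2 + real (j i) * (1 / real m)"
    using assms(2,3) unfolding cube_def mem_Collect_eq by (blast intro: less_trans)+
  have "real (j i) - 1 < real (k i)" "real (k i) - 1 < real (j i)"
    using * m' by (simp_all add: divide_less_cancel)
  then show "j i = k i" by linarith
qed

lemma cube_eq_box:
  "(cube m j :: (real^'n) set) = box (\<chi> i. - 1/2 + (real (j i) - 1) * (1 / real m)) (\<chi> i. - 1/2 + real (j i) * (1 / real m))"
  by (auto simp: cube_def mem_box_cart)

lemma cube_nonempty:
  assumes "0 < m" shows "(cube m j :: (real^'n) set) \<noteq> {}"
proof -
  have "(\<chi> i. - 1/2 + (real (j i) - 1/2) * (1 / real m)) \<in> (cube m j :: (real^'n) set)"
    using assms by (simp add: cube_def divide_strict_right_mono)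
  then show ?thesis by blast
qed

text \<open>The cubes contained in \<open>[-r,0]\<^sup>n\<close>. Those of first coordinate at most 0 are about half of all the cubes
  and come first, hence they are among the first \<open>N\<close>.\<close>

definition corner_cubes :: "real \<Rightarrow> nat \<Rightarrow> ('n \<Rightarrow> nat) set"
  where "corner_cubes r m = {j. \<forall>i. (1/2 - r) * real m + 1 \<le> real (j i) \<and> 2 * j i \<le> m}"

lemma corner_cubes_eq:
  "(corner_cubes r m :: ('n::finite \<Rightarrow> nat) set) = (\<Pi>\<^sub>E i\<in>UNIV. {k. (1/2 - r) * real m + 1 \<le> real k \<and> 2 * k \<le> m})"
  by (auto simp: corner_cubes_def PiE_UNIV_domain Pi_def)

lemma finite_corner_cubes: "finite (corner_cubes r m :: ('n::finite \<Rightarrow> nat) set)"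
  unfolding corner_cubes_eq
  by (intro finite_PiE) (auto intro: finite_subset[of _ "{..m}"])

text \<open>Each coordinate ranges over at least rm - 3/2 integers, and rm >= 3 makes this at least
  rm/2.\<close>

lemma card_corner_cubes:
  assumes r: "0 < r" "r \<le> 1/2" and m: "3 / r \<le> real m"
  shows "(r / 2 * real m) ^ CARD('n) \<le> real (card (corner_cubes r m :: ('n::finite \<Rightarrow> nat) set))"
proof -
  let ?S = "{k. (1/2 - r) * real m + 1 \<le> real k \<and> 2 * k \<le> m}"
  define a where "a = nat \<lceil>(1/2 - r) * real m\<rceil> + 1"
  have "0 \<le> (1/2 - r) * real m" using r by simp
  then have a: "(1/2 - r) * real m + 1 \<le> real a" "real a \<le> (1/2 - r) * real m + 2"
    unfolding a_def by linarith+
  have sub: "{a..m div 2} \<subseteq> ?S" using a(1) by auto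
  have "3 \<le> r * real m" using m r by (simp add: field_simps)
  then have "r / 2 * real m \<le> r * real m - 3 / 2" by simp
  also have "\<dots> = (real m - 1) / 2 + 1 - ((1/2 - r) * real m + 2)" by (simp add: field_simps)
  also have "\<dots> \<le> real (m div 2) + 1 - real a"
  proof -
    have "m \<le> 2 * (m div 2) + 1" by presburger
    then have "real m \<le> real (2 * (m div 2) + 1)" by (simp only: of_nat_le_iff)
    then have "(real m - 1) / 2 \<le> real (m div 2)" by simp
    then show ?thesis using a(2) by linarith
  qed
  also have "\<dots> \<le> real (card {a..m div 2})" by simp
  also have "\<dots> \<le> real (card ?S)"
    using card_mono[OF finite_subset[of ?S "{..m}"] sub] by fastforce
  finally have "r / 2 * real m \<le> real (card ?S)" .
  then have "(r / 2 * real m) ^ CARD('n) \<le> real (card ?S) ^ CARD('n)" using r by (intro power_mono) auto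
  then show ?thesis by (simp add: corner_cubes_eq card_funcsetE)
qed

text \<open>Every predecessor of such a cube has first coordinate at most m/2, so there are at most
  m^n/2 of them. On the other hand N > (m-1)^n >= m^n/2, by Bernoulli's inequality and m >=
  2n.\<close>

lemma corner_cubes_subset_first_indices:
  assumes n2: "2 \<le> CARD('n::{finite,linorder})" and r: "r \<le> 1/2" and N: "1 \<le> N"
    and m: "m = side_count CARD('n) N" and large: "2 * CARD('n) \<le> m"
  shows "(corner_cubes r m :: ('n \<Rightarrow> nat) set) \<subseteq> first_indices N"
proof
  define n where "n = CARD('n)"
  have n: "2 \<le> n" using n2 by (simp add: n_def)
  note sc = side_count_bounds[OF N, of n, folded m[folded n_def]]
  have m1: "1 \<le> m" and mN: "(m - 1) ^ n < N" using sc n by auto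
  fix j :: "'n \<Rightarrow> nat" assume j: "j \<in> corner_cubes r m"
  have j1: "1 \<le> j i" "2 * j i \<le> m" for i
  proof -
    have "0 \<le> (1/2 - r) * real m" using r by simp
    moreover have "(1/2 - r) * real m + 1 \<le> real (j i)" using j by (simp add: corner_cubes_def)
    ultimately show "1 \<le> j i" by linarith
    show "2 * j i \<le> m" using j by (simp add: corner_cubes_def)
  qed
  have jm: "j \<in> multi_indices m"
    unfolding multi_indices_def
  proof (intro CollectI allI)
    fix i show "j i \<in> {1..m}" using j1[of i] by auto
  qed
  let ?i = "Min (UNIV :: 'n set)"
  define T where "T = (\<Pi>\<^sub>E i\<in>(UNIV :: 'n set). if i = ?i then {1..m div 2} else {1..m})"
  have sub: "{k \<in> multi_indices m. less_fun k j} \<subseteq> T"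
  proof
    fix k assume k: "k \<in> {k \<in> multi_indices m. less_fun k j}"
    have "k ?i \<le> m div 2" using less_fun_Min[of k j] k j1(2)[of ?i] by simp
    then show "k \<in> T" using k by (auto simp: T_def PiE_UNIV_domain Pi_def multi_indices_def)
  qed
  have fT: "finite T" unfolding T_def by (intro finite_PiE) auto
  have "card T = (\<Prod>i\<in>(UNIV :: 'n set). card (if i = ?i then {1..m div 2} else {1..m}))"
    unfolding T_def by (rule card_PiE) simp
  also have "\<dots> = m div 2 * (\<Prod>i\<in>UNIV - {?i}. card (if i = ?i then {1..m div 2} else {1..m}))"
    by (subst prod.remove[of _ ?i]) auto
  also have "(\<Prod>i\<in>UNIV - {?i}. card (if i = ?i then {1..m div 2} else {1..m})) = (\<Prod>i\<in>UNIV - {?i}. m)"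
    by (intro prod.cong) auto
  also have "\<dots> = m ^ (n - 1)" by (simp add: n_def)
  finally have cT: "card T = m div 2 * m ^ (n - 1)" .
  have "real (card T) \<le> real m / 2 * real m ^ (n - 1)"
    unfolding cT of_nat_mult of_nat_power by (intro mult_right_mono, linarith, simp)
  also have "\<dots> = real m ^ n / 2" using n by (cases n) auto
  also have "\<dots> \<le> real m ^ n * (1 - 1 / real m) ^ n"
  proof -
    have "1 + real n * (- 1 / real m) \<le> (1 + - 1 / real m) ^ n"
      using m1 by (intro Bernoulli_inequality) simp
    moreover have "real n / real m \<le> 1 / 2" using large m1 by (simp add: n_def field_simps)
    ultimately have "1 / 2 \<le> (1 - 1 / real m) ^ n" by simp
    then have "real m ^ n * (1 / 2) \<le> real m ^ n * (1 - 1 / real m) ^ n" by (intro mult_left_mono) auto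
    then show ?thesis by simp
  qed
  also have "\<dots> = (real m - 1) ^ n" using m1 by (simp add: power_mult_distrib[symmetric] right_diff_distrib)
  also have "\<dots> = real ((m - 1) ^ n)" using m1 by (simp add: of_nat_diff)
  also have "\<dots> < real N" using mN by (simp only: of_nat_less_iff)
  finally have "card T < N" by simp
  then have "card {k \<in> multi_indices m. less_fun k j} < N" using card_mono[OF fT sub] by simp
  then show "j \<in> first_indices N" using jm unfolding first_indices_def Let_def m by simp
qed

section \<open>Potentials given by sets of cubes\<close>

definition cube_pot :: "nat \<Rightarrow> ('n \<Rightarrow> nat) set \<Rightarrow> real^'n \<Rightarrow> real"
  where "cube_pot m S x = 1 + 1/2 * indicator (\<Union>j\<in>S. cube m j) x"

lemma finite_first_indices: "finite (first_indices N :: ('n::{finite,linorder} \<Rightarrow> nat) set)"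
proof -
  let ?m = "side_count CARD('n) N"
  have "(multi_indices ?m :: ('n \<Rightarrow> nat) set) = (\<Pi>\<^sub>E i\<in>UNIV. {1..?m})"
    by (auto simp: multi_indices_def PiE_UNIV_domain Pi_def)
  then have "finite (multi_indices ?m :: ('n \<Rightarrow> nat) set)" by (simp add: finite_PiE)
  then show ?thesis unfolding first_indices_def Let_def by simp
qed

text \<open>Coefficient 3/2 on the chosen cubes and 1 on the others; the latter matches the value
  prescribed off the cubes, including the faces between them.\<close>

lemma cube_pot_in_A_class:
  fixes S :: "('n::{finite,linorder} \<Rightarrow> nat) set"
  assumes S: "S \<subseteq> first_indices N" and m: "m = side_count CARD('n) N" and m0: "0 < m"
  shows "cube_pot m S \<in> A_class N"
proof -
  define c where "c j = (if j \<in> S then 3/2 else 1 :: real)" for j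
  let ?J = "first_indices N :: ('n \<Rightarrow> nat) set"
  have "cube_pot m S x = (\<Sum>j\<in>?J. c j * indicator (cube m j) x) + indicator (Omega - (\<Union>j\<in>?J. cube m j)) x"
    if x: "x \<in> Omega" for x
  proof (cases "\<exists>j0\<in>?J. x \<in> cube m j0")
    case True
    then obtain j0 where j0: "j0 \<in> ?J" "x \<in> cube m j0" by blast
    have u: "x \<in> cube m j \<longleftrightarrow> j = j0" for j using cube_disjoint[OF m0 _ j0(2)] j0(2) by blast
    have "(\<Sum>j\<in>?J. c j * indicator (cube m j) x) = (\<Sum>j\<in>?J. if j = j0 then c j0 else 0)"
      by (intro sum.cong) (auto simp: u)
    also have "\<dots> = c j0" using j0(1) by (simp add: finite_first_indices)
    finally have 1: "(\<Sum>j\<in>?J. c j * indicator (cube m j) x) = c j0" .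
    have 2: "indicator (Omega - (\<Union>j\<in>?J. cube m j)) x = (0::real)"
      using j0 by (intro indicator_simps(2)) blast
    have "x \<in> (\<Union>j\<in>S. cube m j) \<longleftrightarrow> j0 \<in> S" by (auto simp: u)
    then show ?thesis unfolding 1 2 by (simp add: cube_pot_def c_def indicator_def)
  next
    case False
    then have 1: "(\<Sum>j\<in>?J. c j * indicator (cube m j) x) = 0" by (intro sum.neutral) auto
    have 2: "indicator (Omega - (\<Union>j\<in>?J. cube m j)) x = (1::real)"
      using False x by (intro indicator_simps(1)) blast
    have "x \<notin> (\<Union>j\<in>S. cube m j)" using False S by blast
    then show ?thesis unfolding 1 2 by (simp add: cube_pot_def)
  qed
  moreover have "\<forall>j\<in>?J. c j \<in> {1/2..3/2}" by (simp add: c_def)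
  ultimately show ?thesis unfolding A_class_def Let_def m[symmetric] by blast
qed

lemma corner_cube_subset:
  assumes j: "j \<in> corner_cubes r m" and r: "0 < r" and m: "0 < m"
  shows "(cube m j :: (real^'n) set) \<subseteq> cubeQ r"
proof
  fix x :: "real^'n" assume x: "x \<in> cube m j"
  have m': "0 < real m" using m by simp
  have "\<bar>x $ i\<bar> \<le> r" for i
  proof -
    have xl: "- 1/2 + (real (j i) - 1) * (1 / real m) < x $ i" and xu: "x $ i < - 1/2 + real (j i) * (1 / real m)"
      using x by (auto simp: cube_def)
    have "(1/2 - r) * real m + 1 \<le> real (j i)" "2 * j i \<le> m" using j by (auto simp: corner_cubes_def)
    then have "(1/2 - r) \<le> (real (j i) - 1) * (1 / real m)" "real (j i) * (1 / real m) \<le> 1/2"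
      using m' by (auto simp: field_simps)
    then show ?thesis using xl xu r by linarith
  qed
  then show "x \<in> cubeQ r" by (simp add: cubeQ_def)
qed

lemma cube_pot_measurable: "finite S \<Longrightarrow> cube_pot m S \<in> borel_measurable borel"
proof -
  assume "finite S"
  have "(\<Union>j\<in>S. cube m j) \<in> sets borel" by (intro borel_open open_UN) (simp add: cube_eq_box open_box)
  then show ?thesis unfolding cube_pot_def[abs_def] by measurable
qed

lemma cube_pot_local_pot:
  fixes S :: "('n::finite \<Rightarrow> nat) set"
  assumes S: "S \<subseteq> corner_cubes r m" and r: "0 < r" and m: "0 < m"
  shows "local_pot r (cube_pot m S)"
proof -
  have "finite S" by (rule finite_subset[OF S finite_corner_cubes])
  then have "cube_pot m S \<in> borel_measurable vol"
    by (intro measurable_restrict_space1) (simp add: cube_pot_measurable)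
  moreover have "cube_pot m S x = 1" if "x \<notin> cubeQ r" for x
    using that S corner_cube_subset[OF _ r m] unfolding cube_pot_def by (auto simp: indicator_def)
  ultimately show ?thesis unfolding local_pot_def pot_def
    by (auto simp: cube_pot_def indicator_def)
qed

lemma cube_pot_diff:
  assumes "j \<in> S" "j \<notin> S'" "x \<in> cube m j" "0 < m"
  shows "cube_pot m S x - cube_pot m S' x = 1/2"
proof -
  have "x \<notin> (\<Union>j\<in>S'. cube m j)" using cube_disjoint[OF assms(4,3)] assms(2) by blast
  moreover have "x \<in> (\<Union>j\<in>S. cube m j)" using assms by blast
  ultimately show ?thesis by (simp add: cube_pot_def)
qed

text \<open>A nonempty open set is not null, so a pointwise lower bound on it survives in the
  essential supremum.\<close>

lemma Linf_norm_ge_on_open: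
  fixes f :: "real^'n \<Rightarrow> real"
  assumes D: "open D" "D \<noteq> {}" "D \<subseteq> Omega" and f: "\<And>x. x \<in> D \<Longrightarrow> e \<le> \<bar>f x\<bar>"
  shows "ennreal e \<le> Linf_norm f"
proof (rule ccontr)
  assume "\<not> ?thesis"
  then have lt: "Linf_norm f < ennreal e" by simp
  have "AE x in vol. ennreal \<bar>f x\<bar> \<le> Linf_norm f" unfolding Linf_norm_def by (rule esssup_AE)
  then have "AE x in lborel. x \<in> Omega \<longrightarrow> ennreal \<bar>f x\<bar> \<le> Linf_norm f" by (subst (asm) AE_restrict_space_iff) auto
  then have "AE x in lborel. x \<notin> D"
  proof (rule AE_mp, intro AE_I2 impI notI)
    fix x assume "x \<in> Omega \<longrightarrow> ennreal \<bar>f x\<bar> \<le> Linf_norm f" "x \<in> D"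
    then have "ennreal \<bar>f x\<bar> \<le> Linf_norm f" "ennreal e \<le> ennreal \<bar>f x\<bar>" using D f by (auto intro: ennreal_leI)
    then show False using lt by (meson leD order_trans)
  qed
  then have "D \<in> null_sets lborel" using D(1) by (simp add: AE_iff_null_sets)
  then have "negligible D" by (simp add: negligible_iff_null_sets null_sets_completionI)
  then show False using open_not_negligible D by blast
qed

lemma cube_pot_distance:
  fixes S S' :: "('n::finite \<Rightarrow> nat) set"
  assumes S: "S \<subseteq> corner_cubes r m" "S' \<subseteq> corner_cubes r m" "S \<noteq> S'" and r: "0 < r" "r \<le> 1 / real CARD('n)"
    and m: "0 < m" and n2: "2 \<le> CARD('n)"
  shows "ennreal (1/2) \<le> Linf_norm (\<lambda>x. cube_pot m S x - cube_pot m S' x)"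
proof -
  obtain j where j: "j \<in> S \<and> j \<notin> S' \<or> j \<in> S' \<and> j \<notin> S" using S(3) by blast
  then have "j \<in> corner_cubes r m" using S by blast
  then have "cube m j \<subseteq> cubeQ r" by (rule corner_cube_subset[OF _ r(1) m])
  \<comment> \<open>The norm sees only the ball, so the cube on which the potentials differ has to
    lie in it.\<close>
  then have sub: "cube m j \<subseteq> Omega" using cubeQ_subset_Omega[OF r(2) n2] by blast
  have d: "1/2 \<le> \<bar>cube_pot m S x - cube_pot m S' x\<bar>" if "x \<in> cube m j" for x
    using j cube_pot_diff[of j S S' x m, OF _ _ that m] cube_pot_diff[of j S' S x m, OF _ _ that m] by fastforce
  show ?thesis
    by (rule Linf_norm_ge_on_open[OF _ cube_nonempty[OF m] sub d]) (simp_all add: cube_eq_box open_box)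
qed

section \<open>Matching the precision l with N\<close>

theorem mainTheorem2:
  assumes "CARD('n::{finite,linorder}) \<ge> 2"
  shows "\<exists>K1::real. K1 > 0 \<and> (\<exists>N0::nat. \<forall>N::nat. N \<ge> 1 \<and> N \<ge> N0 \<longrightarrow>
    (\<forall>C::real. C > 0 \<and>
      (\<forall>q1 \<in> (A_class N :: (real^'n::{finite,linorder} \<Rightarrow> real) set).
       \<forall>q2 \<in> (A_class N :: (real^'n::{finite,linorder} \<Rightarrow> real) set).
        Linf_norm (\<lambda>x. q1 x - q2 x) \<le> ennreal C * DN_dist q1 q2) \<longrightarrow>
      C \<ge> 1/4 * exp (K1 * real N powr (1 / (2 * real CARD('n) - 1)))))"
proof -
  note n2 = assms
  define n where "n = CARD('n)"
  have n: "2 \<le> n" using n2 by (simp add: n_def)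
  from DN_pigeonhole[OF n2] obtain r K where r: "0 < r" "r \<le> 1 / real n" and K: "0 < K"
    and PH: "\<forall>l Q. 0 < l \<longrightarrow>
    (\<forall>q\<in>Q. local_pot r (q :: (real,'n) vec \<Rightarrow> real)) \<longrightarrow> exp (K * real l ^ (2 * n - 1)) < real (card Q) \<longrightarrow>
    (\<exists>q1\<in>Q. \<exists>q2\<in>Q. q1 \<noteq> q2 \<and> DN_dist q1 q2 \<le> ennreal (K * exp (- real l)))"
    unfolding n_def by (elim exE conjE)
  have "1 / real n \<le> 1 / 2" using n by (intro divide_left_mono) auto
  then have r2: "r \<le> 1/2" using r by linarith
  define a where "a = 2 * real n - 1"
  have a0: "0 < a" using n by (simp add: a_def)
  have an: "real (2 * n - 1) = a" using n by (simp add: a_def of_nat_diff)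
  define c where "c = (r / 2) ^ n"
  have c0: "0 < c" using r by (simp add: c_def)
  \<comment> \<open>With l^(2n-1) <= bN one gets K l^(2n-1) <= cN ln 2/2, which is less than the
    logarithm of the number of potentials, at least cN ln 2.\<close>
  define b where "b = c * ln 2 / (2 * K)"
  have b0: "0 < b" using c0 K by (simp add: b_def)
  define \<kappa> where "\<kappa> = b powr (1 / a)"
  have \<kappa>0: "0 < \<kappa>" using b0 by (simp add: \<kappa>_def)
  \<comment> \<open>Grid sizes m > B satisfy m >= 2n and m >= 3/r, as the counting lemmas require. N
    > B^n enforces this, because N <= m^n.\<close>
  define B where "B = nat \<lceil>max (2 * real n) (3 / r)\<rceil>"
  \<comment> \<open>From X0 on, \<kappa> X is at least 1, so that l > 0, and at least 3K, which
    absorbs the constants at the end.\<close>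
  define X0 where "X0 = max 1 (3 * K) / \<kappa>"
  have X00: "0 \<le> X0" using \<kappa>0 by (simp add: X0_def)
  define N0 where "N0 = max (B ^ n + 1) (nat \<lceil>X0 powr a\<rceil>)"
  have "1/4 * exp (\<kappa> / 2 * real N powr (1 / (2 * real CARD('n) - 1))) \<le> C"
    if N: "1 \<le> N" "N0 \<le> N" and C: "0 < C" and
      stab: "\<And>q1 q2 :: (real,'n) vec \<Rightarrow> real. q1 \<in> A_class N \<Longrightarrow> q2 \<in> A_class N \<Longrightarrow>
        Linf_norm (\<lambda>x. q1 x - q2 x) \<le> ennreal C * DN_dist q1 q2" for N C
  proof -
    define m where "m = side_count n N"
    have mN: "N \<le> m ^ n" and m1: "1 \<le> m" using side_count_bounds[OF N(1), of n] n by (auto simp: m_def)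
    have Bm: "B < m"
    proof (rule ccontr)
      assume "\<not> B < m"
      then have "m ^ n \<le> B ^ n" by (intro power_mono) auto
      then show False using mN N(2) by (simp add: N0_def)
    qed
    then have mB: "2 * real n \<le> real m" "3 / r \<le> real m" unfolding B_def by linarith+
    define F where "F = (corner_cubes r m :: ('n \<Rightarrow> nat) set)"
    have FJ: "F \<subseteq> first_indices N" unfolding F_def
      by (rule corner_cubes_subset_first_indices[OF n2 r2 N(1)]) (use mB in \<open>auto simp: m_def n_def\<close>)
    have fF: "finite F" unfolding F_def by (rule finite_corner_cubes)
    have "c * real N \<le> c * real m ^ n" using mN c0 by (intro mult_left_mono) (auto simp flip: of_nat_power)
    also have "\<dots> = (r / 2 * real m) ^ n" by (simp only: c_def power_mult_distrib)
    also have "\<dots> \<le> real (card F)" unfolding F_def n_def by (rule card_corner_cubes[OF r(1) r2 mB(2)])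
    finally have cF: "c * real N \<le> real (card F)" .
    define Q where "Q = cube_pot m ` Pow F"
    have m0: "0 < m" using m1 by simp
    have dist: "ennreal (1/2) \<le> Linf_norm (\<lambda>x. cube_pot m S x - cube_pot m S' x)" if "S \<subseteq> F" "S' \<subseteq> F" "S \<noteq> S'" for S S'
      using cube_pot_distance[of S r m S'] that r m0 n2 unfolding F_def n_def by blast
    have inj: "inj_on (cube_pot m) (Pow F)"
    proof (rule inj_onI, rule ccontr)
      fix S S' assume *: "S \<in> Pow F" "S' \<in> Pow F" "cube_pot m S = cube_pot m S'" "S \<noteq> S'"
      then obtain j where j: "j \<in> S \<and> j \<notin> S' \<or> j \<in> S' \<and> j \<notin> S" by blast
      obtain x :: "(real,'n) vec" where x: "x \<in> cube m j" using cube_nonempty[OF m0] by blast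
      show False
        using j cube_pot_diff[of j S S' x m, OF _ _ x m0] cube_pot_diff[of j S' S x m, OF _ _ x m0] *(3) by auto
    qed
    have cQ: "card Q = 2 ^ card F" unfolding Q_def using card_image[OF inj] card_Pow[OF fF] by simp
    define X where "X = real N powr (1 / a)"
    have XX0: "X0 \<le> X"
    proof -
      have "X0 powr a \<le> real N" using N(2) unfolding N0_def by linarith
      then have "(X0 powr a) powr (1 / a) \<le> real N powr (1 / a)" using a0 by (intro powr_mono2) auto
      then show ?thesis using a0 X00 by (simp add: X_def powr_powr)
    qed
    then have \<kappa>X: "1 \<le> \<kappa> * X" "3 * K \<le> \<kappa> * X"
      using \<kappa>0 by (auto simp: X0_def field_simps)
    define l where "l = nat \<lfloor>\<kappa> * X\<rfloor>"
    have l: "0 < l" "real l \<le> \<kappa> * X" "\<kappa> * X - 1 \<le> real l" using \<kappa>X(1) unfolding l_def by linarith+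
    have "K * real l ^ (2 * n - 1) \<le> K * (b * real N)"
    proof (rule mult_left_mono)
      have "real l ^ (2 * n - 1) = real l powr a" using l(1) by (simp only: an[symmetric] powr_realpow of_nat_0_less_iff)
      also have "\<dots> \<le> (\<kappa> * X) powr a" using l(1,2) a0 by (intro powr_mono2) auto
      also have "\<dots> = b * real N" using a0 b0 N by (simp add: \<kappa>_def X_def powr_mult powr_powr)
      finally show "real l ^ (2 * n - 1) \<le> b * real N" .
    qed (use K in simp)
    also have "\<dots> = c * real N * ln 2 / 2" using K by (simp add: b_def)
    also have "\<dots> < c * real N * ln 2" using c0 N by simp
    also have "\<dots> \<le> real (card F) * ln 2" by (intro mult_right_mono cF) simp
    finally have "exp (K * real l ^ (2 * n - 1)) < exp (real (card F) * ln 2)" by simp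
    also have "\<dots> = real (card Q)" by (simp add: cQ exp_of_nat_mult)
    finally have big: "exp (K * real l ^ (2 * n - 1)) < real (card Q)" .
    have loc: "\<forall>q\<in>Q. local_pot r q" unfolding Q_def F_def using cube_pot_local_pot[OF _ r(1) m0] by blast
    obtain q1 q2 where q: "q1 \<in> Q" "q2 \<in> Q" "q1 \<noteq> q2" and D: "DN_dist q1 q2 \<le> ennreal (K * exp (- real l))"
      using PH[THEN spec, THEN spec, THEN mp, THEN mp, THEN mp, OF l(1) loc big] by (elim bexE conjE)
    obtain S S' where S: "S \<subseteq> F" "S' \<subseteq> F" "q1 = cube_pot m S" "q2 = cube_pot m S'"
      using q unfolding Q_def by blast
    have A: "q1 \<in> A_class N" "q2 \<in> A_class N"
      unfolding S(3,4) using S(1,2) FJ m0 by (intro cube_pot_in_A_class; auto simp: m_def n_def)+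
    have "ennreal (1/2) \<le> Linf_norm (\<lambda>x. q1 x - q2 x)" using dist[OF S(1,2)] q(3) unfolding S(3,4) by blast
    also have "\<dots> \<le> ennreal C * DN_dist q1 q2" by (rule stab[OF A])
    also have "\<dots> \<le> ennreal C * ennreal (K * exp (- real l))" by (rule mult_left_mono[OF D]) simp
    also have "\<dots> = ennreal (C * (K * exp (- real l)))" using C by (simp add: ennreal_mult')
    finally have "ennreal (1/2) \<le> ennreal (C * (K * exp (- real l)))" .
    then have "1/2 \<le> C * (K * exp (- real l))" using C K by (subst (asm) ennreal_le_iff) auto
    then have CK: "exp (real l) \<le> 2 * K * C" by (simp add: exp_minus field_simps)
    \<comment> \<open>Half of the exponent is given up: e^(2t) <= 6KC <= 4Ct <= 4C e^t, where 3K <=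
      2t is used. Dividing by e^t leaves the factor 1/4.\<close>
    define t where "t = \<kappa> * X / 2"
    have "exp t * exp t = exp 1 * exp (\<kappa> * X - 1)" by (simp add: t_def exp_add[symmetric])
    also have "\<dots> \<le> 3 * (2 * K * C)"
      using CK l(3) exp_le by (intro mult_mono order_trans[OF _ CK]) auto
    also have "\<dots> \<le> 4 * C * t" using \<kappa>X(2) C by (simp add: t_def mult.commute)
    also have "\<dots> \<le> 4 * C * exp t"
      using C exp_ge_add_one_self[of t] by (intro mult_left_mono) linarith+
    finally have "exp t \<le> 4 * C" by simp
    then show ?thesis by (simp add: t_def X_def a_def n_def)
  qed
  then show ?thesis using \<kappa>0 by (intro exI[of _ "\<kappa> / 2"] conjI exI[of _ N0] allI impI) auto
qed

end
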